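(* Let $G$ be a second countable locally compact abelian group. Then, for any closed ideal $J\subseteq L^1(G)$, $$(\operatorname{Ran} J)^{\perp} = \operatorname{Bim}(J^{\perp}).$$
   Context: Notation (for a second countable locally compact group $G$ with left Haar measure and modular function $\Delta$). $\lambda,\rho$ are the left and right regular representations on $L^2(G)$: $(\lambda_s f)(t)=f(s^{-1}t)$, $(\rho_r f)(s)=\Delta(r)^{1/2}f(sr)$. $\operatorname{VN}(G)$ is the weak-* closed linear span of $\{\lambda_x:x\in G\}$ in $\mathcal B(L^2(G))$. $M_a$ is multiplication by $a\in L^\infty(G)$ on $L^2(G)$. $\mathcal T(G)$ is the predual of $\mathcal B(L^2(G))$ (the trace class with trace norm $\|\cdot\|_t$), identified with functions $h(x,y)=\sum_i f_i(x)g_i(y)$, $\sum_i\|f_i\|_2^2<\infty$, $\sum_i\|g_i\|_2^2<\infty$, with pairing $\langle T,h\rangle_t=\sum_i (Tf_i,\overline{g_i})$. $M(G)$ is the convolution algebra of bounded complex Borel measures; $L^1(G)$ is identified with the absolutely continuous ones. For $\mu\in M(G)$, $\Theta(\mu):\mathcal B(L^2(G))\to\mathcal B(L^2(G))$ is the bounded weak-* continuous map $\langle\Theta(\mu)(T),h\rangle_t=\int_G\langle \rho_rT\rho_r^*,h\rangle_t\,d\mu(r)$, $h\in\mathcal T(G)$, and $\theta(\mu):\mathcal T(G)\to\mathcal T(G)$ is its predual. For a closed left ideal $J\subseteq L^1(G)$: $J^\perp=\{a\in L^\infty(G):\int_G af=0\ \forall f\in J\}$; $\operatorname{Ran}J$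 is the $\|\cdot\|_t$-closed linear span of $\{\theta(f)(h): f\in J,\ h\in\mathcal T(G)\}$ in $\mathcal T(G)$; $(\operatorname{Ran}J)^\perp$ is its annihilator in $\mathcal B(L^2(G))$. For a subspace $\mathcal U\subseteq L^\infty(G)$, $\operatorname{Bim}(\mathcal U)$ is the weak-* closed linear span of $\{AM_aB: A,B\in\operatorname{VN}(G),\ a\in\mathcal U\}$ in $\mathcal B(L^2(G))$. *)

theory Defs
  imports "HOL-Analysis.Analysis"
begin

text \<open>
  Groups are written additively, as the library's class of topological groups is additive;
  the group operation is not assumed commutative here.

  Elements of \<open>L\<^sup>1\<close>, \<open>L\<^sup>2\<close>, \<open>L\<^sup>\<infinity>\<close> are represented by functions, and elements of the trace class by
  functions on the product, all up to almost everywhere equality. Operators on \<open>L\<^sup>2\<close> act on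
  representatives and are likewise meant up to a.e. equality of values on \<open>L\<^sup>2\<close> (values outside
  \<open>L\<^sup>2\<close> are irrelevant). All closures below are taken for seminorms, or for families of seminorms,
  that do not distinguish representatives, so closed sets are saturated and equality of such sets
  is equality of sets of classes.
\<close>

definition left_haar_measure :: "'g::{topological_group_add,t2_space} measure \<Rightarrow> bool" where
  "left_haar_measure \<mu> \<longleftrightarrow>
     sets \<mu> = sets borel \<and>
     emeasure \<mu> UNIV \<noteq> 0 \<and>
     (\<forall>K. compact K \<longrightarrow> emeasure \<mu> K < \<infinity>) \<and>
     (\<forall>E\<in>sets borel. emeasure \<mu> E = (INF U\<in>{U. open U \<and> E \<subseteq> U}. emeasure \<mu> U)) \<and>
     (\<forall>U. open U \<longrightarrow> emeasure \<mu> U = (SUP K\<in>{K. compact K \<and> K \<subseteq> U}. emeasure \<mu> K)) \<and>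
     (\<forall>s. \<forall>E\<in>sets borel. emeasure \<mu> ((\<lambda>x. s + x) ` E) = emeasure \<mu> E)"

text \<open>Normalised so that \<open>rho\<close> below is unitary.\<close>

definition modular :: "'g::topological_group_add measure \<Rightarrow> 'g \<Rightarrow> real" where
  "modular \<mu> r = (THE c. c > 0 \<and>
     (\<forall>E\<in>sets borel. emeasure \<mu> ((\<lambda>x. x + r) ` E) = ennreal c * emeasure \<mu> E))"

definition L1 :: "'g measure \<Rightarrow> ('g \<Rightarrow> complex) set" where
  "L1 \<mu> = {f. integrable \<mu> f}"

definition L2 :: "'g measure \<Rightarrow> ('g \<Rightarrow> complex) set" where
  "L2 \<mu> = {f \<in> borel_measurable \<mu>. integrable \<mu> (\<lambda>x. (cmod (f x))\<^sup>2)}"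

definition Linf :: "'g measure \<Rightarrow> ('g \<Rightarrow> complex) set" where
  "Linf \<mu> = {a \<in> borel_measurable \<mu>. \<exists>C. AE x in \<mu>. cmod (a x) \<le> C}"

definition l2_norm :: "'g measure \<Rightarrow> ('g \<Rightarrow> complex) \<Rightarrow> real" where
  "l2_norm \<mu> f = sqrt (\<integral>x. (cmod (f x))\<^sup>2 \<partial>\<mu>)"

definition l2_inner :: "'g measure \<Rightarrow> ('g \<Rightarrow> complex) \<Rightarrow> ('g \<Rightarrow> complex) \<Rightarrow> complex" where
  "l2_inner \<mu> f g = (\<integral>x. f x * cnj (g x) \<partial>\<mu>)"


subsection \<open>Operators on \<open>L\<^sup>2\<close>\<close>

type_synonym 'g oper = "('g \<Rightarrow> complex) \<Rightarrow> ('g \<Rightarrow> complex)"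

definition BL2 :: "'g measure \<Rightarrow> 'g oper set" where
  "BL2 \<mu> = {T.
     (\<forall>f\<in>L2 \<mu>. T f \<in> L2 \<mu>) \<and>
     (\<forall>f\<in>L2 \<mu>. \<forall>g\<in>L2 \<mu>. AE x in \<mu>. T (\<lambda>y. f y + g y) x = T f x + T g x) \<and>
     (\<forall>c. \<forall>f\<in>L2 \<mu>. AE x in \<mu>. T (\<lambda>y. c * f y) x = c * T f x) \<and>
     (\<exists>C. \<forall>f\<in>L2 \<mu>. l2_norm \<mu> (T f) \<le> C * l2_norm \<mu> f)}"

definition oper_span :: "'g oper set \<Rightarrow> 'g oper set" where
  "oper_span X = {\<lambda>f x. \<Sum>i<n. c i * T i f x | (n::nat) c T. \<forall>i<n. T i \<in> X}"

definition lambda :: "'g::group_add \<Rightarrow> 'g oper" where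
  "lambda s f t = f (- s + t)"

definition rho :: "'g::topological_group_add measure \<Rightarrow> 'g \<Rightarrow> 'g oper" where
  "rho \<mu> r f s = complex_of_real (sqrt (modular \<mu> r)) * f (s + r)"

definition mult_op :: "('g \<Rightarrow> complex) \<Rightarrow> 'g oper" where
  "mult_op a f x = a x * f x"


subsection \<open>The trace class as predual of the bounded operators\<close>

definition represents ::
  "'g measure \<Rightarrow> (nat \<Rightarrow> 'g \<Rightarrow> complex) \<Rightarrow> (nat \<Rightarrow> 'g \<Rightarrow> complex) \<Rightarrow> ('g \<times> 'g \<Rightarrow> complex) \<Rightarrow> bool" where
  "represents \<mu> f g h \<longleftrightarrow>
     (\<forall>i. f i \<in> L2 \<mu> \<and> g i \<in> L2 \<mu>) \<and>
     summable (\<lambda>i. (l2_norm \<mu> (f i))\<^sup>2) \<and> summable (\<lambda>i. (l2_norm \<mu> (g i))\<^sup>2) \<and>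
     (AE (x, y) in \<mu> \<Otimes>\<^sub>M \<mu>. (\<lambda>i. f i x * g i y) sums h (x, y))"

definition TC :: "'g measure \<Rightarrow> ('g \<times> 'g \<Rightarrow> complex) set" where
  "TC \<mu> = {h. \<exists>f g. represents \<mu> f g h}"

text \<open>The value of the pairing does not depend on the representation of \<open>h\<close>.\<close>

definition pairing :: "'g measure \<Rightarrow> 'g oper \<Rightarrow> ('g \<times> 'g \<Rightarrow> complex) \<Rightarrow> complex" where
  "pairing \<mu> T h = (THE c. \<exists>f g. represents \<mu> f g h \<and>
     c = (\<Sum>i. l2_inner \<mu> (T (f i)) (\<lambda>x. cnj (g i x))))"

text \<open>The trace norm, as the norm of the predual: the norm of the functional \<open>\<langle>\<cdot>, h\<rangle>\<^sub>t\<close>.\<close>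

definition trace_norm :: "'g measure \<Rightarrow> ('g \<times> 'g \<Rightarrow> complex) \<Rightarrow> real" where
  "trace_norm \<mu> h = (SUP T\<in>{T \<in> BL2 \<mu>. \<forall>f\<in>L2 \<mu>. l2_norm \<mu> (T f) \<le> l2_norm \<mu> f}.
     cmod (pairing \<mu> T h))"

definition weak_star_topology :: "'g measure \<Rightarrow> 'g oper topology" where
  "weak_star_topology \<mu> =
     pullback_topology (BL2 \<mu>) (\<lambda>T. \<lambda>h\<in>TC \<mu>. pairing \<mu> T h)
       (product_topology (\<lambda>_. euclidean) (TC \<mu>))"

definition tc_span :: "('g \<times> 'g \<Rightarrow> complex) set \<Rightarrow> ('g \<times> 'g \<Rightarrow> complex) set" where
  "tc_span X = {\<lambda>z. \<Sum>i<n. c i * h i z | (n::nat) c h. \<forall>i<n. h i \<in> X}"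

definition tc_closure :: "'g measure \<Rightarrow> ('g \<times> 'g \<Rightarrow> complex) set \<Rightarrow> ('g \<times> 'g \<Rightarrow> complex) set" where
  "tc_closure \<mu> X = {h \<in> TC \<mu>. \<forall>\<epsilon>>0. \<exists>k\<in>X. trace_norm \<mu> (\<lambda>z. h z - k z) < \<epsilon>}"

definition VN :: "'g::topological_group_add measure \<Rightarrow> 'g oper set" where
  "VN \<mu> = weak_star_topology \<mu> closure_of oper_span (range lambda)"

definition Bim :: "'g::topological_group_add measure \<Rightarrow> ('g \<Rightarrow> complex) set \<Rightarrow> 'g oper set" where
  "Bim \<mu> U = weak_star_topology \<mu> closure_of
     oper_span {A \<circ> mult_op a \<circ> B | A a B. A \<in> VN \<mu> \<and> a \<in> U \<and> B \<in> VN \<mu>}"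


subsection \<open>The action of \<open>L\<^sup>1\<close> on operators and its predual\<close>

text \<open>
  \<open>Theta_pairing \<mu> \<phi> T h\<close> is \<open>\<langle>\<Theta>(\<phi>)(T), h\<rangle>\<^sub>t\<close>, where \<open>\<phi>\<close> stands for the measure with density \<open>\<phi>\<close>
  with respect to \<open>\<mu>\<close>. As \<open>rho\<close> is a unitary representation, the adjoint of \<open>rho \<mu> r\<close> is
  \<open>rho \<mu> (- r)\<close>.
\<close>

definition Theta_pairing ::
  "'g::topological_group_add measure \<Rightarrow> ('g \<Rightarrow> complex) \<Rightarrow> 'g oper \<Rightarrow> ('g \<times> 'g \<Rightarrow> complex) \<Rightarrow> complex" where
  "Theta_pairing \<mu> \<phi> T h = (\<integral>r. pairing \<mu> (rho \<mu> r \<circ> T \<circ> rho \<mu> (- r)) h * \<phi> r \<partial>\<mu>)"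

text \<open>The defining property determines \<open>theta \<mu> \<phi> h\<close> up to a.e. equality.\<close>

definition theta ::
  "'g::topological_group_add measure \<Rightarrow> ('g \<Rightarrow> complex) \<Rightarrow> ('g \<times> 'g \<Rightarrow> complex) \<Rightarrow> ('g \<times> 'g \<Rightarrow> complex)" where
  "theta \<mu> \<phi> h = (SOME k. k \<in> TC \<mu> \<and> (\<forall>T\<in>BL2 \<mu>. pairing \<mu> T k = Theta_pairing \<mu> \<phi> T h))"

definition Ran :: "'g::topological_group_add measure \<Rightarrow> ('g \<Rightarrow> complex) set \<Rightarrow> ('g \<times> 'g \<Rightarrow> complex) set" where
  "Ran \<mu> J = tc_closure \<mu> (tc_span {theta \<mu> \<phi> h | \<phi> h. \<phi> \<in> J \<and> h \<in> TC \<mu>})"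

definition tc_annihilator :: "'g measure \<Rightarrow> ('g \<times> 'g \<Rightarrow> complex) set \<Rightarrow> 'g oper set" where
  "tc_annihilator \<mu> X = {T \<in> BL2 \<mu>. \<forall>h\<in>X. pairing \<mu> T h = 0}"


subsection \<open>Closed ideals of the convolution algebra \<open>L\<^sup>1\<close>\<close>

definition convolution ::
  "'g::group_add measure \<Rightarrow> ('g \<Rightarrow> complex) \<Rightarrow> ('g \<Rightarrow> complex) \<Rightarrow> ('g \<Rightarrow> complex)" where
  "convolution \<mu> f g t = (\<integral>s. f s * g (- s + t) \<partial>\<mu>)"

definition closed_ideal_L1 :: "'g::group_add measure \<Rightarrow> ('g \<Rightarrow> complex) set \<Rightarrow> bool" where
  "closed_ideal_L1 \<mu> J \<longleftrightarrow>
     J \<subseteq> L1 \<mu> \<and>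
     (\<lambda>_. 0) \<in> J \<and>
     (\<forall>f\<in>J. \<forall>g\<in>J. (\<lambda>x. f x + g x) \<in> J) \<and>
     (\<forall>c. \<forall>f\<in>J. (\<lambda>x. c * f x) \<in> J) \<and>
     (\<forall>f\<in>J. \<forall>g\<in>L1 \<mu>. convolution \<mu> g f \<in> J \<and> convolution \<mu> f g \<in> J) \<and>
     (\<forall>f\<in>L1 \<mu>. (\<forall>\<epsilon>>0. \<exists>g\<in>J. (\<integral>x. cmod (f x - g x) \<partial>\<mu>) < \<epsilon>) \<longrightarrow> f \<in> J)"

definition L1_annihilator :: "'g measure \<Rightarrow> ('g \<Rightarrow> complex) set \<Rightarrow> ('g \<Rightarrow> complex) set" where
  "L1_annihilator \<mu> J = {a \<in> Linf \<mu>. \<forall>f\<in>J. (\<integral>x. a x * f x \<partial>\<mu>) = 0}"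

end

(* Write B(f, g) for the integral of f g. As G is abelian, conjugation by rho_r turns
   lambda_s M_a lambda_t into lambda_s M_b lambda_t with b the translate of a by r, so Theta(phi)
   acts on such operators through the integral of a(s + r) phi(r), which vanishes for almost all s
   when a annihilates the ideal J and phi is in J. Weak-* continuity gives the inclusion of
   Bim(J^perp) in the annihilator of Ran J.

   Conversely let Theta(J) kill T, and let h in the trace class annihilate Bim(J^perp). For a
   symmetric approximate identity e at 0 put e_x(z) = e(z - x) and K(x, y) = B(T e_x, e_y). Each
   diagonal r |-> K(r, v + r) is r |-> B(rho_r T rho_r^* e, e_v), hence it lies in J^perp, hence h
   integrates to 0 against K along each diagonal. If u is an integrable function on G, then the
   integral of h(x, y) u(y - x) K(x, y) over (x, y) is therefore 0. Taking for u the
   autocorrelations of a Folner sequence (which exists because compactly generated abelian groups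
   have polynomial growth) these multipliers are uniformly bounded on the trace class and tend
   to 1, so the pairing of the smoothed operator with h is 0; letting e shrink to the point mass
   at 0 shows that the pairing of T with h is 0. The bipolar theorem concludes. *)
theory Submission
  imports Defs
begin

subsection \<open>Square-integrable functions\<close>

text \<open>The kernel K is bounded, but its product with h need not be integrable over the plane,
  so h cannot be integrated against K diagonal by diagonal; the weight u makes the integral over v =
  y - x converge. That u is bounded as a multiplier comes from positive definiteness: the
  autocorrelation of a unit vector w is the integral over r of w(r + x) w(r + y), so weighting the
  kernel averages the forms (f, g) -> B(T S(f w_r), S(g w_r)), S being convolution with e, and
  Cauchy-Schwarz in r gives a bound free of u and e. That bound lets both limits, in the Folner sets
  and in e, pass under the series representing h. Adjoints are avoided since the pairing is
  bilinear: an operator is moved through an integral by composing it with the projections onto the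
  first n vectors of an orthonormal basis, where only finite sums of products of integrals occur,
  and letting n grow. As theta is a choice among functions with a prescribed pairing, its existence
  must be shown: phi in L1 is split into two L2 factors, and the integral of translated rank-one
  elements is expanded in the basis.\<close>

lemma L2_measurable [measurable_dest]: "f \<in> L2 M \<Longrightarrow> f \<in> borel_measurable M"
  by (simp add: L2_def)

lemma L2_integrable: "f \<in> L2 M \<Longrightarrow> integrable M (\<lambda>x. (cmod (f x))\<^sup>2)"
  by (simp add: L2_def)

lemma L2I: "f \<in> borel_measurable M \<Longrightarrow> integrable M (\<lambda>x. (cmod (f x))\<^sup>2) \<Longrightarrow> f \<in> L2 M"
  by (simp add: L2_def)

lemma L2_dominated:
  assumes "f \<in> borel_measurable M" "g \<in> L2 M" "AE x in M. cmod (f x) \<le> cmod (g x)"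
  shows "f \<in> L2 M"
proof (rule L2I)
  show "integrable M (\<lambda>x. (cmod (f x))\<^sup>2)"
    using assms by (intro Bochner_Integration.integrable_bound[OF L2_integrable[OF assms(2)]])
      (auto intro!: power_mono elim!: eventually_mono)
qed (rule assms)

lemma L2_zero [simp, intro]: "(\<lambda>x. 0) \<in> L2 M"
  by (simp add: L2_def)

lemma L2_scale [intro]: "f \<in> L2 M \<Longrightarrow> (\<lambda>x. c * f x) \<in> L2 M"
  by (auto simp: L2_def norm_mult power_mult_distrib)

lemma borel_measurable_cnj [measurable]:
  "f \<in> borel_measurable M \<Longrightarrow> (\<lambda>x. cnj (f x)) \<in> borel_measurable M"
  by (rule borel_measurable_continuous_on[OF continuous_on_cnj[OF continuous_on_id], unfolded id_def]) 

lemma L2_cnj [intro]: "f \<in> L2 M \<Longrightarrow> (\<lambda>x. cnj (f x)) \<in> L2 M"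
  by (auto simp: L2_def intro: borel_measurable_cnj)

lemma norm_add_square_le: "(norm (a + b :: 'a::real_normed_vector))\<^sup>2 \<le> 2 * (norm a)\<^sup>2 + 2 * (norm b)\<^sup>2"
proof -
  have "(norm (a + b))\<^sup>2 \<le> (norm a + norm b)\<^sup>2"
    by (intro power_mono norm_triangle_ineq) auto
  also have "\<dots> \<le> 2 * (norm a)\<^sup>2 + 2 * (norm b)\<^sup>2"
    using zero_le_power2[of "norm a - norm b"] by (simp add: power2_eq_square algebra_simps)
  finally show ?thesis .
qed

lemma L2_add [intro]:
  assumes "f \<in> L2 M" "g \<in> L2 M"
  shows "(\<lambda>x. f x + g x) \<in> L2 M"
proof (rule L2I)
  show "(\<lambda>x. f x + g x) \<in> borel_measurable M"
    using assms by (auto dest: L2_measurable)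
  show "integrable M (\<lambda>x. (cmod (f x + g x))\<^sup>2)"
  proof (rule Bochner_Integration.integrable_bound)
    show "integrable M (\<lambda>x. 2 * (cmod (f x))\<^sup>2 + 2 * (cmod (g x))\<^sup>2)"
      by (intro Bochner_Integration.integrable_add integrable_mult_right L2_integrable assms)
    show "AE x in M. norm ((cmod (f x + g x))\<^sup>2) \<le> norm (2 * (cmod (f x))\<^sup>2 + 2 * (cmod (g x))\<^sup>2)"
      by (intro AE_I2) (auto simp: norm_add_square_le)
  qed (use assms in \<open>auto dest!: L2_measurable\<close>)
qed

lemma L2_sum [intro]:
  assumes "\<And>i. i \<in> I \<Longrightarrow> f i \<in> L2 M"
  shows "(\<lambda>x. \<Sum>i\<in>I. f i x) \<in> L2 M"
  using assms by (induction I rule: infinite_finite_induct) auto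

lemma L2_minus [intro]: "f \<in> L2 M \<Longrightarrow> (\<lambda>x. - f x) \<in> L2 M"
  using L2_scale[of f M "-1"] by simp

lemma L2_diff [intro]: "f \<in> L2 M \<Longrightarrow> g \<in> L2 M \<Longrightarrow> (\<lambda>x. f x - g x) \<in> L2 M"
  using L2_add[OF _ L2_minus] by fastforce

lemma l2_norm_nonneg [simp]: "0 \<le> l2_norm M f"
  by (simp add: l2_norm_def)

lemma l2_norm_square: "(l2_norm M f)\<^sup>2 = (\<integral>x. (cmod (f x))\<^sup>2 \<partial>M)"
  by (simp add: l2_norm_def)

lemma l2_norm_square_nn: "f \<in> L2 M \<Longrightarrow> ennreal ((l2_norm M f)\<^sup>2) = (\<integral>\<^sup>+x. ennreal ((cmod (f x))\<^sup>2) \<partial>M)"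
  by (simp add: l2_norm_square nn_integral_eq_integral L2_integrable)

lemma l2_norm_cnj [simp]: "l2_norm M (\<lambda>x. cnj (f x)) = l2_norm M f"
  by (simp add: l2_norm_def)

lemma l2_norm_zero [simp]: "l2_norm M (\<lambda>x. 0) = 0"
  by (simp add: l2_norm_def)

lemma l2_norm_scale: "l2_norm M (\<lambda>x. c * f x) = cmod c * l2_norm M f"
  by (simp add: l2_norm_def norm_mult power_mult_distrib real_sqrt_mult)

lemma l2_norm_minus_commute: "l2_norm M (\<lambda>x. f x - g x) = l2_norm M (\<lambda>x. g x - f x)"
  by (simp add: l2_norm_def norm_minus_commute)

lemma l2_norm_cong_AE:
  assumes "f \<in> borel_measurable M" "g \<in> borel_measurable M" "AE x in M. f x = g x"
  shows "l2_norm M f = l2_norm M g"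
proof -
  have "(\<integral>x. (cmod (f x))\<^sup>2 \<partial>M) = (\<integral>x. (cmod (g x))\<^sup>2 \<partial>M)"
    using assms by (intro integral_cong_AE) auto
  then show ?thesis by (simp add: l2_norm_def)
qed

lemma l2_norm_eq_0_iff:
  assumes "f \<in> L2 M"
  shows "l2_norm M f = 0 \<longleftrightarrow> (AE x in M. f x = 0)"
  using integral_nonneg_eq_0_iff_AE[OF L2_integrable[OF assms]] by (simp add: l2_norm_def)

lemma L2_mult_integrable:
  assumes "f \<in> L2 M" "g \<in> L2 M"
  shows "integrable M (\<lambda>x. f x * g x)"
proof (rule Bochner_Integration.integrable_bound)
  show "integrable M (\<lambda>x. (cmod (f x))\<^sup>2 + (cmod (g x))\<^sup>2)"
    using assms by (auto dest: L2_integrable)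
  have "a * b \<le> a\<^sup>2 + b\<^sup>2" if "0 \<le> a" "0 \<le> b" for a b :: real
    using sum_squares_bound[of a b] mult_nonneg_nonneg[OF that] by linarith
  then show "AE x in M. norm (f x * g x) \<le> norm ((cmod (f x))\<^sup>2 + (cmod (g x))\<^sup>2)"
    by (simp add: norm_mult)
qed (use assms in \<open>auto dest!: L2_measurable\<close>)

text \<open>The modulus stays inside the integral, as needed for dominating series of integrals; the
  inequality itself is the extended nonnegative one, transferred through squares.\<close>

lemma l2_norm_Cauchy_Schwarz:
  assumes f: "f \<in> L2 M" and g: "g \<in> L2 M"
  shows "(\<integral>x. cmod (f x * g x) \<partial>M) \<le> l2_norm M f * l2_norm M g"
proof -
  have [measurable]: "f \<in> borel_measurable M" "g \<in> borel_measurable M"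
    using f g by (auto dest: L2_measurable)
  have i: "integrable M (\<lambda>x. cmod (f x * g x))"
    using L2_mult_integrable[OF f g] by (rule integrable_norm)
  have "ennreal ((\<integral>x. cmod (f x * g x) \<partial>M)\<^sup>2) = (\<integral>\<^sup>+x. ennreal (cmod (f x)) * ennreal (cmod (g x)) \<partial>M)\<^sup>2"
    using nn_integral_eq_integral[OF i] by (simp add: norm_mult ennreal_mult power2_eq_square ennreal_mult')
  also have "\<dots> \<le> (\<integral>\<^sup>+x. (ennreal (cmod (f x)))\<^sup>2 \<partial>M) * (\<integral>\<^sup>+x. (ennreal (cmod (g x)))\<^sup>2 \<partial>M)"
    by (intro Cauchy_Schwarz_nn_integral) auto
  also have "\<dots> = ennreal ((l2_norm M f)\<^sup>2) * ennreal ((l2_norm M g)\<^sup>2)"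
    by (simp add: l2_norm_square_nn f g ennreal_power)
  also have "\<dots> = ennreal ((l2_norm M f * l2_norm M g)\<^sup>2)"
    by (simp add: ennreal_mult power_mult_distrib)
  finally have "(\<integral>x. cmod (f x * g x) \<partial>M)\<^sup>2 \<le> (l2_norm M f * l2_norm M g)\<^sup>2"
    by (simp add: ennreal_le_iff)
  then show ?thesis
    by (rule power2_le_imp_le) simp
qed

lemma l2_norm_triangle:
  assumes f: "f \<in> L2 M" and g: "g \<in> L2 M"
  shows "l2_norm M (\<lambda>x. f x + g x) \<le> l2_norm M f + l2_norm M g"
proof (rule power2_le_imp_le)
  have i: "integrable M (\<lambda>x. cmod (f x * g x))"
    using L2_mult_integrable[OF f g] by (rule integrable_norm)
  have "(l2_norm M (\<lambda>x. f x + g x))\<^sup>2 \<le> (\<integral>x. (cmod (f x))\<^sup>2 + (2 * cmod (f x * g x) + (cmod (g x))\<^sup>2) \<partial>M)"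
    unfolding l2_norm_square
  proof (rule integral_mono)
    show "integrable M (\<lambda>x. (cmod (f x + g x))\<^sup>2)"
      by (intro L2_integrable L2_add f g)
    show "integrable M (\<lambda>x. (cmod (f x))\<^sup>2 + (2 * cmod (f x * g x) + (cmod (g x))\<^sup>2))"
      by (intro Bochner_Integration.integrable_add integrable_mult_right i L2_integrable f g)
    show "(cmod (f x + g x))\<^sup>2 \<le> (cmod (f x))\<^sup>2 + (2 * cmod (f x * g x) + (cmod (g x))\<^sup>2)" for x
      using power_mono[OF norm_triangle_ineq[of "f x" "g x"], of 2]
      by (simp add: power2_eq_square algebra_simps norm_mult)
  qed
  also have "\<dots> = (l2_norm M f)\<^sup>2 + (2 * (\<integral>x. cmod (f x * g x) \<partial>M) + (l2_norm M g)\<^sup>2)"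
    by (subst Bochner_Integration.integral_add)
       (auto intro!: Bochner_Integration.integrable_add integrable_mult_right i L2_integrable f g
             simp: l2_norm_square i L2_integrable[OF g])
  also have "\<dots> \<le> (l2_norm M f + l2_norm M g)\<^sup>2"
    using l2_norm_Cauchy_Schwarz[OF f g] by (simp add: power2_eq_square algebra_simps)
  finally show "(l2_norm M (\<lambda>x. f x + g x))\<^sup>2 \<le> (l2_norm M f + l2_norm M g)\<^sup>2" .
qed simp

lemma l2_norm_triangle_diff:
  assumes "f \<in> L2 M" "g \<in> L2 M" "h \<in> L2 M"
  shows "l2_norm M (\<lambda>x. f x - h x) \<le> l2_norm M (\<lambda>x. f x - g x) + l2_norm M (\<lambda>x. g x - h x)"
  using l2_norm_triangle[OF L2_diff[OF assms(1,2)] L2_diff[OF assms(2,3)]] by simp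

text \<open>In \<open>l2_inner M (T f) (\<lambda>x. cnj (g x))\<close> the two conjugations cancel.
  Working with \<open>bil\<close> treats the two legs of \<open>f x * g y\<close> alike and makes
  operators act on the second leg through transposes instead of adjoints.\<close>

definition bil :: "'a measure \<Rightarrow> ('a \<Rightarrow> complex) \<Rightarrow> ('a \<Rightarrow> complex) \<Rightarrow> complex" where
  "bil M f g = (\<integral>x. f x * g x \<partial>M)"

lemma l2_inner_bil: "l2_inner M f g = bil M f (\<lambda>x. cnj (g x))"
  by (simp add: l2_inner_def bil_def)

lemma l2_inner_cnj_eq_bil: "l2_inner M f (\<lambda>x. cnj (g x)) = bil M f g"
  by (simp add: l2_inner_bil)

lemma bil_commute: "bil M f g = bil M g f"
  by (simp add: bil_def mult.commute)

lemma bil_bound: "f \<in> L2 M \<Longrightarrow> g \<in> L2 M \<Longrightarrow> cmod (bil M f g) \<le> l2_norm M f * l2_norm M g"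
  unfolding bil_def using l2_norm_Cauchy_Schwarz integral_norm_bound by (rule order_trans[rotated])

lemma bil_cong_AE:
  assumes "f \<in> borel_measurable M" "f' \<in> borel_measurable M" "g \<in> borel_measurable M" "g' \<in> borel_measurable M"
    "AE x in M. f x = f' x" "AE x in M. g x = g' x"
  shows "bil M f g = bil M f' g'"
  unfolding bil_def using assms by (intro integral_cong_AE) auto

lemma bil_add_left: "f \<in> L2 M \<Longrightarrow> f' \<in> L2 M \<Longrightarrow> g \<in> L2 M \<Longrightarrow>
    bil M (\<lambda>x. f x + f' x) g = bil M f g + bil M f' g"
  by (simp add: bil_def distrib_right L2_mult_integrable)

lemma bil_diff_left: "f \<in> L2 M \<Longrightarrow> f' \<in> L2 M \<Longrightarrow> g \<in> L2 M \<Longrightarrow>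
    bil M (\<lambda>x. f x - f' x) g = bil M f g - bil M f' g"
  by (simp add: bil_def left_diff_distrib L2_mult_integrable)

lemma bil_scale_left: "bil M (\<lambda>x. c * f x) g = c * bil M f g"
  by (simp add: bil_def mult.assoc)

lemma bil_scale_right: "bil M f (\<lambda>x. c * g x) = c * bil M f g"
  by (simp add: bil_commute[of M f] bil_scale_left)

lemma bil_sum_left:
  assumes "\<And>i. i \<in> I \<Longrightarrow> f i \<in> L2 M" "g \<in> L2 M"
  shows "bil M (\<lambda>x. \<Sum>i\<in>I. c i * f i x) g = (\<Sum>i\<in>I. c i * bil M (f i) g)"
  using assms
proof (induction I rule: infinite_finite_induct)
  case (insert a I)
  then show ?case
    by (simp add: bil_add_left L2_scale L2_sum bil_scale_left)
qed (auto simp: bil_def)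

lemma bil_diff_right: "f \<in> L2 M \<Longrightarrow> f' \<in> L2 M \<Longrightarrow> g \<in> L2 M \<Longrightarrow>
    bil M g (\<lambda>x. f x - f' x) = bil M g f - bil M g f'"
  by (simp add: bil_commute[of M g] bil_diff_left)

lemma bil_sum_right:
  assumes "\<And>i. i \<in> I \<Longrightarrow> f i \<in> L2 M" "g \<in> L2 M"
  shows "bil M g (\<lambda>x. \<Sum>i\<in>I. c i * f i x) = (\<Sum>i\<in>I. c i * bil M g (f i))"
  using bil_sum_left[OF assms] by (simp add: bil_commute[of M g])

lemma bil_tendsto:
  assumes L2: "\<And>n. F n \<in> L2 M" "f \<in> L2 M" "\<And>n. G n \<in> L2 M" "g \<in> L2 M"
    and lim: "(\<lambda>n. l2_norm M (\<lambda>x. F n x - f x)) \<longlonglongrightarrow> 0" "(\<lambda>n. l2_norm M (\<lambda>x. G n x - g x)) \<longlonglongrightarrow> 0"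
  shows "(\<lambda>n. bil M (F n) (G n)) \<longlonglongrightarrow> bil M f g"
proof (rule LIM_zero_cancel, rule Lim_null_comparison)
  let ?d = "\<lambda>n. l2_norm M (\<lambda>x. F n x - f x)" and ?e = "\<lambda>n. l2_norm M (\<lambda>x. G n x - g x)"
  show "\<forall>\<^sub>F n in sequentially. norm (bil M (F n) (G n) - bil M f g)
      \<le> ?d n * ?e n + ?d n * l2_norm M g + l2_norm M f * ?e n"
  proof (rule always_eventually, rule allI)
    fix n
    \<comment> \<open>Each term contains a difference and otherwise only the limits \<open>f\<close>
      and \<open>g\<close>, so no prior bound on the norms of \<open>F n\<close> and
      \<open>G n\<close> enters.\<close>
    have "bil M (F n) (G n) - bil M f g = bil M (\<lambda>x. F n x - f x) (\<lambda>x. G n x - g x)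
        + bil M (\<lambda>x. F n x - f x) g + bil M f (\<lambda>x. G n x - g x)"
      by (simp add: bil_diff_left bil_diff_right L2 L2_diff)
    then show "norm (bil M (F n) (G n) - bil M f g) \<le> ?d n * ?e n + ?d n * l2_norm M g + l2_norm M f * ?e n"
      by (simp only:) (intro norm_triangle_mono bil_bound L2 L2_diff)
  qed
  show "(\<lambda>n. ?d n * ?e n + ?d n * l2_norm M g + l2_norm M f * ?e n) \<longlonglongrightarrow> 0"
    using lim by (auto intro!: tendsto_eq_intros)
qed

section \<open>The Hermitian inner product\<close>

lemma l2_inner_self: "f \<in> L2 M \<Longrightarrow> l2_inner M f f = complex_of_real ((l2_norm M f)\<^sup>2)"
  by (simp add: l2_inner_def l2_norm_square flip: complex_norm_square integral_complex_of_real of_real_power)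

lemma l2_inner_commute: "l2_inner M g f = cnj (l2_inner M f g)"
proof -
  have "cnj (l2_inner M f g) = (\<integral>x. cnj (f x * cnj (g x)) \<partial>M)"
    unfolding l2_inner_def by (rule Bochner_Integration.integral_cnj[symmetric])
  then show ?thesis
    by (simp add: l2_inner_def mult.commute)
qed

lemma l2_inner_bound: "f \<in> L2 M \<Longrightarrow> g \<in> L2 M \<Longrightarrow> cmod (l2_inner M f g) \<le> l2_norm M f * l2_norm M g"
  using bil_bound[of f M "\<lambda>x. cnj (g x)"] by (simp add: l2_inner_bil L2_cnj)

lemma l2_inner_sum_left:
  assumes "\<And>i. i \<in> I \<Longrightarrow> f i \<in> L2 M" "g \<in> L2 M"
  shows "l2_inner M (\<lambda>x. \<Sum>i\<in>I. c i * f i x) g = (\<Sum>i\<in>I. c i * l2_inner M (f i) g)"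
  by (simp add: l2_inner_bil bil_sum_left assms L2_cnj)

lemma l2_inner_diff_left: "f \<in> L2 M \<Longrightarrow> f' \<in> L2 M \<Longrightarrow> g \<in> L2 M \<Longrightarrow>
    l2_inner M (\<lambda>x. f x - f' x) g = l2_inner M f g - l2_inner M f' g"
  by (simp add: l2_inner_bil bil_diff_left L2_cnj)

lemma l2_inner_scale_left: "l2_inner M (\<lambda>x. c * f x) g = c * l2_inner M f g"
  by (simp add: l2_inner_bil bil_scale_left)

subsection \<open>Orthonormal expansions\<close>

definition proj :: "'a measure \<Rightarrow> (nat \<Rightarrow> 'a \<Rightarrow> complex) \<Rightarrow> nat \<Rightarrow> ('a \<Rightarrow> complex) \<Rightarrow> 'a \<Rightarrow> complex" where
  "proj M e n f = (\<lambda>x. \<Sum>j<n. l2_inner M f (e j) * e j x)"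

lemma L2_proj: "(\<And>j. e j \<in> L2 M) \<Longrightarrow> proj M e n f \<in> L2 M"
  unfolding proj_def by (intro L2_sum L2_scale)

text \<open>If \<open>e\<close> has norm 0, Cauchy-Schwarz makes \<open>l2_inner M f e\<close>
  vanish; if it has norm 1, the second factor is 1. This identity replaces a case distinction
  wherever a zero vector may occur.\<close>

lemma l2_inner_self_absorb:
  assumes "f \<in> L2 M" "e \<in> L2 M" "l2_norm M e = 0 \<or> l2_norm M e = 1"
  shows "l2_inner M f e * l2_inner M e e = l2_inner M f e"
  using assms(3)
proof
  assume "l2_norm M e = 0"
  then show ?thesis
    using l2_inner_bound[OF assms(1,2)] by simp
qed (simp add: l2_inner_self assms(2))

text \<open>Zero vectors are allowed, so that finite-dimensional \<open>L\<^sup>2\<close> spaces are covered as well.\<close>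

locale orthonormal_or_zero =
  fixes M :: "'a measure" and e :: "nat \<Rightarrow> 'a \<Rightarrow> complex"
  assumes e_L2: "e j \<in> L2 M"
    and orth: "i \<noteq> j \<Longrightarrow> l2_inner M (e i) (e j) = 0"
    and unit: "l2_norm M (e j) = 0 \<or> l2_norm M (e j) = 1"
begin

lemma L2_proj': "proj M e n f \<in> L2 M"
  by (simp add: L2_proj e_L2)

lemmas inner_self_absorb = l2_inner_self_absorb[OF _ e_L2 unit]

lemma inner_sum:
  assumes "i < n"
  shows "l2_inner M (\<lambda>x. \<Sum>j<n. c j * e j x) (e i) = c i * l2_inner M (e i) (e i)"
proof -
  have "l2_inner M (\<lambda>x. \<Sum>j<n. c j * e j x) (e i) = (\<Sum>j<n. c j * l2_inner M (e j) (e i))"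
    by (simp add: l2_inner_sum_left e_L2)
  also have "\<dots> = (\<Sum>j<n. if j = i then c i * l2_inner M (e i) (e i) else 0)"
    by (intro sum.cong) (auto simp: orth)
  finally show ?thesis
    using assms by simp
qed

lemma inner_residual:
  assumes "f \<in> L2 M" "i < n"
  shows "l2_inner M (\<lambda>x. f x - proj M e n f x) (e i) = 0"
  using assms inner_sum[OF assms(2), of "\<lambda>j. l2_inner M f (e j)"]
  by (simp add: l2_inner_diff_left L2_proj' e_L2 inner_self_absorb) (simp add: proj_def inner_self_absorb)

lemma residual_orth_sum:
  assumes "f \<in> L2 M"
  shows "l2_inner M (\<lambda>x. f x - proj M e n f x) (\<lambda>x. \<Sum>j<n. c j * e j x) = 0"
  by (subst l2_inner_commute, subst l2_inner_sum_left)
     (auto simp: e_L2 L2_diff L2_proj' assms inner_residual l2_inner_commute[of M _ "\<lambda>x. f x - proj M e n f x"])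

text \<open>The coefficients \<open>c j\<close> need not be the Fourier coefficients, since a zero
  vector admits any coefficient. Still the residual is almost everywhere a combination of the
  \<open>e j\<close>, hence orthogonal to itself.\<close>

lemma residual_null:
  assumes f: "f \<in> L2 M" and ae: "AE x in M. f x = (\<Sum>j<n. c j * e j x)"
  shows "l2_norm M (\<lambda>x. f x - proj M e n f x) = 0"
proof -
  let ?d = "\<lambda>x. f x - proj M e n f x"
  have d: "?d \<in> L2 M"
    by (intro L2_diff f L2_proj')
  have "l2_inner M ?d ?d = l2_inner M ?d (\<lambda>x. \<Sum>j<n. (c j - l2_inner M f (e j)) * e j x)"
  proof -
    have "AE x in M. cnj (?d x) = cnj (\<Sum>j<n. (c j - l2_inner M f (e j)) * e j x)"
      using ae by eventually_elim (simp add: proj_def left_diff_distrib sum_subtractf)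
    then show ?thesis
      unfolding l2_inner_bil
      by (intro bil_cong_AE L2_measurable L2_cnj L2_sum L2_scale d e_L2) auto
  qed
  then have "l2_inner M ?d ?d = 0"
    by (simp add: residual_orth_sum f)
  then show ?thesis
    by (simp add: l2_inner_self[OF d] del: of_real_power)
qed

text \<open>The residual is orthogonal to the projection, so the inner product of the projection
  with itself equals that of \<open>f\<close> with the projection; Cauchy-Schwarz allows one factor
  to be cancelled.\<close>

lemma Bessel:
  assumes f: "f \<in> L2 M"
  shows "l2_norm M (proj M e n f) \<le> l2_norm M f"
proof -
  let ?p = "proj M e n f" and ?d = "\<lambda>x. f x - proj M e n f x"
  have "l2_inner M ?p ?p = l2_inner M f ?p"
    using residual_orth_sum[OF f, of n "\<lambda>j. l2_inner M f (e j)"]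
    by (simp add: l2_inner_diff_left f L2_proj' flip: proj_def)
  then have "(l2_norm M ?p)\<^sup>2 = cmod (l2_inner M f ?p)"
    using l2_inner_self[OF L2_proj', of n f] by (metis norm_of_real abs_of_nonneg zero_le_power2)
  also have "\<dots> \<le> l2_norm M f * l2_norm M ?p"
    by (intro l2_inner_bound f L2_proj')
  finally show ?thesis
    by (cases "l2_norm M ?p = 0") (auto simp: power2_eq_square order_less_le)
qed

end

section \<open>Gram-Schmidt orthonormalisation\<close>

fun gram_schmidt :: "'a measure \<Rightarrow> (nat \<Rightarrow> 'a \<Rightarrow> complex) \<Rightarrow> nat \<Rightarrow> 'a \<Rightarrow> complex" where
  "gram_schmidt M b n =
    (let d = (\<lambda>x. b n x - (\<Sum>j<n. l2_inner M (b n) (gram_schmidt M b j) * gram_schmidt M b j x))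
     in (\<lambda>x. complex_of_real (inverse (l2_norm M d)) * d x))"

declare gram_schmidt.simps [simp del]

text \<open>Linear dependence of the \<open>b j\<close> is harmless: for a null residual
  \<open>d\<close> the convention \<open>inverse 0 = 0\<close> turns the normalised vector into the
  zero function, which is where the zero vectors of \<open>orthonormal_or_zero\<close> come
  from.\<close>

lemma gram_schmidt_properties:
  assumes b: "\<And>j. b j \<in> L2 M"
  shows "gram_schmidt M b n \<in> L2 M
    \<and> (\<forall>i<n. l2_inner M (gram_schmidt M b n) (gram_schmidt M b i) = 0)
    \<and> (l2_norm M (gram_schmidt M b n) = 0 \<or> l2_norm M (gram_schmidt M b n) = 1)"
proof (induction n rule: less_induct)
  case (less n)
  let ?g = "gram_schmidt M b"
  define d where "d = (\<lambda>x. b n x - (\<Sum>j<n. l2_inner M (b n) (?g j) * ?g j x))"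
  have g: "?g j \<in> L2 M" if "j < n" for j
    using less that by blast
  have d: "d \<in> L2 M"
    unfolding d_def by (intro L2_diff b L2_sum L2_scale g) auto
  have gn: "?g n = (\<lambda>x. complex_of_real (inverse (l2_norm M d)) * d x)"
    unfolding d_def by (subst gram_schmidt.simps) (simp add: Let_def)
  have "l2_inner M d (?g i) = 0" if i: "i < n" for i
  proof -
    \<comment> \<open>Both indices are below \<open>n\<close>; the induction hypothesis for the
      larger one applies, after a conjugation if that is \<open>i\<close>.\<close>
    have o: "l2_inner M (?g j) (?g i) = 0" if "j < n" "j \<noteq> i" for j
      using less.IH[OF i] less.IH[OF that(1)] that i l2_inner_commute[of M "?g j" "?g i"]
      by (cases j i rule: linorder_cases) auto
    have "(\<Sum>j<n. l2_inner M (b n) (?g j) * l2_inner M (?g j) (?g i))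
        = (\<Sum>j<n. if j = i then l2_inner M (b n) (?g i) * l2_inner M (?g i) (?g i) else 0)"
      by (intro sum.cong) (auto simp: o)
    also have "\<dots> = l2_inner M (b n) (?g i) * l2_inner M (?g i) (?g i)"
      using i by simp
    also have "\<dots> = l2_inner M (b n) (?g i)"
      using less.IH[OF i] by (intro l2_inner_self_absorb b) auto
    also have "(\<Sum>j<n. l2_inner M (b n) (?g j) * l2_inner M (?g j) (?g i))
        = l2_inner M (\<lambda>x. \<Sum>j<n. l2_inner M (b n) (?g j) * ?g j x) (?g i)"
      using g i by (intro l2_inner_sum_left[symmetric]) auto
    finally show ?thesis
      unfolding d_def using i
      by (subst l2_inner_diff_left) (auto intro!: b L2_sum L2_scale g)
  qed
  moreover have "l2_norm M (?g n) = 0 \<or> l2_norm M (?g n) = 1"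
    unfolding gn l2_norm_scale by (cases "l2_norm M d = 0") (simp_all add: norm_inverse)
  ultimately show ?case
    using d by (auto simp: gn l2_inner_scale_left intro: L2_scale)
qed

text \<open>The matrix \<open>a\<close> is lower triangular, so one choice of coefficients serves
  every \<open>n > k\<close>: the terms with \<open>k < j < n\<close> are zero.\<close>

lemma gram_schmidt_expand:
  assumes b: "\<And>j. b j \<in> L2 M"
  obtains a where "\<And>k n. k < n \<Longrightarrow> AE x in M. b k x = (\<Sum>j<n. a k j * gram_schmidt M b j x)"
proof -
  let ?g = "gram_schmidt M b"
  define d where "d k = (\<lambda>x. b k x - (\<Sum>j<k. l2_inner M (b k) (?g j) * ?g j x))" for k
  define a where "a k j = (if j < k then l2_inner M (b k) (?g j) else if j = k then complex_of_real (l2_norm M (d k)) else 0)" for k j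
  have d: "d k \<in> L2 M" for k
    unfolding d_def by (intro L2_diff b L2_sum L2_scale) (use gram_schmidt_properties[of b M, OF b] in auto)
  have "AE x in M. b k x = (\<Sum>j<n. a k j * ?g j x)" if "k < n" for k n
  proof -
    have gk: "?g k = (\<lambda>x. complex_of_real (inverse (l2_norm M (d k))) * d k x)"
      unfolding d_def by (subst gram_schmidt.simps) (simp add: Let_def)
    \<comment> \<open>For a null residual the equation reduces to \<open>d k x = 0\<close>, which is
      known only almost everywhere.\<close>
    have "AE x in M. d k x = complex_of_real (l2_norm M (d k)) * ?g k x"
    proof (cases "l2_norm M (d k) = 0")
      case True
      then show ?thesis
        using l2_norm_eq_0_iff[OF d, of k] by simp
    qed (simp add: gk)
    moreover have "(\<Sum>j<n. a k j * ?g j x) = (\<Sum>j<k. l2_inner M (b k) (?g j) * ?g j x) + complex_of_real (l2_norm M (d k)) * ?g k x" for x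
    proof -
      have "(\<Sum>j<n. a k j * ?g j x) = (\<Sum>j<Suc k. a k j * ?g j x)"
        using that by (intro sum.mono_neutral_right) (auto simp: a_def)
      then show ?thesis
        by (simp add: a_def)
    qed
    ultimately show ?thesis
      by (auto simp: d_def algebra_simps elim!: eventually_mono)
  qed
  then show thesis
    by (rule that)
qed

text \<open>If a combination \<open>g\<close> of the first \<open>N\<close> vectors
  \<open>b j\<close> is within \<open>\<epsilon> / 2\<close> of \<open>f\<close>, then for
  \<open>N \<le> n\<close> the projection fixes \<open>g\<close> up to a null set, and Bessel
  applied to \<open>g - f\<close> bounds the rest by another \<open>\<epsilon> / 2\<close>.\<close>

lemma total_imp_orthonormal_expansion:
  assumes b: "\<And>j. b j \<in> L2 M"
    and total: "\<And>f \<epsilon>. f \<in> L2 M \<Longrightarrow> 0 < \<epsilon> \<Longrightarrow> \<exists>(N::nat) c. l2_norm M (\<lambda>x. f x - (\<Sum>j<N. c j * b j x)) < \<epsilon>"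
  shows "\<exists>e. orthonormal_or_zero M e \<and>
    (\<forall>f\<in>L2 M. (\<lambda>n. l2_norm M (\<lambda>x. f x - proj M e n f x)) \<longlonglongrightarrow> 0)"
proof (intro exI conjI ballI)
  let ?e = "gram_schmidt M b"
  note gs = gram_schmidt_properties[of b M, OF b]
  show "orthonormal_or_zero M ?e"
  proof
    show "l2_inner M (?e i) (?e j) = 0" if "i \<noteq> j" for i j
      using gs[of i] gs[of j] that l2_inner_commute[of M "?e i" "?e j"]
      by (cases i j rule: linorder_cases) auto
  qed (use gs in auto)
  then interpret orthonormal_or_zero M ?e .
  fix f assume f: "f \<in> L2 M"
  show "(\<lambda>n. l2_norm M (\<lambda>x. f x - proj M ?e n f x)) \<longlonglongrightarrow> 0"
  proof (rule LIMSEQ_I)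
    fix \<epsilon> :: real assume "0 < \<epsilon>"
    then obtain N :: nat and c where Nc: "l2_norm M (\<lambda>x. f x - (\<Sum>j<N. c j * b j x)) < \<epsilon> / 2"
      using total[OF f, of "\<epsilon> / 2"] by auto
    define g where "g = (\<lambda>x. \<Sum>j<N. c j * b j x)"
    have Nc': "l2_norm M (\<lambda>x. f x - g x) < \<epsilon> / 2"
      using Nc by (simp add: g_def)
    have g: "g \<in> L2 M"
      unfolding g_def by (intro L2_sum L2_scale b)
    obtain a where a: "\<And>k n. k < n \<Longrightarrow> AE x in M. b k x = (\<Sum>j<n. a k j * ?e j x)"
      using gram_schmidt_expand[of b M, OF b] by blast
    have "l2_norm M (\<lambda>x. f x - proj M ?e n f x) < \<epsilon>" if n: "N \<le> n" for n
    proof -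
      have "AE x in M. \<forall>k\<in>{..<N}. b k x = (\<Sum>j<n. a k j * ?e j x)"
        using n by (intro AE_finite_allI a) auto
      then have "AE x in M. g x = (\<Sum>j<n. (\<Sum>k<N. c k * a k j) * ?e j x)"
      proof eventually_elim
        case (elim x)
        then have "g x = (\<Sum>k<N. \<Sum>j<n. c k * a k j * ?e j x)"
          unfolding g_def by (intro sum.cong) (auto simp: sum_distrib_left mult.assoc)
        also have "\<dots> = (\<Sum>j<n. \<Sum>k<N. c k * a k j * ?e j x)"
          by (rule sum.swap)
        finally show ?case
          by (simp add: sum_distrib_right)
      qed
      then have null: "l2_norm M (\<lambda>x. g x - proj M ?e n g x) = 0"
        by (rule residual_null[OF g])
      have "proj M ?e n (\<lambda>x. g x - f x) = (\<lambda>x. proj M ?e n g x - proj M ?e n f x)"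
        by (simp add: proj_def l2_inner_diff_left g f e_L2 left_diff_distrib sum_subtractf)
      then have "l2_norm M (\<lambda>x. proj M ?e n g x - proj M ?e n f x) \<le> l2_norm M (\<lambda>x. f x - g x)"
        using Bessel[OF L2_diff[OF g f], of n] by (simp add: l2_norm_minus_commute[of M f g])
      moreover have "l2_norm M (\<lambda>x. f x - proj M ?e n f x) \<le> l2_norm M (\<lambda>x. f x - g x) + l2_norm M (\<lambda>x. g x - proj M ?e n f x)"
        by (intro l2_norm_triangle_diff f g L2_proj')
      moreover have "l2_norm M (\<lambda>x. g x - proj M ?e n f x) \<le> l2_norm M (\<lambda>x. g x - proj M ?e n g x) + l2_norm M (\<lambda>x. proj M ?e n g x - proj M ?e n f x)"
        by (intro l2_norm_triangle_diff f g L2_proj')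
      ultimately show ?thesis
        using null Nc' by linarith
    qed
    then show "\<exists>no. \<forall>n\<ge>no. norm (l2_norm M (\<lambda>x. f x - proj M ?e n f x) - 0) < \<epsilon>"
      by auto
  qed
qed

subsection \<open>Series of integrable functions\<close>

text \<open>By monotone convergence the sum of the norms has finite integral, hence is finite almost
  everywhere. This supplies the pointwise hypothesis of \<open>sums_integral\<close>.\<close>

lemma AE_summable_norm:
  fixes f :: "nat \<Rightarrow> 'a \<Rightarrow> 'b::{banach, second_countable_topology}"
  assumes f: "\<And>i. integrable M (f i)" and s: "summable (\<lambda>i. \<integral>x. norm (f i x) \<partial>M)"
  shows "AE x in M. summable (\<lambda>i. norm (f i x))"
proof -
  have [measurable]: "f i \<in> borel_measurable M" for i
    using f[of i] by auto
  have "(\<integral>\<^sup>+x. (\<Sum>i. ennreal (norm (f i x))) \<partial>M) = (\<Sum>i. \<integral>\<^sup>+x. ennreal (norm (f i x)) \<partial>M)"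
    by (intro nn_integral_suminf) auto
  also have "\<dots> = (\<Sum>i. ennreal (\<integral>x. norm (f i x) \<partial>M))"
    by (intro suminf_cong nn_integral_eq_integral integrable_norm f) auto
  also have "\<dots> < \<infinity>"
    using s by (simp add: less_top ennreal_suminf_neq_top)
  finally have "AE x in M. (\<Sum>i. ennreal (norm (f i x))) \<noteq> \<infinity>"
    by (intro nn_integral_PInf_AE) auto
  then show ?thesis
    by eventually_elim (auto intro: summable_suminf_not_top)
qed

text \<open>Trace class functions are represented by series over one index, whereas sums of two of
  them and images under \<open>theta\<close> come as double series; \<open>prod_decode\<close>
  flattens these, and absolute convergence makes the order irrelevant.\<close>

lemma prod_decode_sums:
  fixes a :: "nat \<Rightarrow> nat \<Rightarrow> 'b::{banach, second_countable_topology}"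
  assumes row: "\<And>i. summable (\<lambda>j. norm (a i j))" and col: "summable (\<lambda>i. \<Sum>j. norm (a i j))"
  shows "summable (\<lambda>m. norm (case prod_decode m of (i, j) \<Rightarrow> a i j))"
    and "(\<lambda>m. case prod_decode m of (i, j) \<Rightarrow> a i j) sums (\<Sum>i. \<Sum>j. a i j)"
proof -
  let ?f = "\<lambda>(i, j). a i j"
  have infsum_nat: "infsum g UNIV = suminf g" if "summable (\<lambda>j. norm (g j))" for g :: "nat \<Rightarrow> 'c::banach"
    using that norm_summable_imp_has_sum[OF that] by (metis infsumI summable_norm_cancel summable_sums)
  have abs: "(\<lambda>p. norm (?f p)) summable_on (UNIV \<times> UNIV)"
  proof (rule Infinite_Sum.abs_summable_on_Sigma_iff[where f = ?f and A = UNIV and B = "\<lambda>_. UNIV", THEN iffD2], intro conjI ballI)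
    show "(\<lambda>j. norm (?f (i, j))) summable_on UNIV" for i
      using row by (simp add: summable_on_UNIV_nonneg_real_iff)
    show "(\<lambda>i. norm (infsum (\<lambda>j. norm (?f (i, j))) UNIV)) summable_on UNIV"
      using row col by (simp add: infsum_nat summable_on_UNIV_nonneg_real_iff suminf_nonneg)
  qed
  have bij: "bij_betw prod_decode UNIV (UNIV \<times> UNIV)"
    by (simp add: bij_prod_decode)
  have abs': "(\<lambda>m. norm (?f (prod_decode m))) summable_on UNIV"
    using abs summable_on_reindex_bij_betw[OF bij, of "\<lambda>p. norm (?f p)"] by simp
  then show s: "summable (\<lambda>m. norm (?f (prod_decode m)))"
    by (simp add: summable_on_UNIV_nonneg_real_iff)
  have "suminf (\<lambda>m. ?f (prod_decode m)) = infsum (\<lambda>m. ?f (prod_decode m)) UNIV"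
    by (rule infsum_nat[OF s, symmetric])
  also have "\<dots> = infsum ?f (UNIV \<times> UNIV)"
    by (rule infsum_reindex_bij_betw[OF bij])
  also have "\<dots> = infsum (\<lambda>i. infsum (\<lambda>j. a i j) UNIV) UNIV"
    using infsum_Sigma'_banach[of a UNIV "\<lambda>_. UNIV"] Infinite_Sum.abs_summable_summable[OF abs] by simp
  also have "\<dots> = infsum (\<lambda>i. \<Sum>j. a i j) UNIV"
    by (simp add: infsum_nat row)
  also have "\<dots> = (\<Sum>i. \<Sum>j. a i j)"
  proof (rule infsum_nat, rule summable_comparison_test'[OF col])
    show "norm (norm (\<Sum>j. a i j)) \<le> (\<Sum>j. norm (a i j))" for i
      using summable_norm[OF row] by simp
  qed
  finally show "(\<lambda>m. ?f (prod_decode m)) sums (\<Sum>i. \<Sum>j. a i j)"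
    using s by (simp add: sums_iff summable_norm_cancel)
qed

lemma summable_mult_of_squares:
  fixes a b :: "nat \<Rightarrow> real"
  assumes "summable (\<lambda>i. (a i)\<^sup>2)" "summable (\<lambda>i. (b i)\<^sup>2)"
  shows "summable (\<lambda>i. \<bar>a i * b i\<bar>)"
proof (rule summable_comparison_test'[OF summable_add[OF assms]])
  show "norm \<bar>a i * b i\<bar> \<le> (a i)\<^sup>2 + (b i)\<^sup>2" for i
    using sum_squares_bound[of "\<bar>a i\<bar>" "\<bar>b i\<bar>"] abs_ge_zero[of "a i * b i"]
    unfolding real_norm_def abs_abs abs_mult power2_abs by linarith
qed

lemma (in pair_sigma_finite) integrable_tensor:
  fixes f g :: "_ \<Rightarrow> complex"
  assumes f: "integrable M1 f" and g: "integrable M2 g"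
  shows "integrable (M1 \<Otimes>\<^sub>M M2) (\<lambda>(x, y). f x * g y)"
    and "(\<integral>(x, y). f x * g y \<partial>(M1 \<Otimes>\<^sub>M M2)) = (\<integral>x. f x \<partial>M1) * (\<integral>y. g y \<partial>M2)"
proof -
  have [measurable]: "f \<in> borel_measurable M1" "g \<in> borel_measurable M2"
    using f g by auto
  show i: "integrable (M1 \<Otimes>\<^sub>M M2) (\<lambda>(x, y). f x * g y)"
    using f g by (intro Fubini_integrable) (auto simp: norm_mult)
  then show "(\<integral>(x, y). f x * g y \<partial>(M1 \<Otimes>\<^sub>M M2)) = (\<integral>x. f x \<partial>M1) * (\<integral>y. g y \<partial>M2)"
    using integral_fst'[OF i] by simp
qed

lemma (in pair_sigma_finite) integral_norm_tensor:
  fixes f g :: "_ \<Rightarrow> complex"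
  assumes f: "integrable M1 f" and g: "integrable M2 g"
  shows "(\<integral>z. cmod (case z of (x, y) \<Rightarrow> f x * g y) \<partial>(M1 \<Otimes>\<^sub>M M2)) = (\<integral>x. cmod (f x) \<partial>M1) * (\<integral>y. cmod (g y) \<partial>M2)"
proof -
  have c: "(\<integral>x. complex_of_real (cmod (f x)) \<partial>M1) = of_real (\<integral>x. cmod (f x) \<partial>M1)"
    "(\<integral>y. complex_of_real (cmod (g y)) \<partial>M2) = of_real (\<integral>y. cmod (g y) \<partial>M2)"
    by (rule integral_complex_of_real)+
  \<comment> \<open>The moduli are regarded as complex functions so that the complex product formula
    \<open>integrable_tensor(2)\<close> applies to them.\<close>
  have "complex_of_real (\<integral>z. cmod (case z of (x, y) \<Rightarrow> f x * g y) \<partial>(M1 \<Otimes>\<^sub>M M2))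
      = (\<integral>(x, y). complex_of_real (cmod (f x)) * complex_of_real (cmod (g y)) \<partial>(M1 \<Otimes>\<^sub>M M2))"
    by (subst integral_complex_of_real[symmetric], intro Bochner_Integration.integral_cong)
       (auto simp: norm_mult)
  also have "\<dots> = of_real (\<integral>x. cmod (f x) \<partial>M1) * of_real (\<integral>y. cmod (g y) \<partial>M2)"
    using f g by (subst integrable_tensor(2)) (auto simp: c intro!: integrable_of_real)
  finally show ?thesis
    by (simp only: of_real_mult[symmetric] of_real_eq_iff)
qed

subsection \<open>Bounded operators\<close>

lemma BL2_L2: "T \<in> BL2 M \<Longrightarrow> f \<in> L2 M \<Longrightarrow> T f \<in> L2 M"
  by (simp add: BL2_def)

lemma BL2_add: "T \<in> BL2 M \<Longrightarrow> f \<in> L2 M \<Longrightarrow> g \<in> L2 M \<Longrightarrow> AE x in M. T (\<lambda>y. f y + g y) x = T f x + T g x"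
  by (simp add: BL2_def)

lemma BL2_scale: "T \<in> BL2 M \<Longrightarrow> f \<in> L2 M \<Longrightarrow> AE x in M. T (\<lambda>y. c * f y) x = c * T f x"
  by (simp add: BL2_def)

lemma BL2_bound:
  assumes "T \<in> BL2 M"
  shows "\<exists>C\<ge>0. \<forall>f\<in>L2 M. l2_norm M (T f) \<le> C * l2_norm M f"
proof -
  from assms obtain C where C: "\<And>f. f \<in> L2 M \<Longrightarrow> l2_norm M (T f) \<le> C * l2_norm M f"
    unfolding BL2_def by blast
  have "l2_norm M (T f) \<le> \<bar>C\<bar> * l2_norm M f" if "f \<in> L2 M" for f
    using C[OF that] abs_ge_self[of C] by (meson l2_norm_nonneg mult_right_mono order_trans)
  then show ?thesis
    by (intro exI[of _ "\<bar>C\<bar>"]) auto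
qed

lemma BL2_diff:
  assumes "T \<in> BL2 M" "f \<in> L2 M" "g \<in> L2 M"
  shows "AE x in M. T (\<lambda>y. f y - g y) x = T f x - T g x"
  using BL2_add[OF assms(1,2) L2_scale[OF assms(3)], of "-1"] BL2_scale[OF assms(1,3), of "-1"]
  by eventually_elim simp

text \<open>\<open>BL2\<close> prescribes no compatibility with almost everywhere equality. It
  follows from the norm bound: \<open>f - g\<close> has norm 0, so its image has norm 0, and
  \<open>T\<close> respects differences up to null sets.\<close>

lemma BL2_cong_AE:
  assumes T: "T \<in> BL2 M" and fg: "f \<in> L2 M" "g \<in> L2 M" and ae: "AE x in M. f x = g x"
  shows "AE x in M. T f x = T g x"
proof -
  obtain C where "0 \<le> C" "\<forall>f\<in>L2 M. l2_norm M (T f) \<le> C * l2_norm M f"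
    using BL2_bound[OF T] by blast
  note C = this(1) this(2)[rule_format]
  have "l2_norm M (\<lambda>y. f y - g y) = 0"
    using ae l2_norm_eq_0_iff[OF L2_diff[OF fg]] by simp
  then have "l2_norm M (T (\<lambda>y. f y - g y)) = 0"
    using C(2)[OF L2_diff[OF fg]] by (simp add: order_antisym)
  then have "AE x in M. T (\<lambda>y. f y - g y) x = 0"
    using l2_norm_eq_0_iff[OF BL2_L2[OF T L2_diff[OF fg]]] by simp
  with BL2_diff[OF T fg] show ?thesis
    by eventually_elim simp
qed

lemma BL2_sum:
  assumes T: "T \<in> BL2 M" and f: "\<And>j. f j \<in> L2 M"
  shows "AE x in M. T (\<lambda>y. \<Sum>j<(n::nat). c j * f j y) x = (\<Sum>j<n. c j * T (f j) x)"
proof (induction n)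
  case 0
  show ?case
    using BL2_scale[OF T f, of 0] by simp
next
  case (Suc n)
  have "AE x in M. T (\<lambda>y. (\<Sum>j<n. c j * f j y) + c n * f n y) x = T (\<lambda>y. \<Sum>j<n. c j * f j y) x + T (\<lambda>y. c n * f n y) x"
    by (intro BL2_add T L2_sum L2_scale f)
  with Suc BL2_scale[OF T f, of "c n" n] show ?case
    by eventually_elim simp
qed

lemma bil_op_bound:
  assumes "T \<in> BL2 M" "0 \<le> C" "\<And>f. f \<in> L2 M \<Longrightarrow> l2_norm M (T f) \<le> C * l2_norm M f" "f \<in> L2 M" "g \<in> L2 M"
  shows "cmod (bil M (T f) g) \<le> C * (l2_norm M f * l2_norm M g)"
proof -
  have "cmod (bil M (T f) g) \<le> l2_norm M (T f) * l2_norm M g"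
    by (intro bil_bound BL2_L2[OF assms(1)] assms)
  also have "\<dots> \<le> C * l2_norm M f * l2_norm M g"
    by (intro mult_right_mono assms) auto
  finally show ?thesis
    by (simp add: mult.assoc)
qed

lemma BL2_tendsto:
  assumes T: "T \<in> BL2 M" and L2: "\<And>n. F n \<in> L2 M" "f \<in> L2 M"
    and lim: "(\<lambda>n. l2_norm M (\<lambda>x. F n x - f x)) \<longlonglongrightarrow> 0"
  shows "(\<lambda>n. l2_norm M (\<lambda>x. T (F n) x - T f x)) \<longlonglongrightarrow> 0"
proof -
  obtain C where "0 \<le> C" "\<forall>f\<in>L2 M. l2_norm M (T f) \<le> C * l2_norm M f"
    using BL2_bound[OF T] by blast
  note C = this(1) this(2)[rule_format]
  have "l2_norm M (\<lambda>x. T (F n) x - T f x) \<le> C * l2_norm M (\<lambda>x. F n x - f x)" for n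
  proof -
    have "l2_norm M (\<lambda>x. T (F n) x - T f x) = l2_norm M (T (\<lambda>x. F n x - f x))"
      using BL2_diff[OF T L2, of n]
      by (intro l2_norm_cong_AE L2_measurable L2_diff BL2_L2[OF T] L2) (simp add: eq_commute)
    then show ?thesis
      using C(2)[OF L2_diff[OF L2]] by simp
  qed
  then have "\<forall>\<^sub>F n in sequentially. norm (l2_norm M (\<lambda>x. T (F n) x - T f x)) \<le> C * l2_norm M (\<lambda>x. F n x - f x)"
    by simp
  moreover have "(\<lambda>n. C * l2_norm M (\<lambda>x. F n x - f x)) \<longlonglongrightarrow> 0"
    using lim by (auto intro: tendsto_eq_intros)
  ultimately show ?thesis
    by (rule Lim_null_comparison)
qed

lemma bil_BL2_tendsto:
  assumes "T \<in> BL2 M" "\<And>n. F n \<in> L2 M" "f \<in> L2 M" "\<And>n. G n \<in> L2 M" "g \<in> L2 M"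
    and "(\<lambda>n. l2_norm M (\<lambda>x. F n x - f x)) \<longlonglongrightarrow> 0" "(\<lambda>n. l2_norm M (\<lambda>x. G n x - g x)) \<longlonglongrightarrow> 0"
  shows "(\<lambda>n. bil M (T (F n)) (G n)) \<longlonglongrightarrow> bil M (T f) g"
  by (rule bil_tendsto[OF BL2_L2[OF assms(1,2)] BL2_L2[OF assms(1,3)] assms(4,5) BL2_tendsto[OF assms(1,2,3,6)] assms(7)])

text \<open>Completeness is used in the form of norm convergence of the partial sums: replacing
  \<open>T f\<close> by \<open>T (proj M e n f)\<close> turns a bilinear expression in
  \<open>T\<close> into a finite sum of products, where integrals and series can be exchanged, and
  the limit in \<open>n\<close> is taken afterwards.\<close>

locale hilbert_basis = sigma_finite_measure M + orthonormal_or_zero M e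
  for M :: "'a measure" and e :: "nat \<Rightarrow> 'a \<Rightarrow> complex" +
  assumes proj_tendsto: "f \<in> L2 M \<Longrightarrow> (\<lambda>n. l2_norm M (\<lambda>x. f x - proj M e n f x)) \<longlonglongrightarrow> 0"
begin

sublocale pair_sigma_finite M M ..

lemma proj_tendsto': "f \<in> L2 M \<Longrightarrow> (\<lambda>n. l2_norm M (\<lambda>x. proj M e n f x - f x)) \<longlonglongrightarrow> 0"
  by (subst l2_norm_minus_commute) (rule proj_tendsto)

lemma bil_op_proj:
  assumes "T \<in> BL2 M" "f \<in> L2 M" "g \<in> L2 M"
  shows "bil M (T (proj M e n f)) g = (\<Sum>j<n. l2_inner M f (e j) * bil M (T (e j)) g)"
proof -
  have "bil M (T (proj M e n f)) g = bil M (\<lambda>x. \<Sum>j<n. l2_inner M f (e j) * T (e j) x) g"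
    using BL2_sum[where c = "\<lambda>j. l2_inner M f (e j)" and n = n, OF assms(1) e_L2]
    by (intro bil_cong_AE L2_measurable BL2_L2[OF assms(1)] L2_proj' L2_sum L2_scale e_L2 assms) (auto simp: proj_def)
  then show ?thesis
    by (simp add: bil_sum_left BL2_L2[OF assms(1)] assms e_L2)
qed

lemma bil_op_proj_tendsto:
  assumes "T \<in> BL2 M" "f \<in> L2 M" "g \<in> L2 M"
  shows "(\<lambda>n. bil M (T (proj M e n f)) g) \<longlonglongrightarrow> bil M (T f) g"
  using assms by (intro bil_BL2_tendsto L2_proj' proj_tendsto') auto

text \<open>The bound is uniform in \<open>n\<close> by Bessel, so it serves as the majorant when
  \<open>n\<close> goes to infinity under a series or an integral.\<close>

lemma bil_op_proj_bound:
  assumes "T \<in> BL2 M" "0 \<le> C" "\<And>f. f \<in> L2 M \<Longrightarrow> l2_norm M (T f) \<le> C * l2_norm M f" "f \<in> L2 M" "g \<in> L2 M"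
  shows "cmod (bil M (T (proj M e n f)) g) \<le> C * (l2_norm M f * l2_norm M g)"
proof -
  have "cmod (bil M (T (proj M e n f)) g) \<le> C * (l2_norm M (proj M e n f) * l2_norm M g)"
    by (intro bil_op_bound L2_proj' assms)
  also have "\<dots> \<le> C * (l2_norm M f * l2_norm M g)"
    by (intro mult_left_mono mult_right_mono Bessel assms) auto
  finally show ?thesis .
qed

subsection \<open>The trace class and its pairing\<close>

lemma represents_norm_summable:
  assumes "represents M f g h"
  shows "summable (\<lambda>i. l2_norm M (f i) * l2_norm M (g i))"
  using summable_mult_of_squares[of "\<lambda>i. l2_norm M (f i)" "\<lambda>i. l2_norm M (g i)"] assms
  by (simp add: represents_def)

lemma represents_L2: "represents M f g h \<Longrightarrow> f i \<in> L2 M" "represents M f g h \<Longrightarrow> g i \<in> L2 M"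
  by (auto simp: represents_def)

text \<open>The right-hand side involves the representation only through the sum of the series, that
  is through \<open>h\<close>. It is the pairing of \<open>h\<close> with the rank-one operator
  sending \<open>u\<close> to \<open>bil M u a\<close> times \<open>b\<close>; the integrals of the
  moduli are summable by Cauchy-Schwarz.\<close>

lemma represents_rank_one_sums:
  assumes r: "represents M f g h" and ab: "a \<in> L2 M" "b \<in> L2 M"
  shows "(\<lambda>i. bil M (f i) a * bil M b (g i)) sums
    (\<integral>(x, y). (\<Sum>i. f i x * g i y) * (a x * b y) \<partial>(M \<Otimes>\<^sub>M M))"
proof -
  let ?F = "\<lambda>i (x, y). (f i x * a x) * (b y * g i y)"
  note fg = represents_L2[OF r]
  have m: "integrable M (\<lambda>x. f i x * a x)" "integrable M (\<lambda>y. b y * g i y)" for i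
    by (auto intro: L2_mult_integrable fg ab)
  have int: "integrable (M \<Otimes>\<^sub>M M) (?F i)" for i
    using integrable_tensor(1)[OF m] .
  have "(\<integral>z. norm (?F i z) \<partial>(M \<Otimes>\<^sub>M M)) = (\<integral>x. cmod (f i x * a x) \<partial>M) * (\<integral>y. cmod (b y * g i y) \<partial>M)" for i
    by (rule integral_norm_tensor[OF m])
  then have "(\<integral>z. norm (?F i z) \<partial>(M \<Otimes>\<^sub>M M))
      \<le> (l2_norm M (f i) * l2_norm M a) * (l2_norm M b * l2_norm M (g i))" for i
    using l2_norm_Cauchy_Schwarz[OF fg(1) ab(1), of i] l2_norm_Cauchy_Schwarz[OF ab(2) fg(2), of i]
    by (auto intro!: mult_mono)
  moreover have "summable (\<lambda>i. (l2_norm M (f i) * l2_norm M a) * (l2_norm M b * l2_norm M (g i)))"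
    using summable_mult[OF represents_norm_summable[OF r], of "l2_norm M a * l2_norm M b"]
    by (simp add: ac_simps)
  ultimately have s: "summable (\<lambda>i. \<integral>z. norm (?F i z) \<partial>(M \<Otimes>\<^sub>M M))"
    using summable_comparison_test'[of "\<lambda>i. (l2_norm M (f i) * l2_norm M a) * (l2_norm M b * l2_norm M (g i))" 0
      "\<lambda>i. \<integral>z. norm (?F i z) \<partial>(M \<Otimes>\<^sub>M M)"]
    by (simp only: real_norm_def abs_of_nonneg[OF Bochner_Integration.integral_nonneg[OF norm_ge_zero]])
  have "(\<lambda>i. \<integral>z. ?F i z \<partial>(M \<Otimes>\<^sub>M M)) sums (\<integral>z. (\<Sum>i. ?F i z) \<partial>(M \<Otimes>\<^sub>M M))"
    by (rule sums_integral[OF int AE_summable_norm[OF int s] s])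
  moreover have "(\<integral>z. ?F i z \<partial>(M \<Otimes>\<^sub>M M)) = bil M (f i) a * bil M b (g i)" for i
    unfolding bil_def by (rule integrable_tensor(2)[OF m])
  moreover have "(\<integral>z. (\<Sum>i. ?F i z) \<partial>(M \<Otimes>\<^sub>M M)) = (\<integral>(x, y). (\<Sum>i. f i x * g i y) * (a x * b y) \<partial>(M \<Otimes>\<^sub>M M))"
  proof (rule integral_cong_AE)
    have [measurable]: "f i \<in> borel_measurable M" "g i \<in> borel_measurable M"
       "a \<in> borel_measurable M" "b \<in> borel_measurable M" for i
      using fg[of i] ab by (auto dest: L2_measurable)
    show "(\<lambda>z. \<Sum>i. ?F i z) \<in> borel_measurable (M \<Otimes>\<^sub>M M)"
      "(\<lambda>(x, y). (\<Sum>i. f i x * g i y) * (a x * b y)) \<in> borel_measurable (M \<Otimes>\<^sub>M M)"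
      by measurable
    have "AE z in M \<Otimes>\<^sub>M M. summable (\<lambda>i. case z of (x, y) \<Rightarrow> f i x * g i y)"
      using r unfolding represents_def by (auto elim!: eventually_mono simp: sums_iff)
    then show "AE z in M \<Otimes>\<^sub>M M. (\<Sum>i. ?F i z) = (case z of (x, y) \<Rightarrow> (\<Sum>i. f i x * g i y) * (a x * b y))"
    proof eventually_elim
      case (elim z)
      obtain x y where z: "z = (x, y)"
        by fastforce
      show ?case
        using suminf_mult2[of "\<lambda>i. f i x * g i y" "a x * b y"] elim by (simp add: z ac_simps)
    qed
  qed
  ultimately show ?thesis
    by simp
qed

text \<open>Composing with the finite-rank projections reduces the claim to rank-one operators, for which
  the sum is the integral of \<open>h\<close> against a function of two variables.\<close>

lemma represents_unique:
  assumes r: "represents M f g h" "represents M f' g' h" and T: "T \<in> BL2 M"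
  shows "(\<Sum>i. bil M (T (f i)) (g i)) = (\<Sum>i. bil M (T (f' i)) (g' i))"
proof -
  obtain C where "0 \<le> C" "\<forall>f\<in>L2 M. l2_norm M (T f) \<le> C * l2_norm M f"
    using BL2_bound[OF T] by blast
  note C = this(1) this(2)[rule_format]
  have lim: "(\<lambda>n. \<Sum>i. bil M (T (proj M e n (f i))) (g i)) \<longlonglongrightarrow> (\<Sum>i. bil M (T (f i)) (g i))"
    if r: "represents M f g h" for f g
  \<comment> \<open>Dominated convergence for series: the terms converge for each \<open>i\<close>
    and share a summable majorant independent of \<open>n\<close>.\<close>
  proof (rule tannerys_theorem[THEN conjunct2, THEN conjunct2])
    show "(\<lambda>n. bil M (T (proj M e n (f i))) (g i)) \<longlonglongrightarrow> bil M (T (f i)) (g i)" for i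
      using represents_L2[OF r] by (intro bil_op_proj_tendsto T)
    show "\<forall>\<^sub>F (i, n) in sequentially \<times>\<^sub>F sequentially.
        cmod (bil M (T (proj M e n (f i))) (g i)) \<le> C * (l2_norm M (f i) * l2_norm M (g i))"
      using represents_L2[OF r] by (auto intro!: always_eventually bil_op_proj_bound T C)
    show "summable (\<lambda>i. C * (l2_norm M (f i) * l2_norm M (g i)))"
      by (intro summable_mult represents_norm_summable[OF r])
  qed simp
  have finite_rank: "(\<Sum>i. bil M (T (proj M e n (f i))) (g i)) = (\<Sum>j<n.
      \<integral>(x, y). (\<Sum>i. f i x * g i y) * (cnj (e j x) * T (e j) y) \<partial>(M \<Otimes>\<^sub>M M))" 
    if r: "represents M f g h" for f g n
  proof -
    have "(\<lambda>i. \<Sum>j<n. bil M (f i) (\<lambda>x. cnj (e j x)) * bil M (T (e j)) (g i)) sums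
      (\<Sum>j<n. \<integral>(x, y). (\<Sum>i. f i x * g i y) * (cnj (e j x) * T (e j) y) \<partial>(M \<Otimes>\<^sub>M M))"
      by (intro sums_sum represents_rank_one_sums[OF r] L2_cnj BL2_L2[OF T] e_L2)
    then show ?thesis
      using represents_L2[OF r] by (simp add: bil_op_proj T sums_iff l2_inner_bil)
  qed
  have "(\<integral>(x, y). (\<Sum>i. f i x * g i y) * (cnj (e j x) * T (e j) y) \<partial>(M \<Otimes>\<^sub>M M))
      = (\<integral>(x, y). (\<Sum>i. f' i x * g' i y) * (cnj (e j x) * T (e j) y) \<partial>(M \<Otimes>\<^sub>M M))" for j
  proof (rule integral_cong_AE)
    have [measurable]: "f i \<in> borel_measurable M" "g i \<in> borel_measurable M" "f' i \<in> borel_measurable M"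
       "g' i \<in> borel_measurable M" "e j \<in> borel_measurable M" "T (e j) \<in> borel_measurable M" for i
      using represents_L2[OF r(1)] represents_L2[OF r(2)] e_L2 BL2_L2[OF T e_L2] by (auto dest: L2_measurable)
    show "(\<lambda>(x, y). (\<Sum>i. f i x * g i y) * (cnj (e j x) * T (e j) y)) \<in> borel_measurable (M \<Otimes>\<^sub>M M)"
      "(\<lambda>(x, y). (\<Sum>i. f' i x * g' i y) * (cnj (e j x) * T (e j) y)) \<in> borel_measurable (M \<Otimes>\<^sub>M M)"
      by measurable
    have "AE (x, y) in M \<Otimes>\<^sub>M M. (\<lambda>i. f i x * g i y) sums h (x, y)"
      "AE (x, y) in M \<Otimes>\<^sub>M M. (\<lambda>i. f' i x * g' i y) sums h (x, y)"
      using r by (auto simp: represents_def)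
    then show "AE z in M \<Otimes>\<^sub>M M. (case z of (x, y) \<Rightarrow> (\<Sum>i. f i x * g i y) * (cnj (e j x) * T (e j) y))
      = (case z of (x, y) \<Rightarrow> (\<Sum>i. f' i x * g' i y) * (cnj (e j x) * T (e j) y))"
      by eventually_elim (auto simp: sums_iff)
  qed
  then have "(\<lambda>n. \<Sum>i. bil M (T (proj M e n (f i))) (g i)) = (\<lambda>n. \<Sum>i. bil M (T (proj M e n (f' i))) (g' i))"
    using r by (simp add: finite_rank)
  then show ?thesis
    using lim[OF r(1)] lim[OF r(2)] LIMSEQ_unique by auto
qed

text \<open>Existence and uniqueness for the \<open>THE\<close> in \<open>pairing_def\<close> are
  the given representation and \<open>represents_unique\<close>, so any representation may be used
  for computing.\<close>

lemma pairing_eq: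
  assumes r: "represents M f g h" and T: "T \<in> BL2 M"
  shows "pairing M T h = (\<Sum>i. bil M (T (f i)) (g i))"
  unfolding pairing_def l2_inner_cnj_eq_bil
proof (rule the_equality)
  show "\<exists>fa ga. represents M fa ga h \<and> (\<Sum>i. bil M (T (f i)) (g i)) = (\<Sum>i. bil M (T (fa i)) (ga i))"
    using r by blast
  show "c = (\<Sum>i. bil M (T (f i)) (g i))" if "\<exists>f g. represents M f g h \<and> c = (\<Sum>i. bil M (T (f i)) (g i))" for c
    using that represents_unique[OF _ r T] by auto
qed

lemma represents_bil_summable:
  assumes r: "represents M f g h" and T: "T \<in> BL2 M"
  shows "summable (\<lambda>i. cmod (bil M (T (f i)) (g i)))"
proof -
  obtain C where "0 \<le> C" "\<forall>f\<in>L2 M. l2_norm M (T f) \<le> C * l2_norm M f"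
    using BL2_bound[OF T] by blast
  note C = this(1) this(2)[rule_format]
  have "summable (\<lambda>i. C * (l2_norm M (f i) * l2_norm M (g i)))"
    by (intro summable_mult represents_norm_summable[OF r])
  then show ?thesis
    by (rule summable_comparison_test'[where N = 0])
       (use represents_L2[OF r] in \<open>auto intro!: bil_op_bound T C\<close>)
qed

lemma pairing_sums:
  assumes r: "represents M f g h" and T: "T \<in> BL2 M"
  shows "(\<lambda>i. bil M (T (f i)) (g i)) sums pairing M T h"
  using represents_bil_summable[OF assms] by (simp add: pairing_eq[OF assms] sums_iff summable_norm_cancel)

lemma pairing_bound:
  assumes r: "represents M f g h" and T: "T \<in> BL2 M"
    and C: "0 \<le> C" "\<And>f. f \<in> L2 M \<Longrightarrow> l2_norm M (T f) \<le> C * l2_norm M f"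
  shows "cmod (pairing M T h) \<le> C * (\<Sum>i. l2_norm M (f i) * l2_norm M (g i))"
proof -
  have "cmod (pairing M T h) \<le> (\<Sum>i. cmod (bil M (T (f i)) (g i)))"
    unfolding pairing_eq[OF r T] by (intro summable_norm represents_bil_summable[OF r T])
  also have "\<dots> \<le> (\<Sum>i. C * (l2_norm M (f i) * l2_norm M (g i)))"
    by (intro suminf_le bil_op_bound T C represents_L2[OF r] represents_bil_summable[OF r T] summable_mult
        represents_norm_summable[OF r])
  finally show ?thesis
    using suminf_mult[OF represents_norm_summable[OF r], of C] by simp
qed

section \<open>Building trace class functions from sequences\<close>

lemma AE_pair_of_AE:
  assumes [measurable]: "\<And>i::nat. f i \<in> borel_measurable M" "\<And>i. g i \<in> borel_measurable M"
    and ae: "AE x in M. AE y in M. summable (\<lambda>i. cmod (f i x * g i y))"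
  shows "AE (x, y) in M \<Otimes>\<^sub>M M. summable (\<lambda>i. cmod (f i x * g i y))"
proof -
  \<comment> \<open>Finiteness of an extended nonnegative series is a measurable condition on
    \<open>(x, y)\<close>, which is required before iterated null sets can be turned into a null set
    of the product.\<close>
  have eq: "summable (\<lambda>i. cmod (f i x * g i y)) \<longleftrightarrow> (\<Sum>i. ennreal (cmod (f i x * g i y))) < \<infinity>" for x y
    by (auto simp: less_top ennreal_suminf_neq_top intro: summable_suminf_not_top)
  show ?thesis
    unfolding eq
  proof (rule AE_pair_measure)
    show "{z \<in> space (M \<Otimes>\<^sub>M M). case z of (x, y) \<Rightarrow> (\<Sum>i. ennreal (cmod (f i x * g i y))) < \<infinity>} \<in> sets (M \<Otimes>\<^sub>M M)"
      by measurable
    show "AE x in M. AE y in M. case (x, y) of (x, y) \<Rightarrow> (\<Sum>i. ennreal (cmod (f i x * g i y))) < \<infinity>"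
      using ae by (simp add: eq)
  qed
qed

text \<open>For almost every \<open>x\<close> the numbers \<open>f i x\<close> are square summable,
  because their squares have summable integrals; likewise for \<open>g i y\<close>. Products of
  square summable sequences are summable.\<close>

lemma AE_summable_tensor:
  assumes L2: "\<And>i. f i \<in> L2 M" "\<And>i. g i \<in> L2 M"
    and s: "summable (\<lambda>i. (l2_norm M (f i))\<^sup>2)" "summable (\<lambda>i. (l2_norm M (g i))\<^sup>2)"
  shows "AE (x, y) in M \<Otimes>\<^sub>M M. summable (\<lambda>i. cmod (f i x * g i y))"
proof -
  have sq: "AE x in M. summable (\<lambda>i. (cmod (f i x))\<^sup>2)"
    if "\<And>i. f i \<in> L2 M" "summable (\<lambda>i. (l2_norm M (f i))\<^sup>2)" for f :: "nat \<Rightarrow> 'a \<Rightarrow> complex"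
    using AE_summable_norm[of M "\<lambda>i x. (cmod (f i x))\<^sup>2"] that by (simp add: L2_integrable l2_norm_square)
  have "AE y in M. summable (\<lambda>i. cmod (f i x * g i y))" if x: "summable (\<lambda>i. (cmod (f i x))\<^sup>2)" for x
    using sq[OF L2(2) s(2)]
  proof eventually_elim
    case (elim y)
    show ?case
      using summable_mult_of_squares[OF x elim] by (simp add: norm_mult abs_mult)
  qed
  then show ?thesis
    using sq[OF L2(1) s(1)] L2 by (intro AE_pair_of_AE) (auto elim!: eventually_mono dest: L2_measurable)
qed

text \<open>Two sequences with summable squared norms already determine an element of
  \<open>TC M\<close>; the almost everywhere convergence demanded by \<open>represents\<close> is
  automatic.\<close>

lemma represents_suminf:
  assumes L2: "\<And>i. f i \<in> L2 M" "\<And>i. g i \<in> L2 M"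
    and s: "summable (\<lambda>i. (l2_norm M (f i))\<^sup>2)" "summable (\<lambda>i. (l2_norm M (g i))\<^sup>2)"
  shows "represents M f g (\<lambda>(x, y). \<Sum>i. f i x * g i y)"
proof -
  have "AE (x, y) in M \<Otimes>\<^sub>M M. (\<lambda>i. f i x * g i y) sums (\<Sum>i. f i x * g i y)"
    using AE_summable_tensor[OF assms] by eventually_elim (auto intro: summable_sums summable_norm_cancel)
  then show ?thesis
    using L2 s by (auto simp: represents_def)
qed

lemma TC_zero: "(\<lambda>z. 0) \<in> TC M"
  unfolding TC_def represents_def
  by (rule CollectI, rule exI[of _ "\<lambda>i x. 0"], rule exI[of _ "\<lambda>i x. 0"]) (auto simp: case_prod_beta)

lemma pairing_zero:
  assumes "T \<in> BL2 M"
  shows "pairing M T (\<lambda>z. 0) = 0"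
proof -
  have "represents M (\<lambda>i x. 0) (\<lambda>i x. 0) (\<lambda>z. 0)"
    by (auto simp: represents_def case_prod_beta)
  from pairing_eq[OF this assms] show ?thesis
    by (simp add: bil_def)
qed

lemma represents_scale:
  assumes "represents M f g h"
  shows "represents M (\<lambda>i x. c * f i x) g (\<lambda>z. c * h z)"
proof -
  have "AE (x, y) in M \<Otimes>\<^sub>M M. (\<lambda>i. c * f i x * g i y) sums (c * h (x, y))"
    using assms unfolding represents_def
    by (auto elim!: eventually_mono dest: sums_mult[of _ _ c] simp: mult.assoc)
  then show ?thesis
    using assms by (auto simp: represents_def l2_norm_scale power_mult_distrib intro!: summable_mult)
qed

lemma TC_scale: "h \<in> TC M \<Longrightarrow> (\<lambda>z. c * h z) \<in> TC M"
  unfolding TC_def using represents_scale by blast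

lemma pairing_scale:
  assumes "h \<in> TC M" and T: "T \<in> BL2 M"
  shows "pairing M T (\<lambda>z. c * h z) = c * pairing M T h"
proof -
  obtain f g where r: "represents M f g h"
    using assms by (auto simp: TC_def)
  have "bil M (T (\<lambda>x. c * f i x)) (g i) = bil M (\<lambda>x. c * T (f i) x) (g i)" for i
    using BL2_scale[OF T represents_L2(1)[OF r], of c i]
    by (intro bil_cong_AE L2_measurable BL2_L2[OF T] L2_scale represents_L2[OF r]) auto
  then have "bil M (T (\<lambda>x. c * f i x)) (g i) = c * bil M (T (f i)) (g i)" for i
    by (simp add: bil_scale_left)
  then show ?thesis
    using sums_unique2[OF pairing_sums[OF represents_scale[OF r] T], where b = "c * pairing M T h"]
      sums_mult[OF pairing_sums[OF r T], of c]
    by simp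
qed

text \<open>The two series are written as a double series whose row \<open>i\<close> consists of the
  \<open>i\<close>-th terms of both followed by zeros, and then flattened by
  \<open>prod_decode\<close>. Additivity of the pairing is part of the claim because it falls out of
  the same rearrangement.\<close>

lemma represents_add:
  assumes r: "represents M f g h" "represents M f' g' h'"
  obtains F G where "represents M F G (\<lambda>z. h z + h' z)"
    "\<And>T. T \<in> BL2 M \<Longrightarrow> pairing M T (\<lambda>z. h z + h' z) = pairing M T h + pairing M T h'"
proof -
  let ?c = "\<lambda>u v i j x. if j = (0::nat) then u i x else if j = 1 then v i x else 0 :: complex"
  define F where "F m = (case prod_decode m of (i, j) \<Rightarrow> ?c f f' i j)" for m
  define G where "G m = (case prod_decode m of (i, j) \<Rightarrow> ?c g g' i j)" for m
  have two: "summable (\<lambda>j. norm (if j = (0::nat) then a else if j = 1 then b else 0))"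
    "(\<Sum>j. if j = (0::nat) then a else if j = 1 then b else 0) = a + b"
    for a b :: "'z::{banach, second_countable_topology}"
  proof -
    have "(\<lambda>j. if j = (0::nat) then a else if j = 1 then b else 0) sums (\<Sum>j\<in>{0, 1::nat}. if j = 0 then a else if j = 1 then b else 0)"
      by (rule sums_finite) auto
    then show "(\<Sum>j. if j = (0::nat) then a else if j = 1 then b else 0) = a + b"
      by (simp add: sums_iff)
    show "summable (\<lambda>j. norm (if j = (0::nat) then a else if j = 1 then b else 0))"
      by (rule summable_finite[of "{0, 1}"]) auto
  qed
  have two_sums: "(\<lambda>m. case prod_decode m of (i, j) \<Rightarrow> if j = (0::nat) then a i else if j = 1 then b i else 0) sums (A + B)"
    if "summable (\<lambda>i. norm (a i))" "summable (\<lambda>i. norm (b i))" "a sums A" "b sums B"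
    for a b :: "nat \<Rightarrow> 'z::{banach, second_countable_topology}" and A B
  proof -
    have n: "norm (if j = (0::nat) then a i else if j = 1 then b i else 0)
        = (if j = 0 then norm (a i) else if j = 1 then norm (b i) else 0)" for i j
      by simp
    have "(\<lambda>m. case prod_decode m of (i, j) \<Rightarrow> if j = (0::nat) then a i else if j = 1 then b i else 0)
        sums (\<Sum>i. \<Sum>j. if j = (0::nat) then a i else if j = 1 then b i else 0)"
    proof (rule prod_decode_sums(2))
      show "summable (\<lambda>i. \<Sum>j. norm (if j = (0::nat) then a i else if j = 1 then b i else 0))"
        unfolding n two(2) using that by (intro summable_add)
    qed (rule two)
    then show ?thesis
      using sums_add[OF that(3,4)] unfolding two(2) by (simp add: sums_iff)
  qed
  note L2 = represents_L2[OF r(1)] represents_L2[OF r(2)]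
  have FG: "F m \<in> L2 M" "G m \<in> L2 M" for m
  proof -
    obtain i j where "prod_decode m = (i, j)"
      by fastforce
    then show "F m \<in> L2 M" "G m \<in> L2 M"
      unfolding F_def G_def by (cases "j = 0"; cases "j = 1"; simp add: L2)+
  qed
  have bil: "bil M (T (F m)) (G m) = (case prod_decode m of (i, j) \<Rightarrow>
      if j = 0 then bil M (T (f i)) (g i) else if j = 1 then bil M (T (f' i)) (g' i) else 0)" if "T \<in> BL2 M" for T m
    unfolding F_def G_def by (auto split: prod.split simp: bil_def cong: if_cong)
  have s: "summable (\<lambda>m. (l2_norm M (case prod_decode m of (i, j) \<Rightarrow> ?c u u' i j))\<^sup>2)"
    if "summable (\<lambda>i. (l2_norm M (u i))\<^sup>2)" "summable (\<lambda>i. (l2_norm M (u' i))\<^sup>2)" for u u'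
  proof -
    have "(l2_norm M (case prod_decode m of (i, j) \<Rightarrow> ?c u u' i j))\<^sup>2 = (case prod_decode m of (i, j) \<Rightarrow>
      if j = 0 then (l2_norm M (u i))\<^sup>2 else if j = 1 then (l2_norm M (u' i))\<^sup>2 else 0)" for m
      by (auto split: prod.split cong: if_cong)
    then show ?thesis
      using two_sums[of "\<lambda>i. (l2_norm M (u i))\<^sup>2" "\<lambda>i. (l2_norm M (u' i))\<^sup>2", OF _ _ summable_sums summable_sums] that
      by (simp add: sums_iff)
  qed
  have s2: "summable (\<lambda>m. (l2_norm M (F m))\<^sup>2)" "summable (\<lambda>m. (l2_norm M (G m))\<^sup>2)"
    unfolding F_def G_def using r by (auto intro!: s simp: represents_def)
  show thesis
  proof (rule that[of F G])
    have abs: "AE (x, y) in M \<Otimes>\<^sub>M M. summable (\<lambda>i. cmod (f i x * g i y))" if "represents M f g h" for f g h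
      using that by (intro AE_summable_tensor) (auto simp: represents_def)
    have "AE (x, y) in M \<Otimes>\<^sub>M M. (\<lambda>m. F m x * G m y) sums (h (x, y) + h' (x, y))"
    proof -
      have "AE (x, y) in M \<Otimes>\<^sub>M M. (\<lambda>i. f i x * g i y) sums h (x, y)"
        "AE (x, y) in M \<Otimes>\<^sub>M M. (\<lambda>i. f' i x * g' i y) sums h' (x, y)"
        using r by (auto simp: represents_def)
      with abs[OF r(1)] abs[OF r(2)] show ?thesis
      proof eventually_elim
        case (elim z)
        obtain x y where z: "z = (x, y)"
          by fastforce
        have "F m x * G m y = (case prod_decode m of (i, j) \<Rightarrow>
           if j = 0 then f i x * g i y else if j = 1 then f' i x * g' i y else 0)" for m
          unfolding F_def G_def by (auto split: prod.split)
        then show ?case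
          using two_sums[of "\<lambda>i. f i x * g i y" "\<lambda>i. f' i x * g' i y" "h (x, y)" "h' (x, y)"] elim
          by (simp add: z)
      qed
    qed
    then show rep: "represents M F G (\<lambda>z. h z + h' z)"
      unfolding represents_def using FG s2 by simp
    show "pairing M T (\<lambda>z. h z + h' z) = pairing M T h + pairing M T h'" if T: "T \<in> BL2 M" for T
    proof -
      have "(\<lambda>m. bil M (T (F m)) (G m)) sums (pairing M T h + pairing M T h')"
        unfolding bil[OF T]
        by (intro two_sums represents_bil_summable[OF r(1) T] represents_bil_summable[OF r(2) T] pairing_sums r T)
      then show ?thesis
        using pairing_sums[OF rep T] sums_unique2 by blast
    qed
  qed
qed

lemma TC_add:
  assumes "h \<in> TC M" "h' \<in> TC M"
  shows "(\<lambda>z. h z + h' z) \<in> TC M"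
proof -
  obtain f g f' g' where "represents M f g h" "represents M f' g' h'"
    using assms by (auto simp: TC_def)
  from represents_add[OF this] show ?thesis
    unfolding TC_def by blast
qed

lemma pairing_add:
  assumes "h \<in> TC M" "h' \<in> TC M" "T \<in> BL2 M"
  shows "pairing M T (\<lambda>z. h z + h' z) = pairing M T h + pairing M T h'"
proof -
  obtain f g f' g' where "represents M f g h" "represents M f' g' h'"
    using assms by (auto simp: TC_def)
  from represents_add[OF this] show ?thesis
    using assms(3) by metis
qed

lemma TC_diff:
  assumes "h \<in> TC M" "h' \<in> TC M"
  shows "(\<lambda>z. h z - h' z) \<in> TC M"
  using TC_add[OF assms(1) TC_scale[OF assms(2), of "-1"]] by simp

lemma pairing_diff:
  assumes "h \<in> TC M" "h' \<in> TC M" "T \<in> BL2 M"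
  shows "pairing M T (\<lambda>z. h z - h' z) = pairing M T h - pairing M T h'"
  using pairing_add[OF assms(1) TC_scale[OF assms(2), of "-1"] assms(3)] pairing_scale[OF assms(2,3), of "-1"]
  by simp

lemma TC_sum:
  assumes "\<And>i. i \<in> I \<Longrightarrow> h i \<in> TC M"
  shows "(\<lambda>z. \<Sum>i\<in>I. c i * h i z) \<in> TC M"
  using assms
proof (induction I rule: infinite_finite_induct)
  case (insert x F)
  then show ?case
    using TC_add[OF TC_scale[of "h x" "c x"], of "\<lambda>z. \<Sum>i\<in>F. c i * h i z"] by simp
qed (simp_all add: TC_zero)

lemma pairing_sum:
  assumes "\<And>i. i \<in> I \<Longrightarrow> h i \<in> TC M" "T \<in> BL2 M"
  shows "pairing M T (\<lambda>z. \<Sum>i\<in>I. c i * h i z) = (\<Sum>i\<in>I. c i * pairing M T (h i))"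
  using assms
  by (induction I rule: infinite_finite_induct)
     (auto simp: pairing_zero pairing_add pairing_scale TC_sum TC_scale)

section \<open>Rank-one elements and the trace norm\<close>

lemma represents_single:
  assumes "f \<in> L2 M" "g \<in> L2 M"
  shows "represents M (\<lambda>i. if i = 0 then f else (\<lambda>x. 0)) (\<lambda>i. if i = 0 then g else (\<lambda>x. 0)) (\<lambda>(x, y). f x * g y)"
proof -
  have "(\<lambda>i. (l2_norm M (if i = (0::nat) then u else (\<lambda>x. 0)))\<^sup>2) = (\<lambda>i. if i = 0 then (l2_norm M u)\<^sup>2 else 0)" for u
    by auto
  moreover have "(\<lambda>i. (if i = (0::nat) then f else (\<lambda>x. 0)) x * (if i = 0 then g else (\<lambda>x. 0)) y)
      = (\<lambda>i. if i = 0 then f x * g y else 0)" for x y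
    by auto
  moreover have "summable (\<lambda>i. if i = (0::nat) then a else 0)" for a :: real
    using sums_single[of 0 "\<lambda>_. a"] by (auto simp: summable_def)
  moreover have "(\<lambda>i. if i = (0::nat) then a else 0) sums a" for a :: complex
    using sums_single[of 0 "\<lambda>_. a"] by simp
  ultimately show ?thesis
    unfolding represents_def using assms by (simp add: case_prod_beta)
qed

lemma pairing_single:
  assumes "f \<in> L2 M" "g \<in> L2 M" and T: "T \<in> BL2 M"
  shows "pairing M T (\<lambda>(x, y). f x * g y) = bil M (T f) g"
proof -
  have "(\<lambda>i. bil M (T (if i = (0::nat) then f else (\<lambda>x. 0))) (if i = 0 then g else (\<lambda>x. 0)))
      = (\<lambda>i. if i = 0 then bil M (T f) g else 0)"
    by (auto simp: bil_def)
  then show ?thesis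
    using pairing_sums[OF represents_single[OF assms(1,2)] T] sums_single[of 0 "\<lambda>_. bil M (T f) g"]
    by (simp add: sums_unique2)
qed

text \<open>\<open>T\<close> divided by \<open>C\<close> is a contraction and so takes part in the
  supremum defining \<open>trace_norm\<close>, which is bounded above by
  \<open>pairing_bound\<close> with constant 1.\<close>

lemma pairing_le_trace_norm:
  assumes h: "h \<in> TC M" and T: "T \<in> BL2 M"
    and C: "0 < C" "\<And>f. f \<in> L2 M \<Longrightarrow> l2_norm M (T f) \<le> C * l2_norm M f"
  shows "cmod (pairing M T h) \<le> C * trace_norm M h"
proof -
  obtain f g where r: "represents M f g h"
    using h by (auto simp: TC_def)
  define S where "S = (\<lambda>f x. complex_of_real (inverse C) * T f x)"
  have S1: "l2_norm M (S f) \<le> l2_norm M f" if "f \<in> L2 M" for f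
    using C(1) C(2)[OF that] unfolding S_def l2_norm_scale norm_of_real by (simp add: field_simps)
  have S: "S \<in> BL2 M"
    unfolding BL2_def
  proof (intro CollectI conjI ballI allI)
    show "S f \<in> L2 M" if "f \<in> L2 M" for f
      unfolding S_def using BL2_L2[OF T that] by auto
    show "AE x in M. S (\<lambda>y. f y + g y) x = S f x + S g x" if "f \<in> L2 M" "g \<in> L2 M" for f g
      using BL2_add[OF T that] by eventually_elim (simp add: S_def algebra_simps)
    show "AE x in M. S (\<lambda>y. c * f y) x = c * S f x" if "f \<in> L2 M" for f c
      using BL2_scale[OF T that, of c] by eventually_elim (simp add: S_def)
    show "\<exists>C. \<forall>f\<in>L2 M. l2_norm M (S f) \<le> C * l2_norm M f"
      using S1 by (intro exI[of _ 1]) auto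
  qed
  have "bil M (S (f i)) (g i) = inverse (complex_of_real C) * bil M (T (f i)) (g i)" for i
    by (simp add: S_def bil_scale_left)
  then have "pairing M S h = inverse (complex_of_real C) * pairing M T h"
    using sums_mult[OF pairing_sums[OF r T]] pairing_sums[OF r S] by (metis (no_types, lifting) ext sums_unique2)
  then have "cmod (pairing M T h) = C * cmod (pairing M S h)"
    using C(1) by (simp add: norm_mult norm_inverse)
  also have "\<dots> \<le> C * trace_norm M h"
    unfolding trace_norm_def
  proof (intro mult_left_mono cSUP_upper)
    show "bdd_above ((\<lambda>T. cmod (pairing M T h)) ` {T \<in> BL2 M. \<forall>f\<in>L2 M. l2_norm M (T f) \<le> l2_norm M f})"
      using pairing_bound[OF r, of _ 1] by (intro bdd_aboveI2) auto
  qed (use S S1 C in auto)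
  finally show ?thesis .
qed

lemma BL2_id: "(\<lambda>f. f) \<in> BL2 M"
  by (auto simp: BL2_def intro!: exI[of _ 1])

lemma trace_norm_zero: "trace_norm M (\<lambda>z. 0) = 0"
proof -
  \<comment> \<open>The identity is a contraction, so the supremum runs over a nonempty set and its
    value is that of \<open>{0}\<close>.\<close>
  have "(\<lambda>f. f) \<in> {T \<in> BL2 M. \<forall>f\<in>L2 M. l2_norm M (T f) \<le> l2_norm M f}"
    using BL2_id by auto
  then have "(\<lambda>T. cmod (pairing M T (\<lambda>z. 0))) ` {T \<in> BL2 M. \<forall>f\<in>L2 M. l2_norm M (T f) \<le> l2_norm M f} = {0}"
    by (force simp: pairing_zero)
  then show ?thesis
    by (simp add: trace_norm_def)
qed

text \<open>Pairing with a fixed \<open>T\<close> is linear and continuous for the trace norm, so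
  vanishing on \<open>X\<close> passes to its closed span.\<close>

lemma tc_annihilator_closure_span:
  assumes X: "X \<subseteq> TC M"
  shows "tc_annihilator M (tc_closure M (tc_span X)) = {T \<in> BL2 M. \<forall>h\<in>X. pairing M T h = 0}"
proof (intro equalityI subsetI)
  fix T assume T: "T \<in> tc_annihilator M (tc_closure M (tc_span X))"
  have "h \<in> tc_closure M (tc_span X)" if "h \<in> X" for h
  proof -
    have "h \<in> tc_span X"
      unfolding tc_span_def using that
      by (intro CollectI exI[of _ 1] exI[of _ "\<lambda>_. 1"] exI[of _ "\<lambda>_. h"]) auto
    then show ?thesis
      unfolding tc_closure_def using that X trace_norm_zero by (auto intro!: bexI[of _ h])
  qed
  then show "T \<in> {T \<in> BL2 M. \<forall>h\<in>X. pairing M T h = 0}"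
    using T by (auto simp: tc_annihilator_def)
next
  fix T assume "T \<in> {T \<in> BL2 M. \<forall>h\<in>X. pairing M T h = 0}"
  then have T: "T \<in> BL2 M" and TX: "\<And>h. h \<in> X \<Longrightarrow> pairing M T h = 0"
    by auto
  obtain C0 where "0 \<le> C0" "\<forall>f\<in>L2 M. l2_norm M (T f) \<le> C0 * l2_norm M f"
    using BL2_bound[OF T] by blast
  \<comment> \<open>Adding 1 gives a strictly positive constant, by which the tolerance below is
    divided.\<close>
  then have C: "0 < C0 + 1" "\<And>f. f \<in> L2 M \<Longrightarrow> l2_norm M (T f) \<le> (C0 + 1) * l2_norm M f"
    by (auto simp: distrib_right intro: add_increasing2)
  have span: "k \<in> TC M \<and> pairing M T k = 0" if k: "k \<in> tc_span X" for k
  proof -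
    obtain n :: nat and c h where k: "k = (\<lambda>z. \<Sum>i<n. c i * h i z)" and h: "\<forall>i<n. h i \<in> X"
      using k unfolding tc_span_def by blast
    have "h i \<in> TC M" if "i \<in> {..<n}" for i
      using h X that by auto
    then show ?thesis
      unfolding k using h TC_sum[of "{..<n}" h c] pairing_sum[of "{..<n}" h T c] T by (simp add: TX)
  qed
  have "pairing M T h = 0" if h: "h \<in> tc_closure M (tc_span X)" for h
  proof (rule ccontr)
    assume "pairing M T h \<noteq> 0"
    then have "0 < cmod (pairing M T h) / (C0 + 1)"
      using C by simp
    moreover have hTC: "h \<in> TC M"
      using h by (simp add: tc_closure_def)
    ultimately obtain k where k: "k \<in> tc_span X" "trace_norm M (\<lambda>z. h z - k z) < cmod (pairing M T h) / (C0 + 1)"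
      using h unfolding tc_closure_def by blast
    have "cmod (pairing M T h) = cmod (pairing M T (\<lambda>z. h z - k z))"
      using span[OF k(1)] hTC by (simp add: pairing_diff T)
    also have "\<dots> \<le> (C0 + 1) * trace_norm M (\<lambda>z. h z - k z)"
      using span[OF k(1)] hTC by (intro pairing_le_trace_norm TC_diff T C) auto
    also have "\<dots> < cmod (pairing M T h)"
      using k(2) C(1) by (simp add: field_simps)
    finally show False
      by simp
  qed
  then show "T \<in> tc_annihilator M (tc_closure M (tc_span X))"
    using T by (simp add: tc_annihilator_def)
qed

subsection \<open>The weak-* topology\<close>

lemma weak_star_closure_BL2: "weak_star_topology M closure_of S \<subseteq> BL2 M"
  using closure_of_subset_topspace[of "weak_star_topology M" S]
  by (simp add: weak_star_topology_def topspace_pullback_topology)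

text \<open>Pairing with \<open>k\<close> is a coordinate of the product topology, so the operators
  with nonzero pairing form an open set. Elements of \<open>S\<close> outside \<open>BL2 M\<close>
  lie outside the space and cannot meet it.\<close>

lemma pairing_zero_closure:
  assumes T: "T \<in> weak_star_topology M closure_of S" and k: "k \<in> TC M"
    and S: "\<And>R. R \<in> S \<Longrightarrow> R \<in> BL2 M \<Longrightarrow> pairing M R k = 0"
  shows "pairing M T k = 0"
proof (rule ccontr)
  let ?U = "{R \<in> BL2 M. pairing M R k \<noteq> 0}"
  assume "pairing M T k \<noteq> 0"
  then have "T \<in> ?U"
    using T weak_star_closure_BL2 by auto
  moreover have "openin (weak_star_topology M) ?U"
  proof -
    have "openin (product_topology (\<lambda>_. euclidean) (TC M)) {p \<in> topspace (product_topology (\<lambda>_. euclidean) (TC M)). p k \<in> - {0::complex}}"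
      using continuous_map_product_projection[OF k, of "\<lambda>_. euclidean :: complex topology"]
      by (rule openin_continuous_map_preimage) auto
    moreover have "?U = (\<lambda>T. \<lambda>h\<in>TC M. pairing M T h) -` {p \<in> topspace (product_topology (\<lambda>_. euclidean) (TC M)). p k \<in> - {0::complex}} \<inter> BL2 M"
      using k by auto
    ultimately show ?thesis
      unfolding weak_star_topology_def openin_pullback_topology by blast
  qed
  ultimately obtain R where "R \<in> S" "R \<in> ?U"
    using T unfolding in_closure_of by meson
  then show False
    using S by auto
qed

text \<open>A basic open set of the product topology constrains only finitely many coordinates, so
  exact agreement with \<open>T\<close> on finite sets suffices.\<close>

lemma in_weak_star_closure:
  assumes T: "T \<in> BL2 M" and S: "\<And>H. finite H \<Longrightarrow> H \<subseteq> TC M \<Longrightarrow> \<exists>R\<in>S \<inter> BL2 M. \<forall>h\<in>H. pairing M R h = pairing M T h"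
  shows "T \<in> weak_star_topology M closure_of S"
  unfolding in_closure_of
proof (intro conjI allI impI)
  show "T \<in> topspace (weak_star_topology M)"
    using T by (simp add: weak_star_topology_def topspace_pullback_topology)
  fix U assume "T \<in> U \<and> openin (weak_star_topology M) U"
  then obtain W where W: "openin (product_topology (\<lambda>_. euclidean) (TC M)) W" and TU: "T \<in> U"
    and U: "U = (\<lambda>T. \<lambda>h\<in>TC M. pairing M T h) -` W \<inter> BL2 M"
    unfolding weak_star_topology_def openin_pullback_topology by blast
  have "(\<lambda>h\<in>TC M. pairing M T h) \<in> W"
    using TU U by auto
  then obtain V where V: "finite {h \<in> TC M. V h \<noteq> UNIV}" "(\<lambda>h\<in>TC M. pairing M T h) \<in> Pi\<^sub>E (TC M) V" "Pi\<^sub>E (TC M) V \<subseteq> W"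
    using bspec[OF W[unfolded openin_product_topology_alt]] unfolding topspace_euclidean by meson
  obtain R where R: "R \<in> S" "R \<in> BL2 M" "\<And>h. h \<in> TC M \<Longrightarrow> V h \<noteq> UNIV \<Longrightarrow> pairing M R h = pairing M T h"
    using S[OF V(1)] by auto
  have "(\<lambda>h\<in>TC M. pairing M R h) \<in> Pi\<^sub>E (TC M) V"
  proof (rule PiE_I)
    show "(\<lambda>h\<in>TC M. pairing M R h) h \<in> V h" if "h \<in> TC M" for h
      using R(3)[OF that] PiE_mem[OF V(2) that] that by (cases "V h = UNIV") auto
  qed auto
  then show "\<exists>y. y \<in> S \<and> y \<in> U"
    using V(3) R U by blast
qed

end

text \<open>Gaussian elimination: a pivot clears coordinate \<open>a\<close>, and the problem passes
  to the vectors of \<open>V\<close> vanishing at \<open>a\<close>. The hypothesis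
  \<open>ann\<close> is the solvability criterion of linear algebra, that every functional killing
  \<open>V\<close> kills \<open>t\<close>; it has to be transferred to the smaller system.\<close>

lemma finite_system_solvable:
  fixes V :: "('h \<Rightarrow> complex) set"
  assumes "finite H"
    and add: "\<And>u v. u \<in> V \<Longrightarrow> v \<in> V \<Longrightarrow> (\<lambda>h. u h + v h) \<in> V"
    and scale: "\<And>c v. v \<in> V \<Longrightarrow> (\<lambda>h. c * v h) \<in> V" and ne: "V \<noteq> {}"
    and ann: "\<And>c. (\<And>v. v \<in> V \<Longrightarrow> (\<Sum>h\<in>H. c h * v h) = 0) \<Longrightarrow> (\<Sum>h\<in>H. c h * t h) = 0"
  shows "\<exists>v\<in>V. \<forall>h\<in>H. v h = t h"
  using assms
proof (induction H arbitrary: V t rule: finite_induct)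
  case empty
  then show ?case by auto
next
  case (insert a H V t)
  note V = insert.prems(1-3) and ann = insert.prems(4)
  show ?case
  proof (cases "\<forall>v\<in>V. v a = 0")
    case True
    have "(\<Sum>h\<in>insert a H. (if h = a then 1 else 0) * t h) = 0"
      using True insert.hyps by (intro ann) (simp add: if_distrib[of "\<lambda>c. c * _"] cong: if_cong)
    then have "t a = 0"
      using insert.hyps by (simp add: if_distrib[of "\<lambda>c. c * _"] cong: if_cong)
    moreover have "\<exists>v\<in>V. \<forall>h\<in>H. v h = t h"
    proof (rule insert.IH[OF V])
      fix c assume c: "\<And>v. v \<in> V \<Longrightarrow> (\<Sum>h\<in>H. c h * v h) = 0"
      have "(\<Sum>h\<in>insert a H. c h * t h) = 0"
        using insert.hyps c True by (intro ann) simp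
      then show "(\<Sum>h\<in>H. c h * t h) = 0"
        using insert.hyps \<open>t a = 0\<close> by simp
    qed
    ultimately show ?thesis
      using True by auto
  next
    case False
    then obtain w where w: "w \<in> V" "w a \<noteq> 0"
      by blast
    define v0 where "v0 = (\<lambda>h. inverse (w a) * w h)"
    have v0: "v0 \<in> V" "v0 a = 1"
      using w V(2) by (auto simp: v0_def)
    have "\<exists>v\<in>{v \<in> V. v a = 0}. \<forall>h\<in>H. v h = t h - t a * v0 h"
    proof (rule insert.IH)
      show "(\<lambda>h. u h + v h) \<in> {v \<in> V. v a = 0}" if "u \<in> {v \<in> V. v a = 0}" "v \<in> {v \<in> V. v a = 0}" for u v
        using that V(1) by auto
      show "(\<lambda>h. c * v h) \<in> {v \<in> V. v a = 0}" if "v \<in> {v \<in> V. v a = 0}" for c v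
        using that V(2) by auto
      show "{v \<in> V. v a = 0} \<noteq> {}"
        using V(2)[OF w(1), of 0] by auto
      fix c assume c: "\<And>v. v \<in> {v \<in> V. v a = 0} \<Longrightarrow> (\<Sum>h\<in>H. c h * v h) = 0"
      \<comment> \<open>The coefficient at \<open>a\<close> is chosen so that the extended
        functional also kills the pivot \<open>v0\<close>, and hence all of
        \<open>V\<close>.\<close>
      define c' where "c' = c(a := - (\<Sum>h\<in>H. c h * v0 h))"
      have c': "(\<Sum>h\<in>insert a H. c' h * v h) = - (\<Sum>h\<in>H. c h * v0 h) * v a + (\<Sum>h\<in>H. c h * v h)" for v
      proof -
        have "(\<Sum>h\<in>H. c' h * v h) = (\<Sum>h\<in>H. c h * v h)"
          using insert.hyps by (intro sum.cong) (auto simp: c'_def)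
        then show ?thesis
          using insert.hyps by (simp add: c'_def)
      qed
      have split: "(\<Sum>h\<in>H. c h * (v h - r * v0 h)) = (\<Sum>h\<in>H. c h * v h) - r * (\<Sum>h\<in>H. c h * v0 h)" for v r
        by (simp add: sum_distrib_left right_diff_distrib sum_subtractf mult.left_commute)
      have "(\<Sum>h\<in>insert a H. c' h * t h) = 0"
      proof (rule ann)
        fix v assume v: "v \<in> V"
        have "(\<lambda>h. v h + - v a * v0 h) \<in> V"
          by (intro V v v0)
        then have "(\<lambda>h. v h - v a * v0 h) \<in> {v \<in> V. v a = 0}"
          using v0 by simp
        from c[OF this] show "(\<Sum>h\<in>insert a H. c' h * v h) = 0"
          unfolding split c' by (simp add: mult.commute)
      qed
      then show "(\<Sum>h\<in>H. c h * (t h - t a * v0 h)) = 0"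
        unfolding split c' by (simp add: mult.commute)
    qed
    then obtain v where v: "v \<in> V" "v a = 0" "\<And>h. h \<in> H \<Longrightarrow> v h = t h - t a * v0 h"
      by blast
    have "(\<lambda>h. v h + t a * v0 h) \<in> V"
      by (intro V v v0)
    then show ?thesis
      using v v0 by (intro bexI[of _ "\<lambda>h. v h + t a * v0 h"]) auto
  qed
qed

context hilbert_basis begin

lemma BL2_sum_ops:
  assumes T: "\<And>i. i < n \<Longrightarrow> T i \<in> BL2 M"
  shows "(\<lambda>f x. \<Sum>i<(n::nat). c i * T i f x) \<in> BL2 M"
  using assms
proof (induction n)
  case 0
  show ?case
    by (auto simp: BL2_def intro!: exI[of _ 0])
next
  case (Suc n)
  let ?S = "\<lambda>f x. \<Sum>i<n. c i * T i f x"
  have S: "?S \<in> BL2 M" and Tn: "T n \<in> BL2 M"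
    using Suc by auto
  obtain C where C: "0 \<le> C" "\<forall>f\<in>L2 M. l2_norm M (?S f) \<le> C * l2_norm M f"
    using BL2_bound[OF S] by blast
  obtain D where D: "0 \<le> D" "\<forall>f\<in>L2 M. l2_norm M (T n f) \<le> D * l2_norm M f"
    using BL2_bound[OF Tn] by blast
  have "(\<lambda>f x. ?S f x + c n * T n f x) \<in> BL2 M"
    unfolding BL2_def
  proof (intro CollectI conjI ballI allI exI)
    show "(\<lambda>x. ?S f x + c n * T n f x) \<in> L2 M" if "f \<in> L2 M" for f
      by (intro L2_add L2_scale BL2_L2[OF S that] BL2_L2[OF Tn that])
    show "AE x in M. ?S (\<lambda>y. f y + g y) x + c n * T n (\<lambda>y. f y + g y) x
        = (?S f x + c n * T n f x) + (?S g x + c n * T n g x)" if "f \<in> L2 M" "g \<in> L2 M" for f g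
      using BL2_add[OF S that] BL2_add[OF Tn that] by eventually_elim (simp add: algebra_simps)
    show "AE x in M. ?S (\<lambda>y. d * f y) x + c n * T n (\<lambda>y. d * f y) x = d * (?S f x + c n * T n f x)"
      if "f \<in> L2 M" for f d
      using BL2_scale[OF S that, of d] BL2_scale[OF Tn that, of d] by eventually_elim (simp add: algebra_simps)
    show "l2_norm M (\<lambda>x. ?S f x + c n * T n f x) \<le> (C + cmod (c n) * D) * l2_norm M f" if "f \<in> L2 M" for f
    proof -
      have "l2_norm M (\<lambda>x. ?S f x + c n * T n f x) \<le> l2_norm M (?S f) + l2_norm M (\<lambda>x. c n * T n f x)"
        by (intro l2_norm_triangle L2_scale BL2_L2[OF S that] BL2_L2[OF Tn that])
      also have "\<dots> \<le> C * l2_norm M f + cmod (c n) * (D * l2_norm M f)"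
        unfolding l2_norm_scale using C D that by (intro add_mono mult_left_mono) auto
      finally show ?thesis
        by (simp add: algebra_simps)
    qed
  qed
  then show ?case
    by simp
qed

lemma pairing_sum_ops:
  assumes T: "\<And>i. i < n \<Longrightarrow> T i \<in> BL2 M" and k: "k \<in> TC M"
  shows "pairing M (\<lambda>f x. \<Sum>i<(n::nat). c i * T i f x) k = (\<Sum>i<n. c i * pairing M (T i) k)"
proof -
  obtain f g where r: "represents M f g k"
    using k by (auto simp: TC_def)
  have "(\<lambda>j. \<Sum>i<n. c i * bil M (T i (f j)) (g j)) sums (\<Sum>i<n. c i * pairing M (T i) k)"
    by (intro sums_sum sums_mult pairing_sums r T) auto
  moreover have "bil M (\<lambda>x. \<Sum>i<n. c i * T i (f j) x) (g j) = (\<Sum>i<n. c i * bil M (T i (f j)) (g j))" for j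
    by (intro bil_sum_left BL2_L2[OF T] represents_L2[OF r]) auto
  ultimately show ?thesis
    using sums_unique2[OF pairing_sums[OF r BL2_sum_ops[where c = c, OF T]]] by simp
qed

text \<open>A bipolar theorem for which finite-dimensional duality suffices, since basic
  neighbourhoods are determined by finitely many \<open>h\<close>.\<close>

lemma in_weak_star_closure_span:
  assumes T: "T \<in> BL2 M" and X: "X \<subseteq> BL2 M"
    and ann: "\<And>k. k \<in> TC M \<Longrightarrow> (\<And>R. R \<in> X \<Longrightarrow> pairing M R k = 0) \<Longrightarrow> pairing M T k = 0"
  shows "T \<in> weak_star_topology M closure_of oper_span X"
proof (rule in_weak_star_closure[OF T])
  fix H assume H: "finite H" "H \<subseteq> TC M"
  have span: "oper_span X \<subseteq> BL2 M"
    using X by (auto simp: oper_span_def intro!: BL2_sum_ops)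
  \<comment> \<open>Operators are identified with their values on \<open>TC M\<close>, where the
    pairing is linear in the operator. The value 0 elsewhere keeps the set closed under sums and
    multiples at every argument.\<close>
  let ?V = "{\<lambda>h. if h \<in> TC M then pairing M R h else 0 | R. R \<in> oper_span X}"
  have "\<exists>v\<in>?V. \<forall>h\<in>H. v h = pairing M T h"
  proof (rule finite_system_solvable[OF H(1)])
    fix u v assume "u \<in> ?V" "v \<in> ?V"
    then obtain R Q where RQ: "R \<in> oper_span X" "Q \<in> oper_span X"
      and u: "u = (\<lambda>h. if h \<in> TC M then pairing M R h else 0)" and v: "v = (\<lambda>h. if h \<in> TC M then pairing M Q h else 0)"
      by blast
    obtain n :: nat and c S where R: "R = (\<lambda>f x. \<Sum>i<n. c i * S i f x)" "\<forall>i<n. S i \<in> X"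
      using RQ(1) unfolding oper_span_def by blast
    obtain m :: nat and d P where Q: "Q = (\<lambda>f x. \<Sum>i<m. d i * P i f x)" "\<forall>i<m. P i \<in> X"
      using RQ(2) unfolding oper_span_def by blast
    define c' where "c' i = (if i < n then c i else d (i - n))" for i
    define S' where "S' i = (if i < n then S i else P (i - n))" for i
    have S': "S' i \<in> X" if "i < n + m" for i
      using that R(2) Q(2) by (auto simp: S'_def)
    have split: "(\<Sum>i<n + m. c' i * F (S' i)) = (\<Sum>i<n. c i * F (S i)) + (\<Sum>i<m. d i * F (P i))" for F :: "_ \<Rightarrow> complex"
    proof -
      have "(\<Sum>i<n + m. c' i * F (S' i)) = (\<Sum>i<n. c' i * F (S' i)) + (\<Sum>i<m. c' (n + i) * F (S' (n + i)))"
        unfolding lessThan_atLeast0 by (subst sum.atLeastLessThan_concat[symmetric, of 0 n "n + m"])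
          (auto simp: sum.shift_bounds_nat_ivl[of _ 0 n m, simplified] add.commute intro!: arg_cong2[of _ _ _ _ "(+)"]
            sum.reindex_bij_witness[of _ "\<lambda>i. i - n" "\<lambda>i. i + n"])
      then show ?thesis
        by (simp add: c'_def S'_def)
    qed
    have "(\<lambda>f x. \<Sum>i<n + m. c' i * S' i f x) \<in> oper_span X"
      unfolding oper_span_def using S' by blast
    moreover have "u h + v h = (if h \<in> TC M then pairing M (\<lambda>f x. \<Sum>i<n + m. c' i * S' i f x) h else 0)" for h
      using S' X R Q split[of "\<lambda>S. pairing M S h"] by (auto simp: u v pairing_sum_ops subset_iff)
    ultimately show "(\<lambda>h. u h + v h) \<in> ?V"
      by blast
  next
    fix a v assume "v \<in> ?V"
    then obtain R where "R \<in> oper_span X" and v: "v = (\<lambda>h. if h \<in> TC M then pairing M R h else 0)"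
      by blast
    from this(1) obtain n :: nat and c S where R: "R = (\<lambda>f x. \<Sum>i<n. c i * S i f x)" "\<forall>i<n. S i \<in> X"
      unfolding oper_span_def by blast
    have "(\<lambda>f x. \<Sum>i<n. (a * c i) * S i f x) \<in> oper_span X"
      unfolding oper_span_def using R(2) by (intro CollectI exI[of _ n] exI[of _ "\<lambda>i. a * c i"] exI[of _ S]) auto
    moreover have "a * v h = (if h \<in> TC M then pairing M (\<lambda>f x. \<Sum>i<n. (a * c i) * S i f x) h else 0)" for h
    proof -
      have "h \<in> TC M \<Longrightarrow> pairing M (\<lambda>f x. \<Sum>i<n. (a * c i) * S i f x) h = (\<Sum>i<n. (a * c i) * pairing M (S i) h)"
        "h \<in> TC M \<Longrightarrow> pairing M (\<lambda>f x. \<Sum>i<n. c i * S i f x) h = (\<Sum>i<n. c i * pairing M (S i) h)"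
        using X R(2) by (intro pairing_sum_ops; auto)+
      then show ?thesis
        unfolding v R(1) by (simp add: sum_distrib_left mult.assoc)
    qed
    ultimately show "(\<lambda>h. a * v h) \<in> ?V"
      by blast
  next
    have "(\<lambda>f x. \<Sum>i<0::nat. 0 * id f x) \<in> oper_span X"
      unfolding oper_span_def by (intro CollectI exI[of _ 0] exI[of _ "\<lambda>_. 0"] exI[of _ "\<lambda>_. id"]) auto
    then show "?V \<noteq> {}"
      by blast
  next
    fix c assume c: "\<And>v. v \<in> ?V \<Longrightarrow> (\<Sum>h\<in>H. c h * v h) = 0"
    \<comment> \<open>A functional on the finitely many coordinates is the pairing with one trace
      class function, the combination of the \<open>h\<close> with coefficients \<open>c h\<close>;
      to it \<open>ann\<close> applies.\<close>
    have "pairing M T (\<lambda>z. \<Sum>h\<in>H. c h * h z) = 0"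
    proof (rule ann)
      show "(\<lambda>z. \<Sum>h\<in>H. c h * h z) \<in> TC M"
        using H by (intro TC_sum) auto
      fix R assume R: "R \<in> X"
      have "(\<lambda>f x. \<Sum>i<1::nat. 1 * R f x) \<in> oper_span X"
        unfolding oper_span_def using R by (intro CollectI exI[of _ 1] exI[of _ "\<lambda>_. 1"] exI[of _ "\<lambda>_. R"]) auto
      then have "(\<Sum>h\<in>H. c h * (if h \<in> TC M then pairing M R h else 0)) = 0"
        by (intro c) auto
      then have "(\<Sum>h\<in>H. c h * pairing M R h) = 0"
        using H by (simp add: subset_iff cong: sum.cong)
      then show "pairing M R (\<lambda>z. \<Sum>h\<in>H. c h * h z) = 0"
        using H R X by (subst pairing_sum) auto
    qed
    then show "(\<Sum>h\<in>H. c h * pairing M T h) = 0"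
      using H T by (subst (asm) pairing_sum) auto
  qed
  then obtain R where "R \<in> oper_span X" "\<forall>h\<in>H. pairing M R h = pairing M T h"
    using H by (auto simp: subset_iff)
  then show "\<exists>R\<in>oper_span X \<inter> BL2 M. \<forall>h\<in>H. pairing M R h = pairing M T h"
    using span by blast
qed

subsection \<open>Square-integrable kernels\<close>

lemma Bessel_sum_inner:
  assumes f: "f \<in> L2 M"
  shows "(\<Sum>j<n. (cmod (l2_inner M f (e j)))\<^sup>2) \<le> (l2_norm M f)\<^sup>2"
proof -
  have "l2_inner M (proj M e n f) f = (\<Sum>j<n. complex_of_real ((cmod (l2_inner M f (e j)))\<^sup>2))"
    unfolding proj_def
    by (subst l2_inner_sum_left) (auto intro!: sum.cong f e_L2 simp: l2_inner_commute[of M _ f] complex_norm_square[symmetric])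
  then have "(\<Sum>j<n. (cmod (l2_inner M f (e j)))\<^sup>2) = cmod (l2_inner M (proj M e n f) f)"
    by (simp flip: of_real_sum add: abs_of_nonneg[OF sum_nonneg] del: of_real_power)
  also have "\<dots> \<le> l2_norm M (proj M e n f) * l2_norm M f"
    by (intro l2_inner_bound L2_proj' f)
  also have "\<dots> \<le> (l2_norm M f)\<^sup>2"
    unfolding power2_eq_square by (intro mult_right_mono Bessel f) auto
  finally show ?thesis .
qed

text \<open>Bessel's inequality is applied to the conjugate of \<open>f\<close>, because
  \<open>bil M f (e j)\<close> is, up to conjugation, the inner product of that function with
  \<open>e j\<close>.\<close>

lemma Bessel_sum_bil:
  assumes f: "f \<in> L2 M"
  shows "(\<Sum>j<n. (cmod (bil M f (e j)))\<^sup>2) \<le> (l2_norm M f)\<^sup>2"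
proof -
  have "cmod (l2_inner M (\<lambda>x. cnj (f x)) (e j)) = cmod (bil M f (e j))" for j
  proof -
    have "l2_inner M (\<lambda>x. cnj (f x)) (e j) = (\<integral>x. cnj (f x * e j x) \<partial>M)"
      by (simp add: l2_inner_def)
    also have "\<dots> = cnj (bil M f (e j))"
      unfolding bil_def by (rule Bochner_Integration.integral_cnj)
    finally show ?thesis
      by simp
  qed
  then show ?thesis
    using Bessel_sum_inner[OF L2_cnj[OF f], of n] by simp
qed

lemma Parseval:
  assumes "\<alpha> \<in> L2 M" "\<beta> \<in> L2 M"
  shows "(\<lambda>j. bil M \<alpha> (e j) * l2_inner M \<beta> (e j)) sums bil M \<alpha> \<beta>"
proof -
  have "(\<lambda>n. bil M \<alpha> (proj M e n \<beta>)) \<longlonglongrightarrow> bil M \<alpha> \<beta>"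
    using assms by (intro bil_tendsto L2_proj' proj_tendsto') auto
  moreover have "bil M \<alpha> (proj M e n \<beta>) = (\<Sum>j<n. bil M \<alpha> (e j) * l2_inner M \<beta> (e j))" for n
    unfolding proj_def by (subst bil_sum_right) (auto simp: e_L2 assms mult.commute)
  ultimately show ?thesis
    by (simp add: sums_def)
qed

lemma L2_tensor:
  assumes a: "a \<in> L2 M" and b: "b \<in> L2 M"
  shows "(\<lambda>(x, y). a x * b y) \<in> L2 (M \<Otimes>\<^sub>M M)"
proof (rule L2I)
  have [measurable]: "a \<in> borel_measurable M" "b \<in> borel_measurable M"
    using a b by (auto dest: L2_measurable)
  show "(\<lambda>(x, y). a x * b y) \<in> borel_measurable (M \<Otimes>\<^sub>M M)"
    by measurable
  have "integrable (M \<Otimes>\<^sub>M M) (\<lambda>z. norm (case z of (x, y) \<Rightarrow> complex_of_real ((cmod (a x))\<^sup>2) * complex_of_real ((cmod (b y))\<^sup>2)))"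
    using a b by (intro integrable_norm integrable_tensor integrable_of_real L2_integrable)
  then show "integrable (M \<Otimes>\<^sub>M M) (\<lambda>z. (cmod (case z of (x, y) \<Rightarrow> a x * b y))\<^sup>2)"
    by (simp add: case_prod_beta norm_mult power_mult_distrib norm_power)
qed

lemma kernel_Fubini:
  assumes F: "F \<in> L2 (M \<Otimes>\<^sub>M M)" and a: "a \<in> L2 M" and b: "b \<in> L2 M"
  shows "bil M (\<lambda>x. \<integral>r. F (x, r) * b r \<partial>M) a = bil M (\<lambda>r. \<integral>x. F (x, r) * a x \<partial>M) b"
proof -
  have "integrable (M \<Otimes>\<^sub>M M) (\<lambda>z. F z * (case z of (x, r) \<Rightarrow> a x * b r))"
    by (intro L2_mult_integrable F L2_tensor a b)
  then have i: "integrable (M \<Otimes>\<^sub>M M) (\<lambda>(x, r). F (x, r) * (a x * b r))"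
    by (simp add: case_prod_beta')
  have "bil M (\<lambda>x. \<integral>r. F (x, r) * b r \<partial>M) a = (\<integral>x. \<integral>r. F (x, r) * (a x * b r) \<partial>M \<partial>M)"
    unfolding bil_def by (simp add: ac_simps flip: Bochner_Integration.integral_mult_right_zero Bochner_Integration.integral_mult_left_zero)
  also have "\<dots> = (\<integral>r. \<integral>x. F (x, r) * (a x * b r) \<partial>M \<partial>M)"
    using Fubini_integral[OF i] by simp
  also have "\<dots> = bil M (\<lambda>r. \<integral>x. F (x, r) * a x \<partial>M) b"
    unfolding bil_def by (simp add: ac_simps flip: Bochner_Integration.integral_mult_right_zero Bochner_Integration.integral_mult_left_zero)
  finally show ?thesis .
qed

lemma kernel_norm_integrable:
  assumes F: "F \<in> L2 (M \<Otimes>\<^sub>M M)"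
  shows "(\<lambda>r. complex_of_real (l2_norm M (\<lambda>x. F (x, r)))) \<in> L2 M"
proof (rule L2I)
  have [measurable]: "F \<in> borel_measurable (M \<Otimes>\<^sub>M M)"
    using F by (rule L2_measurable)
  show "(\<lambda>r. complex_of_real (l2_norm M (\<lambda>x. F (x, r)))) \<in> borel_measurable M"
    unfolding l2_norm_def by measurable
  have "integrable M (\<lambda>r. \<integral>x. (cmod (F (x, r)))\<^sup>2 \<partial>M)"
    using integrable_snd[of "\<lambda>x r. (cmod (F (x, r)))\<^sup>2"] L2_integrable[OF F] by (simp add: case_prod_beta')
  then show "integrable M (\<lambda>r. (cmod (complex_of_real (l2_norm M (\<lambda>x. F (x, r)))))\<^sup>2)"
    by (simp add: l2_norm_square)
qed

lemma kernel_apply_L2: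
  assumes F: "F \<in> L2 (M \<Otimes>\<^sub>M M)" and a: "a \<in> L2 M" and sec: "\<And>r. (\<lambda>x. F (x, r)) \<in> L2 M"
  shows "(\<lambda>r. \<integral>x. F (x, r) * a x \<partial>M) \<in> L2 M"
proof (rule L2_dominated)
  have [measurable]: "F \<in> borel_measurable (M \<Otimes>\<^sub>M M)" "a \<in> borel_measurable M"
    using F a by (auto dest: L2_measurable)
  show "(\<lambda>r. \<integral>x. F (x, r) * a x \<partial>M) \<in> borel_measurable M"
    by measurable
  show "(\<lambda>r. complex_of_real (l2_norm M a) * complex_of_real (l2_norm M (\<lambda>x. F (x, r)))) \<in> L2 M"
    by (intro L2_scale kernel_norm_integrable F)
  show "AE r in M. cmod (\<integral>x. F (x, r) * a x \<partial>M) \<le> cmod (complex_of_real (l2_norm M a) * complex_of_real (l2_norm M (\<lambda>x. F (x, r))))"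
    using bil_bound[OF sec a] by (intro AE_I2) (simp add: bil_def norm_mult mult.commute)
qed

text \<open>For almost every \<open>x\<close> Bessel's inequality holds for the section of
  \<open>F\<close> in \<open>r\<close>; integrating over \<open>x\<close> bounds the squared norms
  of the coefficient functions by the squared Hilbert-Schmidt norm. The system \<open>u\<close> is
  kept abstract since both \<open>e\<close> and its conjugate are used.\<close>

lemma kernel_coefficients:
  assumes F: "F \<in> L2 (M \<Otimes>\<^sub>M M)"
    and u: "\<And>f n. f \<in> L2 M \<Longrightarrow> (\<Sum>j<n. (cmod (bil M f (u j)))\<^sup>2) \<le> (l2_norm M f)\<^sup>2"
    and u_L2: "\<And>j. u j \<in> L2 M"
  shows "(\<lambda>x. \<integral>r. F (x, r) * u j r \<partial>M) \<in> L2 M"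
    and "(\<Sum>j<n. (l2_norm M (\<lambda>x. \<integral>r. F (x, r) * u j r \<partial>M))\<^sup>2) \<le> (l2_norm (M \<Otimes>\<^sub>M M) F)\<^sup>2"
    and "summable (\<lambda>j. (l2_norm M (\<lambda>x. \<integral>r. F (x, r) * u j r \<partial>M))\<^sup>2)"
proof -
  let ?c = "\<lambda>j x. \<integral>r. F (x, r) * u j r \<partial>M"
  have [measurable]: "F \<in> borel_measurable (M \<Otimes>\<^sub>M M)" "u j \<in> borel_measurable M" for j
    using F u_L2[of j] by (auto dest: L2_measurable)
  have int: "integrable (M \<Otimes>\<^sub>M M) (\<lambda>z. (cmod (F z))\<^sup>2)"
    by (rule L2_integrable[OF F])
  have "AE x in M. integrable M (\<lambda>r. (cmod (F (x, r)))\<^sup>2)"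
    using AE_integrable_fst'[OF int] by simp
  then have sec: "AE x in M. (\<lambda>r. F (x, r)) \<in> L2 M"
    using AE_space by eventually_elim (intro L2I, auto)
  have ifst: "integrable M (\<lambda>x. \<integral>r. (cmod (F (x, r)))\<^sup>2 \<partial>M)"
    using integrable_fst'[OF int] by simp
  have bound: "AE x in M. (\<Sum>j<n. (cmod (?c j x))\<^sup>2) \<le> (\<integral>r. (cmod (F (x, r)))\<^sup>2 \<partial>M)" for n
    using sec by eventually_elim (use u in \<open>auto simp: bil_def l2_norm_square\<close>)
  have L2: "?c j \<in> L2 M" for j
  proof (rule L2I)
    show "?c j \<in> borel_measurable M"
      by measurable
    show "integrable M (\<lambda>x. (cmod (?c j x))\<^sup>2)"
    proof (rule Bochner_Integration.integrable_bound[OF ifst])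
      show "AE x in M. norm ((cmod (?c j x))\<^sup>2) \<le> norm (\<integral>r. (cmod (F (x, r)))\<^sup>2 \<partial>M)"
        \<comment> \<open>A single coefficient is dominated by the partial sum that ends with
          it.\<close>
        using bound[of "Suc j"]
      proof eventually_elim
        case (elim x)
        then show ?case
          using sum_nonneg[of "{..<j}" "\<lambda>j. (cmod (?c j x))\<^sup>2"] by simp
      qed
    qed measurable
  qed
  then show "?c j \<in> L2 M" .
  have sum: "(\<Sum>j<n. (l2_norm M (?c j))\<^sup>2) \<le> (l2_norm (M \<Otimes>\<^sub>M M) F)\<^sup>2" for n
  proof -
    have "(\<Sum>j<n. (l2_norm M (?c j))\<^sup>2) = (\<integral>x. (\<Sum>j<n. (cmod (?c j x))\<^sup>2) \<partial>M)"
      unfolding l2_norm_square by (rule Bochner_Integration.integral_sum[symmetric]) (intro L2_integrable L2)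
    also have "\<dots> \<le> (\<integral>x. (\<integral>r. (cmod (F (x, r)))\<^sup>2 \<partial>M) \<partial>M)"
      by (intro integral_mono_AE ifst bound Bochner_Integration.integrable_sum L2_integrable L2)
    also have "\<dots> = (l2_norm (M \<Otimes>\<^sub>M M) F)\<^sup>2"
      using integral_fst'[OF int] by (simp add: l2_norm_square)
    finally show ?thesis .
  qed
  then show "(\<Sum>j<n. (l2_norm M (?c j))\<^sup>2) \<le> (l2_norm (M \<Otimes>\<^sub>M M) F)\<^sup>2" .
  show "summable (\<lambda>j. (l2_norm M (?c j))\<^sup>2)"
    by (rule summableI_nonneg_bounded[where x = "(l2_norm (M \<Otimes>\<^sub>M M) F)\<^sup>2"]) (auto intro: sum)
qed

text \<open>Expanding both kernels in the second variable writes an integral of rank-one operators as a series,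
  which makes it trace class.\<close>

lemma kernel_pairing_sums:
  assumes F: "F \<in> L2 (M \<Otimes>\<^sub>M M)" "\<And>r. (\<lambda>x. F (x, r)) \<in> L2 M"
    and G: "G \<in> L2 (M \<Otimes>\<^sub>M M)" "\<And>r. (\<lambda>x. G (x, r)) \<in> L2 M"
    and T: "T \<in> BL2 M"
  shows "integrable M (\<lambda>r. bil M (T (\<lambda>x. F (x, r))) (\<lambda>y. G (y, r)))" (is ?int)
    and "(\<lambda>j. bil M (T (\<lambda>x. \<integral>r. F (x, r) * e j r \<partial>M)) (\<lambda>y. \<integral>r. G (y, r) * cnj (e j r) \<partial>M)) sums
      (\<integral>r. bil M (T (\<lambda>x. F (x, r))) (\<lambda>y. G (y, r)) \<partial>M)" (is ?sums)
proof -
  \<comment> \<open>The basis is used for one kernel and its conjugate for the other, so that the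
    sum over \<open>j\<close> of \<open>Fc j x * Gc j y\<close> stands for the integral over
    \<open>r\<close> of \<open>F (x, r) * G (y, r)\<close>.\<close>
  define Fc where "Fc j = (\<lambda>x. \<integral>r. F (x, r) * e j r \<partial>M)" for j
  define Gc where "Gc j = (\<lambda>y. \<integral>r. G (y, r) * cnj (e j r) \<partial>M)" for j
  note Fk = kernel_coefficients[OF F(1), of e, OF Bessel_sum_bil e_L2, folded Fc_def]
  note Gk = kernel_coefficients[OF G(1), of "\<lambda>j r. cnj (e j r)", OF Bessel_sum_inner[unfolded l2_inner_bil] L2_cnj[OF e_L2],
    folded Gc_def]
  obtain C where "0 \<le> C" "\<forall>f\<in>L2 M. l2_norm M (T f) \<le> C * l2_norm M f"
    using BL2_bound[OF T] by blast
  note C = this(1) this(2)[rule_format]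
  \<comment> \<open>With \<open>T\<close> preceded by the projection onto the first \<open>n\<close>
    basis vectors, the integrand becomes the finite sum of
    \<open>\<alpha> l r * \<beta> l r\<close>.\<close>
  define \<alpha> where "\<alpha> l = (\<lambda>r. \<integral>x. F (x, r) * cnj (e l x) \<partial>M)" for l
  define \<beta> where "\<beta> l = (\<lambda>r. \<integral>y. G (y, r) * T (e l) y \<partial>M)" for l
  have ab: "\<alpha> l \<in> L2 M" "\<beta> l \<in> L2 M" for l
    unfolding \<alpha>_def \<beta>_def by (intro kernel_apply_L2 F G L2_cnj e_L2 BL2_L2[OF T])+
  have sum_fc: "summable (\<lambda>j. C * (l2_norm M (Fc j) * l2_norm M (Gc j)))"
    using summable_mult_of_squares[OF Fk(3) Gk(3)] by (intro summable_mult) simp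
  have lim1: "(\<lambda>n. \<Sum>j. bil M (T (proj M e n (Fc j))) (Gc j)) \<longlonglongrightarrow> (\<Sum>j. bil M (T (Fc j)) (Gc j))"
  proof (rule tannerys_theorem[THEN conjunct2, THEN conjunct2, OF _ _ sum_fc])
    show "(\<lambda>n. bil M (T (proj M e n (Fc j))) (Gc j)) \<longlonglongrightarrow> bil M (T (Fc j)) (Gc j)" for j
      by (intro bil_op_proj_tendsto T Fk Gk)
    show "\<forall>\<^sub>F (j, n) in sequentially \<times>\<^sub>F sequentially.
        cmod (bil M (T (proj M e n (Fc j))) (Gc j)) \<le> C * (l2_norm M (Fc j) * l2_norm M (Gc j))"
      by (auto intro!: always_eventually bil_op_proj_bound T C Fk Gk)
  qed simp
  have w: "integrable M (\<lambda>r. C * (l2_norm M (\<lambda>x. F (x, r)) * l2_norm M (\<lambda>y. G (y, r))))"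
    using integrable_norm[OF L2_mult_integrable[OF kernel_norm_integrable[OF F(1)] kernel_norm_integrable[OF G(1)]]]
    by (intro integrable_mult_right) (simp add: norm_mult)
  have integrand: "bil M (T (proj M e n (\<lambda>x. F (x, r)))) (\<lambda>y. G (y, r)) = (\<Sum>l<n. \<alpha> l r * \<beta> l r)" for n r
  proof -
    have "bil M (T (e l)) (\<lambda>y. G (y, r)) = \<beta> l r" for l
      by (simp add: \<beta>_def bil_def mult.commute)
    then show ?thesis
      by (simp add: bil_op_proj T F G \<alpha>_def l2_inner_def)
  qed
  have meas: "(\<lambda>r. bil M (T (proj M e n (\<lambda>x. F (x, r)))) (\<lambda>y. G (y, r))) \<in> borel_measurable M" for n
    unfolding integrand using ab by (auto dest: L2_measurable)
  have ptw: "(\<lambda>n. bil M (T (proj M e n (\<lambda>x. F (x, r)))) (\<lambda>y. G (y, r))) \<longlonglongrightarrow> bil M (T (\<lambda>x. F (x, r))) (\<lambda>y. G (y, r))" for r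
    by (intro bil_op_proj_tendsto T F G)
  have dom: "cmod (bil M (T (proj M e n (\<lambda>x. F (x, r)))) (\<lambda>y. G (y, r)))
      \<le> C * (l2_norm M (\<lambda>x. F (x, r)) * l2_norm M (\<lambda>y. G (y, r)))" for n r
    by (intro bil_op_proj_bound T C F G)
  have meas': "(\<lambda>r. bil M (T (\<lambda>x. F (x, r))) (\<lambda>y. G (y, r))) \<in> borel_measurable M"
    by (rule borel_measurable_LIMSEQ_metric[OF meas ptw])
  show ?int
    by (rule integrable_dominated_convergence[where s = "\<lambda>n r. bil M (T (proj M e n (\<lambda>x. F (x, r)))) (\<lambda>y. G (y, r))",
        OF meas' meas w]) (use ptw dom in auto)
  have lim2: "(\<lambda>n. \<integral>r. bil M (T (proj M e n (\<lambda>x. F (x, r)))) (\<lambda>y. G (y, r)) \<partial>M)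
      \<longlonglongrightarrow> (\<integral>r. bil M (T (\<lambda>x. F (x, r))) (\<lambda>y. G (y, r)) \<partial>M)"
    by (rule integral_dominated_convergence[where s = "\<lambda>n r. bil M (T (proj M e n (\<lambda>x. F (x, r)))) (\<lambda>y. G (y, r))",
        OF meas' meas w]) (use ptw dom in auto)
  \<comment> \<open>For finite \<open>n\<close> the identity is Parseval's formula in the variable
    \<open>r\<close>, applied to \<open>\<alpha> l\<close> and \<open>\<beta> l\<close>; the two
    limits above then remove the projection.\<close>
  have "(\<Sum>j. bil M (T (proj M e n (Fc j))) (Gc j)) = (\<integral>r. bil M (T (proj M e n (\<lambda>x. F (x, r)))) (\<lambda>y. G (y, r)) \<partial>M)" for n
  proof -
    have "bil M (T (proj M e n (Fc j))) (Gc j) = (\<Sum>l<n. bil M (\<alpha> l) (e j) * l2_inner M (\<beta> l) (e j))" for j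
    proof -
      have "l2_inner M (Fc j) (e l) = bil M (\<alpha> l) (e j)" for l
        unfolding l2_inner_bil Fc_def \<alpha>_def by (intro kernel_Fubini F L2_cnj e_L2)
      moreover have "bil M (T (e l)) (Gc j) = l2_inner M (\<beta> l) (e j)" for l
        unfolding l2_inner_bil Gc_def \<beta>_def
        by (subst bil_commute) (intro kernel_Fubini G L2_cnj e_L2 BL2_L2[OF T])
      ultimately show ?thesis
        by (simp add: bil_op_proj T Fk Gk)
    qed
    moreover have "(\<lambda>j. \<Sum>l<n. bil M (\<alpha> l) (e j) * l2_inner M (\<beta> l) (e j)) sums (\<Sum>l<n. bil M (\<alpha> l) (\<beta> l))"
      by (intro sums_sum Parseval ab)
    moreover have "(\<integral>r. (\<Sum>l<n. \<alpha> l r * \<beta> l r) \<partial>M) = (\<Sum>l<n. bil M (\<alpha> l) (\<beta> l))"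
      unfolding bil_def by (intro Bochner_Integration.integral_sum L2_mult_integrable ab)
    ultimately show ?thesis
      by (simp add: integrand sums_iff)
  qed
  then have "(\<Sum>j. bil M (T (Fc j)) (Gc j)) = (\<integral>r. bil M (T (\<lambda>x. F (x, r))) (\<lambda>y. G (y, r)) \<partial>M)"
    using lim1 lim2 LIMSEQ_unique by simp
  moreover have "summable (\<lambda>j. bil M (T (Fc j)) (Gc j))"
    by (rule summable_comparison_test'[OF sum_fc, of 0]) (intro bil_op_bound T C Fk Gk)
  ultimately show ?sums
    by (simp add: sums_iff Fc_def Gc_def)
qed

end

subsection \<open>Haar measure on a second countable locally compact abelian group\<close>

lemma borel_measurable_group_uminus [measurable (raw)]:
  fixes g :: "'a \<Rightarrow> 'b::{topological_group_add, t2_space}"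
  assumes "g \<in> borel_measurable M"
  shows "(\<lambda>x. - g x) \<in> borel_measurable M"
  by (rule borel_measurable_continuous_on[OF _ assms]) (intro continuous_intros)

lemma borel_measurable_group_diff [measurable (raw)]:
  fixes f g :: "'a \<Rightarrow> 'b::{topological_group_add, t2_space, second_countable_topology}"
  assumes [measurable]: "f \<in> borel_measurable M" "g \<in> borel_measurable M"
  shows "(\<lambda>x. f x - g x) \<in> borel_measurable M"
  unfolding diff_conv_add_uminus by measurable

locale haar_abelian =
  fixes \<mu> :: "'g::{topological_ab_group_add, t2_space, second_countable_topology} measure"
  assumes lc: "locally_compact_space (euclidean :: 'g topology)"
    and haar: "left_haar_measure \<mu>"
begin

lemma sets_eq [measurable_cong, simp]: "sets \<mu> = sets borel"
  using haar by (simp add: left_haar_measure_def)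

lemma space_eq [simp]: "space \<mu> = UNIV"
  using sets_eq_imp_space_eq[OF sets_eq] by simp

lemma emeasure_compact: "compact K \<Longrightarrow> emeasure \<mu> K < \<infinity>"
  using haar by (simp add: left_haar_measure_def)

lemma emeasure_translate_image: "E \<in> sets borel \<Longrightarrow> emeasure \<mu> ((\<lambda>x. s + x) ` E) = emeasure \<mu> E"
  using haar by (simp add: left_haar_measure_def)

lemma outer_regular:
  assumes "E \<in> sets borel" "emeasure \<mu> E < \<infinity>" "0 < \<epsilon>"
  obtains U where "open U" "E \<subseteq> U" "emeasure \<mu> U < emeasure \<mu> E + ennreal \<epsilon>"
proof -
  have eq: "emeasure \<mu> E = (INF U\<in>{U. open U \<and> E \<subseteq> U}. emeasure \<mu> U)"
    using haar assms(1) unfolding left_haar_measure_def by blast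
  have "emeasure \<mu> E < emeasure \<mu> E + ennreal \<epsilon>"
    using assms(2,3) by (cases "emeasure \<mu> E") (auto simp: ennreal_less_iff simp flip: ennreal_plus)
  then show thesis
    using that unfolding eq INF_less_iff by blast
qed

lemma inner_regular:
  assumes "open U" "emeasure \<mu> U < \<infinity>" "0 < \<epsilon>"
  obtains K where "compact K" "K \<subseteq> U" "emeasure \<mu> U < emeasure \<mu> K + ennreal \<epsilon>"
\<comment> \<open>Subtracting \<open>\<epsilon>\<close> does not make a measure of 0 smaller, so
  null sets are treated separately, with the empty compact set.\<close>
proof (cases "emeasure \<mu> U = 0")
  case True
  then show thesis
    using that[of "{}"] assms(3) by simp
next
  case False
  have eq: "emeasure \<mu> U = (SUP K\<in>{K. compact K \<and> K \<subseteq> U}. emeasure \<mu> K)"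
    using haar assms(1) unfolding left_haar_measure_def by blast
  have "emeasure \<mu> U - ennreal \<epsilon> < emeasure \<mu> U"
    using assms(2,3) False by (cases "emeasure \<mu> U") (auto simp: ennreal_minus intro!: ennreal_lessI)
  then obtain K where K: "compact K" "K \<subseteq> U" "emeasure \<mu> U - ennreal \<epsilon> < emeasure \<mu> K"
    unfolding eq less_SUP_iff by blast
  then have "emeasure \<mu> U < emeasure \<mu> K + ennreal \<epsilon>"
    using assms(2,3) emeasure_compact[OF K(1)]
    by (cases "emeasure \<mu> U"; cases "emeasure \<mu> K")
       (auto simp: ennreal_less_iff ennreal_minus simp flip: ennreal_plus, meson ennreal_leI le_diff_eq linorder_not_le)
  then show thesis
    using that K by blast
qed

section \<open>Invariance under translations\<close>

lemma distr_translate: "distr \<mu> \<mu> (\<lambda>x. s + x) = \<mu>"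
proof (rule measure_eqI)
  fix A assume "A \<in> sets (distr \<mu> \<mu> (\<lambda>x. s + x))"
  then have A: "A \<in> sets borel"
    by simp
  have "(\<lambda>x. s + x) -` A = (\<lambda>x. - s + x) ` A"
    by (force intro: image_eqI[of _ _ "s + _"])
  moreover have "emeasure (distr \<mu> \<mu> (\<lambda>x. s + x)) A = emeasure \<mu> ((\<lambda>x. s + x) -` A)"
    using A by (subst emeasure_distr) auto
  ultimately show "emeasure (distr \<mu> \<mu> (\<lambda>x. s + x)) A = emeasure \<mu> A"
    using emeasure_translate_image[OF A, of "- s"] by simp
qed simp

lemma borel_measurable_translate_iff:
  fixes f :: "'g \<Rightarrow> 'b::topological_space"
  shows "(\<lambda>x. f (s + x)) \<in> borel_measurable borel \<longleftrightarrow> f \<in> borel_measurable borel"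
proof
  assume [measurable]: "(\<lambda>x. f (s + x)) \<in> borel_measurable borel"
  have "(\<lambda>x. f (s + (- s + x))) \<in> borel_measurable borel"
    by (rule measurable_compose[of "\<lambda>x. - s + x" borel borel]) measurable
  then show "f \<in> borel_measurable borel"
    by (simp add: add.assoc[symmetric])
next
  assume [measurable]: "f \<in> borel_measurable borel"
  show "(\<lambda>x. f (s + x)) \<in> borel_measurable borel"
    by measurable
qed

lemma borel_measurable_eq: "borel_measurable \<mu> = borel_measurable borel"
  by (rule measurable_cong_sets) auto

lemma integrable_translate_iff:
  fixes f :: "'g \<Rightarrow> 'b::{banach, second_countable_topology}"
  shows "integrable \<mu> (\<lambda>x. f (s + x)) \<longleftrightarrow> integrable \<mu> f"
proof (cases "f \<in> borel_measurable borel")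
  case True
  then show ?thesis
    using integrable_distr_eq[of "\<lambda>x. s + x" \<mu> \<mu> f] by (simp add: distr_translate borel_measurable_eq)
next
  case False
  then show ?thesis
    using borel_measurable_integrable borel_measurable_translate_iff borel_measurable_eq by metis
qed

text \<open>If \<open>f\<close> is not measurable, neither side is integrable and both integrals are
  0 by convention. Thus the rule applies to an arbitrary integrand without side conditions.\<close>

lemma integral_translate:
  fixes f :: "'g \<Rightarrow> 'b::{banach, second_countable_topology}"
  shows "(\<integral>x. f (s + x) \<partial>\<mu>) = (\<integral>x. f x \<partial>\<mu>)"
proof (cases "f \<in> borel_measurable borel")
  case True
  then show ?thesis
    using integral_distr[of "\<lambda>x. s + x" \<mu> \<mu> f] by (simp add: distr_translate borel_measurable_eq)
next
  case False
  then have "\<not> integrable \<mu> f"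
    using borel_measurable_integrable borel_measurable_eq by metis
  then show ?thesis
    using integrable_translate_iff[of f s] by (simp add: not_integrable_integral_eq)
qed

lemma nn_integral_translate:
  "f \<in> borel_measurable borel \<Longrightarrow> (\<integral>\<^sup>+x. f (s + x) \<partial>\<mu>) = (\<integral>\<^sup>+x. f x \<partial>\<mu>)"
  using nn_integral_distr[of "\<lambda>x. s + x" \<mu> \<mu> f] by (simp add: distr_translate borel_measurable_eq)

lemma emeasure_translate:
  assumes [measurable]: "E \<in> sets borel"
  shows "emeasure \<mu> {x. s + x \<in> E} = emeasure \<mu> E"
proof -
  have "emeasure \<mu> E = emeasure (distr \<mu> \<mu> (\<lambda>x. s + x)) E"
    by (simp add: distr_translate)
  also have "\<dots> = emeasure \<mu> ((\<lambda>x. s + x) -` E \<inter> space \<mu>)"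
    using assms by (intro emeasure_distr) auto
  finally show ?thesis
    by (simp add: vimage_def)
qed

lemma AE_translate:
  assumes "AE x in \<mu>. P x"
  shows "AE x in \<mu>. P (s + x)"
proof -
  obtain N where N: "{x. \<not> P x} \<subseteq> N" "emeasure \<mu> N = 0" "N \<in> sets borel"
    using assms by (auto elim!: AE_E)
  have "emeasure \<mu> {x. s + x \<in> N} = 0"
    using emeasure_translate[OF N(3)] N(2) by simp
  moreover have "{x. s + x \<in> N} \<in> sets borel"
    using N(3) by measurable
  ultimately show ?thesis
    using N(1) by (intro AE_I[of _ _ "{x. s + x \<in> N}"]) auto
qed

lemma L2_translate_iff: "(\<lambda>x. f (s + x)) \<in> L2 \<mu> \<longleftrightarrow> f \<in> L2 \<mu>"
  using integrable_translate_iff[of "\<lambda>x. (cmod (f x))\<^sup>2" s]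
  by (simp add: L2_def borel_measurable_eq borel_measurable_translate_iff)

lemma l2_norm_translate: "l2_norm \<mu> (\<lambda>x. f (s + x)) = l2_norm \<mu> f"
  using integral_translate[of "\<lambda>x. (cmod (f x))\<^sup>2" s] by (simp add: l2_norm_def)

lemma bil_translate: "bil \<mu> (\<lambda>x. f (s + x)) (\<lambda>x. g (s + x)) = bil \<mu> f g"
  using integral_translate[of "\<lambda>x. f x * g x" s] by (simp add: bil_def)

section \<open>Consequences of local compactness and second countability\<close>

lemma ex_nhd_compact: "\<exists>U K. open U \<and> compact K \<and> x \<in> U \<and> U \<subseteq> (K :: 'g set)"
  using lc unfolding locally_compact_space_def by auto

lemma ex_nhd_finite: "\<exists>U. open U \<and> x \<in> U \<and> emeasure \<mu> U < \<infinity>"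
proof -
  obtain U K where UK: "open U" "compact K" "x \<in> U" "U \<subseteq> K"
    using ex_nhd_compact[of x] by blast
  have "emeasure \<mu> U \<le> emeasure \<mu> K"
    using UK by (intro emeasure_mono) (auto intro: borel_compact)
  then show ?thesis
    using UK emeasure_compact[OF UK(2)] by (auto intro: le_less_trans)
qed

text \<open>Lindelof's theorem extracts a countable cover from the open sets contained in compact
  ones, and those compact sets are taken. They yield sigma-finiteness and the exhaustion in the
  Folner construction.\<close>

lemma ex_countable_compact_cover: "\<exists>\<K>. countable \<K> \<and> (\<forall>K\<in>\<K>. compact K) \<and> \<Union>\<K> = (UNIV :: 'g set)"
proof -
  define \<F> where "\<F> = {U. open U \<and> (\<exists>K. compact K \<and> U \<subseteq> (K :: 'g set))}"
  obtain \<F>' where F': "\<F>' \<subseteq> \<F>" "countable \<F>'" "\<Union>\<F>' = \<Union>\<F>"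
    using Lindelof[of \<F>] by (auto simp: \<F>_def)
  have "\<Union>\<F> = UNIV"
    using ex_nhd_compact unfolding \<F>_def by blast
  have "\<forall>U\<in>\<F>'. \<exists>K. compact K \<and> U \<subseteq> K"
    using F'(1) by (auto simp: \<F>_def)
  then obtain k where k: "\<forall>U\<in>\<F>'. compact (k U) \<and> U \<subseteq> k U"
    unfolding bchoice_iff ..
  show ?thesis
  proof (intro exI conjI)
    show "countable (k ` \<F>')"
      using F'(2) by simp
    show "\<forall>K\<in>k ` \<F>'. compact K"
      using k by simp
    have "\<Union>\<F>' \<subseteq> \<Union>(k ` \<F>')"
      using k by (intro Union_least) (meson UN_upper order_trans)
    then show "\<Union>(k ` \<F>') = UNIV"
      using F'(3) \<open>\<Union>\<F> = UNIV\<close> by auto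
  qed
qed

lemma sigma_finite_haar: "sigma_finite_measure \<mu>"
proof
  obtain \<K> where K: "countable \<K>" "\<forall>K\<in>\<K>. compact K" "\<Union>\<K> = (UNIV :: 'g set)"
    using ex_countable_compact_cover by (elim exE conjE)
  show "\<exists>A. countable A \<and> A \<subseteq> sets \<mu> \<and> \<Union>A = space \<mu> \<and> (\<forall>a\<in>A. emeasure \<mu> a \<noteq> \<infinity>)"
    using K emeasure_compact by (intro exI[of _ \<K>]) (auto intro: borel_compact simp: less_top)
qed

text \<open>By Lindelof countably many translates of \<open>U\<close> cover the group, so a null
  \<open>U\<close> would make the whole measure vanish.\<close>

lemma emeasure_open_pos:
  assumes U: "open U" "x \<in> (U :: 'g set)"
  shows "0 < emeasure \<mu> U"
proof (rule ccontr)
  assume "\<not> 0 < emeasure \<mu> U"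
  then have U0: "emeasure \<mu> U = 0"
    by simp
  define V where "V s = {y. s + y \<in> U}" for s
  have V: "open (V s)" for s
    unfolding V_def using open_vimage[OF U(1), of "\<lambda>y. s + y"] by (simp add: vimage_def continuous_intros)
  obtain \<F> where F: "\<F> \<subseteq> range V" "countable \<F>" "\<Union>\<F> = \<Union>(range V)"
    using Lindelof[of "range V"] V by auto
  have "y \<in> V (x - y)" for y
    using U by (simp add: V_def)
  then have "\<Union>\<F> = UNIV"
    using F(3) by blast
  moreover have "emeasure \<mu> W = 0" if "W \<in> \<F>" for W
    using that F(1) U(1) U0 emeasure_translate[of U] by (auto simp: V_def)
  then have "\<Union>\<F> \<in> null_sets \<mu>"
    using F V by (intro null_sets_UN'[of \<F> "\<lambda>x. x", simplified]) (auto simp: null_sets_def)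
  ultimately have "emeasure \<mu> UNIV = 0"
    by auto
  then show False
    using haar by (simp add: left_haar_measure_def)
qed

text \<open>Left and right translates coincide by commutativity, so the factor 1 qualifies; it is
  the only one because some open set has positive and finite measure.\<close>

lemma modular_eq_1: "modular \<mu> r = 1"
  unfolding modular_def
proof (rule the_equality)
  have "(\<lambda>x. x + r) ` E = (\<lambda>x. r + x) ` E" for E
    by (simp add: add.commute)
  then show "1 > (0::real) \<and> (\<forall>E\<in>sets borel. emeasure \<mu> ((\<lambda>x. x + r) ` E) = ennreal 1 * emeasure \<mu> E)"
    by (simp add: emeasure_translate_image)
  fix c assume c: "c > (0::real) \<and> (\<forall>E\<in>sets borel. emeasure \<mu> ((\<lambda>x. x + r) ` E) = ennreal c * emeasure \<mu> E)"
  obtain U where U: "open U" "0 \<in> U" "emeasure \<mu> U < \<infinity>"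
    using ex_nhd_finite by blast
  have "emeasure \<mu> U = ennreal c * emeasure \<mu> U"
    using c U(1) emeasure_translate_image[of U r] by (metis add.commute borel_open image_cong)
  moreover have "emeasure \<mu> U = ennreal (measure \<mu> U)"
    using U(3) by (simp add: emeasure_eq_ennreal_measure less_top)
  moreover have "0 < measure \<mu> U"
    using emeasure_open_pos[OF U(1,2)] calculation(2) by (metis ennreal_less_zero_iff)
  ultimately have "measure \<mu> U = c * measure \<mu> U"
    using c by (metis ennreal_inj ennreal_mult less_eq_real_def measure_nonneg mult_nonneg_nonneg)
  then show "c = 1"
    using \<open>0 < measure \<mu> U\<close> by simp
qed

lemma rho_eq: "rho \<mu> r f = (\<lambda>x. f (r + x))"
  by (simp add: rho_def modular_eq_1 fun_eq_iff add.commute)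

section \<open>Density of the indicators of open sets\<close>

lemma indicator_L2:
  assumes "E \<in> sets borel" "emeasure \<mu> E < \<infinity>"
  shows "(\<lambda>x. indicator E x :: complex) \<in> L2 \<mu>"
    and "(l2_norm \<mu> (\<lambda>x. indicator E x :: complex))\<^sup>2 = measure \<mu> E"
proof -
  have eq: "(cmod (indicator E x))\<^sup>2 = indicator E x" for x
    by (simp add: indicator_def)
  show "(\<lambda>x. indicator E x :: complex) \<in> L2 \<mu>"
    using assms by (intro L2I) (auto simp: eq less_top)
  show "(l2_norm \<mu> (\<lambda>x. indicator E x :: complex))\<^sup>2 = measure \<mu> E"
    using assms by (simp add: l2_norm_square eq)
qed

lemma l2_norm_indicator_diff:
  assumes "A \<in> sets borel" "B \<in> sets borel" "A \<subseteq> B" "emeasure \<mu> B < \<infinity>"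
  shows "(l2_norm \<mu> (\<lambda>x. indicator A x - indicator B x))\<^sup>2 = measure \<mu> B - measure \<mu> A"
proof -
  have fin: "emeasure \<mu> A < \<infinity>"
    using emeasure_mono[of A B \<mu>] assms by (auto intro: le_less_trans)
  have "l2_norm \<mu> (\<lambda>x. indicator A x - indicator B x) = l2_norm \<mu> (\<lambda>x. indicator (B - A) x)"
    using assms(3) by (simp add: l2_norm_def) (intro Bochner_Integration.integral_cong, auto simp: indicator_def)
  then have "(l2_norm \<mu> (\<lambda>x. indicator A x - indicator B x))\<^sup>2 = measure \<mu> (B - A)"
    using assms by (subst indicator_L2(2)[symmetric]) (auto intro: le_less_trans[OF emeasure_mono[of "B - A" B]])
  also have "\<dots> = measure \<mu> B - measure \<mu> A"
    using assms by (intro measure_Diff) (auto simp: less_top)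
  finally show ?thesis .
qed

text \<open>Outer regularity passes from open sets to Borel sets of finite measure, linearity to
  simple functions, and dominated convergence to all of \<open>L2 \<mu>\<close>.\<close>

lemma L2_induct_open [consumes 1, case_names open_set add scale lim]:
  assumes f: "f \<in> L2 \<mu>"
    and open_set: "\<And>U. open U \<Longrightarrow> emeasure \<mu> U < \<infinity> \<Longrightarrow> P (\<lambda>x. indicator U x)"
    and add: "\<And>f g. f \<in> L2 \<mu> \<Longrightarrow> g \<in> L2 \<mu> \<Longrightarrow> P f \<Longrightarrow> P g \<Longrightarrow> P (\<lambda>x. f x + g x)"
    and scale: "\<And>c f. f \<in> L2 \<mu> \<Longrightarrow> P f \<Longrightarrow> P (\<lambda>x. c * f x)"
    and lim: "\<And>f. f \<in> L2 \<mu> \<Longrightarrow> (\<And>\<epsilon>. 0 < \<epsilon> \<Longrightarrow> \<exists>g\<in>L2 \<mu>. P g \<and> l2_norm \<mu> (\<lambda>x. f x - g x) < \<epsilon>) \<Longrightarrow> P f"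
  shows "P f"
proof -
  have zero: "P (\<lambda>x. 0)"
    using open_set[of "{}"] by simp
  have ind: "P (\<lambda>x. indicator E x)" if E: "E \<in> sets borel" "emeasure \<mu> E < \<infinity>" for E
  proof (rule lim)
    show "(\<lambda>x. indicator E x) \<in> L2 \<mu>"
      by (rule indicator_L2[OF E])
    fix \<epsilon> :: real assume "0 < \<epsilon>"
    then have e: "0 < \<epsilon>\<^sup>2"
      by simp
    obtain U where U: "open U" "E \<subseteq> U" "emeasure \<mu> U < emeasure \<mu> E + ennreal (\<epsilon>\<^sup>2)"
      using outer_regular[OF E e] by blast
    have Ufin: "emeasure \<mu> U < \<infinity>"
      using U(3) E(2) by (auto intro: less_trans simp: less_top)
    have "measure \<mu> U < measure \<mu> E + \<epsilon>\<^sup>2"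
      using U(3) E Ufin e by (simp add: emeasure_eq_ennreal_measure less_top ennreal_less_iff flip: ennreal_plus)
    then have "(l2_norm \<mu> (\<lambda>x. indicator E x - indicator U x))\<^sup>2 < \<epsilon>\<^sup>2"
      using U E Ufin by (subst l2_norm_indicator_diff) auto
    then have "l2_norm \<mu> (\<lambda>x. indicator E x - indicator U x) < \<epsilon>"
      by (rule power2_less_imp_less) (use \<open>0 < \<epsilon>\<close> in simp)
    then show "\<exists>g\<in>L2 \<mu>. P g \<and> l2_norm \<mu> (\<lambda>x. indicator E x - g x) < \<epsilon>"
      using open_set[OF U(1) Ufin] indicator_L2(1)[of U] U(1) Ufin by (intro bexI[of _ "\<lambda>x. indicator U x"]) auto
  qed
  have sum: "P (\<lambda>x. \<Sum>i\<in>I. c i * u i x)" if "finite I" "\<And>i. i \<in> I \<Longrightarrow> u i \<in> L2 \<mu> \<and> P (u i)"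
    for I :: "complex set" and c u
    using that
  proof (induction I rule: finite_induct)
    case (insert i I)
    have "P (\<lambda>x. c i * u i x + (\<Sum>i\<in>I. c i * u i x))"
      using insert by (intro add scale L2_scale L2_sum) auto
    then show ?case
      using insert.hyps by simp
  qed (simp add: zero)
  have [measurable]: "f \<in> borel_measurable \<mu>"
    by (rule L2_measurable[OF f])
  have "\<exists>s. (\<forall>i. simple_function \<mu> (s i)) \<and> (\<forall>x. (\<lambda>i. s i x) \<longlonglongrightarrow> f x) \<and>
      (\<forall>i x. norm (s i x) \<le> 2 * norm (f x))"
    using borel_measurable_implies_sequence_metric[of f \<mu> 0] by (simp add: dist_norm)
  then obtain s where "\<forall>i. simple_function \<mu> (s i)" "\<forall>x. (\<lambda>i. s i x) \<longlonglongrightarrow> f x"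
    "\<forall>i x. norm (s i x) \<le> 2 * norm (f x)"
    by (elim exE conjE)
  note s = this[rule_format]
  have [measurable]: "s i \<in> borel_measurable \<mu>" for i
    using s(1) by (rule borel_measurable_simple_function)
  have sL2: "s i \<in> L2 \<mu>" for i
    by (rule L2_dominated[OF _ L2_scale[OF f, of 2]]) (use s(3) in \<open>auto simp: norm_mult\<close>)
  have Ps: "P (s i)" for i
  proof -
    let ?I = "range (s i) - {0}"
    have fin: "finite ?I"
      using s(1)[of i] by (simp add: simple_function_def)
    have "P (\<lambda>x. \<Sum>y\<in>?I. y * indicator {x. s i x = y} x)"
    proof (rule sum[OF fin])
      fix y assume "y \<in> ?I"
      then have y: "y \<noteq> 0"
        by simp
      have [measurable]: "{x. s i x = y} \<in> sets borel"
        using borel_measurable_eq \<open>s i \<in> borel_measurable \<mu>\<close> by measurable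
      \<comment> \<open>Chebyshev's inequality: a nonzero value of a square-integrable simple
        function is taken on a set of finite measure.\<close>
      have "ennreal ((cmod y)\<^sup>2) * emeasure \<mu> {x. s i x = y} = (\<integral>\<^sup>+x. ennreal ((cmod y)\<^sup>2) * indicator {x. s i x = y} x \<partial>\<mu>)"
        by (intro nn_integral_cmult_indicator[symmetric]) simp
      also have "\<dots> \<le> (\<integral>\<^sup>+x. ennreal ((cmod (s i x))\<^sup>2) \<partial>\<mu>)"
        by (intro nn_integral_mono) (auto simp: indicator_def)
      also have "\<dots> < \<infinity>"
        using l2_norm_square_nn[OF sL2, of i] by (metis ennreal_less_top infinity_ennreal_def)
      finally have "emeasure \<mu> {x. s i x = y} < \<infinity>"
        using y by (auto simp: ennreal_mult_less_top less_top)
      then show "(\<lambda>x. indicator {x. s i x = y} x) \<in> L2 \<mu> \<and> P (\<lambda>x. indicator {x. s i x = y} x)"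
        by (intro conjI ind indicator_L2) measurable
    qed
    moreover have "(\<Sum>y\<in>?I. y * indicator {x. s i x = y} x) = s i x" for x
    proof -
      have "(\<Sum>y\<in>?I. y * indicator {x. s i x = y} x) = (\<Sum>y\<in>?I. if y = s i x then y else 0)"
        by (intro sum.cong) (auto simp: indicator_def)
      then show ?thesis
        using fin by simp
    qed
    ultimately show ?thesis
      by simp
  qed
  show "P f"
  proof (rule lim[OF f])
    fix \<epsilon> :: real assume \<epsilon>: "0 < \<epsilon>"
    have "(\<lambda>i. \<integral>x. (cmod (f x - s i x))\<^sup>2 \<partial>\<mu>) \<longlonglongrightarrow> (\<integral>x. 0 \<partial>\<mu>)"
    proof (rule integral_dominated_convergence)
      \<comment> \<open>Since \<open>s i\<close> is at most twice \<open>f\<close> in modulus, the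
        difference is at most three times, whence the 9.\<close>
      show "integrable \<mu> (\<lambda>x. 9 * (cmod (f x))\<^sup>2)"
        by (intro integrable_mult_right L2_integrable f)
      show "AE x in \<mu>. (\<lambda>i. (cmod (f x - s i x))\<^sup>2) \<longlonglongrightarrow> 0"
        using s(2) by (intro AE_I2) (auto intro!: tendsto_eq_intros)
      show "AE x in \<mu>. norm ((cmod (f x - s i x))\<^sup>2) \<le> 9 * (cmod (f x))\<^sup>2" for i
      proof (intro AE_I2)
        fix x
        have "cmod (f x - s i x) \<le> 3 * cmod (f x)"
          using norm_triangle_ineq4[of "f x" "s i x"] s(3)[of i x] by linarith
        then have "(cmod (f x - s i x))\<^sup>2 \<le> (3 * cmod (f x))\<^sup>2"
          by (intro power_mono) auto
        then show "norm ((cmod (f x - s i x))\<^sup>2) \<le> 9 * (cmod (f x))\<^sup>2"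
          by (simp add: power_mult_distrib)
      qed
    qed auto
    then have "\<forall>\<^sub>F i in sequentially. (\<integral>x. (cmod (f x - s i x))\<^sup>2 \<partial>\<mu>) < \<epsilon>\<^sup>2"
      using \<epsilon> by (intro order_tendstoD(2)[of _ 0]) auto
    then obtain i where "(l2_norm \<mu> (\<lambda>x. f x - s i x))\<^sup>2 < \<epsilon>\<^sup>2"
      unfolding l2_norm_square by (auto simp: eventually_sequentially)
    then have "l2_norm \<mu> (\<lambda>x. f x - s i x) < \<epsilon>"
      by (rule power2_less_imp_less) (use \<epsilon> in simp)
    then show "\<exists>g\<in>L2 \<mu>. P g \<and> l2_norm \<mu> (\<lambda>x. f x - g x) < \<epsilon>"
      using sL2 Ps by blast
  qed
qed

text \<open>Finite unions of basic open sets of finite measure form a countable family. An open set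
  of finite measure is the increasing union of such unions, so continuity from below approximates
  its indicator.\<close>

lemma ex_total_sequence:
  "\<exists>b :: nat \<Rightarrow> 'g \<Rightarrow> complex. (\<forall>n. b n \<in> L2 \<mu>) \<and>
    (\<forall>f\<in>L2 \<mu>. \<forall>\<epsilon>>0. \<exists>N c. l2_norm \<mu> (\<lambda>x. f x - (\<Sum>j<N. c j * b j x)) < \<epsilon>)"
proof -
  obtain B :: "'g set set" where B: "countable B" "topological_basis B"
    using ex_countable_basis by blast
  \<comment> \<open>The empty set is included so that the family \<open>C\<close> of basic subsets
    of an open set can be enumerated even if that open set is empty.\<close>
  define B' where "B' = insert {} {b \<in> B. emeasure \<mu> b < \<infinity>}"
  have B'_open: "open b" "emeasure \<mu> b < \<infinity>" if "b \<in> B'" for b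
    using that topological_basis_open[OF B(2)] by (auto simp: B'_def)
  have B'_cnt: "countable B'"
    using B(1) by (simp add: B'_def)
  define \<F> where "\<F> = Union ` {F. finite F \<and> F \<subseteq> B'}"
  have F: "open V" "emeasure \<mu> V < \<infinity>" if "V \<in> \<F>" for V
  proof -
    obtain F where F: "finite F" "F \<subseteq> B'" "V = \<Union>F"
      using \<open>V \<in> \<F>\<close> by (auto simp: \<F>_def)
    then show "open V"
      using B'_open by auto
    have "emeasure \<mu> (\<Union>F) \<le> (\<Sum>b\<in>F. emeasure \<mu> b)"
      using F B'_open emeasure_subadditive_finite[of F "\<lambda>b. b" \<mu>] by (auto intro: borel_open)
    also have "\<dots> < \<infinity>"
      using F B'_open(2) by (auto simp: less_top)
    finally show "emeasure \<mu> V < \<infinity>"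
      using F(3) by simp
  qed
  have F_cnt: "countable \<F>" and F_ne: "\<F> \<noteq> {}"
    using B'_cnt unfolding \<F>_def by (auto intro: countable_Collect_finite_subset)
  define S where "S = from_nat_into \<F>"
  have S: "range S = \<F>"
    using range_from_nat_into[OF F_ne F_cnt] by (simp add: S_def)
  define b where "b n = (\<lambda>x. indicator (S n) x :: complex)" for n
  have b: "b n \<in> L2 \<mu>" for n
  proof -
    have "S n \<in> \<F>"
      using S by (rule subst) simp
    then show ?thesis
      unfolding b_def using F by (intro indicator_L2) auto
  qed
  define Sp where "Sp = {\<lambda>x. \<Sum>j<N. c j * b j x | (N::nat) c. True}"
  have Sp_L2: "g \<in> L2 \<mu>" if "g \<in> Sp" for g
    using that b unfolding Sp_def by (auto intro!: L2_sum L2_scale)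
  have Sp_add: "(\<lambda>x. g x + h x) \<in> Sp" if gh: "g \<in> Sp" "h \<in> Sp" for g h
  proof -
    obtain N :: nat and c where g: "g = (\<lambda>x. \<Sum>j<N. c j * b j x)"
      using gh(1) unfolding Sp_def by blast
    obtain N' :: nat and c' where h: "h = (\<lambda>x. \<Sum>j<N'. c' j * b j x)"
      using gh(2) unfolding Sp_def by blast
    let ?c = "\<lambda>j. (if j < N then c j else 0) + (if j < N' then c' j else 0)"
    have "g x + h x = (\<Sum>j<N + N'. ?c j * b j x)" for x
    proof -
      have "(\<Sum>j<N. c j * b j x) = (\<Sum>j<N + N'. (if j < N then c j else 0) * b j x)"
        "(\<Sum>j<N'. c' j * b j x) = (\<Sum>j<N + N'. (if j < N' then c' j else 0) * b j x)"
        by (intro sum.mono_neutral_cong_left; auto)+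
      then show ?thesis
        by (simp add: g h distrib_right sum.distrib)
    qed
    then show ?thesis
      unfolding Sp_def by (intro CollectI exI[of _ "N + N'"] exI[of _ ?c]) auto
  qed
  have Sp_scale: "(\<lambda>x. a * g x) \<in> Sp" if g: "g \<in> Sp" for g a
  proof -
    obtain N :: nat and c where g: "g = (\<lambda>x. \<Sum>j<N. c j * b j x)"
      using g unfolding Sp_def by blast
    show ?thesis
      unfolding Sp_def g
      by (intro CollectI exI[of _ N] exI[of _ "\<lambda>j. a * c j"]) (simp add: sum_distrib_left mult.assoc)
  qed
  have "\<forall>\<epsilon>>0. \<exists>g\<in>Sp. l2_norm \<mu> (\<lambda>x. f x - g x) < \<epsilon>" if "f \<in> L2 \<mu>" for f
    using that
  proof (induction f rule: L2_induct_open)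
    case (open_set U)
    show ?case
    proof (intro allI impI)
      fix \<epsilon> :: real assume \<epsilon>: "0 < \<epsilon>"
      define C where "C = {b \<in> B'. b \<subseteq> U}"
      have "{} \<in> C" "C \<subseteq> B'"
        by (auto simp: C_def B'_def)
      then have C: "countable C" "C \<noteq> {}"
        using countable_subset[OF _ B'_cnt, of C] by auto
      define c where "c = from_nat_into C"
      have rc: "range c = C"
        using range_from_nat_into[OF C(2,1)] by (simp add: c_def)
      define V where "V N = (\<Union>n<N. c n)" for N :: nat
      have UC: "U = \<Union>C"
      proof (intro equalityI subsetI)
        fix x assume "x \<in> U"
        then obtain b where b: "b \<in> B" "x \<in> b" "b \<subseteq> U"
          using topological_basisE[OF B(2) open_set(1)] by blast
        moreover have "emeasure \<mu> b < \<infinity>"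
          using emeasure_mono[of b U \<mu>] b(3) open_set by (auto intro: le_less_trans)
        ultimately show "x \<in> \<Union>C"
          by (auto simp: C_def B'_def)
      qed (auto simp: C_def)
      have VU: "(\<Union>N. V N) = U"
        unfolding V_def UC rc[symmetric] by auto
      have VF: "V N \<in> \<F>" for N
        unfolding \<F>_def V_def using rc
        by (intro image_eqI[of _ _ "c ` {..<N}"]) (auto simp: C_def)
      have "(\<lambda>N. measure \<mu> (V N)) \<longlonglongrightarrow> measure \<mu> (\<Union>N. V N)"
        using F[OF VF] open_set VU
      proof (intro Lim_measure_incseq)
        show "incseq V"
          unfolding V_def by (intro incseq_SucI UN_mono) auto
      qed (auto simp: less_top)
      then have "\<forall>\<^sub>F N in sequentially. measure \<mu> U - \<epsilon>\<^sup>2 < measure \<mu> (V N)"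
        unfolding VU using \<epsilon> by (intro order_tendstoD(1)) auto
      then obtain N where N: "measure \<mu> U - \<epsilon>\<^sup>2 < measure \<mu> (V N)"
        by (auto simp: eventually_sequentially)
      have "(l2_norm \<mu> (\<lambda>x. indicator (V N) x - indicator U x))\<^sup>2 < \<epsilon>\<^sup>2"
        using F[OF VF] open_set VU N by (subst l2_norm_indicator_diff) auto
      then have "l2_norm \<mu> (\<lambda>x. indicator (V N) x - indicator U x) < \<epsilon>"
        by (rule power2_less_imp_less) (use \<epsilon> in simp)
      then have lt: "l2_norm \<mu> (\<lambda>x. indicator U x - indicator (V N) x) < \<epsilon>"
        by (subst l2_norm_minus_commute)
      obtain m where m: "V N = S m"
        using VF[of N] S by (metis imageE)
      have "(\<lambda>x. indicator (V N) x) \<in> Sp"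
        unfolding Sp_def
      proof (intro CollectI exI[of _ "Suc m"] exI[of _ "\<lambda>j. if j = m then 1 else 0"] conjI TrueI ext)
        show "indicator (V N) x = (\<Sum>j<Suc m. (if j = m then 1 else 0) * b j x)" for x
          by (simp add: m b_def)
      qed
      with lt show "\<exists>g\<in>Sp. l2_norm \<mu> (\<lambda>x. indicator U x - g x) < \<epsilon>"
        by blast
    qed
  next
    case (add f f')
    show ?case
    proof (intro allI impI)
      fix \<epsilon> :: real assume "0 < \<epsilon>"
      then have "0 < \<epsilon> / 2" by simp
      then obtain g g' where g: "g \<in> Sp" "g' \<in> Sp"
        "l2_norm \<mu> (\<lambda>x. f x - g x) < \<epsilon> / 2" "l2_norm \<mu> (\<lambda>x. f' x - g' x) < \<epsilon> / 2"
        using add.IH by meson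
      have "l2_norm \<mu> (\<lambda>x. (f x - g x) + (f' x - g' x)) \<le> l2_norm \<mu> (\<lambda>x. f x - g x) + l2_norm \<mu> (\<lambda>x. f' x - g' x)"
        by (intro l2_norm_triangle L2_diff add.hyps Sp_L2[OF g(1)] Sp_L2[OF g(2)])
      then have "l2_norm \<mu> (\<lambda>x. (f x + f' x) - (g x + g' x)) < \<epsilon>"
        using g by (simp add: algebra_simps)
      then show "\<exists>g\<in>Sp. l2_norm \<mu> (\<lambda>x. f x + f' x - g x) < \<epsilon>"
        using Sp_add[OF g(1,2)] by (intro bexI[of _ "\<lambda>x. g x + g' x"])
    qed
  next
    case (scale c f)
    show ?case
    proof (intro allI impI)
      fix \<epsilon> :: real assume "0 < \<epsilon>"
      \<comment> \<open>The added 1 guards against \<open>c = 0\<close>.\<close>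
      then have "0 < \<epsilon> / (cmod c + 1)"
        by (simp add: add_nonneg_pos)
      then obtain g where g: "g \<in> Sp" "l2_norm \<mu> (\<lambda>x. f x - g x) < \<epsilon> / (cmod c + 1)"
        using scale.IH by meson
      have "l2_norm \<mu> (\<lambda>x. c * f x - c * g x) = cmod c * l2_norm \<mu> (\<lambda>x. f x - g x)"
        using l2_norm_scale[of \<mu> c "\<lambda>x. f x - g x"] by (simp add: right_diff_distrib)
      also have "\<dots> \<le> (cmod c + 1) * l2_norm \<mu> (\<lambda>x. f x - g x)"
        by (intro mult_right_mono) auto
      also have "\<dots> < \<epsilon>"
        using g(2) by (simp add: pos_less_divide_eq add_nonneg_pos mult.commute)
      finally show "\<exists>g\<in>Sp. l2_norm \<mu> (\<lambda>x. c * f x - g x) < \<epsilon>"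
        using Sp_scale[OF g(1)] by (intro bexI[of _ "\<lambda>x. c * g x"])
    qed
  next
    case (lim f)
    show ?case
    proof (intro allI impI)
      fix \<epsilon> :: real assume "0 < \<epsilon>"
      then have "0 < \<epsilon> / 2" by simp
      then obtain f' where f': "f' \<in> L2 \<mu>" "\<forall>\<epsilon>>0. \<exists>g\<in>Sp. l2_norm \<mu> (\<lambda>x. f' x - g x) < \<epsilon>" "l2_norm \<mu> (\<lambda>x. f x - f' x) < \<epsilon> / 2"
        using lim.IH by meson
      then obtain g where g: "g \<in> Sp" "l2_norm \<mu> (\<lambda>x. f' x - g x) < \<epsilon> / 2"
        using \<open>0 < \<epsilon> / 2\<close> by meson
      have "l2_norm \<mu> (\<lambda>x. f x - g x) \<le> l2_norm \<mu> (\<lambda>x. f x - f' x) + l2_norm \<mu> (\<lambda>x. f' x - g x)"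
        by (intro l2_norm_triangle_diff lim.hyps f' Sp_L2 g)
      then show "\<exists>g\<in>Sp. l2_norm \<mu> (\<lambda>x. f x - g x) < \<epsilon>"
        using f' g by (intro bexI[of _ g]) auto
    qed
  qed
  then show ?thesis
    using b unfolding Sp_def by (intro exI[of _ b]) fastforce
qed

lemma ex_hilbert_basis: "\<exists>e. hilbert_basis \<mu> e"
proof -
  obtain b :: "nat \<Rightarrow> 'g \<Rightarrow> complex" where b: "\<forall>n. b n \<in> L2 \<mu>"
    "\<forall>f\<in>L2 \<mu>. \<forall>\<epsilon>>0. \<exists>N c. l2_norm \<mu> (\<lambda>x. f x - (\<Sum>j<N. c j * b j x)) < \<epsilon>"
    using ex_total_sequence by (elim exE conjE)
  obtain e where "orthonormal_or_zero \<mu> e"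
    "\<forall>f\<in>L2 \<mu>. (\<lambda>n. l2_norm \<mu> (\<lambda>x. f x - proj \<mu> e n f x)) \<longlonglongrightarrow> 0"
    using total_imp_orthonormal_expansion[of b \<mu>] b by blast
  then have "hilbert_basis \<mu> e"
    by (intro hilbert_basis.intro hilbert_basis_axioms.intro sigma_finite_haar) auto
  then show ?thesis
    by (intro exI[of _ e])
qed

text \<open>For an open set \<open>U\<close> take a compact \<open>K\<close> in it. The tube lemma
  gives a neighbourhood \<open>W\<close> of 0 with \<open>W + K\<close> inside \<open>U\<close>, so
  \<open>U\<close> and its translate by \<open>- r\<close>, for \<open>r \<in> W\<close>, both
  contain \<open>K\<close> and differ little in measure.\<close>

lemma translation_continuous:
  assumes "f \<in> L2 \<mu>" "0 < \<epsilon>"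
  shows "\<exists>W. open W \<and> 0 \<in> W \<and> (\<forall>r\<in>W. l2_norm \<mu> (\<lambda>x. f (r + x) - f x) < \<epsilon>)"
  using assms
proof (induction f arbitrary: \<epsilon> rule: L2_induct_open)
  case (open_set U)
  \<comment> \<open>The squared norm is the measure of a symmetric difference, at most twice the
    measure of \<open>U\<close> minus that of \<open>K\<close>; hence the half.\<close>
  have "0 < \<epsilon>\<^sup>2 / 2"
    using open_set by simp
  then obtain K where K: "compact K" "K \<subseteq> U" "emeasure \<mu> U < emeasure \<mu> K + ennreal (\<epsilon>\<^sup>2 / 2)"
    using inner_regular open_set by blast
  have mK: "measure \<mu> U < measure \<mu> K + \<epsilon>\<^sup>2 / 2"
    using K(3) emeasure_compact[OF K(1)] open_set
    by (simp add: emeasure_eq_ennreal_measure less_top ennreal_less_iff flip: ennreal_plus)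
  have "open {z. fst z + snd z \<in> U}"
    using open_vimage[OF open_set(1), of "\<lambda>z. fst z + snd z"] by (simp add: vimage_def continuous_intros)
  then have "\<exists>W. 0 \<in> W \<and> open W \<and> W \<times> K \<subseteq> {z. fst z + snd z \<in> U}"
    by (rule Elementary_Topology.tube_lemma[OF K(1)]) (use K(2) in auto)
  then obtain W where W: "0 \<in> W" "open W" "W \<times> K \<subseteq> {z. fst z + snd z \<in> U}"
    by (elim exE conjE)
  have "l2_norm \<mu> (\<lambda>x. indicator U (r + x) - indicator U x) < \<epsilon>" if r: "r \<in> W" for r
  proof (rule power2_less_imp_less)
    define V where "V = {x. r + x \<in> U}"
    have VK: "K \<subseteq> V"
      using W(3) r by (auto simp: V_def)
    have [measurable]: "U \<in> sets borel" "K \<in> sets borel"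
      using open_set(1) K(1) by (auto simp: borel_compact)
    have [measurable]: "V \<in> sets borel"
      unfolding V_def by measurable
    have mV: "emeasure \<mu> V = emeasure \<mu> U"
      unfolding V_def by (rule emeasure_translate) measurable
    have int: "integrable \<mu> (indicator U :: _ \<Rightarrow> real)" "integrable \<mu> (indicator V :: _ \<Rightarrow> real)" "integrable \<mu> (indicator K :: _ \<Rightarrow> real)"
      using mV open_set emeasure_compact[OF K(1)] by auto
    have "(l2_norm \<mu> (\<lambda>x. indicator U (r + x) - indicator U x))\<^sup>2
        = (\<integral>x. (cmod (indicator V x - indicator U x))\<^sup>2 \<partial>\<mu>)"
      unfolding l2_norm_square by (intro Bochner_Integration.integral_cong) (auto simp: V_def indicator_def)
    also have "\<dots> \<le> (\<integral>x. (indicator U x - indicator K x) + (indicator V x - indicator K x) \<partial>\<mu>)"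
    proof (rule integral_mono)
      show "integrable \<mu> (\<lambda>x. (cmod (indicator V x - indicator U x))\<^sup>2)"
        using open_set mV by (intro L2_integrable L2_diff indicator_L2) auto
      show "integrable \<mu> (\<lambda>x. (indicator U x - indicator K x) + (indicator V x - indicator K x) :: real)"
        using int by (intro Bochner_Integration.integrable_add Bochner_Integration.integrable_diff)
      show "(cmod (indicator V x - indicator U x))\<^sup>2 \<le> (indicator U x - indicator K x) + (indicator V x - indicator K x)" for x
        using VK K(2) by (auto simp: indicator_def)
    qed
    also have "\<dots> = (measure \<mu> U - measure \<mu> K) + (measure \<mu> V - measure \<mu> K)"
      using int by simp
    also have "\<dots> < \<epsilon>\<^sup>2"
      using mK mV by (simp add: measure_def)
    finally show "(l2_norm \<mu> (\<lambda>x. indicator U (r + x) - indicator U x))\<^sup>2 < \<epsilon>\<^sup>2" .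
  qed (use open_set in simp)
  then show ?case
    using W by blast
next
  case (add f g)
  have "0 < \<epsilon> / 2"
    using add.prems by simp
  obtain W where W: "open W" "0 \<in> W" "\<forall>r\<in>W. l2_norm \<mu> (\<lambda>x. f (r + x) - f x) < \<epsilon> / 2"
    using add.IH(1)[OF \<open>0 < \<epsilon> / 2\<close>] by blast
  obtain W' where W': "open W'" "0 \<in> W'" "\<forall>r\<in>W'. l2_norm \<mu> (\<lambda>x. g (r + x) - g x) < \<epsilon> / 2"
    using add.IH(2)[OF \<open>0 < \<epsilon> / 2\<close>] by blast
  have "l2_norm \<mu> (\<lambda>x. (f (r + x) + g (r + x)) - (f x + g x)) < \<epsilon>" if "r \<in> W \<inter> W'" for r
  proof -
    have "l2_norm \<mu> (\<lambda>x. (f (r + x) - f x) + (g (r + x) - g x))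
        \<le> l2_norm \<mu> (\<lambda>x. f (r + x) - f x) + l2_norm \<mu> (\<lambda>x. g (r + x) - g x)"
      using add.hyps by (intro l2_norm_triangle L2_diff) (simp_all add: L2_translate_iff)
    also have "\<dots> < \<epsilon>"
      using W W' that by fastforce
    finally show ?thesis
      by (simp add: algebra_simps)
  qed
  then show ?case
    using W W' by (intro exI[of _ "W \<inter> W'"]) auto
next
  case (scale c f)
  have "0 < \<epsilon> / (cmod c + 1)"
    using scale.prems by (simp add: add_nonneg_pos)
  then obtain W where W: "open W" "0 \<in> W" "\<forall>r\<in>W. l2_norm \<mu> (\<lambda>x. f (r + x) - f x) < \<epsilon> / (cmod c + 1)"
    using scale.IH by blast
  have "l2_norm \<mu> (\<lambda>x. c * f (r + x) - c * f x) < \<epsilon>" if "r \<in> W" for r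
  proof -
    have "l2_norm \<mu> (\<lambda>x. c * f (r + x) - c * f x) = cmod c * l2_norm \<mu> (\<lambda>x. f (r + x) - f x)"
      using l2_norm_scale[of \<mu> c "\<lambda>x. f (r + x) - f x"] by (simp add: right_diff_distrib)
    also have "\<dots> \<le> (cmod c + 1) * l2_norm \<mu> (\<lambda>x. f (r + x) - f x)"
      by (intro mult_right_mono) auto
    also have "\<dots> < \<epsilon>"
      using W that by (simp add: pos_less_divide_eq add_nonneg_pos mult.commute)
    finally show ?thesis .
  qed
  then show ?case
    using W by blast
next
  case (lim f)
  have "0 < \<epsilon> / 3"
    using lim.prems by simp
  then obtain g where g: "g \<in> L2 \<mu>" "\<forall>\<epsilon>>0. \<exists>W. open W \<and> 0 \<in> W \<and> (\<forall>r\<in>W. l2_norm \<mu> (\<lambda>x. g (r + x) - g x) < \<epsilon>)"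
    "l2_norm \<mu> (\<lambda>x. f x - g x) < \<epsilon> / 3"
    using lim.IH by meson
  obtain W where W: "open W" "0 \<in> W" "\<forall>r\<in>W. l2_norm \<mu> (\<lambda>x. g (r + x) - g x) < \<epsilon> / 3"
    using g(2) \<open>0 < \<epsilon> / 3\<close> by meson
  have "l2_norm \<mu> (\<lambda>x. f (r + x) - f x) < \<epsilon>" if "r \<in> W" for r
  proof -
    have L2: "(\<lambda>x. f (r + x)) \<in> L2 \<mu>" "(\<lambda>x. g (r + x)) \<in> L2 \<mu>"
      using g(1) lim.hyps by (simp_all add: L2_translate_iff)
    have "l2_norm \<mu> (\<lambda>x. f (r + x) - f x) \<le> l2_norm \<mu> (\<lambda>x. f (r + x) - g (r + x)) + l2_norm \<mu> (\<lambda>x. g (r + x) - f x)"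
      by (intro l2_norm_triangle_diff L2 lim.hyps)
    moreover have "l2_norm \<mu> (\<lambda>x. g (r + x) - f x) \<le> l2_norm \<mu> (\<lambda>x. g (r + x) - g x) + l2_norm \<mu> (\<lambda>x. g x - f x)"
      by (intro l2_norm_triangle_diff L2 lim.hyps g)
    moreover have "l2_norm \<mu> (\<lambda>x. f (r + x) - g (r + x)) = l2_norm \<mu> (\<lambda>x. f x - g x)"
      using l2_norm_translate[of "\<lambda>x. f x - g x" r] by simp
    ultimately show ?thesis
      using g(3) W that l2_norm_minus_commute[of \<mu> f g] by fastforce
  qed
  then show ?case
    using W by blast
qed

text \<open>First countability supplies the sequence; intersecting with a neighbourhood of finite
  measure and then with the reflected set gives supports for symmetric approximate
  identities.\<close>

lemma ex_symmetric_nhds: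
  "\<exists>U :: nat \<Rightarrow> 'g set. (\<forall>n. open (U n) \<and> 0 \<in> U n \<and> emeasure \<mu> (U n) < \<infinity> \<and> (\<forall>x. - x \<in> U n \<longleftrightarrow> x \<in> U n)) \<and>
    (\<forall>W. open W \<longrightarrow> 0 \<in> W \<longrightarrow> (\<forall>\<^sub>F n in sequentially. U n \<subseteq> W))"
proof -
  obtain A :: "nat \<Rightarrow> 'g set" where A: "\<And>i. open (A i)" "\<And>i. 0 \<in> A i"
    "\<And>S. open S \<Longrightarrow> 0 \<in> S \<Longrightarrow> \<forall>\<^sub>F i in sequentially. A i \<subseteq> S"
    by (rule countable_basis_at_decseq[of "0 :: 'g"]) blast
  obtain V where V: "open V" "0 \<in> V" "emeasure \<mu> V < \<infinity>"
    using ex_nhd_finite by blast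
  define U where "U n = (A n \<inter> V) \<inter> {x. - x \<in> A n \<inter> V}" for n
  show ?thesis
  proof (intro exI[of _ U] conjI allI impI)
    fix n
    have "open {x. - x \<in> A n \<inter> V}"
      using open_vimage[of "A n \<inter> V" uminus] A(1) V(1) by (simp add: vimage_def open_Int continuous_intros)
    then show op: "open (U n)"
      unfolding U_def using A V by (intro open_Int)
    show "0 \<in> U n"
      using A V by (simp add: U_def)
    have "emeasure \<mu> (U n) \<le> emeasure \<mu> V"
      using V by (intro emeasure_mono) (auto simp: U_def)
    then show "emeasure \<mu> (U n) < \<infinity>"
      using V(3) by (rule le_less_trans)
    show "- x \<in> U n \<longleftrightarrow> x \<in> U n" for x
      by (auto simp: U_def)
  next
    fix W :: "'g set" assume "open W" "0 \<in> W"
    then show "\<forall>\<^sub>F n in sequentially. U n \<subseteq> W"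
      using A(3)[of W] by (auto elim!: eventually_mono simp: U_def)
  qed
qed

end

subsection \<open>Folner sequences\<close>

text \<open>With \<open>y\<close> the root of order \<open>Suc d\<close> of
  \<open>1 / (1 + \<epsilon>)\<close>, the quotient of \<open>(n + 1) ^ Suc d\<close> by
  \<open>(1 + \<epsilon>) ^ n\<close> is a power of \<open>(n + 1) * y ^ n\<close>, which tends to
  0. The exponent is raised to \<open>Suc d\<close> so that the root is meaningful also for
  \<open>d = 0\<close>.\<close>

lemma polynomial_less_exponential:
  fixes \<epsilon> C :: real
  assumes "0 < \<epsilon>"
  shows "\<exists>n. C * (real n + 1) ^ d < (1 + \<epsilon>) ^ n"
proof -
  define y where "y = root (Suc d) (1 / (1 + \<epsilon>))"
  have y: "0 < y" "y < 1" "y ^ Suc d = 1 / (1 + \<epsilon>)"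
    using assms unfolding y_def by (auto simp: real_root_gt_0_iff intro!: real_root_pow_pos simp del: power_Suc)
  have "(\<lambda>n. of_nat n * y ^ n) \<longlonglongrightarrow> (0::real)"
    using y by (intro powser_times_n_limit_0) simp
  moreover have "(\<lambda>n. y ^ n) \<longlonglongrightarrow> 0"
    using y by (intro LIMSEQ_power_zero) simp
  ultimately have "(\<lambda>n. (real n * y ^ n + y ^ n) ^ Suc d) \<longlonglongrightarrow> (0 + 0) ^ Suc d"
    by (intro tendsto_power tendsto_add)
  then have "(\<lambda>n. \<bar>C\<bar> * (real n * y ^ n + y ^ n) ^ Suc d) \<longlonglongrightarrow> \<bar>C\<bar> * (0 + 0) ^ Suc d"
    by (intro tendsto_mult_left)
  then have "\<forall>\<^sub>F n in sequentially. \<bar>C\<bar> * (real n * y ^ n + y ^ n) ^ Suc d < 1"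
    by (intro order_tendstoD(2)) auto
  then obtain n where "\<bar>C\<bar> * (real n * y ^ n + y ^ n) ^ Suc d < 1"
    by (auto simp: eventually_sequentially)
  moreover have "(real n * y ^ n + y ^ n) ^ Suc d = (real n + 1) ^ Suc d * (1 / (1 + \<epsilon>)) ^ n"
  proof -
    have "(real n * y ^ n + y ^ n) ^ Suc d = ((real n + 1) * y ^ n) ^ Suc d"
      by (simp add: distrib_right)
    also have "\<dots> = (real n + 1) ^ Suc d * (y ^ Suc d) ^ n"
      unfolding power_mult_distrib by (simp only: power_mult[symmetric] mult.commute)
    finally show ?thesis
      by (simp only: y(3))
  qed
  ultimately have "\<bar>C\<bar> * ((real n + 1) ^ Suc d * (1 / (1 + \<epsilon>)) ^ n) < 1"
    by (simp only:)
  then have "\<bar>C\<bar> * (real n + 1) ^ Suc d / (1 + \<epsilon>) ^ n < 1"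
    by (simp add: power_one_over del: power_Suc)
  then have "\<bar>C\<bar> * (real n + 1) ^ Suc d < (1 + \<epsilon>) ^ n"
    using assms by (simp add: pos_divide_less_eq del: power_Suc)
  moreover have "C * (real n + 1) ^ d \<le> \<bar>C\<bar> * (real n + 1) ^ Suc d"
    by (intro mult_mono power_increasing) auto
  ultimately show ?thesis
    by (meson le_less_trans)
qed

context haar_abelian begin

lemma compact_borel [measurable]: "compact K \<Longrightarrow> (K :: 'g set) \<in> sets borel"
  by (rule borel_compact)

lemma measure_translate: "E \<in> sets borel \<Longrightarrow> measure \<mu> {x. s + x \<in> E} = measure \<mu> E"
  by (simp add: measure_def emeasure_translate)

lemma compact_fmeasurable: "compact K \<Longrightarrow> K \<in> fmeasurable \<mu>"
  using emeasure_compact by (intro fmeasurableI) (auto intro: borel_compact)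

text \<open>Off by one: \<open>sumset K n\<close> is the sum of \<open>n + 1\<close> copies of
  \<open>K\<close>.\<close>

primrec sumset :: "'g set \<Rightarrow> nat \<Rightarrow> 'g set" where
  "sumset K 0 = K"
| "sumset K (Suc n) = (\<lambda>(x, y). x + y) ` (sumset K n \<times> K)"

lemma compact_sumset:
  assumes "compact K"
  shows "compact (sumset K n)"
proof (induction n)
  case (Suc n)
  have "continuous_on (sumset K n \<times> K) (\<lambda>z. fst z + snd z)"
    by (intro continuous_intros)
  then show ?case
    using compact_continuous_image[OF _ compact_Times[OF Suc assms]] by (simp add: case_prod_beta')
qed (simp add: assms)

text \<open>\<open>K + K\<close> is covered by finitely many translates \<open>f + K\<close>, \<open>f \<in> F\<close>, and since the group is abelian there
  are at most \<open>(n + 1) ^ card F\<close> sums of \<open>n\<close> elements of \<open>F\<close>.\<close>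

lemma sumset_growth:
  assumes K: "compact K" and U: "open U" "0 \<in> U" "U \<subseteq> K"
  shows "\<exists>d. \<forall>n. measure \<mu> (sumset K n) \<le> (real n + 1) ^ d * measure \<mu> K"
proof -
  define V where "V s = {y. - s + y \<in> U}" for s
  have V: "open (V s)" for s
    unfolding V_def using open_vimage[OF U(1), of "\<lambda>y. - s + y"] by (simp add: vimage_def continuous_intros)
  have "sumset K 1 \<subseteq> (\<Union>s\<in>UNIV. V s)"
  proof
    fix z assume "z \<in> sumset K 1"
    have "z \<in> V z"
      using U(2) by (simp add: V_def)
    then show "z \<in> (\<Union>s\<in>UNIV. V s)"
      by blast
  qed
  then obtain F where F: "finite F" "sumset K 1 \<subseteq> (\<Union>s\<in>F. V s)"
    using compactE_image[OF compact_sumset[OF K, of 1], of UNIV V] V by (metis subset_UNIV)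
  have cover: "\<exists>f\<in>F. \<exists>k\<in>K. x + y = f + k" if "x \<in> K" "y \<in> K" for x y
  proof -
    have "x + y \<in> sumset K 1"
      using that by force
    then obtain f where "f \<in> F" "- f + (x + y) \<in> U"
      using F(2) by (auto simp: V_def)
    then show ?thesis
      using U(3) by (intro bexI[of _ f] bexI[of _ "- f + (x + y)"]) auto
  qed
  \<comment> \<open>By commutativity a sum of elements of \<open>F\<close> depends only on how often
    each occurs; \<open>c f\<close> counts the occurrences of \<open>f\<close>, and the inner sum is
    the \<open>c f\<close>-fold multiple of \<open>f\<close>.\<close>
  define p where "p c = (\<Sum>f\<in>F. \<Sum>i<c f. f)" for c :: "'g \<Rightarrow> nat"
  have step: "p (c(f := Suc (c f))) = p c + f" if "f \<in> F" for c f
  proof -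
    have "p (c(f := Suc (c f))) = (\<Sum>i<Suc (c f). f) + (\<Sum>g\<in>F - {f}. \<Sum>i<c g. g)"
      unfolding p_def using that F(1) by (subst sum.remove[of _ f]) auto
    moreover have "p c = (\<Sum>i<c f. f) + (\<Sum>g\<in>F - {f}. \<Sum>i<c g. g)"
      unfolding p_def using that F(1) by (subst sum.remove[of _ f]) auto
    ultimately show ?thesis
      by (simp add: algebra_simps)
  qed
  \<comment> \<open>\<open>K\<close> plus a further element of \<open>K\<close> is absorbed into
    some \<open>f + K\<close>, which raises the count of that \<open>f\<close> by one. Extensional
    functions make the index set finite, with \<open>(n + 1) ^ card F\<close> members.\<close>
  have sub: "sumset K n \<subseteq> (\<Union>c\<in>F \<rightarrow>\<^sub>E {..n}. {x. - p c + x \<in> K})" for n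
  proof (induction n)
    case 0
    have "p (\<lambda>f\<in>F. 0) = 0"
      by (simp add: p_def)
    then have "sumset K 0 \<subseteq> {x. - p (\<lambda>f\<in>F. 0) + x \<in> K}"
      by (simp only: sumset.simps) simp
    moreover have "(\<lambda>f\<in>F. 0 :: nat) \<in> F \<rightarrow>\<^sub>E {..0}"
      by auto
    ultimately show ?case
      by blast
  next
    case (Suc n)
    show ?case
    proof
      fix z assume "z \<in> sumset K (Suc n)"
      then obtain s k where z: "z = s + k" "s \<in> sumset K n" "k \<in> K"
        by auto
      then obtain c where c: "c \<in> F \<rightarrow>\<^sub>E {..n}" "- p c + s \<in> K"
        using Suc by blast
      obtain f k' where f: "f \<in> F" "k' \<in> K" "(- p c + s) + k = f + k'"
        using cover[OF c(2) z(3)] by blast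
      have "c(f := Suc (c f)) \<in> F \<rightarrow>\<^sub>E {..Suc n}"
        using c(1) f(1) by (auto simp: PiE_iff extensional_def le_Suc_eq) 
      moreover have "- p (c(f := Suc (c f))) + z = k'"
        using f(3) unfolding step[OF f(1)] z(1) by (simp add: algebra_simps)
      ultimately show "z \<in> (\<Union>c\<in>F \<rightarrow>\<^sub>E {..Suc n}. {x. - p c + x \<in> K})"
        using f(2) by blast
    qed
  qed
  have "measure \<mu> (sumset K n) \<le> (real n + 1) ^ card F * measure \<mu> K" for n
  proof -
    have fin: "finite (F \<rightarrow>\<^sub>E {..n})"
      using F(1) by (intro finite_PiE) auto
    have sets: "{x. s + x \<in> K} \<in> sets borel" for s
      using compact_borel[OF K] by measurable
    have fm: "{x. s + x \<in> K} \<in> fmeasurable \<mu>" for s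
      using emeasure_translate[OF compact_borel[OF K]] emeasure_compact[OF K] sets by (intro fmeasurableI) auto
    have "measure \<mu> (sumset K n) \<le> measure \<mu> (\<Union>c\<in>F \<rightarrow>\<^sub>E {..n}. {x. - p c + x \<in> K})"
      using compact_borel[OF compact_sumset[OF K]]
      by (intro measure_mono_fmeasurable fmeasurable.finite_UN sub fm fin) simp
    also have "\<dots> \<le> (\<Sum>c\<in>F \<rightarrow>\<^sub>E {..n}. measure \<mu> {x. - p c + x \<in> K})"
      by (intro measure_UNION_le fin fmeasurableD fm)
    also have "\<dots> = (real n + 1) ^ card F * measure \<mu> K"
      unfolding measure_translate[OF compact_borel[OF K]] using F(1) by (simp add: card_PiE add.commute)
    finally show ?thesis .
  qed
  then show ?thesis
    by blast
qed

text \<open>If every step enlarged the measure by a factor above \<open>1 + \<epsilon>\<close>,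
  growth would be exponential, against the polynomial bound. At a step that does not,
  \<open>sumset K n\<close> and its translate by \<open>- w\<close> both lie in the translate of
  \<open>sumset K (Suc n)\<close> by \<open>- w\<close>, and inclusion-exclusion bounds their
  intersection from below.\<close>

lemma Folner_step:
  assumes K: "compact K" and U: "open U" "0 \<in> U" "U \<subseteq> K" and \<epsilon>: "0 < \<epsilon>"
  shows "\<exists>S. compact S \<and> 0 < measure \<mu> S \<and>
    (\<forall>w\<in>K. (1 - \<epsilon>) * measure \<mu> S \<le> measure \<mu> (S \<inter> {x. w + x \<in> S}))"
proof -
  let ?S = "sumset K"
  have mono: "?S n \<subseteq> ?S (Suc n)" for n
    using U by (force intro: image_eqI[of _ _ "(_, 0)"])
  have fm: "?S n \<in> fmeasurable \<mu>" for n
    by (intro compact_fmeasurable compact_sumset K)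
  have mK: "0 < measure \<mu> K"
  proof -
    have "0 < emeasure \<mu> U"
      by (rule emeasure_open_pos[OF U(1,2)])
    also have "\<dots> \<le> emeasure \<mu> K"
      using U compact_borel[OF K] by (intro emeasure_mono) auto
    finally show ?thesis
      using emeasure_compact[OF K] by (simp add: emeasure_eq_ennreal_measure less_top)
  qed
  have "\<exists>n. measure \<mu> (?S (Suc n)) \<le> (1 + \<epsilon>) * measure \<mu> (?S n)"
  proof (rule ccontr)
    assume "\<nexists>n. measure \<mu> (?S (Suc n)) \<le> (1 + \<epsilon>) * measure \<mu> (?S n)"
    then have grow: "(1 + \<epsilon>) * measure \<mu> (?S n) \<le> measure \<mu> (?S (Suc n))" for n
      by (meson linear)
    have "(1 + \<epsilon>) ^ n * measure \<mu> K \<le> measure \<mu> (?S n)" for n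
    proof (induction n)
      case (Suc n)
      have "(1 + \<epsilon>) ^ Suc n * measure \<mu> K = (1 + \<epsilon>) * ((1 + \<epsilon>) ^ n * measure \<mu> K)"
        by simp
      also have "\<dots> \<le> (1 + \<epsilon>) * measure \<mu> (?S n)"
        using Suc \<epsilon> by (intro mult_left_mono) auto
      also note grow
      finally show ?case .
    qed simp
    moreover obtain d where "\<forall>n. measure \<mu> (?S n) \<le> (real n + 1) ^ d * measure \<mu> K"
      using sumset_growth[OF K U] by blast
    ultimately have "(1 + \<epsilon>) ^ n * measure \<mu> K \<le> (real n + 1) ^ d * measure \<mu> K" for n
      by (meson order_trans)
    then have "(1 + \<epsilon>) ^ n \<le> 1 * (real n + 1) ^ d" for n
      using mK by simp
    with polynomial_less_exponential[OF \<epsilon>, of 1 d] show False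
      by (auto simp: not_less[symmetric])
  qed
  then obtain n where n: "measure \<mu> (?S (Suc n)) \<le> (1 + \<epsilon>) * measure \<mu> (?S n)"
    by blast
  show ?thesis
  proof (intro exI[of _ "?S n"] conjI ballI)
    show "compact (?S n)"
      by (intro compact_sumset K)
    have "K \<subseteq> ?S n"
      by (induction n) (use mono in auto)
    then have "measure \<mu> K \<le> measure \<mu> (?S n)"
      using fm compact_borel[OF K] by (intro measure_mono_fmeasurable) auto
    then show "0 < measure \<mu> (?S n)"
      using mK by simp
    fix w assume w: "w \<in> K"
    let ?A = "{x. w + x \<in> ?S n}"
    have sets: "?S n \<in> sets borel" for n
      by (intro compact_borel compact_sumset K)
    have trans_fm: "{x. w + x \<in> ?S n} \<in> fmeasurable \<mu>" for n
      using fmeasurableD2[OF fm] emeasure_translate[OF sets] sets[of n] by (intro fmeasurableI) (auto simp: less_top)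
    have "?S n \<union> ?A \<subseteq> {x. w + x \<in> ?S (Suc n)}"
    proof
      fix x assume "x \<in> ?S n \<union> ?A"
      then show "x \<in> {x. w + x \<in> ?S (Suc n)}"
      proof
        assume "x \<in> ?S n"
        then have "x + w \<in> ?S (Suc n)"
          using w by force
        then show ?thesis
          by (simp only: mem_Collect_eq add.commute[of w])
      qed (use mono[of n] in blast)
    qed
    then have "measure \<mu> (?S n \<union> ?A) \<le> measure \<mu> {x. w + x \<in> ?S (Suc n)}"
      by (intro measure_mono_fmeasurable sets.Un fmeasurableD fm trans_fm)
    also have "\<dots> \<le> (1 + \<epsilon>) * measure \<mu> (?S n)"
      using n by (simp only: measure_translate[OF sets])
    finally have "measure \<mu> (?S n) + measure \<mu> ?A - measure \<mu> (?S n \<inter> ?A) \<le> (1 + \<epsilon>) * measure \<mu> (?S n)"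
      using measure_Un3[OF fm trans_fm] by simp
    then show "(1 - \<epsilon>) * measure \<mu> (?S n) \<le> measure \<mu> (?S n \<inter> ?A)"
      unfolding measure_translate[OF sets] by (simp add: distrib_right left_diff_distrib)
  qed
qed

text \<open>An exhaustion by compact sets with tolerance \<open>1 / (n + 1)\<close> makes the ratios
  converge for every \<open>w\<close>. Each \<open>C n\<close> contains the fixed neighbourhood
  \<open>U\<close> of 0 that \<open>Folner_step\<close> asks for.\<close>

lemma ex_Folner_sequence:
  "\<exists>E :: nat \<Rightarrow> 'g set. (\<forall>n. compact (E n) \<and> 0 < measure \<mu> (E n)) \<and>
    (\<forall>w. (\<lambda>n. measure \<mu> (E n \<inter> {x. w + x \<in> E n}) / measure \<mu> (E n)) \<longlonglongrightarrow> 1)"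
proof -
  obtain \<K> where K: "countable \<K>" "\<forall>K\<in>\<K>. compact K" "\<Union>\<K> = (UNIV :: 'g set)"
    using ex_countable_compact_cover by (elim exE conjE)
  have ne: "\<K> \<noteq> {}"
    using K(3) by auto
  define k where "k = from_nat_into \<K>"
  have rk: "range k = \<K>"
    using range_from_nat_into[OF ne K(1)] by (simp add: k_def)
  obtain U K0 where U: "open U" "compact K0" "0 \<in> U" "U \<subseteq> (K0 :: 'g set)"
    using ex_nhd_compact[of 0] by blast
  define C where "C n = K0 \<union> (\<Union>i<n. k i)" for n :: nat
  have C: "compact (C n)" "U \<subseteq> C n" for n
    using U K(2) rk unfolding C_def by (auto intro!: compact_Un compact_UN)
  have "\<exists>S. compact S \<and> 0 < measure \<mu> S \<and>
    (\<forall>w\<in>C n. (1 - inverse (real (Suc n))) * measure \<mu> S \<le> measure \<mu> (S \<inter> {x. w + x \<in> S}))" for n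
    using Folner_step[OF C(1) U(1,3) C(2), of "inverse (real (Suc n))" n] by simp
  then obtain E where E: "\<forall>n. compact (E n) \<and> 0 < measure \<mu> (E n) \<and>
    (\<forall>w\<in>C n. (1 - inverse (real (Suc n))) * measure \<mu> (E n) \<le> measure \<mu> (E n \<inter> {x. w + x \<in> E n}))"
    by metis
  show ?thesis
  proof (intro exI[of _ E] conjI allI)
    show "compact (E n)" "0 < measure \<mu> (E n)" for n
      using E by auto
    fix w
    let ?q = "\<lambda>n. measure \<mu> (E n \<inter> {x. w + x \<in> E n}) / measure \<mu> (E n)"
    obtain m where m: "w \<in> k m"
      using K(3) rk by (metis UNIV_I UnionE imageE)
    show "?q \<longlonglongrightarrow> 1"
    proof (rule tendsto_sandwich)
      show "\<forall>\<^sub>F n in sequentially. 1 - inverse (real (Suc n)) \<le> ?q n"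
        using eventually_gt_at_top[of m]
      proof eventually_elim
        case (elim n)
        then have "w \<in> C n"
          using m by (auto simp: C_def)
        then show ?case
          using E by (simp add: pos_le_divide_eq)
      qed
      show "\<forall>\<^sub>F n in sequentially. ?q n \<le> 1"
      proof (rule always_eventually, rule allI)
        fix n
        have "measure \<mu> (E n \<inter> {x. w + x \<in> E n}) \<le> measure \<mu> (E n)"
        proof (rule measure_mono_fmeasurable)
          have [measurable]: "E n \<in> sets borel"
            using E compact_borel by blast
          show "E n \<inter> {x. w + x \<in> E n} \<in> sets \<mu>"
            by measurable
          show "E n \<in> fmeasurable \<mu>"
            using E by (intro compact_fmeasurable) auto
        qed auto
        then show "?q n \<le> 1"
          using E by (simp add: pos_divide_le_eq)
      qed
      have "(\<lambda>n. 1 - inverse (real (Suc n))) \<longlonglongrightarrow> 1 - 0"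
        by (intro tendsto_intros LIMSEQ_inverse_real_of_nat)
      then show "(\<lambda>n. 1 - inverse (real (Suc n))) \<longlonglongrightarrow> 1"
        by simp
    qed simp
  qed
qed

end

locale haar_hilbert = haar_abelian \<mu> + hilbert_basis \<mu> e
  for \<mu> :: "'g::{topological_ab_group_add, t2_space, second_countable_topology} measure" and e
begin

text \<open>Keeps translates in the form \<open>- s + x\<close> to which the translation lemmas apply.\<close>

declare uminus_add_conv_diff [simp del]

subsection \<open>Translations, multiplications and the predual action\<close>

lemma lambda_eq: "lambda s f = (\<lambda>x. f (- s + x))"
  by (simp add: lambda_def fun_eq_iff)

text \<open>Commutativity and the trivial modular function let facts about \<open>rho\<close> be
  inherited from \<open>lambda\<close>.\<close>

lemma rho_lambda: "rho \<mu> r = lambda (- r)"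
  by (simp add: fun_eq_iff rho_eq lambda_eq)

lemma lambda_BL2: "lambda s \<in> BL2 \<mu>"
  unfolding BL2_def lambda_eq
  by (auto simp: L2_translate_iff l2_norm_translate intro!: exI[of _ 1])

lemma BL2_comp:
  assumes S: "S \<in> BL2 \<mu>" and T: "T \<in> BL2 \<mu>"
  shows "S \<circ> T \<in> BL2 \<mu>"
  unfolding BL2_def
proof (intro CollectI conjI ballI allI)
  show "(S \<circ> T) f \<in> L2 \<mu>" if "f \<in> L2 \<mu>" for f
    using BL2_L2[OF S BL2_L2[OF T that]] by simp
  show "AE x in \<mu>. (S \<circ> T) (\<lambda>y. f y + g y) x = (S \<circ> T) f x + (S \<circ> T) g x" if fg: "f \<in> L2 \<mu>" "g \<in> L2 \<mu>" for f g
  proof -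
    \<comment> \<open>\<open>T\<close> is additive only up to a null set, while \<open>S\<close> is
      applied to representatives; \<open>BL2_cong_AE\<close> bridges this.\<close>
    have "AE x in \<mu>. S (T (\<lambda>y. f y + g y)) x = S (\<lambda>y. T f y + T g y) x"
      by (intro BL2_cong_AE[OF S] BL2_add[OF T] BL2_L2[OF T] L2_add fg)
    with BL2_add[OF S BL2_L2[OF T fg(1)] BL2_L2[OF T fg(2)]] show ?thesis
      by eventually_elim simp
  qed
  show "AE x in \<mu>. (S \<circ> T) (\<lambda>y. c * f y) x = c * (S \<circ> T) f x" if f: "f \<in> L2 \<mu>" for f c
  proof -
    have "AE x in \<mu>. S (T (\<lambda>y. c * f y)) x = S (\<lambda>y. c * T f y) x"
      by (intro BL2_cong_AE[OF S] BL2_scale[OF T] BL2_L2[OF T] L2_scale f)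
    with BL2_scale[OF S BL2_L2[OF T f], of c] show ?thesis
      by eventually_elim simp
  qed
  obtain C where C: "0 \<le> C" "\<forall>f\<in>L2 \<mu>. l2_norm \<mu> (S f) \<le> C * l2_norm \<mu> f"
    using BL2_bound[OF S] by blast
  obtain D where D: "0 \<le> D" "\<forall>f\<in>L2 \<mu>. l2_norm \<mu> (T f) \<le> D * l2_norm \<mu> f"
    using BL2_bound[OF T] by blast
  have "l2_norm \<mu> ((S \<circ> T) f) \<le> (C * D) * l2_norm \<mu> f" if "f \<in> L2 \<mu>" for f
  proof -
    have "l2_norm \<mu> (S (T f)) \<le> C * l2_norm \<mu> (T f)"
      using C BL2_L2[OF T that] by blast
    also have "\<dots> \<le> C * (D * l2_norm \<mu> f)"
      using C(1) D(2) that by (intro mult_left_mono) auto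
    finally show ?thesis
      by (simp add: mult.assoc)
  qed
  then show "\<exists>C. \<forall>f\<in>L2 \<mu>. l2_norm \<mu> ((S \<circ> T) f) \<le> C * l2_norm \<mu> f"
    by blast
qed

lemma Linf_bound:
  assumes "a \<in> Linf \<mu>"
  obtains C where "0 < C" "AE x in \<mu>. cmod (a x) \<le> C"
proof -
  obtain C where "AE x in \<mu>. cmod (a x) \<le> C"
    using assms by (auto simp: Linf_def)
  then have "AE x in \<mu>. cmod (a x) \<le> max C 1"
    by eventually_elim auto
  then show thesis
    using that[of "max C 1"] by auto
qed

lemma L2_mult_Linf:
  assumes a: "a \<in> Linf \<mu>" and f: "f \<in> L2 \<mu>"
  shows "(\<lambda>x. a x * f x) \<in> L2 \<mu>"
proof -
  obtain C where C: "0 < C" "AE x in \<mu>. cmod (a x) \<le> C"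
    using Linf_bound[OF a] by blast
  show ?thesis
  proof (rule L2_dominated)
    show "(\<lambda>x. a x * f x) \<in> borel_measurable \<mu>"
      using a L2_measurable[OF f] by (auto simp: Linf_def)
    show "(\<lambda>x. complex_of_real C * f x) \<in> L2 \<mu>"
      by (intro L2_scale f)
    show "AE x in \<mu>. cmod (a x * f x) \<le> cmod (complex_of_real C * f x)"
      using C(2) by eventually_elim (use C(1) in \<open>auto simp: norm_mult intro: mult_right_mono\<close>)
  qed
qed

lemma l2_norm_mono:
  assumes "f \<in> L2 \<mu>" "g \<in> L2 \<mu>" "AE x in \<mu>. cmod (f x) \<le> cmod (g x)"
  shows "l2_norm \<mu> f \<le> l2_norm \<mu> g"
  unfolding l2_norm_def using assms
  by (intro real_sqrt_le_mono integral_mono_AE L2_integrable) (auto elim!: eventually_mono)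

lemma l2_norm_mult_Linf:
  assumes a: "a \<in> Linf \<mu>" and f: "f \<in> L2 \<mu>" and C: "0 < C" "AE x in \<mu>. cmod (a x) \<le> C"
  shows "l2_norm \<mu> (\<lambda>x. a x * f x) \<le> C * l2_norm \<mu> f"
proof -
  have "l2_norm \<mu> (\<lambda>x. a x * f x) \<le> l2_norm \<mu> (\<lambda>x. complex_of_real C * f x)"
  proof (rule l2_norm_mono)
    show "AE x in \<mu>. cmod (a x * f x) \<le> cmod (complex_of_real C * f x)"
      using C(2) by eventually_elim (use C(1) in \<open>auto simp: norm_mult intro: mult_right_mono\<close>)
  qed (intro L2_mult_Linf L2_scale a f)+
  then show ?thesis
    using C(1) by (simp add: l2_norm_scale)
qed

lemma mult_op_BL2:
  assumes a: "a \<in> Linf \<mu>"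
  shows "mult_op a \<in> BL2 \<mu>"
proof -
  obtain C where C: "0 < C" "AE x in \<mu>. cmod (a x) \<le> C"
    using Linf_bound[OF a] by blast
  show ?thesis
    unfolding BL2_def mult_op_def
    using L2_mult_Linf[OF a] l2_norm_mult_Linf[OF a _ C] by (auto simp: algebra_simps intro!: exI[of _ C])
qed

section \<open>Conjugation by translations and its predual map\<close>

lemma bil_conjugate:
  "bil \<mu> ((rho \<mu> r \<circ> T \<circ> rho \<mu> (- r)) f) g = bil \<mu> (T (\<lambda>x. f (- r + x))) (\<lambda>x. g (- r + x))"
  \<comment> \<open>Invariance of the integral moves the outer translation to \<open>g\<close>, in
    place of an adjoint.\<close>
  using bil_translate[of "T (\<lambda>x. f (- r + x))" r "\<lambda>x. g (- r + x)"] by (simp add: rho_eq)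

lemma conjugate_BL2: "T \<in> BL2 \<mu> \<Longrightarrow> rho \<mu> r \<circ> T \<circ> rho \<mu> (- r) \<in> BL2 \<mu>"
  unfolding rho_lambda by (intro BL2_comp lambda_BL2)

text \<open>A translated function times a weight in \<open>r\<close> is one leg of the integral over
  \<open>r\<close> of \<open>f (- r + x) * g (- r + y) * \<phi> r\<close>. Tonelli and invariance
  show that it is a Hilbert-Schmidt kernel.\<close>

lemma shear_kernel:
  assumes a: "a \<in> L2 \<mu>" and s: "s \<in> L2 \<mu>"
  shows "(\<lambda>(x, r). a (- r + x) * s r) \<in> L2 (\<mu> \<Otimes>\<^sub>M \<mu>)"
    and "(l2_norm (\<mu> \<Otimes>\<^sub>M \<mu>) (\<lambda>(x, r). a (- r + x) * s r))\<^sup>2 = (l2_norm \<mu> a)\<^sup>2 * (l2_norm \<mu> s)\<^sup>2"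
proof -
  have [measurable]: "a \<in> borel_measurable borel" "s \<in> borel_measurable borel"
    using a s by (auto dest!: L2_measurable simp: borel_measurable_eq)
  let ?F = "\<lambda>(x, r). a (- r + x) * s r"
  have meas: "?F \<in> borel_measurable (\<mu> \<Otimes>\<^sub>M \<mu>)"
    by measurable
  have nn: "(\<integral>\<^sup>+z. ennreal ((cmod (?F z))\<^sup>2) \<partial>(\<mu> \<Otimes>\<^sub>M \<mu>)) = ennreal ((l2_norm \<mu> a)\<^sup>2 * (l2_norm \<mu> s)\<^sup>2)"
  proof -
    have "(\<integral>\<^sup>+z. ennreal ((cmod (?F z))\<^sup>2) \<partial>(\<mu> \<Otimes>\<^sub>M \<mu>)) = (\<integral>\<^sup>+r. \<integral>\<^sup>+x. ennreal ((cmod (a (- r + x)))\<^sup>2 * (cmod (s r))\<^sup>2) \<partial>\<mu> \<partial>\<mu>)"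
      by (subst nn_integral_snd[symmetric]) (simp_all add: norm_mult power_mult_distrib)
    also have "\<dots> = (\<integral>\<^sup>+r. ennreal ((l2_norm \<mu> a)\<^sup>2) * ennreal ((cmod (s r))\<^sup>2) \<partial>\<mu>)"
    proof (rule nn_integral_cong)
      fix r
      have "(\<integral>\<^sup>+x. ennreal ((cmod (a (- r + x)))\<^sup>2 * (cmod (s r))\<^sup>2) \<partial>\<mu>)
          = (\<integral>\<^sup>+x. ennreal ((cmod (a (- r + x)))\<^sup>2) * ennreal ((cmod (s r))\<^sup>2) \<partial>\<mu>)"
        by (simp add: ennreal_mult)
      also have "\<dots> = (\<integral>\<^sup>+x. ennreal ((cmod (a (- r + x)))\<^sup>2) \<partial>\<mu>) * ennreal ((cmod (s r))\<^sup>2)"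
        by (rule nn_integral_multc) measurable
      also have "(\<integral>\<^sup>+x. ennreal ((cmod (a (- r + x)))\<^sup>2) \<partial>\<mu>) = ennreal ((l2_norm \<mu> a)\<^sup>2)"
        using nn_integral_translate[of "\<lambda>x. ennreal ((cmod (a x))\<^sup>2)" "- r"] by (simp add: l2_norm_square_nn a)
      finally show "(\<integral>\<^sup>+x. ennreal ((cmod (a (- r + x)))\<^sup>2 * (cmod (s r))\<^sup>2) \<partial>\<mu>) = ennreal ((l2_norm \<mu> a)\<^sup>2) * ennreal ((cmod (s r))\<^sup>2)" .
    qed
    also have "\<dots> = ennreal ((l2_norm \<mu> a)\<^sup>2) * (\<integral>\<^sup>+r. ennreal ((cmod (s r))\<^sup>2) \<partial>\<mu>)"
      by (rule nn_integral_cmult) measurable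
    also have "\<dots> = ennreal ((l2_norm \<mu> a)\<^sup>2 * (l2_norm \<mu> s)\<^sup>2)"
      by (simp add: l2_norm_square_nn[OF s, symmetric] ennreal_mult)
    finally show ?thesis .
  qed
  show L2: "?F \<in> L2 (\<mu> \<Otimes>\<^sub>M \<mu>)"
  proof (rule L2I[OF meas], rule integrableI_bounded)
    show "(\<lambda>z. (cmod (?F z))\<^sup>2) \<in> borel_measurable (\<mu> \<Otimes>\<^sub>M \<mu>)"
      using meas by measurable
    show "(\<integral>\<^sup>+z. ennreal (norm ((cmod (?F z))\<^sup>2)) \<partial>(\<mu> \<Otimes>\<^sub>M \<mu>)) < \<infinity>"
      using nn by simp
  qed
  show "(l2_norm (\<mu> \<Otimes>\<^sub>M \<mu>) ?F)\<^sup>2 = (l2_norm \<mu> a)\<^sup>2 * (l2_norm \<mu> s)\<^sup>2"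
    using nn l2_norm_square_nn[OF L2] by (simp add: ennreal_inj)
qed

text \<open>\<open>F j\<close> and \<open>G j\<close> are the coefficients in \<open>r\<close> of
  the two legs, so their products represent the image of \<open>f x * g y\<close> under
  \<open>theta\<close> for the density \<open>s r * t r\<close>.\<close>

lemma conjugate_kernel:
  assumes f: "f \<in> L2 \<mu>" and g: "g \<in> L2 \<mu>" and T: "T \<in> BL2 \<mu>" and s: "s \<in> L2 \<mu>" "t \<in> L2 \<mu>"
  defines "F \<equiv> \<lambda>j x. \<integral>r. f (- r + x) * s r * e j r \<partial>\<mu>"
    and "G \<equiv> \<lambda>j y. \<integral>r. g (- r + y) * t r * cnj (e j r) \<partial>\<mu>"
  shows "integrable \<mu> (\<lambda>r. bil \<mu> (T (\<lambda>x. f (- r + x))) (\<lambda>x. g (- r + x)) * (s r * t r))"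
    and "(\<lambda>j. bil \<mu> (T (F j)) (G j)) sums (\<integral>r. bil \<mu> (T (\<lambda>x. f (- r + x))) (\<lambda>x. g (- r + x)) * (s r * t r) \<partial>\<mu>)"
proof -
  have sec: "(\<lambda>x. (case (x, r) of (x, r) \<Rightarrow> a (- r + x) * u r)) \<in> L2 \<mu>" if "a \<in> L2 \<mu>" for a u r
    using L2_scale[of "\<lambda>x. a (- r + x)" \<mu> "u r"] that by (simp add: L2_translate_iff mult.commute)
  have eq: "bil \<mu> (T (\<lambda>x. f (- r + x) * s r)) (\<lambda>y. g (- r + y) * t r)
      = bil \<mu> (T (\<lambda>x. f (- r + x))) (\<lambda>x. g (- r + x)) * (s r * t r)" for r
  proof -
    have L2: "(\<lambda>x. f (- r + x)) \<in> L2 \<mu>" "(\<lambda>x. g (- r + x)) \<in> L2 \<mu>"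
      using f g by (simp_all add: L2_translate_iff)
    have "bil \<mu> (T (\<lambda>x. s r * f (- r + x))) (\<lambda>y. t r * g (- r + y))
        = bil \<mu> (\<lambda>x. s r * T (\<lambda>x. f (- r + x)) x) (\<lambda>y. t r * g (- r + y))"
      by (intro bil_cong_AE L2_measurable BL2_L2[OF T] L2_scale L2 BL2_scale[OF T] AE_I2 refl)
    then show ?thesis
      by (simp add: bil_scale_left bil_scale_right ac_simps)
  qed
  show "integrable \<mu> (\<lambda>r. bil \<mu> (T (\<lambda>x. f (- r + x))) (\<lambda>x. g (- r + x)) * (s r * t r))"
    using kernel_pairing_sums(1)[OF shear_kernel(1)[OF f s(1)] sec[OF f] shear_kernel(1)[OF g s(2)] sec[OF g] T]
    by (simp add: eq)
  show "(\<lambda>j. bil \<mu> (T (F j)) (G j)) sums (\<integral>r. bil \<mu> (T (\<lambda>x. f (- r + x))) (\<lambda>x. g (- r + x)) * (s r * t r) \<partial>\<mu>)"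
    using kernel_pairing_sums(2)[OF shear_kernel(1)[OF f s(1)] sec[OF f] shear_kernel(1)[OF g s(2)] sec[OF g] T]
    by (simp add: eq F_def G_def)
qed

text \<open>Take for \<open>s\<close> the square root of the modulus and for \<open>t\<close> the
  quotient; where \<open>\<phi> r = 0\<close>, division by zero returns 0, as it should. Both then
  have squared modulus \<open>cmod (\<phi> r)\<close>.\<close>

lemma ex_sqrt_factors:
  assumes "\<phi> \<in> L1 \<mu>"
  obtains s t where "s \<in> L2 \<mu>" "t \<in> L2 \<mu>" "\<And>r. s r * t r = \<phi> r"
proof -
  define s where "s r = complex_of_real (sqrt (cmod (\<phi> r)))" for r
  define t where "t r = \<phi> r / s r" for r
  have [measurable]: "\<phi> \<in> borel_measurable \<mu>"
    using assms by (auto simp: L1_def)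
  have int: "integrable \<mu> (\<lambda>r. cmod (\<phi> r))"
    using assms by (auto simp: L1_def)
  have t: "(cmod (t r))\<^sup>2 = cmod (\<phi> r)" for r
    by (cases "\<phi> r = 0") (auto simp: t_def s_def norm_divide power_divide power2_eq_square)
  have "s \<in> L2 \<mu>"
  proof (rule L2I)
    show "s \<in> borel_measurable \<mu>"
      unfolding s_def by measurable
  qed (simp add: s_def int)
  moreover have "t \<in> L2 \<mu>"
  proof (rule L2I)
    show "t \<in> borel_measurable \<mu>"
      unfolding t_def s_def by measurable
  qed (simp add: t int)
  moreover have "s r * t r = \<phi> r" for r
    by (auto simp: t_def s_def)
  ultimately show thesis
    by (rule that) 
qed

lemma conjugate_integrable:
  assumes "f \<in> L2 \<mu>" "g \<in> L2 \<mu>" "T \<in> BL2 \<mu>" "\<phi> \<in> L1 \<mu>"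
  shows "integrable \<mu> (\<lambda>r. bil \<mu> (T (\<lambda>x. f (- r + x))) (\<lambda>x. g (- r + x)) * \<phi> r)"
proof -
  obtain s t where "s \<in> L2 \<mu>" "t \<in> L2 \<mu>" "\<And>r. s r * t r = \<phi> r"
    using ex_sqrt_factors[OF assms(4)] by metis
  then show ?thesis
    using conjugate_kernel(1)[OF assms(1,2,3), of s t] by simp
qed

text \<open>Sum and integral are exchanged on the strength of the bound \<open>C * (l2_norm \<mu> (f
  i) * l2_norm \<mu> (g i)) * cmod (\<phi> r)\<close>, summable in \<open>i\<close> and integrable
  in \<open>r\<close>.\<close>

lemma Theta_pairing_sums:
  assumes \<phi>: "\<phi> \<in> L1 \<mu>" and r: "represents \<mu> f g h" and T: "T \<in> BL2 \<mu>"
  shows "(\<lambda>i. \<integral>r. bil \<mu> (T (\<lambda>x. f i (- r + x))) (\<lambda>x. g i (- r + x)) * \<phi> r \<partial>\<mu>) sums Theta_pairing \<mu> \<phi> T h"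
proof -
  obtain C where "0 \<le> C" "\<forall>f\<in>L2 \<mu>. l2_norm \<mu> (T f) \<le> C * l2_norm \<mu> f"
    using BL2_bound[OF T] by blast
  note C = this(1) this(2)[rule_format]
  let ?B = "\<lambda>i r. bil \<mu> (T (\<lambda>x. f i (- r + x))) (\<lambda>x. g i (- r + x))"
  have pair: "(\<lambda>i. ?B i r) sums pairing \<mu> (rho \<mu> r \<circ> T \<circ> rho \<mu> (- r)) h" for r
    using pairing_sums[OF r conjugate_BL2[OF T, of r]] unfolding bil_conjugate .
  have int: "integrable \<mu> (\<lambda>r. ?B i r * \<phi> r)" for i
    by (intro conjugate_integrable represents_L2[OF r] T \<phi>)
  have bound: "cmod (?B i r) \<le> C * (l2_norm \<mu> (f i) * l2_norm \<mu> (g i))" for i r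
    using bil_op_bound[OF T C, of "\<lambda>x. f i (- r + x)" "\<lambda>x. g i (- r + x)"] represents_L2[OF r, of i]
    by (simp add: L2_translate_iff l2_norm_translate)
  have sb: "summable (\<lambda>i. C * (l2_norm \<mu> (f i) * l2_norm \<mu> (g i)))"
    by (intro summable_mult represents_norm_summable[OF r])
  have "summable (\<lambda>i. cmod (?B i r) * cmod (\<phi> r))" for r
    by (intro summable_mult2 summable_comparison_test'[OF sb, of 0]) (simp add: bound)
  then have s1: "AE r in \<mu>. summable (\<lambda>i. norm (?B i r * \<phi> r))"
    by (simp add: norm_mult)
  have "summable (\<lambda>i. \<integral>r. norm (?B i r * \<phi> r) \<partial>\<mu>)"
  proof (rule summable_comparison_test'[where N = 0])
    show "summable (\<lambda>i. C * (l2_norm \<mu> (f i) * l2_norm \<mu> (g i)) * (\<integral>r. cmod (\<phi> r) \<partial>\<mu>))"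
      by (intro summable_mult2 sb)
    fix i
    have "(\<integral>r. norm (?B i r * \<phi> r) \<partial>\<mu>) \<le> (\<integral>r. C * (l2_norm \<mu> (f i) * l2_norm \<mu> (g i)) * cmod (\<phi> r) \<partial>\<mu>)"
      using \<phi> bound by (intro integral_mono integrable_norm int integrable_mult_right)
        (auto simp: L1_def norm_mult intro: mult_right_mono)
    then show "norm (\<integral>r. norm (?B i r * \<phi> r) \<partial>\<mu>) \<le> C * (l2_norm \<mu> (f i) * l2_norm \<mu> (g i)) * (\<integral>r. cmod (\<phi> r) \<partial>\<mu>)"
      by (simp add: abs_of_nonneg[OF Bochner_Integration.integral_nonneg])
  qed
  from sums_integral[OF int s1 this]
  have "(\<lambda>i. \<integral>r. ?B i r * \<phi> r \<partial>\<mu>) sums (\<integral>r. (\<Sum>i. ?B i r * \<phi> r) \<partial>\<mu>)" .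
  moreover have "(\<Sum>i. ?B i r * \<phi> r) = pairing \<mu> (rho \<mu> r \<circ> T \<circ> rho \<mu> (- r)) h * \<phi> r" for r
    using sums_mult2[OF pair] by (simp add: sums_iff)
  ultimately show ?thesis
    by (simp add: Theta_pairing_def)
qed

text \<open>\<open>theta\<close> is a \<open>SOME\<close>, so everything about it rests on this. The
  candidate is a double series, with \<open>i\<close> from the representation of \<open>h\<close>
  and \<open>j\<close> from the basis expansion in \<open>r\<close>; for each \<open>i\<close> its
  squared norms sum to at most those of \<open>f i\<close> and \<open>s\<close> multiplied, and
  similarly for \<open>g i\<close> and \<open>t\<close>.\<close>

lemma ex_theta:
  assumes \<phi>: "\<phi> \<in> L1 \<mu>" and h: "h \<in> TC \<mu>"
  shows "\<exists>k. k \<in> TC \<mu> \<and> (\<forall>T\<in>BL2 \<mu>. pairing \<mu> T k = Theta_pairing \<mu> \<phi> T h)"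
proof -
  obtain f g where r: "represents \<mu> f g h"
    using h by (auto simp: TC_def)
  obtain s t where st: "s \<in> L2 \<mu>" "t \<in> L2 \<mu>" "\<And>r. s r * t r = \<phi> r"
    using ex_sqrt_factors[OF \<phi>] by metis
  note L2 = represents_L2[OF r]
  define F where "F i j = (\<lambda>x. \<integral>r. f i (- r + x) * s r * e j r \<partial>\<mu>)" for i j
  define G where "G i j = (\<lambda>y. \<integral>r. g i (- r + y) * t r * cnj (e j r) \<partial>\<mu>)" for i j
  have Fk: "F i j \<in> L2 \<mu>" "(\<Sum>j<n. (l2_norm \<mu> (F i j))\<^sup>2) \<le> (l2_norm \<mu> (f i))\<^sup>2 * (l2_norm \<mu> s)\<^sup>2"
    "summable (\<lambda>j. (l2_norm \<mu> (F i j))\<^sup>2)" for i j n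
    using kernel_coefficients[OF shear_kernel(1)[OF L2(1) st(1)], of e i] Bessel_sum_bil e_L2 shear_kernel(2)[OF L2(1) st(1), of i]
    by (simp_all add: F_def)
  have Gk: "G i j \<in> L2 \<mu>" "(\<Sum>j<n. (l2_norm \<mu> (G i j))\<^sup>2) \<le> (l2_norm \<mu> (g i))\<^sup>2 * (l2_norm \<mu> t)\<^sup>2"
    "summable (\<lambda>j. (l2_norm \<mu> (G i j))\<^sup>2)" for i j n
    using kernel_coefficients[OF shear_kernel(1)[OF L2(2) st(2)], of "\<lambda>j r. cnj (e j r)" i]
      Bessel_sum_inner[unfolded l2_inner_bil] L2_cnj[OF e_L2] shear_kernel(2)[OF L2(2) st(2), of i]
    by (simp_all add: G_def)
  have sumF: "(\<Sum>j. (l2_norm \<mu> (F i j))\<^sup>2) \<le> (l2_norm \<mu> (f i))\<^sup>2 * (l2_norm \<mu> s)\<^sup>2" for i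
    by (intro suminf_le_const Fk)
  have sumG: "(\<Sum>j. (l2_norm \<mu> (G i j))\<^sup>2) \<le> (l2_norm \<mu> (g i))\<^sup>2 * (l2_norm \<mu> t)\<^sup>2" for i
    by (intro suminf_le_const Gk)
  have sF: "summable (\<lambda>i. (l2_norm \<mu> (f i))\<^sup>2 * (l2_norm \<mu> s)\<^sup>2)" and sG: "summable (\<lambda>i. (l2_norm \<mu> (g i))\<^sup>2 * (l2_norm \<mu> t)\<^sup>2)"
    using r by (auto simp: represents_def intro: summable_mult2)
  define F' where "F' m = (case prod_decode m of (i, j) \<Rightarrow> F i j)" for m
  define G' where "G' m = (case prod_decode m of (i, j) \<Rightarrow> G i j)" for m
  have rep: "represents \<mu> F' G' (\<lambda>(x, y). \<Sum>m. F' m x * G' m y)"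
  proof (rule represents_suminf)
    show "F' m \<in> L2 \<mu>" "G' m \<in> L2 \<mu>" for m
      by (auto simp: F'_def G'_def Fk Gk split: prod.split)
    have "summable (\<lambda>m. norm (case prod_decode m of (i, j) \<Rightarrow> (l2_norm \<mu> (F i j))\<^sup>2))"
    proof (rule prod_decode_sums(1))
      show "summable (\<lambda>i. \<Sum>j. norm ((l2_norm \<mu> (F i j))\<^sup>2))"
        by (rule summable_comparison_test'[OF sF, of 0]) (simp add: sumF suminf_nonneg Fk)
    qed (simp add: Fk)
    then show "summable (\<lambda>m. (l2_norm \<mu> (F' m))\<^sup>2)"
      by (simp add: F'_def case_prod_beta)
    have "summable (\<lambda>m. norm (case prod_decode m of (i, j) \<Rightarrow> (l2_norm \<mu> (G i j))\<^sup>2))"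
    proof (rule prod_decode_sums(1))
      show "summable (\<lambda>i. \<Sum>j. norm ((l2_norm \<mu> (G i j))\<^sup>2))"
        by (rule summable_comparison_test'[OF sG, of 0]) (simp add: sumG suminf_nonneg Gk)
    qed (simp add: Gk)
    then show "summable (\<lambda>m. (l2_norm \<mu> (G' m))\<^sup>2)"
      by (simp add: G'_def case_prod_beta)
  qed
  show ?thesis
  proof (intro exI conjI ballI)
    show "(\<lambda>(x, y). \<Sum>m. F' m x * G' m y) \<in> TC \<mu>"
      using rep by (auto simp: TC_def)
    fix T assume T: "T \<in> BL2 \<mu>"
    obtain C where "0 \<le> C" "\<forall>f\<in>L2 \<mu>. l2_norm \<mu> (T f) \<le> C * l2_norm \<mu> f"
      using BL2_bound[OF T] by blast
    note C = this(1) this(2)[rule_format]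
    \<comment> \<open>The product of norms is replaced by the sum of squares, whose summability over
      both indices is already known.\<close>
    have b: "cmod (bil \<mu> (T (F i j)) (G i j)) \<le> C * ((l2_norm \<mu> (F i j))\<^sup>2 + (l2_norm \<mu> (G i j))\<^sup>2)" for i j
    proof -
      have "cmod (bil \<mu> (T (F i j)) (G i j)) \<le> C * (l2_norm \<mu> (F i j) * l2_norm \<mu> (G i j))"
        by (intro bil_op_bound T C Fk Gk)
      also have "\<dots> \<le> C * ((l2_norm \<mu> (F i j))\<^sup>2 + (l2_norm \<mu> (G i j))\<^sup>2)"
      proof (rule mult_left_mono[OF _ C(1)])
        show "l2_norm \<mu> (F i j) * l2_norm \<mu> (G i j) \<le> (l2_norm \<mu> (F i j))\<^sup>2 + (l2_norm \<mu> (G i j))\<^sup>2"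
          using sum_squares_bound[of "l2_norm \<mu> (F i j)" "l2_norm \<mu> (G i j)"]
            mult_nonneg_nonneg[OF l2_norm_nonneg[of \<mu> "F i j"] l2_norm_nonneg[of \<mu> "G i j"]] by linarith
      qed
      finally show ?thesis .
    qed
    have sb: "summable (\<lambda>j. C * ((l2_norm \<mu> (F i j))\<^sup>2 + (l2_norm \<mu> (G i j))\<^sup>2))" for i
      by (intro summable_mult summable_add Fk Gk)
    have row: "summable (\<lambda>j. norm (bil \<mu> (T (F i j)) (G i j)))" for i
      by (rule summable_comparison_test'[OF sb[of i], of 0]) (simp add: b)
    have "(\<lambda>m. case prod_decode m of (i, j) \<Rightarrow> bil \<mu> (T (F i j)) (G i j)) sums (\<Sum>i. \<Sum>j. bil \<mu> (T (F i j)) (G i j))"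
    proof (rule prod_decode_sums(2)[OF row])
      show "summable (\<lambda>i. \<Sum>j. norm (bil \<mu> (T (F i j)) (G i j)))"
      proof (rule summable_comparison_test'[where N = 0])
        show "summable (\<lambda>i. C * ((l2_norm \<mu> (f i))\<^sup>2 * (l2_norm \<mu> s)\<^sup>2 + (l2_norm \<mu> (g i))\<^sup>2 * (l2_norm \<mu> t)\<^sup>2))"
          by (intro summable_mult summable_add sF sG)
        fix i
        have "(\<Sum>j. norm (bil \<mu> (T (F i j)) (G i j))) \<le> (\<Sum>j. C * ((l2_norm \<mu> (F i j))\<^sup>2 + (l2_norm \<mu> (G i j))\<^sup>2))"
          by (intro suminf_le b row sb)
        also have "\<dots> = C * ((\<Sum>j. (l2_norm \<mu> (F i j))\<^sup>2) + (\<Sum>j. (l2_norm \<mu> (G i j))\<^sup>2))"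
          using Fk(3) Gk(3) by (simp add: suminf_mult suminf_add summable_add)
        also have "\<dots> \<le> C * ((l2_norm \<mu> (f i))\<^sup>2 * (l2_norm \<mu> s)\<^sup>2 + (l2_norm \<mu> (g i))\<^sup>2 * (l2_norm \<mu> t)\<^sup>2)"
          by (intro mult_left_mono add_mono sumF sumG C)
        finally show "norm (\<Sum>j. norm (bil \<mu> (T (F i j)) (G i j)))
            \<le> C * ((l2_norm \<mu> (f i))\<^sup>2 * (l2_norm \<mu> s)\<^sup>2 + (l2_norm \<mu> (g i))\<^sup>2 * (l2_norm \<mu> t)\<^sup>2)"
          by (simp add: suminf_nonneg row)
      qed
    qed
    moreover have "(\<Sum>j. bil \<mu> (T (F i j)) (G i j)) = (\<integral>r. bil \<mu> (T (\<lambda>x. f i (- r + x))) (\<lambda>x. g i (- r + x)) * \<phi> r \<partial>\<mu>)" for i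
      using conjugate_kernel(2)[OF L2(1) L2(2) T st(1,2), of i i] by (simp add: sums_iff st(3) F_def G_def)
    moreover have "bil \<mu> (T (F' m)) (G' m) = (case prod_decode m of (i, j) \<Rightarrow> bil \<mu> (T (F i j)) (G i j))" for m
      by (simp add: F'_def G'_def split: prod.split)
    ultimately have "(\<lambda>m. bil \<mu> (T (F' m)) (G' m)) sums (\<Sum>i. \<integral>r. bil \<mu> (T (\<lambda>x. f i (- r + x))) (\<lambda>x. g i (- r + x)) * \<phi> r \<partial>\<mu>)"
      by simp
    then show "pairing \<mu> T (\<lambda>(x, y). \<Sum>m. F' m x * G' m y) = Theta_pairing \<mu> \<phi> T h"
      using pairing_sums[OF rep T] Theta_pairing_sums[OF \<phi> r T] by (simp add: sums_iff)
  qed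
qed

lemma theta_TC: "\<phi> \<in> L1 \<mu> \<Longrightarrow> h \<in> TC \<mu> \<Longrightarrow> theta \<mu> \<phi> h \<in> TC \<mu>"
  and pairing_theta: "\<phi> \<in> L1 \<mu> \<Longrightarrow> h \<in> TC \<mu> \<Longrightarrow> T \<in> BL2 \<mu> \<Longrightarrow> pairing \<mu> T (theta \<mu> \<phi> h) = Theta_pairing \<mu> \<phi> T h"
  unfolding theta_def using someI_ex[OF ex_theta] by blast+

text \<open>The defining relation of \<open>theta\<close> eliminates it together with the closed
  span, leaving a condition on \<open>Theta_pairing\<close> in terms of which both inclusions are
  proved.\<close>

lemma annihilator_Ran:
  assumes "J \<subseteq> L1 \<mu>"
  shows "tc_annihilator \<mu> (Ran \<mu> J) = {T \<in> BL2 \<mu>. \<forall>\<phi>\<in>J. \<forall>h\<in>TC \<mu>. Theta_pairing \<mu> \<phi> T h = 0}"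
proof -
  have "{theta \<mu> \<phi> h | \<phi> h. \<phi> \<in> J \<and> h \<in> TC \<mu>} \<subseteq> TC \<mu>"
    using assms theta_TC by blast
  then have "tc_annihilator \<mu> (Ran \<mu> J) = {T \<in> BL2 \<mu>. \<forall>k\<in>{theta \<mu> \<phi> h | \<phi> h. \<phi> \<in> J \<and> h \<in> TC \<mu>}. pairing \<mu> T k = 0}"
    unfolding Ran_def by (rule tc_annihilator_closure_span)
  also have "\<dots> = {T \<in> BL2 \<mu>. \<forall>\<phi>\<in>J. \<forall>h\<in>TC \<mu>. pairing \<mu> T (theta \<mu> \<phi> h) = 0}"
    by auto
  also have "\<dots> = {T \<in> BL2 \<mu>. \<forall>\<phi>\<in>J. \<forall>h\<in>TC \<mu>. Theta_pairing \<mu> \<phi> T h = 0}"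
    using assms pairing_theta by (intro Collect_cong conj_cong ball_cong refl) (auto simp: subset_iff)
  finally show ?thesis .
qed

subsection \<open>The inclusion of \<open>Bim\<close> in the annihilator\<close>

lemma pairing_cong_op:
  assumes S: "S \<in> BL2 \<mu>" and T: "T \<in> BL2 \<mu>" and eq: "\<And>f. f \<in> L2 \<mu> \<Longrightarrow> AE x in \<mu>. S f x = T f x"
    and k: "k \<in> TC \<mu>"
  shows "pairing \<mu> S k = pairing \<mu> T k"
proof -
  obtain f g where r: "represents \<mu> f g k"
    using k by (auto simp: TC_def)
  have "bil \<mu> (S (f i)) (g i) = bil \<mu> (T (f i)) (g i)" for i
    by (intro bil_cong_AE L2_measurable BL2_L2[OF S] BL2_L2[OF T] represents_L2[OF r] eq) simp
  then show ?thesis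
    by (simp add: pairing_eq[OF r S] pairing_eq[OF r T])
qed

section \<open>Annihilators of ideals and their translates\<close>

lemma Linf_bounded_version:
  assumes "a \<in> Linf \<mu>"
  obtains a' C where "a' \<in> borel_measurable borel" "\<And>x. cmod (a' x) \<le> C" "AE x in \<mu>. a x = a' x" "0 < C"
proof -
  obtain C where C: "0 < C" "AE x in \<mu>. cmod (a x) \<le> C"
    using Linf_bound[OF assms] by blast
  have [measurable]: "a \<in> borel_measurable borel"
    using assms by (simp add: Linf_def borel_measurable_eq)
  have "(\<lambda>x. if cmod (a x) \<le> C then a x else 0) \<in> borel_measurable borel"
    by measurable
  then show thesis
    using C by (intro that[of "\<lambda>x. if cmod (a x) \<le> C then a x else 0" C]) (auto elim!: eventually_mono)
qed

lemma bounded_Linf: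
  assumes "a \<in> borel_measurable borel" "\<And>x. cmod (a x) \<le> C"
  shows "a \<in> Linf \<mu>"
  using assms by (auto simp: Linf_def borel_measurable_eq intro!: exI[of _ C])

lemma L1_annihilator_cong_AE:
  assumes a: "a \<in> L1_annihilator \<mu> J" and J: "J \<subseteq> L1 \<mu>"
    and a': "a' \<in> Linf \<mu>" and ae: "AE x in \<mu>. a x = a' x"
  shows "a' \<in> L1_annihilator \<mu> J"
proof -
  have "(\<integral>x. a' x * f x \<partial>\<mu>) = (\<integral>x. a x * f x \<partial>\<mu>)" if "f \<in> J" for f
  proof (rule integral_cong_AE)
    show "(\<lambda>x. a' x * f x) \<in> borel_measurable \<mu>" "(\<lambda>x. a x * f x) \<in> borel_measurable \<mu>"
      using that J a a' by (auto simp: L1_def L1_annihilator_def Linf_def subset_iff)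
  qed (use ae in \<open>auto elim: eventually_mono\<close>)
  then show ?thesis
    using a a' by (auto simp: L1_annihilator_def)
qed

text \<open>Translation invariance of \<open>J\<close> is replaced by the weaker statement below, obtained by testing
  against convolutions with the function itself, cut off to sets of finite measure.\<close>

lemma L1_annihilator_translates:
  assumes J: "closed_ideal_L1 \<mu> J" and a: "a \<in> L1_annihilator \<mu> J"
    and am: "a \<in> borel_measurable borel" and C: "\<And>x. cmod (a x) \<le> C"
    and \<phi>: "\<phi> \<in> J"
  shows "AE s in \<mu>. (\<integral>t. a (s + t) * \<phi> t \<partial>\<mu>) = 0"
proof -
  have JL: "J \<subseteq> L1 \<mu>" and conv: "\<And>g. g \<in> L1 \<mu> \<Longrightarrow> convolution \<mu> g \<phi> \<in> J"
    using J \<phi> by (auto simp: closed_ideal_L1_def)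
  have i\<phi>: "integrable \<mu> \<phi>"
    using JL \<phi> by (auto simp: L1_def)
  note [measurable] = am
  have [measurable]: "\<phi> \<in> borel_measurable borel"
    using i\<phi> by (auto simp flip: borel_measurable_eq)
  have C0: "0 \<le> C"
    using C[of 0] norm_ge_zero order_trans by blast
  define N where "N = (\<integral>t. cmod (\<phi> t) \<partial>\<mu>)"
  define F where "F s = (\<integral>t. a t * \<phi> (- s + t) \<partial>\<mu>)" for s
  have F_eq: "F s = (\<integral>t. a (s + t) * \<phi> t \<partial>\<mu>)" for s
    using integral_translate[of "\<lambda>t. a t * \<phi> (- s + t)" s] by (simp add: F_def)
  have F_meas [measurable]: "F \<in> borel_measurable \<mu>"
    unfolding F_def by measurable
  have i\<phi>s: "integrable \<mu> (\<lambda>t. \<phi> (- s + t))" for s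
    using i\<phi> by (simp add: integrable_translate_iff)
  have ia: "integrable \<mu> (\<lambda>t. a t * \<phi> (- s + t))" for s
    using C C0 by (intro Bochner_Integration.integrable_bound[OF integrable_mult_right[OF i\<phi>s, of "complex_of_real C" s]])
      (auto simp: norm_mult intro!: mult_right_mono)
  have abs_le: "(\<integral>t. cmod (a t * \<phi> (- s + t)) \<partial>\<mu>) \<le> C * N" for s
  proof -
    have "(\<integral>t. cmod (a t * \<phi> (- s + t)) \<partial>\<mu>) \<le> (\<integral>t. C * cmod (\<phi> (- s + t)) \<partial>\<mu>)"
      using C by (intro integral_mono integrable_norm ia integrable_mult_right i\<phi>s)
        (auto simp: norm_mult intro: mult_right_mono)
    also have "\<dots> = C * N"
      using integral_translate[of "\<lambda>t. cmod (\<phi> t)" "- s"] by (simp add: N_def)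
    finally show ?thesis .
  qed
  have F_bound: "cmod (F s) \<le> C * N" for s
    unfolding F_def using integral_norm_bound abs_le by (rule order_trans)
  have zero: "AE s in \<mu>. s \<in> A \<longrightarrow> F s = 0" if A: "A \<in> sets \<mu>" "emeasure \<mu> A < \<infinity>" for A
  proof -
    note [measurable] = A(1)
    define g where "g s = cnj (F s) * indicator A s" for s
    have g_meas [measurable]: "g \<in> borel_measurable \<mu>"
      unfolding g_def by measurable
    have CN: "0 \<le> C * N"
      using C0 by (simp add: N_def)
    have ig: "integrable \<mu> g"
    proof (rule Bochner_Integration.integrable_bound)
      show "integrable \<mu> (\<lambda>s. C * N * indicator A s)"
        using A by (intro integrable_mult_right) (simp add: less_top)
      show "AE s in \<mu>. norm (g s) \<le> norm (C * N * indicator A s)"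
        using F_bound CN by (intro AE_I2) (auto simp: g_def indicator_def)
    qed measurable
    have cJ: "convolution \<mu> g \<phi> \<in> J"
      by (rule conv) (simp add: L1_def ig)
    have int2: "integrable (\<mu> \<Otimes>\<^sub>M \<mu>) (\<lambda>(s, t). g s * (a t * \<phi> (- s + t)))"
    proof (rule Fubini_integrable)
      show "(\<lambda>(s, t). g s * (a t * \<phi> (- s + t))) \<in> borel_measurable (\<mu> \<Otimes>\<^sub>M \<mu>)"
        by measurable
      show "integrable \<mu> (\<lambda>s. \<integral>t. norm (case (s, t) of (s, t) \<Rightarrow> g s * (a t * \<phi> (- s + t))) \<partial>\<mu>)"
      proof (rule Bochner_Integration.integrable_bound)
        show "integrable \<mu> (\<lambda>s. (C * N) * norm (g s))"
          by (intro integrable_mult_right integrable_norm ig)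
        show "(\<lambda>s. \<integral>t. norm (case (s, t) of (s, t) \<Rightarrow> g s * (a t * \<phi> (- s + t))) \<partial>\<mu>) \<in> borel_measurable \<mu>"
          by measurable
        show "AE s in \<mu>. norm (\<integral>t. norm (case (s, t) of (s, t) \<Rightarrow> g s * (a t * \<phi> (- s + t))) \<partial>\<mu>) \<le> norm ((C * N) * norm (g s))"
        proof (rule AE_I2)
          fix s
          have "(\<integral>t. norm (case (s, t) of (s, t) \<Rightarrow> g s * (a t * \<phi> (- s + t))) \<partial>\<mu>) = norm (g s) * (\<integral>t. cmod (a t * \<phi> (- s + t)) \<partial>\<mu>)"
            by (simp add: norm_mult)
          also have "\<dots> \<le> norm (g s) * (C * N)"
            by (intro mult_left_mono abs_le) auto
          also have "\<dots> \<le> norm ((C * N) * norm (g s))"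
            unfolding real_norm_def by (subst mult.commute) (rule abs_ge_self)
          finally show "norm (\<integral>t. norm (case (s, t) of (s, t) \<Rightarrow> g s * (a t * \<phi> (- s + t))) \<partial>\<mu>) \<le> norm ((C * N) * norm (g s))"
            by (simp only: real_norm_def abs_of_nonneg[OF Bochner_Integration.integral_nonneg[OF norm_ge_zero]])
        qed
      qed
      show "AE s in \<mu>. integrable \<mu> (\<lambda>t. case (s, t) of (s, t) \<Rightarrow> g s * (a t * \<phi> (- s + t)))"
        using ia by (intro AE_I2) simp
    qed
    \<comment> \<open>The convolution lies in \<open>J\<close>, so \<open>a\<close> annihilates it;
      exchanging the integrals leaves the integral of \<open>g s * F s\<close>, that is, of the
      squared modulus of \<open>F\<close> over \<open>A\<close>.\<close>
    have "0 = (\<integral>t. a t * convolution \<mu> g \<phi> t \<partial>\<mu>)"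
      using a cJ by (simp add: L1_annihilator_def)
    also have "\<dots> = (\<integral>t. \<integral>s. g s * (a t * \<phi> (- s + t)) \<partial>\<mu> \<partial>\<mu>)"
      by (simp add: convolution_def mult.left_commute flip: Bochner_Integration.integral_mult_right_zero)
    also have "\<dots> = (\<integral>s. \<integral>t. g s * (a t * \<phi> (- s + t)) \<partial>\<mu> \<partial>\<mu>)"
      using Fubini_integral[OF int2] by simp
    also have "\<dots> = (\<integral>s. g s * F s \<partial>\<mu>)"
      by (simp add: F_def)
    also have "\<dots> = (\<integral>s. complex_of_real ((cmod (F s))\<^sup>2 * indicator A s) \<partial>\<mu>)"
      by (intro Bochner_Integration.integral_cong) (auto simp: g_def indicator_def complex_norm_square mult.commute simp del: of_real_power)
    also have "\<dots> = complex_of_real (\<integral>s. (cmod (F s))\<^sup>2 * indicator A s \<partial>\<mu>)"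
      by (rule integral_complex_of_real)
    finally have z: "(\<integral>s. (cmod (F s))\<^sup>2 * indicator A s \<partial>\<mu>) = 0"
      by simp
    have iF: "integrable \<mu> (\<lambda>s. (cmod (F s))\<^sup>2 * indicator A s)"
    proof (rule Bochner_Integration.integrable_bound)
      show "integrable \<mu> (\<lambda>s. (C * N)\<^sup>2 * indicator A s)"
        using A by (intro integrable_mult_right) (simp add: less_top)
      show "AE s in \<mu>. norm ((cmod (F s))\<^sup>2 * indicator A s) \<le> norm ((C * N)\<^sup>2 * indicator A s)"
        using F_bound CN by (intro AE_I2) (auto simp: indicator_def intro!: power_mono)
    qed measurable
    have "AE s in \<mu>. (cmod (F s))\<^sup>2 * indicator A s = 0"
      using z by (subst (asm) integral_nonneg_eq_0_iff_AE[OF iF]) auto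
    then show ?thesis
      by eventually_elim (auto simp: indicator_def)
  qed
  obtain \<A> where A: "countable \<A>" "\<A> \<subseteq> sets \<mu>" "\<Union>\<A> = space \<mu>" "\<forall>A\<in>\<A>. emeasure \<mu> A \<noteq> \<infinity>"
    using sigma_finite_measure.sigma_finite_countable[OF sigma_finite_haar] by (elim exE conjE)
  have "AE s in \<mu>. \<forall>A\<in>\<A>. s \<in> A \<longrightarrow> F s = 0"
    unfolding AE_ball_countable[OF A(1)] using A by (intro ballI zero) (auto simp: less_top)
  then have "AE s in \<mu>. F s = 0"
    by eventually_elim (use A(3) in auto)
  then show ?thesis
    by (simp add: F_eq)
qed

lemma Theta_pairing_lambda_mult_lambda:
  assumes J: "closed_ideal_L1 \<mu> J" and a: "a \<in> L1_annihilator \<mu> J"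
    and am: "a \<in> borel_measurable borel" and C: "\<And>x. cmod (a x) \<le> C"
    and \<phi>: "\<phi> \<in> J" and h: "h \<in> TC \<mu>"
  shows "Theta_pairing \<mu> \<phi> (lambda s \<circ> mult_op a \<circ> lambda t) h = 0"
proof -
  let ?R = "lambda s \<circ> mult_op a \<circ> lambda t"
  have R: "?R \<in> BL2 \<mu>"
    by (intro BL2_comp lambda_BL2 mult_op_BL2 bounded_Linf[OF am C])
  have \<phi>1: "\<phi> \<in> L1 \<mu>"
    using J \<phi> by (auto simp: closed_ideal_L1_def)
  obtain f g where r: "represents \<mu> f g h"
    using h by (auto simp: TC_def)
  note [measurable] = am
  have "(\<integral>r. bil \<mu> (?R (\<lambda>x. f (- r + x))) (\<lambda>x. g (- r + x)) * \<phi> r \<partial>\<mu>) = 0"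
    if fg: "f \<in> L2 \<mu>" "g \<in> L2 \<mu>" for f g
  proof -
    define q where "q x = f (- t + (- s + x)) * g x" for x
    have "(\<lambda>x. f (- t + x)) \<in> L2 \<mu>"
      using fg by (simp add: L2_translate_iff)
    then have "(\<lambda>x. f (- t + (- s + x))) \<in> L2 \<mu>"
      using L2_translate_iff[of "\<lambda>x. f (- t + x)" "- s"] by simp
    then have q: "integrable \<mu> q"
      unfolding q_def by (intro L2_mult_integrable fg)
    have bil: "bil \<mu> (?R (\<lambda>x. f (- r + x))) (\<lambda>x. g (- r + x)) = (\<integral>x. a ((- s + x) + r) * q x \<partial>\<mu>)" for r
    proof -
      have "bil \<mu> (?R (\<lambda>x. f (- r + x))) (\<lambda>x. g (- r + x))
          = (\<integral>x. a (- s + x) * f (- r + (- t + (- s + x))) * g (- r + x) \<partial>\<mu>)"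
        by (simp add: bil_def lambda_eq mult_op_def)
      \<comment> \<open>The substitution of \<open>r + x\<close> for \<open>x\<close> frees
        \<open>f\<close> and \<open>g\<close> of \<open>r\<close>, since the group is abelian; only
        the argument of \<open>a\<close> remains shifted by \<open>r\<close>.\<close>
      also have "\<dots> = (\<integral>x. a (- s + (r + x)) * f (- r + (- t + (- s + (r + x)))) * g (- r + (r + x)) \<partial>\<mu>)"
        by (rule integral_translate[symmetric])
      also have "\<dots> = (\<integral>x. a ((- s + x) + r) * q x \<partial>\<mu>)"
      proof (rule Bochner_Integration.integral_cong[OF refl])
        fix x
        have "- r + (- t + (- s + (r + x))) = - t + (- s + x)" "- s + (r + x) = (- s + x) + r" "- r + (r + x) = x"
          by (simp_all add: algebra_simps)
        then show "a (- s + (r + x)) * f (- r + (- t + (- s + (r + x)))) * g (- r + (r + x)) = a ((- s + x) + r) * q x"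
          by (simp only: q_def mult.assoc)
      qed
      finally show ?thesis .
    qed
    have i\<phi>: "integrable \<mu> \<phi>"
      using \<phi>1 by (simp add: L1_def)
    note [measurable] = borel_measurable_integrable[OF i\<phi>] borel_measurable_integrable[OF q]
    have int: "integrable (\<mu> \<Otimes>\<^sub>M \<mu>) (\<lambda>(x, r). a ((- s + x) + r) * (q x * \<phi> r))"
    proof (rule Bochner_Integration.integrable_bound)
      show "integrable (\<mu> \<Otimes>\<^sub>M \<mu>) (\<lambda>z. complex_of_real C * (case z of (x, r) \<Rightarrow> q x * \<phi> r))"
        by (intro integrable_mult_right integrable_tensor q i\<phi>)
      show "AE z in \<mu> \<Otimes>\<^sub>M \<mu>. norm (case z of (x, r) \<Rightarrow> a ((- s + x) + r) * (q x * \<phi> r))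
          \<le> norm (complex_of_real C * (case z of (x, r) \<Rightarrow> q x * \<phi> r))"
        using C by (intro AE_I2) (auto simp: norm_mult intro!: mult_right_mono order_trans[OF C abs_ge_self])
    qed measurable
    have "(\<integral>r. bil \<mu> (?R (\<lambda>x. f (- r + x))) (\<lambda>x. g (- r + x)) * \<phi> r \<partial>\<mu>)
        = (\<integral>r. \<integral>x. a ((- s + x) + r) * (q x * \<phi> r) \<partial>\<mu> \<partial>\<mu>)"
      unfolding bil by (simp add: mult.assoc flip: Bochner_Integration.integral_mult_left_zero)
    also have "\<dots> = (\<integral>x. \<integral>r. a ((- s + x) + r) * (q x * \<phi> r) \<partial>\<mu> \<partial>\<mu>)"
      using Fubini_integral[OF int] by simp
    also have "\<dots> = (\<integral>x. q x * (\<integral>r. a ((- s + x) + r) * \<phi> r \<partial>\<mu>) \<partial>\<mu>)"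
      by (simp add: mult.left_commute flip: Bochner_Integration.integral_mult_right_zero)
    also have "\<dots> = (\<integral>x. 0 \<partial>\<mu>)"
    proof (rule integral_cong_AE)
      show "(\<lambda>x. q x * (\<integral>r. a ((- s + x) + r) * \<phi> r \<partial>\<mu>)) \<in> borel_measurable \<mu>"
        by measurable
      show "AE x in \<mu>. q x * (\<integral>r. a ((- s + x) + r) * \<phi> r \<partial>\<mu>) = 0"
        using AE_translate[OF L1_annihilator_translates[OF J a am C \<phi>], of "- s"] by eventually_elim simp
    qed simp
    finally show ?thesis
      by simp
  qed
  then show ?thesis
    using Theta_pairing_sums[OF \<phi>1 r R] represents_L2[OF r] by (simp add: sums_iff)
qed

section \<open>Passage from translations to the algebra they generate\<close>

lemma VN_BL2: "A \<in> VN \<mu> \<Longrightarrow> A \<in> BL2 \<mu>"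
  using weak_star_closure_BL2 by (auto simp: VN_def)

lemma lambda_VN: "lambda s \<in> VN \<mu>"
proof -
  have "lambda s \<in> oper_span (range lambda)"
    unfolding oper_span_def by (intro CollectI exI[of _ 1] exI[of _ "\<lambda>_. 1"] exI[of _ "\<lambda>_. lambda s"]) auto
  moreover have "lambda s \<in> topspace (weak_star_topology \<mu>)"
    by (simp add: weak_star_topology_def topspace_pullback_topology lambda_BL2)
  ultimately show ?thesis
    unfolding VN_def in_closure_of by blast
qed

lemma pairing_oper_span_zero:
  assumes X: "X \<subseteq> BL2 \<mu>" and k: "k \<in> TC \<mu>" and z: "\<And>R. R \<in> X \<Longrightarrow> pairing \<mu> R k = 0"
    and T: "T \<in> weak_star_topology \<mu> closure_of oper_span X"
  shows "pairing \<mu> T k = 0"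
proof (rule pairing_zero_closure[OF T k])
  fix R assume "R \<in> oper_span X"
  then obtain n :: nat and c S where R: "R = (\<lambda>f x. \<Sum>i<n. c i * S i f x)" "\<forall>i<n. S i \<in> X"
    unfolding oper_span_def by blast
  then show "pairing \<mu> R k = 0"
    using pairing_sum_ops[of n S k c] X k z by (auto simp: subset_iff)
qed

lemma pairing_VN_zero:
  assumes "A \<in> VN \<mu>" "k \<in> TC \<mu>" "\<And>s. pairing \<mu> (lambda s) k = 0"
  shows "pairing \<mu> A k = 0"
  using assms by (intro pairing_oper_span_zero[of "range lambda" k A]) (auto simp: VN_def lambda_BL2)

text \<open>Right multiplication by \<open>S\<close> is weak-* continuous: its predual map applies
  \<open>S\<close> to the first leg \<open>f i\<close>.\<close>

lemma ex_pairing_comp_right: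
  assumes S: "S \<in> BL2 \<mu>" and k: "k \<in> TC \<mu>"
  obtains k' where "k' \<in> TC \<mu>" "\<And>A. A \<in> BL2 \<mu> \<Longrightarrow> pairing \<mu> (A \<circ> S) k = pairing \<mu> A k'"
proof -
  obtain f g where r: "represents \<mu> f g k"
    using k by (auto simp: TC_def)
  obtain C where C: "0 \<le> C" "\<forall>f\<in>L2 \<mu>. l2_norm \<mu> (S f) \<le> C * l2_norm \<mu> f"
    using BL2_bound[OF S] by blast
  have r': "represents \<mu> (\<lambda>i. S (f i)) g (\<lambda>(x, y). \<Sum>i. S (f i) x * g i y)"
  proof (rule represents_suminf)
    have "summable (\<lambda>i. C\<^sup>2 * (l2_norm \<mu> (f i))\<^sup>2)"
      using r by (intro summable_mult) (simp add: represents_def)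
    then show "summable (\<lambda>i. (l2_norm \<mu> (S (f i)))\<^sup>2)"
    proof (rule summable_comparison_test'[where N = 0])
      show "norm ((l2_norm \<mu> (S (f i)))\<^sup>2) \<le> C\<^sup>2 * (l2_norm \<mu> (f i))\<^sup>2" for i
        using power_mono[OF C(2)[rule_format, OF represents_L2(1)[OF r, of i]], of 2] by (simp add: power_mult_distrib)
    qed
  qed (use r in \<open>auto simp: represents_def intro: BL2_L2[OF S]\<close>)
  show thesis
  proof (rule that[of "\<lambda>(x, y). \<Sum>i. S (f i) x * g i y"])
    show "(\<lambda>(x, y). \<Sum>i. S (f i) x * g i y) \<in> TC \<mu>"
      using r' by (auto simp: TC_def)
    show "pairing \<mu> (A \<circ> S) k = pairing \<mu> A (\<lambda>(x, y). \<Sum>i. S (f i) x * g i y)" if A: "A \<in> BL2 \<mu>" for A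
      by (simp add: pairing_eq[OF r BL2_comp[OF A S]] pairing_eq[OF r' A])
  qed
qed

text \<open>Left multiplication acts on the second leg by the transpose. For \<open>lambda s\<close>
  and \<open>mult_op a\<close> this is explicit, a translation followed by multiplication by
  \<open>a\<close>, so the transpose of a general operator is never formed.\<close>

lemma ex_pairing_comp_left:
  assumes a: "a \<in> Linf \<mu>" and k: "k \<in> TC \<mu>"
  obtains k' where "k' \<in> TC \<mu>" "\<And>B. B \<in> BL2 \<mu> \<Longrightarrow> pairing \<mu> (lambda s \<circ> mult_op a \<circ> B) k = pairing \<mu> B k'"
proof -
  obtain f g where r: "represents \<mu> f g k"
    using k by (auto simp: TC_def)
  obtain C where C: "0 < C" "AE x in \<mu>. cmod (a x) \<le> C"
    using Linf_bound[OF a] by blast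
  define g' where "g' i = (\<lambda>x. a x * g i (s + x))" for i
  have g_s: "(\<lambda>x. g i (s + x)) \<in> L2 \<mu>" for i
    using represents_L2[OF r] by (simp add: L2_translate_iff)
  have r': "represents \<mu> f g' (\<lambda>(x, y). \<Sum>i. f i x * g' i y)"
  proof (rule represents_suminf)
    show "g' i \<in> L2 \<mu>" for i
      unfolding g'_def by (intro L2_mult_Linf a g_s)
    have "summable (\<lambda>i. C\<^sup>2 * (l2_norm \<mu> (g i))\<^sup>2)"
      using r by (intro summable_mult) (simp add: represents_def)
    then show "summable (\<lambda>i. (l2_norm \<mu> (g' i))\<^sup>2)"
    proof (rule summable_comparison_test'[where N = 0])
      show "norm ((l2_norm \<mu> (g' i))\<^sup>2) \<le> C\<^sup>2 * (l2_norm \<mu> (g i))\<^sup>2" for i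
        using power_mono[OF l2_norm_mult_Linf[OF a g_s[of i] C], of 2] by (simp add: g'_def power_mult_distrib l2_norm_translate)
    qed
  qed (use r in \<open>auto simp: represents_def\<close>)
  show thesis
  proof (rule that[of "\<lambda>(x, y). \<Sum>i. f i x * g' i y"])
    show "(\<lambda>(x, y). \<Sum>i. f i x * g' i y) \<in> TC \<mu>"
      using r' by (auto simp: TC_def)
    show "pairing \<mu> (lambda s \<circ> mult_op a \<circ> B) k = pairing \<mu> B (\<lambda>(x, y). \<Sum>i. f i x * g' i y)" if B: "B \<in> BL2 \<mu>" for B
    proof -
      have "bil \<mu> ((lambda s \<circ> mult_op a \<circ> B) (f i)) (g i) = bil \<mu> (B (f i)) (g' i)" for i
        using integral_translate[of "\<lambda>x. a (- s + x) * B (f i) (- s + x) * g i x" s]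
        by (simp add: bil_def lambda_eq mult_op_def g'_def ac_simps)
      moreover have "lambda s \<circ> mult_op a \<circ> B \<in> BL2 \<mu>"
        by (intro BL2_comp lambda_BL2 mult_op_BL2 a B)
      ultimately show ?thesis
        by (simp add: pairing_eq[OF r] pairing_eq[OF r' B])
    qed
  qed
qed

text \<open>Separate weak-* continuity is enough. The factor \<open>B\<close> is extended from
  translations with \<open>lambda s\<close> on the left; then \<open>A\<close> is extended with
  \<open>mult_op a \<circ> B\<close> fixed on the right.\<close>

lemma pairing_VN_mult_VN_zero:
  assumes a: "a \<in> Linf \<mu>" and k: "k \<in> TC \<mu>"
    and z: "\<And>s t. pairing \<mu> (lambda s \<circ> mult_op a \<circ> lambda t) k = 0"
    and A: "A \<in> VN \<mu>" and B: "B \<in> VN \<mu>"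
  shows "pairing \<mu> (A \<circ> mult_op a \<circ> B) k = 0"
proof -
  have 1: "pairing \<mu> (lambda s \<circ> mult_op a \<circ> B) k = 0" for s
  proof -
    obtain k' where k': "k' \<in> TC \<mu>" "\<And>B. B \<in> BL2 \<mu> \<Longrightarrow> pairing \<mu> (lambda s \<circ> mult_op a \<circ> B) k = pairing \<mu> B k'"
      using ex_pairing_comp_left[OF a k, of s] by blast
    have "pairing \<mu> (lambda t) k' = 0" for t
      using k'(2)[OF lambda_BL2] z by simp
    then show ?thesis
      using pairing_VN_zero[OF B k'(1)] k'(2)[OF VN_BL2[OF B]] by simp
  qed
  have S: "mult_op a \<circ> B \<in> BL2 \<mu>"
    by (intro BL2_comp mult_op_BL2 a VN_BL2 B)
  obtain k' where k': "k' \<in> TC \<mu>" "\<And>A. A \<in> BL2 \<mu> \<Longrightarrow> pairing \<mu> (A \<circ> (mult_op a \<circ> B)) k = pairing \<mu> A k'"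
    using ex_pairing_comp_right[OF S k] by blast
  have "pairing \<mu> (lambda s) k' = 0" for s
    using k'(2)[OF lambda_BL2] 1 by (simp add: comp_assoc)
  then show ?thesis
    using pairing_VN_zero[OF A k'(1)] k'(2)[OF VN_BL2[OF A]] by (simp add: comp_assoc)
qed

text \<open>Having pairing 0 with \<open>theta \<mu> \<phi> h\<close> survives weak-* closed spans
  and the passage to factors from \<open>VN \<mu>\<close>, so only the operators
  \<open>lambda s \<circ> mult_op a \<circ> lambda t\<close> have to be examined.\<close>

lemma Bim_subset_annihilator:
  assumes J: "closed_ideal_L1 \<mu> J"
  shows "Bim \<mu> (L1_annihilator \<mu> J) \<subseteq> tc_annihilator \<mu> (Ran \<mu> J)"
proof
  have JL: "J \<subseteq> L1 \<mu>"
    using J by (simp add: closed_ideal_L1_def)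
  let ?X = "{A \<circ> mult_op a \<circ> B | A a B. A \<in> VN \<mu> \<and> a \<in> L1_annihilator \<mu> J \<and> B \<in> VN \<mu>}"
  have X: "?X \<subseteq> BL2 \<mu>"
    by (auto simp: L1_annihilator_def intro!: BL2_comp[OF BL2_comp[OF VN_BL2 mult_op_BL2] VN_BL2])
  fix T assume T: "T \<in> Bim \<mu> (L1_annihilator \<mu> J)"
  then have T': "T \<in> weak_star_topology \<mu> closure_of oper_span ?X"
    by (simp add: Bim_def)
  have TB: "T \<in> BL2 \<mu>"
    using T' weak_star_closure_BL2 by blast
  have "Theta_pairing \<mu> \<phi> T h = 0" if \<phi>: "\<phi> \<in> J" and h: "h \<in> TC \<mu>" for \<phi> h
  proof -
    have \<phi>1: "\<phi> \<in> L1 \<mu>"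
      using \<phi> JL by blast
    have k: "theta \<mu> \<phi> h \<in> TC \<mu>"
      by (rule theta_TC[OF \<phi>1 h])
    have "pairing \<mu> T (theta \<mu> \<phi> h) = 0"
    proof (rule pairing_oper_span_zero[OF X k _ T'])
      fix R assume "R \<in> ?X"
      then obtain A a B where R: "R = A \<circ> mult_op a \<circ> B" "A \<in> VN \<mu>" "a \<in> L1_annihilator \<mu> J" "B \<in> VN \<mu>"
        by blast
      have a: "a \<in> Linf \<mu>"
        using R(3) by (simp add: L1_annihilator_def)
      \<comment> \<open>The generators use essentially bounded functions; a bounded Borel
        representative allows estimates at every point and defines the same operator up to null
        sets.\<close>
      obtain a' C where a': "a' \<in> borel_measurable borel" "\<And>x. cmod (a' x) \<le> C" "AE x in \<mu>. a x = a' x"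
        using Linf_bounded_version[OF a] by metis
      have a'L: "a' \<in> Linf \<mu>"
        by (rule bounded_Linf[OF a'(1,2)])
      have a'J: "a' \<in> L1_annihilator \<mu> J"
        by (rule L1_annihilator_cong_AE[OF R(3) JL a'L a'(3)])
      have "pairing \<mu> (A \<circ> mult_op a' \<circ> B) (theta \<mu> \<phi> h) = 0"
      proof (rule pairing_VN_mult_VN_zero[OF a'L k _ R(2,4)])
        have "lambda s \<circ> mult_op a' \<circ> lambda t \<in> BL2 \<mu>" for s t
          by (intro BL2_comp lambda_BL2 mult_op_BL2 a'L)
        then show "pairing \<mu> (lambda s \<circ> mult_op a' \<circ> lambda t) (theta \<mu> \<phi> h) = 0" for s t
          using Theta_pairing_lambda_mult_lambda[OF J a'J a'(1,2) \<phi> h] pairing_theta[OF \<phi>1 h] by simp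
      qed
      moreover have "pairing \<mu> (A \<circ> mult_op a \<circ> B) (theta \<mu> \<phi> h) = pairing \<mu> (A \<circ> mult_op a' \<circ> B) (theta \<mu> \<phi> h)"
      proof (rule pairing_cong_op[OF _ _ _ k])
        show "A \<circ> mult_op a \<circ> B \<in> BL2 \<mu>" "A \<circ> mult_op a' \<circ> B \<in> BL2 \<mu>"
          by (intro BL2_comp VN_BL2 mult_op_BL2 a a'L R)+
        show "AE x in \<mu>. (A \<circ> mult_op a \<circ> B) f x = (A \<circ> mult_op a' \<circ> B) f x" if f: "f \<in> L2 \<mu>" for f
          unfolding comp_def
        proof (rule BL2_cong_AE[OF VN_BL2[OF R(2)]])
          show "mult_op a (B f) \<in> L2 \<mu>" "mult_op a' (B f) \<in> L2 \<mu>"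
            using BL2_L2[OF mult_op_BL2[OF a] BL2_L2[OF VN_BL2[OF R(4)] f]]
              BL2_L2[OF mult_op_BL2[OF a'L] BL2_L2[OF VN_BL2[OF R(4)] f]] by auto
        qed (use a'(3) in \<open>auto simp: mult_op_def elim: eventually_mono\<close>)
      qed
      ultimately show "pairing \<mu> R (theta \<mu> \<phi> h) = 0"
        by (simp add: R(1))
    qed
    then show ?thesis
      using pairing_theta[OF \<phi>1 h TB] by simp
  qed
  then show "T \<in> tc_annihilator \<mu> (Ran \<mu> J)"
    unfolding annihilator_Ran[OF JL] using TB by blast
qed

end

subsection \<open>Smoothing by approximate identities\<close>

locale haar_bump = haar_hilbert \<mu> e
  for \<mu> :: "'g::{topological_ab_group_add, t2_space, second_countable_topology} measure" and e +
  fixes U :: "'g set"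
  assumes U_open: "open U" and U_0: "0 \<in> U" and U_fin: "emeasure \<mu> U < \<infinity>" and U_sym: "- x \<in> U \<longleftrightarrow> x \<in> U"
begin

definition dens :: "'g \<Rightarrow> real" where
  "dens z = indicator U z / measure \<mu> U"

definition bump :: "'g \<Rightarrow> 'g \<Rightarrow> complex" where
  "bump x z = complex_of_real (dens (- x + z))"

text \<open>Convolution with the probability density \<open>dens\<close>, written as a superposition
  of the vectors \<open>bump x\<close> with weights \<open>f x\<close>; in this form an operator can
  be moved under the integral.\<close>

definition smooth :: "('g \<Rightarrow> complex) \<Rightarrow> 'g \<Rightarrow> complex" where
  "smooth f z = (\<integral>x. f x * bump x z \<partial>\<mu>)"

lemma U_sets [measurable]: "U \<in> sets borel"
  using U_open by simp

lemma dens_measurable [measurable]: "dens \<in> borel_measurable borel"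
  unfolding dens_def by measurable

lemma dens_nonneg: "0 \<le> dens z"
  by (simp add: dens_def)

lemma dens_sym: "dens (- x + z) = dens (- z + x)"
proof -
  have "- z + x = - (- x + z)"
    by (simp add: algebra_simps)
  then have "- z + x \<in> U \<longleftrightarrow> - x + z \<in> U"
    using U_sym[of "- x + z"] by (simp only:)
  then show ?thesis
    by (simp add: dens_def indicator_def)
qed

lemma measure_U_pos: "0 < measure \<mu> U"
  using emeasure_open_pos[OF U_open U_0] U_fin by (simp add: emeasure_eq_ennreal_measure less_top)

lemma nn_integral_dens: "(\<integral>\<^sup>+z. ennreal (dens z) \<partial>\<mu>) = 1"
proof -
  have "(\<integral>\<^sup>+z. ennreal (dens z) \<partial>\<mu>) = (\<integral>\<^sup>+z. ennreal (1 / measure \<mu> U) * indicator U z \<partial>\<mu>)"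
    by (intro nn_integral_cong) (auto simp: dens_def indicator_def)
  also have "\<dots> = ennreal (1 / measure \<mu> U) * emeasure \<mu> U"
    by (intro nn_integral_cmult_indicator) simp
  also have "\<dots> = 1"
    using measure_U_pos U_fin by (simp add: emeasure_eq_ennreal_measure less_top flip: ennreal_mult)
  finally show ?thesis .
qed

lemma nn_integral_dens_translate: "(\<integral>\<^sup>+z. ennreal (dens (- x + z)) \<partial>\<mu>) = 1"
  using nn_integral_translate[of "\<lambda>z. ennreal (dens z)" "- x"] by (simp add: nn_integral_dens)

lemma integral_dens_translate: "(\<integral>x. dens (- z + x) \<partial>\<mu>) = 1" "integrable \<mu> (\<lambda>x. dens (- z + x))"
proof -
  show int: "integrable \<mu> (\<lambda>x. dens (- z + x))"
    using nn_integral_dens_translate[of z] by (intro integrableI_bounded) (auto simp: dens_nonneg)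
  show "(\<integral>x. dens (- z + x) \<partial>\<mu>) = 1"
    using nn_integral_dens_translate[of z] nn_integral_eq_integral[OF int] dens_nonneg by simp
qed

lemma bump_sym: "bump x z = bump z x"
  by (simp add: bump_def dens_sym[of x z])

lemma bump_measurable' [measurable (raw)]:
  "f \<in> borel_measurable M \<Longrightarrow> g \<in> borel_measurable M \<Longrightarrow> (\<lambda>w. bump (f w) (g w)) \<in> borel_measurable M"
  unfolding bump_def by measurable

lemma bump_L2: "bump x \<in> L2 \<mu>"
proof (rule L2I)
  show "bump x \<in> borel_measurable \<mu>"
    by measurable
  have "(cmod (bump x z))\<^sup>2 = dens (- x + z) / measure \<mu> U" for z
    unfolding bump_def norm_of_real power2_abs by (simp add: dens_def indicator_def power2_eq_square)
  then show "integrable \<mu> (\<lambda>z. (cmod (bump x z))\<^sup>2)"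
    using integral_dens_translate(2)[of x] by simp
qed

lemma bump_eq_translate: "bump x = (\<lambda>z. bump 0 (- x + z))"
  by (simp add: bump_def fun_eq_iff)

definition bump_norm :: real where
  "bump_norm = l2_norm \<mu> (bump 0)"

lemma l2_norm_bump: "l2_norm \<mu> (bump x) = bump_norm"
  using l2_norm_translate[of "bump 0" "- x"] bump_eq_translate[of x] by (simp add: bump_norm_def)

lemma bump_norm_nonneg: "0 \<le> bump_norm"
  by (simp add: bump_norm_def)

lemma smooth_eq_bil: "smooth f z = bil \<mu> f (bump z)"
  by (simp add: smooth_def bil_def bump_sym[of _ z])

text \<open>Jensen's inequality for the probability density \<open>dens (- z + x)\<close>, obtained
  from Cauchy-Schwarz by splitting the density into square roots. When the right-hand side is
  infinite there is nothing to show.\<close>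

lemma bil_bump_square:
  assumes [measurable]: "h \<in> borel_measurable borel"
  shows "ennreal ((cmod (\<integral>x. h x * bump z x \<partial>\<mu>))\<^sup>2) \<le> (\<integral>\<^sup>+x. ennreal ((cmod (h x))\<^sup>2 * dens (- z + x)) \<partial>\<mu>)"
proof (cases "(\<integral>\<^sup>+x. ennreal ((cmod (h x))\<^sup>2 * dens (- z + x)) \<partial>\<mu>) < \<infinity>")
  case True
  define w where "w x = complex_of_real (sqrt (dens (- z + x)))" for x
  have [measurable]: "w \<in> borel_measurable borel"
    unfolding w_def by measurable
  have w2: "(cmod (w x))\<^sup>2 = dens (- z + x)" "w x * w x = bump z x" for x
    using dens_nonneg[of "- z + x"] by (simp_all add: w_def bump_def flip: of_real_mult)
  have hw: "(\<lambda>x. h x * w x) \<in> L2 \<mu>"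
  proof (rule L2I, simp add: borel_measurable_eq, rule integrableI_bounded)
    show "(\<lambda>x. (cmod (h x * w x))\<^sup>2) \<in> borel_measurable \<mu>"
      by measurable
    show "(\<integral>\<^sup>+x. ennreal (norm ((cmod (h x * w x))\<^sup>2)) \<partial>\<mu>) < \<infinity>"
      using True by (simp add: norm_mult power_mult_distrib w2 abs_mult dens_nonneg)
  qed
  have w: "w \<in> L2 \<mu>"
    using integral_dens_translate(2)[of z] by (intro L2I) (simp_all add: borel_measurable_eq w2)
  have nw: "l2_norm \<mu> w = 1"
    by (simp add: l2_norm_def w2 integral_dens_translate)
  have "(\<integral>x. h x * bump z x \<partial>\<mu>) = bil \<mu> (\<lambda>x. h x * w x) w"
    by (simp add: bil_def mult.assoc w2)
  then have "cmod (\<integral>x. h x * bump z x \<partial>\<mu>) \<le> l2_norm \<mu> (\<lambda>x. h x * w x)"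
    using bil_bound[OF hw w] nw by simp
  then have "ennreal ((cmod (\<integral>x. h x * bump z x \<partial>\<mu>))\<^sup>2) \<le> ennreal ((l2_norm \<mu> (\<lambda>x. h x * w x))\<^sup>2)"
    by (intro ennreal_leI power_mono) auto
  also have "\<dots> = (\<integral>\<^sup>+x. ennreal ((cmod (h x))\<^sup>2 * dens (- z + x)) \<partial>\<mu>)"
    by (simp add: l2_norm_square_nn[OF hw] norm_mult power_mult_distrib w2)
  finally show ?thesis .
qed (simp add: less_top[symmetric])

text \<open>Jensen pointwise, then Tonelli: the density integrates to 1 in either variable, by
  symmetry of \<open>U\<close>.\<close>

lemma smooth_L2:
  assumes f: "f \<in> L2 \<mu>"
  shows "smooth f \<in> L2 \<mu>" and "l2_norm \<mu> (smooth f) \<le> l2_norm \<mu> f"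
proof -
  have [measurable]: "f \<in> borel_measurable borel"
    using L2_measurable[OF f] by (simp add: borel_measurable_eq)
  have meas [measurable]: "smooth f \<in> borel_measurable \<mu>"
    unfolding smooth_def[abs_def] by measurable
  have "(\<integral>\<^sup>+z. ennreal ((cmod (smooth f z))\<^sup>2) \<partial>\<mu>) \<le> (\<integral>\<^sup>+z. \<integral>\<^sup>+x. ennreal ((cmod (f x))\<^sup>2 * dens (- z + x)) \<partial>\<mu> \<partial>\<mu>)"
    unfolding smooth_eq_bil bil_def by (intro nn_integral_mono bil_bump_square) measurable
  also have "\<dots> = (\<integral>\<^sup>+x. \<integral>\<^sup>+z. ennreal ((cmod (f x))\<^sup>2 * dens (- z + x)) \<partial>\<mu> \<partial>\<mu>)"
    by (rule Fubini') measurable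
  also have "\<dots> = (\<integral>\<^sup>+x. ennreal ((cmod (f x))\<^sup>2) \<partial>\<mu>)"
  proof (rule nn_integral_cong)
    fix x
    have "(\<integral>\<^sup>+z. ennreal ((cmod (f x))\<^sup>2 * dens (- z + x)) \<partial>\<mu>) = (\<integral>\<^sup>+z. ennreal ((cmod (f x))\<^sup>2) * ennreal (dens (- x + z)) \<partial>\<mu>)"
      by (simp add: ennreal_mult dens_nonneg dens_sym[of _ x])
    also have "\<dots> = ennreal ((cmod (f x))\<^sup>2)"
      by (subst nn_integral_cmult) (simp_all add: nn_integral_dens_translate)
    finally show "(\<integral>\<^sup>+z. ennreal ((cmod (f x))\<^sup>2 * dens (- z + x)) \<partial>\<mu>) = ennreal ((cmod (f x))\<^sup>2)" .
  qed
  finally have le: "(\<integral>\<^sup>+z. ennreal ((cmod (smooth f z))\<^sup>2) \<partial>\<mu>) \<le> ennreal ((l2_norm \<mu> f)\<^sup>2)"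
    by (simp add: l2_norm_square_nn f)
  show L2: "smooth f \<in> L2 \<mu>"
  proof (rule L2I[OF meas], rule integrableI_bounded)
    show "(\<lambda>z. (cmod (smooth f z))\<^sup>2) \<in> borel_measurable \<mu>"
      by measurable
    show "(\<integral>\<^sup>+z. ennreal (norm ((cmod (smooth f z))\<^sup>2)) \<partial>\<mu>) < \<infinity>"
      using le by (auto intro: le_less_trans)
  qed
  have "(l2_norm \<mu> (smooth f))\<^sup>2 \<le> (l2_norm \<mu> f)\<^sup>2"
    using le by (simp add: l2_norm_square_nn[OF L2, symmetric])
  then show "l2_norm \<mu> (smooth f) \<le> l2_norm \<mu> f"
    by (rule power2_le_imp_le) simp
qed

text \<open>\<open>smooth f z - f z\<close> is an average of \<open>f x - f z\<close> over
  \<open>x\<close> near \<open>z\<close>. After Jensen and the substitution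
  \<open>x = z + r\<close>, Tonelli puts the integral over \<open>r\<close> outside, where each
  \<open>r \<in> U\<close> contributes at most the square of \<open>\<delta>\<close>.\<close>

lemma smooth_diff_bound:
  assumes f: "f \<in> L2 \<mu>" and \<delta>: "0 \<le> \<delta>" "\<And>r. r \<in> U \<Longrightarrow> l2_norm \<mu> (\<lambda>x. f (r + x) - f x) \<le> \<delta>"
  shows "l2_norm \<mu> (\<lambda>x. smooth f x - f x) \<le> \<delta>"
proof -
  have [measurable]: "f \<in> borel_measurable borel"
    using L2_measurable[OF f] by (simp add: borel_measurable_eq)
  have L2: "(\<lambda>x. smooth f x - f x) \<in> L2 \<mu>"
    by (intro L2_diff smooth_L2 f)
  have eq: "smooth f z - f z = (\<integral>x. (f x - f z) * bump z x \<partial>\<mu>)" for z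
  proof -
    have "(\<integral>x. bump z x \<partial>\<mu>) = 1" "integrable \<mu> (bump z)"
      unfolding bump_def[abs_def] using integral_dens_translate[of z]
      by (simp_all add: integral_complex_of_real integrable_of_real)
    then show ?thesis
      by (simp add: smooth_eq_bil bil_def left_diff_distrib L2_mult_integrable[OF f bump_L2])
  qed
  have "(\<integral>\<^sup>+z. ennreal ((cmod (smooth f z - f z))\<^sup>2) \<partial>\<mu>) \<le> (\<integral>\<^sup>+z. \<integral>\<^sup>+x. ennreal ((cmod (f x - f z))\<^sup>2 * dens (- z + x)) \<partial>\<mu> \<partial>\<mu>)"
    unfolding eq by (intro nn_integral_mono bil_bump_square) measurable
  also have "\<dots> = (\<integral>\<^sup>+z. \<integral>\<^sup>+r. ennreal ((cmod (f (r + z) - f z))\<^sup>2 * dens r) \<partial>\<mu> \<partial>\<mu>)"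
  proof (rule nn_integral_cong)
    fix z
    show "(\<integral>\<^sup>+x. ennreal ((cmod (f x - f z))\<^sup>2 * dens (- z + x)) \<partial>\<mu>) = (\<integral>\<^sup>+r. ennreal ((cmod (f (r + z) - f z))\<^sup>2 * dens r) \<partial>\<mu>)"
      using nn_integral_translate[of "\<lambda>x. ennreal ((cmod (f x - f z))\<^sup>2 * dens (- z + x))" z]
      by (simp add: add.commute[of z])
  qed
  also have "\<dots> = (\<integral>\<^sup>+r. \<integral>\<^sup>+z. ennreal ((cmod (f (r + z) - f z))\<^sup>2 * dens r) \<partial>\<mu> \<partial>\<mu>)"
    by (rule Fubini') measurable
  also have "\<dots> \<le> (\<integral>\<^sup>+r. ennreal (\<delta>\<^sup>2) * ennreal (dens r) \<partial>\<mu>)"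
  proof (rule nn_integral_mono)
    fix r
    have "(\<integral>\<^sup>+z. ennreal ((cmod (f (r + z) - f z))\<^sup>2 * dens r) \<partial>\<mu>) = (\<integral>\<^sup>+z. ennreal ((cmod (f (r + z) - f z))\<^sup>2) \<partial>\<mu>) * ennreal (dens r)"
      by (subst nn_integral_multc[symmetric]) (simp_all add: ennreal_mult dens_nonneg)
    also have "\<dots> = ennreal ((l2_norm \<mu> (\<lambda>z. f (r + z) - f z))\<^sup>2) * ennreal (dens r)"
      using f by (subst l2_norm_square_nn) (auto intro!: L2_diff simp: L2_translate_iff)
    also have "\<dots> \<le> ennreal (\<delta>\<^sup>2) * ennreal (dens r)"
    proof (cases "r \<in> U")
      case True
      then show ?thesis
        using \<delta> by (intro mult_right_mono ennreal_leI power_mono) auto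
    qed (simp add: dens_def)
    finally show "(\<integral>\<^sup>+z. ennreal ((cmod (f (r + z) - f z))\<^sup>2 * dens r) \<partial>\<mu>) \<le> ennreal (\<delta>\<^sup>2) * ennreal (dens r)" .
  qed
  also have "\<dots> = ennreal (\<delta>\<^sup>2)"
    by (subst nn_integral_cmult) (simp_all add: nn_integral_dens)
  finally have "(l2_norm \<mu> (\<lambda>x. smooth f x - f x))\<^sup>2 \<le> \<delta>\<^sup>2"
    by (simp add: l2_norm_square_nn[OF L2, symmetric])
  then show ?thesis
    by (rule power2_le_imp_le) (use \<delta> in simp)
qed

lemma smooth_diff: "f \<in> L2 \<mu> \<Longrightarrow> g \<in> L2 \<mu> \<Longrightarrow> smooth (\<lambda>x. f x - g x) = (\<lambda>x. smooth f x - smooth g x)"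
  by (simp add: fun_eq_iff smooth_eq_bil bil_diff_left bump_L2)

section \<open>The kernel of a smoothed operator\<close>

lemma bil_bump_measurable [measurable (raw)]:
  assumes F: "F \<in> L2 \<mu>" and [measurable]: "p \<in> borel_measurable N"
  shows "(\<lambda>w. bil \<mu> F (bump (p w))) \<in> borel_measurable N"
proof -
  have [measurable]: "F \<in> borel_measurable \<mu>"
    by (rule L2_measurable[OF F])
  have "(\<lambda>x. bil \<mu> F (bump x)) \<in> borel_measurable borel"
    unfolding bil_def borel_measurable_eq[symmetric] by measurable
  then show ?thesis
    by measurable
qed

lemma bil_bump_bound: "F \<in> L2 \<mu> \<Longrightarrow> cmod (bil \<mu> F (bump x)) \<le> l2_norm \<mu> F * bump_norm"
  using bil_bound[OF _ bump_L2, of F x] by (simp add: l2_norm_bump)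

lemma integrable_mult_bil_bump:
  assumes f: "integrable \<mu> f" and F: "F \<in> L2 \<mu>"
  shows "integrable \<mu> (\<lambda>x. f x * bil \<mu> F (bump x))"
proof (rule Bochner_Integration.integrable_bound)
  show "integrable \<mu> (\<lambda>x. (l2_norm \<mu> F * bump_norm) * cmod (f x))"
    by (intro integrable_mult_right integrable_norm f)
  show "(\<lambda>x. f x * bil \<mu> F (bump x)) \<in> borel_measurable \<mu>"
    using F f by measurable
  show "AE x in \<mu>. norm (f x * bil \<mu> F (bump x)) \<le> norm (l2_norm \<mu> F * bump_norm * cmod (f x))"
    using bil_bump_bound[OF F] bump_norm_nonneg by (intro AE_I2) (simp add: norm_mult abs_mult mult.commute mult_left_mono)
qed

text \<open>All vectors \<open>bump x\<close> have the same norm, so it is the integrability of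
  \<open>f\<close>, on top of square integrability, that bounds the double integral and permits
  Fubini.\<close>

lemma bil_smooth:
  assumes f: "f \<in> L2 \<mu>" "integrable \<mu> f" and F: "F \<in> L2 \<mu>"
  shows "bil \<mu> F (smooth f) = (\<integral>x. f x * bil \<mu> F (bump x) \<partial>\<mu>)"
proof -
  have [measurable]: "f \<in> borel_measurable borel" "F \<in> borel_measurable borel"
    using L2_measurable[OF f(1)] L2_measurable[OF F] by (simp_all add: borel_measurable_eq)
  have int: "integrable (\<mu> \<Otimes>\<^sub>M \<mu>) (\<lambda>(x, z). f x * (F z * bump x z))"
  proof (rule Fubini_integrable)
    show "(\<lambda>(x, z). f x * (F z * bump x z)) \<in> borel_measurable (\<mu> \<Otimes>\<^sub>M \<mu>)"
      by measurable
    show "AE x in \<mu>. integrable \<mu> (\<lambda>z. case (x, z) of (x, z) \<Rightarrow> f x * (F z * bump x z))"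
      using L2_mult_integrable[OF F bump_L2] by (intro AE_I2) simp
    show "integrable \<mu> (\<lambda>x. \<integral>z. norm (case (x, z) of (x, z) \<Rightarrow> f x * (F z * bump x z)) \<partial>\<mu>)"
    proof (rule Bochner_Integration.integrable_bound)
      show "integrable \<mu> (\<lambda>x. (l2_norm \<mu> F * bump_norm) * cmod (f x))"
        by (intro integrable_mult_right integrable_norm f)
      show "(\<lambda>x. \<integral>z. norm (case (x, z) of (x, z) \<Rightarrow> f x * (F z * bump x z)) \<partial>\<mu>) \<in> borel_measurable \<mu>"
        by measurable
      show "AE x in \<mu>. norm (\<integral>z. norm (case (x, z) of (x, z) \<Rightarrow> f x * (F z * bump x z)) \<partial>\<mu>)
          \<le> norm ((l2_norm \<mu> F * bump_norm) * cmod (f x))"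
      proof (rule AE_I2)
        fix x
        have "(\<integral>z. norm (case (x, z) of (x, z) \<Rightarrow> f x * (F z * bump x z)) \<partial>\<mu>) = cmod (f x) * (\<integral>z. cmod (F z * bump x z) \<partial>\<mu>)"
          by (simp add: norm_mult)
        also have "\<dots> \<le> cmod (f x) * (l2_norm \<mu> F * bump_norm)"
          using l2_norm_Cauchy_Schwarz[OF F bump_L2, of x] by (intro mult_left_mono) (simp_all add: l2_norm_bump)
        also have "\<dots> \<le> norm ((l2_norm \<mu> F * bump_norm) * cmod (f x))"
          unfolding real_norm_def by (subst mult.commute) (rule abs_ge_self)
        finally show "norm (\<integral>z. norm (case (x, z) of (x, z) \<Rightarrow> f x * (F z * bump x z)) \<partial>\<mu>)
            \<le> norm ((l2_norm \<mu> F * bump_norm) * cmod (f x))"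
          by (simp only: real_norm_def abs_of_nonneg[OF Bochner_Integration.integral_nonneg[OF norm_ge_zero]])
      qed
    qed
  qed
  have "bil \<mu> F (smooth f) = (\<integral>z. \<integral>x. f x * (F z * bump x z) \<partial>\<mu> \<partial>\<mu>)"
    unfolding bil_def smooth_def by (simp add: mult.left_commute flip: Bochner_Integration.integral_mult_right_zero)
  also have "\<dots> = (\<integral>x. \<integral>z. f x * (F z * bump x z) \<partial>\<mu> \<partial>\<mu>)"
    using Fubini_integral[OF int] by simp
  also have "\<dots> = (\<integral>x. f x * bil \<mu> F (bump x) \<partial>\<mu>)"
    by (simp add: bil_def)
  finally show ?thesis .
qed

lemma bil_op_bump_proj:
  assumes T: "T \<in> BL2 \<mu>" and g: "g \<in> L2 \<mu>"
  shows "bil \<mu> (T (proj \<mu> e n (bump x))) g = (\<Sum>j<n. bil \<mu> (\<lambda>z. cnj (e j z)) (bump x) * bil \<mu> (T (e j)) g)"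
  by (simp add: bil_op_proj T g bump_L2 l2_inner_bil bil_commute[of \<mu> "bump x"])

text \<open>A bounded operator need not have an integral kernel from which measurability could be
  read off. For \<open>T\<close> composed with a finite projection the expression is a finite sum of
  measurable coefficients, and pointwise limits stay measurable.\<close>

lemma op_kernel_measurable [measurable (raw)]:
  assumes T: "T \<in> BL2 \<mu>" and [measurable]: "p \<in> borel_measurable N" "q \<in> borel_measurable N"
  shows "(\<lambda>w. bil \<mu> (T (bump (p w))) (bump (q w))) \<in> borel_measurable N"
proof (rule borel_measurable_LIMSEQ_metric)
  show "(\<lambda>w. bil \<mu> (T (proj \<mu> e n (bump (p w)))) (bump (q w))) \<in> borel_measurable N" for n
    unfolding bil_op_bump_proj[OF T bump_L2]
    by (intro borel_measurable_sum borel_measurable_times bil_bump_measurable L2_cnj e_L2 BL2_L2[OF T]) measurable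
  show "(\<lambda>n. bil \<mu> (T (proj \<mu> e n (bump (p w)))) (bump (q w))) \<longlonglongrightarrow> bil \<mu> (T (bump (p w))) (bump (q w))" for w
    by (intro bil_op_proj_tendsto T bump_L2)
qed

lemma op_bump_measurable [measurable (raw)]:
  assumes T: "T \<in> BL2 \<mu>" and g: "g \<in> L2 \<mu>" and [measurable]: "p \<in> borel_measurable N"
  shows "(\<lambda>w. bil \<mu> (T (bump (p w))) g) \<in> borel_measurable N"
proof (rule borel_measurable_LIMSEQ_metric)
  show "(\<lambda>w. bil \<mu> (T (proj \<mu> e n (bump (p w)))) g) \<in> borel_measurable N" for n
    unfolding bil_op_bump_proj[OF T g]
    by (intro borel_measurable_sum borel_measurable_times bil_bump_measurable L2_cnj e_L2) measurable
  show "(\<lambda>n. bil \<mu> (T (proj \<mu> e n (bump (p w)))) g) \<longlonglongrightarrow> bil \<mu> (T (bump (p w))) g" for w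
    by (intro bil_op_proj_tendsto T bump_L2 g)
qed

text \<open>Expanding in the orthonormal basis lets \<open>T\<close> be exchanged with the integral without adjoints.\<close>

lemma bil_op_smooth:
  assumes f: "f \<in> L2 \<mu>" "integrable \<mu> f" and T: "T \<in> BL2 \<mu>" and g: "g \<in> L2 \<mu>"
  shows "bil \<mu> (T (smooth f)) g = (\<integral>x. f x * bil \<mu> (T (bump x)) g \<partial>\<mu>)"
proof -
  obtain C where "0 \<le> C" "\<forall>f\<in>L2 \<mu>. l2_norm \<mu> (T f) \<le> C * l2_norm \<mu> f"
    using BL2_bound[OF T] by blast
  note C = this(1) this(2)[rule_format]
  have [measurable]: "f \<in> borel_measurable borel"
    using L2_measurable[OF f(1)] by (simp add: borel_measurable_eq)
  have eq: "bil \<mu> (T (proj \<mu> e n (smooth f))) g = (\<integral>x. f x * bil \<mu> (T (proj \<mu> e n (bump x))) g \<partial>\<mu>)" for n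
  proof -
    have ip: "l2_inner \<mu> (smooth f) (e j) = (\<integral>x. f x * bil \<mu> (\<lambda>z. cnj (e j z)) (bump x) \<partial>\<mu>)" for j
      unfolding l2_inner_bil bil_commute[of \<mu> "smooth f"] by (intro bil_smooth f L2_cnj e_L2)
    have int: "integrable \<mu> (\<lambda>x. f x * bil \<mu> (\<lambda>z. cnj (e j z)) (bump x))" for j
      by (intro integrable_mult_bil_bump f L2_cnj e_L2)
    have "bil \<mu> (T (proj \<mu> e n (smooth f))) g = (\<Sum>j<n. (\<integral>x. f x * bil \<mu> (\<lambda>z. cnj (e j z)) (bump x) \<partial>\<mu>) * bil \<mu> (T (e j)) g)"
      by (simp add: bil_op_proj T g smooth_L2 f ip)
    also have "\<dots> = (\<integral>x. (\<Sum>j<n. f x * bil \<mu> (\<lambda>z. cnj (e j z)) (bump x) * bil \<mu> (T (e j)) g) \<partial>\<mu>)"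
      using int by (subst Bochner_Integration.integral_sum) auto
    finally show ?thesis
      by (simp add: bil_op_bump_proj T g sum_distrib_left mult.assoc)
  qed
  have "(\<lambda>n. \<integral>x. f x * bil \<mu> (T (proj \<mu> e n (bump x))) g \<partial>\<mu>) \<longlonglongrightarrow> (\<integral>x. f x * bil \<mu> (T (bump x)) g \<partial>\<mu>)"
  proof (rule integral_dominated_convergence)
    show "integrable \<mu> (\<lambda>x. (C * (bump_norm * l2_norm \<mu> g)) * cmod (f x))"
      by (intro integrable_mult_right integrable_norm f)
    show "(\<lambda>x. f x * bil \<mu> (T (bump x)) g) \<in> borel_measurable \<mu>"
      by (intro borel_measurable_times op_bump_measurable T g) measurable
    show "(\<lambda>x. f x * bil \<mu> (T (proj \<mu> e n (bump x))) g) \<in> borel_measurable \<mu>" for n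
      unfolding bil_op_bump_proj[OF T g]
      by (intro borel_measurable_sum borel_measurable_times bil_bump_measurable L2_cnj e_L2) measurable
    show "AE x in \<mu>. (\<lambda>n. f x * bil \<mu> (T (proj \<mu> e n (bump x))) g) \<longlonglongrightarrow> f x * bil \<mu> (T (bump x)) g"
      by (intro AE_I2 tendsto_mult_left bil_op_proj_tendsto T bump_L2 g)
    show "AE x in \<mu>. norm (f x * bil \<mu> (T (proj \<mu> e n (bump x))) g) \<le> C * (bump_norm * l2_norm \<mu> g) * cmod (f x)" for n
      using bil_op_proj_bound[OF T C bump_L2 g, of n]
      by (intro AE_I2) (simp add: norm_mult l2_norm_bump mult.commute mult_left_mono)
  qed
  moreover have "(\<lambda>n. bil \<mu> (T (proj \<mu> e n (smooth f))) g) \<longlonglongrightarrow> bil \<mu> (T (smooth f)) g"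
    by (intro bil_op_proj_tendsto T smooth_L2 f g)
  ultimately show ?thesis
    unfolding eq using LIMSEQ_unique by blast
qed

lemma op_kernel_bound:
  assumes "T \<in> BL2 \<mu>" "0 \<le> C" "\<And>f. f \<in> L2 \<mu> \<Longrightarrow> l2_norm \<mu> (T f) \<le> C * l2_norm \<mu> f"
  shows "cmod (bil \<mu> (T (bump x)) (bump y)) \<le> C * (bump_norm)\<^sup>2"
  using bil_op_bound[OF assms bump_L2 bump_L2, of x y] by (simp add: l2_norm_bump power2_eq_square)

text \<open>The operator smoothed on both sides has the bounded kernel
  \<open>bil \<mu> (T (bump x)) (bump y)\<close>, which can be integrated against
  \<open>f x * g y\<close> for integrable \<open>f\<close> and \<open>g\<close>.\<close>

lemma bil_op_smooth_smooth:
  assumes f: "f \<in> L2 \<mu>" "integrable \<mu> f" and g: "g \<in> L2 \<mu>" "integrable \<mu> g" and T: "T \<in> BL2 \<mu>"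
  shows "integrable (\<mu> \<Otimes>\<^sub>M \<mu>) (\<lambda>(x, y). f x * g y * bil \<mu> (T (bump x)) (bump y))"
    and "bil \<mu> (T (smooth f)) (smooth g) = (\<integral>(x, y). f x * g y * bil \<mu> (T (bump x)) (bump y) \<partial>(\<mu> \<Otimes>\<^sub>M \<mu>))"
proof -
  obtain C where "0 \<le> C" "\<forall>f\<in>L2 \<mu>. l2_norm \<mu> (T f) \<le> C * l2_norm \<mu> f"
    using BL2_bound[OF T] by blast
  note C = this(1) this(2)[rule_format]
  have [measurable]: "f \<in> borel_measurable \<mu>" "g \<in> borel_measurable \<mu>"
    using L2_measurable[OF f(1)] L2_measurable[OF g(1)] by simp_all
  show int: "integrable (\<mu> \<Otimes>\<^sub>M \<mu>) (\<lambda>(x, y). f x * g y * bil \<mu> (T (bump x)) (bump y))"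
  proof (rule Bochner_Integration.integrable_bound)
    show "integrable (\<mu> \<Otimes>\<^sub>M \<mu>) (\<lambda>z. complex_of_real (C * (bump_norm)\<^sup>2) * (case z of (x, y) \<Rightarrow> f x * g y))"
      by (intro integrable_mult_right integrable_tensor f g)
    show "(\<lambda>(x, y). f x * g y * bil \<mu> (T (bump x)) (bump y)) \<in> borel_measurable (\<mu> \<Otimes>\<^sub>M \<mu>)"
      unfolding case_prod_beta by (intro borel_measurable_times op_kernel_measurable T) measurable
    have "cmod (bil \<mu> (T (bump x)) (bump y)) * cmod (f x * g y) \<le> C * (bump_norm)\<^sup>2 * cmod (f x * g y)" for x y
      by (intro mult_right_mono op_kernel_bound[OF T C]) auto
    then show "AE z in \<mu> \<Otimes>\<^sub>M \<mu>. norm (case z of (x, y) \<Rightarrow> f x * g y * bil \<mu> (T (bump x)) (bump y))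
        \<le> norm (complex_of_real (C * (bump_norm)\<^sup>2) * (case z of (x, y) \<Rightarrow> f x * g y))"
      using C(1) by (intro AE_I2) (auto simp: norm_mult mult_ac simp del: of_real_mult of_real_power)
  qed
  have "bil \<mu> (T (smooth f)) (smooth g) = (\<integral>x. f x * (\<integral>y. g y * bil \<mu> (T (bump x)) (bump y) \<partial>\<mu>) \<partial>\<mu>)"
    by (simp add: bil_op_smooth[OF f T smooth_L2(1)[OF g(1)]] bil_smooth[OF g BL2_L2[OF T bump_L2]])
  also have "\<dots> = (\<integral>x. \<integral>y. f x * g y * bil \<mu> (T (bump x)) (bump y) \<partial>\<mu> \<partial>\<mu>)"
    by (simp add: mult.assoc)
  also have "\<dots> = (\<integral>(x, y). f x * g y * bil \<mu> (T (bump x)) (bump y) \<partial>(\<mu> \<Otimes>\<^sub>M \<mu>))"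
    using integral_fst'[OF int] by simp
  finally show "bil \<mu> (T (smooth f)) (smooth g) = (\<integral>(x, y). f x * g y * bil \<mu> (T (bump x)) (bump y) \<partial>(\<mu> \<Otimes>\<^sub>M \<mu>))" .
qed

end

subsection \<open>Averaging over Folner sets\<close>

context haar_hilbert begin

text \<open>Autocorrelation of the indicator of \<open>E\<close>, scaled to be 1 at 0; it tends to 1
  at every point along a Folner sequence.\<close>

definition overlap :: "'g set \<Rightarrow> 'g \<Rightarrow> real" where
  "overlap E w = measure \<mu> (E \<inter> {x. w + x \<in> E}) / measure \<mu> E"

text \<open>The indicator of \<open>E\<close> normalised to a unit vector, whose autocorrelation is
  \<open>overlap E\<close>.\<close>

definition window :: "'g set \<Rightarrow> 'g \<Rightarrow> complex" where
  "window E x = complex_of_real (indicator E x / sqrt (measure \<mu> E))"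

context
  fixes E :: "'g set"
  assumes E: "compact E" "0 < measure \<mu> E"
begin

lemma E_sets [measurable]: "E \<in> sets borel"
  using E by (intro compact_borel)

lemma E_fin: "emeasure \<mu> E < \<infinity>"
  using E by (intro emeasure_compact)

lemma window_measurable [measurable]: "window E \<in> borel_measurable borel"
  unfolding window_def[abs_def] by measurable

lemma window_square: "(cmod (window E x))\<^sup>2 = indicator E x / measure \<mu> E"
  using E(2) by (simp add: window_def power_divide indicator_def norm_divide)

lemma overlap_eq_integral: "overlap E w = (\<integral>x. indicator E x * indicator E (w + x) \<partial>\<mu>) / measure \<mu> E"
proof -
  have "measure \<mu> (E \<inter> {x. w + x \<in> E}) = (\<integral>x. indicator (E \<inter> {x. w + x \<in> E}) x \<partial>\<mu>)"
    by simp
  also have "\<dots> = (\<integral>x. indicator E x * indicator E (w + x) \<partial>\<mu>)"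
    by (intro Bochner_Integration.integral_cong) (auto simp: indicator_def)
  finally show ?thesis
    by (simp add: overlap_def)
qed

lemma overlap_measurable [measurable]: "overlap E \<in> borel_measurable borel"
proof -
  have "(\<lambda>w. (\<integral>x. indicator E x * indicator E (w + x) \<partial>\<mu>) / measure \<mu> E) \<in> borel_measurable \<mu>"
    by measurable
  then show ?thesis
    unfolding overlap_eq_integral[abs_def] borel_measurable_eq .
qed

lemma overlap_nonneg: "0 \<le> overlap E w"
  by (simp add: overlap_def)

lemma overlap_le_1: "overlap E w \<le> 1"
proof -
  have "measure \<mu> (E \<inter> {x. w + x \<in> E}) \<le> measure \<mu> E"
  proof (rule measure_mono_fmeasurable)
    show "E \<inter> {x. w + x \<in> E} \<in> sets \<mu>"
      by measurable
  qed (use E in \<open>auto intro: compact_fmeasurable\<close>)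
  then show ?thesis
    using E by (simp add: overlap_def)
qed

text \<open>By Tonelli the weight has total integral \<open>measure \<mu> E\<close>; this makes the
  integral over all diagonals converge although the kernel is only bounded.\<close>

lemma integrable_overlap: "integrable \<mu> (overlap E)"
proof -
  have int: "integrable \<mu> (\<lambda>w. indicator E (w + x) :: real)" for x
    using E_fin integrable_translate_iff[of "indicator E :: _ \<Rightarrow> real" x] by (simp add: add.commute less_top)
  have eq: "(\<integral>w. indicator E (w + x) \<partial>\<mu>) = measure \<mu> E" for x
    using integral_translate[of "indicator E :: _ \<Rightarrow> real" x] by (simp add: add.commute)
  have "integrable (\<mu> \<Otimes>\<^sub>M \<mu>) (\<lambda>(x, w). indicator E x * (indicator E (w + x) :: real))"
  proof (rule Fubini_integrable)
    show "(\<lambda>(x, w). indicator E x * (indicator E (w + x) :: real)) \<in> borel_measurable (\<mu> \<Otimes>\<^sub>M \<mu>)"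
      by measurable
    show "integrable \<mu> (\<lambda>x. \<integral>w. norm (case (x, w) of (x, w) \<Rightarrow> indicator E x * (indicator E (w + x) :: real)) \<partial>\<mu>)"
      using E_fin by (simp add: abs_mult eq less_top)
    show "AE x in \<mu>. integrable \<mu> (\<lambda>w. case (x, w) of (x, w) \<Rightarrow> indicator E x * (indicator E (w + x) :: real))"
      using int by (intro AE_I2) simp
  qed
  from integrable_snd[OF this] show ?thesis
    unfolding overlap_eq_integral[abs_def] by simp
qed

text \<open>The translation-invariant weight is exhibited as an average over \<open>r\<close> of
  product weights in \<open>x\<close> and \<open>y\<close>. A product weight merely multiplies
  \<open>f\<close> and \<open>g\<close>, and this keeps the averaged forms bounded.\<close>

lemma window_autocorrelation: "(\<integral>r. window E (r + x) * window E (r + y) \<partial>\<mu>) = complex_of_real (overlap E (- x + y))"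
proof -
  have m: "sqrt (measure \<mu> E) * sqrt (measure \<mu> E) = measure \<mu> E"
    using E by simp
  have "(\<integral>r. window E (r + x) * window E (r + y) \<partial>\<mu>) = (\<integral>r. window E ((- x + r) + x) * window E ((- x + r) + y) \<partial>\<mu>)"
    by (rule integral_translate[symmetric])
  also have "\<dots> = (\<integral>r. complex_of_real (indicator E r * indicator E ((- x + y) + r) / measure \<mu> E) \<partial>\<mu>)"
  proof (rule Bochner_Integration.integral_cong[OF refl])
    fix r
    have "(- x + r) + x = r" "(- x + r) + y = (- x + y) + r"
      by (simp_all add: algebra_simps)
    then show "window E ((- x + r) + x) * window E ((- x + r) + y) = complex_of_real (indicator E r * indicator E ((- x + y) + r) / measure \<mu> E)"
      by (simp only: window_def of_real_mult[symmetric] times_divide_times_eq m)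
  qed
  also have "\<dots> = complex_of_real (\<integral>r. indicator E r * indicator E ((- x + y) + r) / measure \<mu> E \<partial>\<mu>)"
    by (rule integral_complex_of_real)
  finally show ?thesis
    by (simp add: overlap_eq_integral)
qed

text \<open>For each \<open>x\<close> the squared window integrates to 1 over \<open>r\<close>, so
  attaching the window is an isometry from functions on the group to functions on the
  product.\<close>

lemma window_kernel:
  assumes f: "f \<in> L2 \<mu>"
  shows "(\<lambda>(x, r). f x * window E (r + x)) \<in> L2 (\<mu> \<Otimes>\<^sub>M \<mu>)"
    and "l2_norm (\<mu> \<Otimes>\<^sub>M \<mu>) (\<lambda>(x, r). f x * window E (r + x)) = l2_norm \<mu> f"
proof -
  have [measurable]: "f \<in> borel_measurable borel"
    using L2_measurable[OF f] by (simp add: borel_measurable_eq)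
  let ?F = "\<lambda>(x, r). f x * window E (r + x)"
  have meas: "?F \<in> borel_measurable (\<mu> \<Otimes>\<^sub>M \<mu>)"
    by measurable
  have w1: "(\<integral>\<^sup>+r. ennreal ((cmod (window E (r + x)))\<^sup>2) \<partial>\<mu>) = 1" for x
  proof -
    have "(\<integral>\<^sup>+r. ennreal ((cmod (window E (r + x)))\<^sup>2) \<partial>\<mu>) = (\<integral>\<^sup>+r. ennreal (1 / measure \<mu> E) * indicator E r \<partial>\<mu>)"
      using nn_integral_translate[of "\<lambda>r. ennreal ((cmod (window E r))\<^sup>2)" x] unfolding window_square
      by (simp add: add.commute) (intro nn_integral_cong, auto simp: indicator_def)
    also have "\<dots> = ennreal (1 / measure \<mu> E) * emeasure \<mu> E"
      by (intro nn_integral_cmult_indicator) simp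
    also have "\<dots> = 1"
      using E E_fin by (simp add: emeasure_eq_ennreal_measure less_top flip: ennreal_mult)
    finally show ?thesis .
  qed
  have nn: "(\<integral>\<^sup>+z. ennreal ((cmod (?F z))\<^sup>2) \<partial>(\<mu> \<Otimes>\<^sub>M \<mu>)) = ennreal ((l2_norm \<mu> f)\<^sup>2)"
  proof -
    have "(\<integral>\<^sup>+z. ennreal ((cmod (?F z))\<^sup>2) \<partial>(\<mu> \<Otimes>\<^sub>M \<mu>)) = (\<integral>\<^sup>+x. \<integral>\<^sup>+r. ennreal ((cmod (f x))\<^sup>2) * ennreal ((cmod (window E (r + x)))\<^sup>2) \<partial>\<mu> \<partial>\<mu>)"
      by (subst sigma_finite_measure.nn_integral_fst[OF sigma_finite_haar, symmetric]) (simp_all add: norm_mult power_mult_distrib ennreal_mult)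
    also have "\<dots> = (\<integral>\<^sup>+x. ennreal ((cmod (f x))\<^sup>2) \<partial>\<mu>)"
      by (subst nn_integral_cmult) (simp_all add: w1)
    finally show ?thesis
      by (simp add: l2_norm_square_nn f)
  qed
  show L2: "?F \<in> L2 (\<mu> \<Otimes>\<^sub>M \<mu>)"
  proof (rule L2I[OF meas], rule integrableI_bounded)
    show "(\<lambda>z. (cmod (?F z))\<^sup>2) \<in> borel_measurable (\<mu> \<Otimes>\<^sub>M \<mu>)"
      using meas by measurable
    show "(\<integral>\<^sup>+z. ennreal (norm ((cmod (?F z))\<^sup>2)) \<partial>(\<mu> \<Otimes>\<^sub>M \<mu>)) < \<infinity>"
      using nn by simp
  qed
  have "(l2_norm (\<mu> \<Otimes>\<^sub>M \<mu>) ?F)\<^sup>2 = (l2_norm \<mu> f)\<^sup>2"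
    using nn l2_norm_square_nn[OF L2] by (simp add: ennreal_inj)
  then show "l2_norm (\<mu> \<Otimes>\<^sub>M \<mu>) ?F = l2_norm \<mu> f"
    by (simp add: power2_eq_iff_nonneg)
qed

text \<open>The window confines \<open>f\<close> to a set of measure \<open>measure \<mu> E\<close>,
  on which square-integrable functions are integrable by Cauchy-Schwarz.\<close>

lemma windowed:
  assumes f: "f \<in> L2 \<mu>"
  shows "(\<lambda>x. f x * window E (r + x)) \<in> L2 \<mu>" (is "?f \<in> _")
    and "integrable \<mu> (\<lambda>x. f x * window E (r + x))"
    and "(\<integral>x. cmod (f x * window E (r + x)) \<partial>\<mu>) \<le> l2_norm \<mu> (\<lambda>x. f x * window E (r + x)) * sqrt (measure \<mu> E)"
proof -
  let ?A = "{x. r + x \<in> E}"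
  have [measurable]: "f \<in> borel_measurable borel"
    using L2_measurable[OF f] by (simp add: borel_measurable_eq)
  have A1: "?A \<in> sets borel"
    using E_sets by measurable
  have A: "?A \<in> sets borel" "emeasure \<mu> ?A < \<infinity>" "measure \<mu> ?A = measure \<mu> E"
    using A1 emeasure_translate[OF E_sets] measure_translate[OF E_sets] E_fin by simp_all
  show L2: "?f \<in> L2 \<mu>"
  proof (rule L2_dominated)
    show "(\<lambda>x. complex_of_real (1 / sqrt (measure \<mu> E)) * f x) \<in> L2 \<mu>"
      by (intro L2_scale f)
    show "AE x in \<mu>. cmod (f x * window E (r + x)) \<le> cmod (complex_of_real (1 / sqrt (measure \<mu> E)) * f x)"
      by (intro AE_I2) (simp add: window_def norm_mult norm_divide indicator_def)
  qed measurable
  have eq: "?f x = ?f x * indicator ?A x" for x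
    by (simp add: window_def indicator_def)
  show "integrable \<mu> ?f"
    using L2_mult_integrable[OF L2 indicator_L2(1)[OF A(1,2)]] by (simp only: eq[symmetric])
  have "sqrt ((l2_norm \<mu> (\<lambda>x. indicator ?A x :: complex))\<^sup>2) = sqrt (measure \<mu> E)"
    using indicator_L2(2)[OF A(1,2)] A(3) by simp
  then show "(\<integral>x. cmod (?f x) \<partial>\<mu>) \<le> l2_norm \<mu> ?f * sqrt (measure \<mu> E)"
    using l2_norm_Cauchy_Schwarz[OF L2 indicator_L2(1)[OF A(1,2)]] by (simp only: eq[symmetric]) simp
qed

lemma window_norm_L2:
  assumes "f \<in> L2 \<mu>"
  shows "(\<lambda>r. complex_of_real (l2_norm \<mu> (\<lambda>x. f x * window E (r + x)))) \<in> L2 \<mu>"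
    and "l2_norm \<mu> (\<lambda>r. complex_of_real (l2_norm \<mu> (\<lambda>x. f x * window E (r + x)))) = l2_norm \<mu> f"
proof -
  let ?F = "\<lambda>(x, r). f x * window E (r + x)"
  show "(\<lambda>r. complex_of_real (l2_norm \<mu> (\<lambda>x. f x * window E (r + x)))) \<in> L2 \<mu>"
    using kernel_norm_integrable[OF window_kernel(1)[OF assms]] by simp
  have "integrable (\<mu> \<Otimes>\<^sub>M \<mu>) (\<lambda>(x, r). (cmod (f x * window E (r + x)))\<^sup>2)"
    using L2_integrable[OF window_kernel(1)[OF assms]] by (simp add: case_prod_beta')
  from integral_snd[OF this] have "(\<integral>r. \<integral>x. (cmod (f x * window E (r + x)))\<^sup>2 \<partial>\<mu> \<partial>\<mu>) = (l2_norm (\<mu> \<Otimes>\<^sub>M \<mu>) ?F)\<^sup>2"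
    by (simp add: l2_norm_square case_prod_beta')
  then show "l2_norm \<mu> (\<lambda>r. complex_of_real (l2_norm \<mu> (\<lambda>x. f x * window E (r + x)))) = l2_norm \<mu> f"
    unfolding window_kernel(2)[OF assms] by (simp add: l2_norm_def)
qed

end

end

context haar_bump begin

text \<open>The smoothed kernel is multiplied by the Schur multiplier
  \<open>overlap E (- x + y)\<close> before being tested on \<open>f\<close> and
  \<open>g\<close>.\<close>

definition averaged :: "'g oper \<Rightarrow> 'g set \<Rightarrow> ('g \<Rightarrow> complex) \<Rightarrow> ('g \<Rightarrow> complex) \<Rightarrow> complex" where
  "averaged T E f g = (\<integral>(x, y). f x * g y * complex_of_real (overlap E (- x + y)) * bil \<mu> (T (bump x)) (bump y) \<partial>(\<mu> \<Otimes>\<^sub>M \<mu>))"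

text \<open>The constant \<open>C\<close> involves neither \<open>E\<close> nor \<open>U\<close>.
  Writing the weight as an integral over \<open>r\<close> turns the form into the integral of
  \<open>bil \<mu> (T (smooth (fw r))) (smooth (gw r))\<close>; smoothing is a contraction, and
  Cauchy-Schwarz in \<open>r\<close> with the isometry of the windows gives the product of the
  norms.\<close>

lemma averaged_bound:
  assumes f: "f \<in> L2 \<mu>" and g: "g \<in> L2 \<mu>" and T: "T \<in> BL2 \<mu>" and E: "compact E" "0 < measure \<mu> E"
    and C: "0 \<le> C" "\<And>f. f \<in> L2 \<mu> \<Longrightarrow> l2_norm \<mu> (T f) \<le> C * l2_norm \<mu> f"
  shows "integrable (\<mu> \<Otimes>\<^sub>M \<mu>) (\<lambda>(x, y). f x * g y * complex_of_real (overlap E (- x + y)) * bil \<mu> (T (bump x)) (bump y))"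
    and "cmod (averaged T E f g) \<le> C * (l2_norm \<mu> f * l2_norm \<mu> g)"
proof -
  interpret P: pair_sigma_finite \<mu> "\<mu> \<Otimes>\<^sub>M \<mu>" ..
  note [measurable] = E_sets[OF E] window_measurable[OF E]
  have [measurable]: "f \<in> borel_measurable borel" "g \<in> borel_measurable borel"
    using L2_measurable[OF f] L2_measurable[OF g] by (simp_all add: borel_measurable_eq)
  define K where "K x y = bil \<mu> (T (bump x)) (bump y)" for x y
  have K_meas [measurable (raw)]: "(\<lambda>w. K (p w) (q w)) \<in> borel_measurable N"
    if "p \<in> borel_measurable N" "q \<in> borel_measurable N" for p q and N :: "'n measure"
    unfolding K_def using op_kernel_measurable[OF T that] .
  have K_bound: "cmod (K x y) \<le> C * bump_norm\<^sup>2" for x y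
    unfolding K_def by (rule op_kernel_bound[OF T C])
  define fw where "fw r x = f x * window E (r + x)" for r x
  define gw where "gw r x = g x * window E (r + x)" for r x
  have fw: "fw r \<in> L2 \<mu>" "integrable \<mu> (fw r)" "(\<integral>x. cmod (fw r x) \<partial>\<mu>) \<le> l2_norm \<mu> (fw r) * sqrt (measure \<mu> E)" for r
    unfolding fw_def using windowed[OF E f] by auto
  have gw: "gw r \<in> L2 \<mu>" "integrable \<mu> (gw r)" "(\<integral>x. cmod (gw r x) \<partial>\<mu>) \<le> l2_norm \<mu> (gw r) * sqrt (measure \<mu> E)" for r
    unfolding gw_def using windowed[OF E g] by auto
  have [measurable]: "(\<lambda>(r, x). fw r x) \<in> borel_measurable (borel \<Otimes>\<^sub>M borel)" "(\<lambda>(r, x). gw r x) \<in> borel_measurable (borel \<Otimes>\<^sub>M borel)"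
    unfolding fw_def gw_def by measurable
  have fw_eta: "(\<lambda>x. f x * window E (r + x)) = fw r" "(\<lambda>x. g x * window E (r + x)) = gw r" for r
    by (simp_all add: fw_def gw_def fun_eq_iff)
  have nf: "(\<lambda>r. complex_of_real (l2_norm \<mu> (fw r))) \<in> L2 \<mu>" "l2_norm \<mu> (\<lambda>r. complex_of_real (l2_norm \<mu> (fw r))) = l2_norm \<mu> f"
    using window_norm_L2[OF E f] by (simp_all add: fw_eta)
  have ng: "(\<lambda>r. complex_of_real (l2_norm \<mu> (gw r))) \<in> L2 \<mu>" "l2_norm \<mu> (\<lambda>r. complex_of_real (l2_norm \<mu> (gw r))) = l2_norm \<mu> g"
    using window_norm_L2[OF E g] by (simp_all add: fw_eta)
  have nfg: "integrable \<mu> (\<lambda>r. l2_norm \<mu> (fw r) * l2_norm \<mu> (gw r))"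
    using integrable_norm[OF L2_mult_integrable[OF nf(1) ng(1)]] by (simp add: norm_mult)
  define W where "W = (\<lambda>(r, z). case z of (x, y) \<Rightarrow> fw r x * gw r y * K x y)"
  have W_sec: "integrable (\<mu> \<Otimes>\<^sub>M \<mu>) (\<lambda>z. W (r, z))" for r
    using bil_op_smooth_smooth(1)[OF fw(1,2) gw(1,2) T, of r r] by (simp add: W_def K_def)
  have W_int: "(\<integral>z. W (r, z) \<partial>(\<mu> \<Otimes>\<^sub>M \<mu>)) = bil \<mu> (T (smooth (fw r))) (smooth (gw r))" for r
    using bil_op_smooth_smooth(2)[OF fw(1,2) gw(1,2) T, of r r] by (simp add: W_def K_def)
  have W_meas: "W \<in> borel_measurable (\<mu> \<Otimes>\<^sub>M (\<mu> \<Otimes>\<^sub>M \<mu>))"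
    unfolding W_def fw_def gw_def case_prod_beta by measurable
  have int_W: "integrable (\<mu> \<Otimes>\<^sub>M (\<mu> \<Otimes>\<^sub>M \<mu>)) W"
  proof (rule P.Fubini_integrable[OF W_meas])
    show "AE r in \<mu>. integrable (\<mu> \<Otimes>\<^sub>M \<mu>) (\<lambda>z. W (r, z))"
      using W_sec by simp
    show "integrable \<mu> (\<lambda>r. \<integral>z. norm (W (r, z)) \<partial>(\<mu> \<Otimes>\<^sub>M \<mu>))"
    proof (rule Bochner_Integration.integrable_bound)
      \<comment> \<open>This crude majorant depends on \<open>U\<close> and \<open>E\<close>; it
        serves to justify Fubini in the three variables \<open>r\<close>, \<open>x\<close>,
        \<open>y\<close>.\<close>
      show "integrable \<mu> (\<lambda>r. (C * bump_norm\<^sup>2 * measure \<mu> E) * (l2_norm \<mu> (fw r) * l2_norm \<mu> (gw r)))"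
        by (intro integrable_mult_right nfg)
      show "(\<lambda>r. \<integral>z. norm (W (r, z)) \<partial>(\<mu> \<Otimes>\<^sub>M \<mu>)) \<in> borel_measurable \<mu>"
        using W_meas by measurable
      have "(\<integral>z. norm (W (r, z)) \<partial>(\<mu> \<Otimes>\<^sub>M \<mu>)) \<le> (C * bump_norm\<^sup>2 * measure \<mu> E) * (l2_norm \<mu> (fw r) * l2_norm \<mu> (gw r))" for r
      proof -
        have "(\<integral>z. norm (W (r, z)) \<partial>(\<mu> \<Otimes>\<^sub>M \<mu>)) \<le> (\<integral>z. C * bump_norm\<^sup>2 * cmod (case z of (x, y) \<Rightarrow> fw r x * gw r y) \<partial>(\<mu> \<Otimes>\<^sub>M \<mu>))"
        proof (rule integral_mono)
          show "integrable (\<mu> \<Otimes>\<^sub>M \<mu>) (\<lambda>z. C * bump_norm\<^sup>2 * cmod (case z of (x, y) \<Rightarrow> fw r x * gw r y))"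
            by (intro integrable_mult_right integrable_norm integrable_tensor fw gw)
          show "norm (W (r, z)) \<le> C * bump_norm\<^sup>2 * cmod (case z of (x, y) \<Rightarrow> fw r x * gw r y)" for z
            using mult_right_mono[OF K_bound, of "cmod (case z of (x, y) \<Rightarrow> fw r x * gw r y)" "fst z" "snd z"]
            by (simp add: W_def case_prod_beta norm_mult mult_ac)
        qed (intro integrable_norm W_sec)
        also have "\<dots> = C * bump_norm\<^sup>2 * ((\<integral>x. cmod (fw r x) \<partial>\<mu>) * (\<integral>y. cmod (gw r y) \<partial>\<mu>))"
          by (simp add: integral_norm_tensor[OF fw(2) gw(2)])
        also have "\<dots> \<le> C * bump_norm\<^sup>2 * ((l2_norm \<mu> (fw r) * sqrt (measure \<mu> E)) * (l2_norm \<mu> (gw r) * sqrt (measure \<mu> E)))"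
          using C(1) by (intro mult_left_mono mult_mono fw gw) auto
        also have "\<dots> = (C * bump_norm\<^sup>2 * measure \<mu> E) * (l2_norm \<mu> (fw r) * l2_norm \<mu> (gw r))"
          using real_sqrt_mult_self[of "measure \<mu> E"] by (simp add: mult_ac)
        finally show ?thesis .
      qed
      then show "AE r in \<mu>. norm (\<integral>z. norm (W (r, z)) \<partial>(\<mu> \<Otimes>\<^sub>M \<mu>)) \<le> norm ((C * bump_norm\<^sup>2 * measure \<mu> E) * (l2_norm \<mu> (fw r) * l2_norm \<mu> (gw r)))"
        by (intro AE_I2) (simp only: real_norm_def abs_of_nonneg[OF Bochner_Integration.integral_nonneg[OF norm_ge_zero]],
          rule order_trans[OF _ abs_ge_self])
    qed
  qed
  \<comment> \<open>Integrating over \<open>r\<close> first recovers the weight, integrating over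
    \<open>(x, y)\<close> first gives the smoothed forms; Fubini equates the two.\<close>
  have inner: "(\<integral>r. W (r, (x, y)) \<partial>\<mu>) = f x * g y * complex_of_real (overlap E (- x + y)) * K x y" for x y
  proof -
    have "(\<integral>r. W (r, (x, y)) \<partial>\<mu>) = (\<integral>r. (f x * g y * K x y) * (window E (r + x) * window E (r + y)) \<partial>\<mu>)"
      by (intro Bochner_Integration.integral_cong) (auto simp: W_def fw_def gw_def)
    then show ?thesis
      by (simp add: window_autocorrelation[OF E])
  qed
  have W': "integrable (\<mu> \<Otimes>\<^sub>M (\<mu> \<Otimes>\<^sub>M \<mu>)) (\<lambda>(r, z). W (r, z))"
    using int_W by simp
  show "integrable (\<mu> \<Otimes>\<^sub>M \<mu>) (\<lambda>(x, y). f x * g y * complex_of_real (overlap E (- x + y)) * bil \<mu> (T (bump x)) (bump y))"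
  proof -
    have "(\<lambda>z. \<integral>r. W (r, z) \<partial>\<mu>) = (\<lambda>(x, y). f x * g y * complex_of_real (overlap E (- x + y)) * bil \<mu> (T (bump x)) (bump y))"
      by (auto simp: fun_eq_iff inner K_def)
    then show ?thesis
      using P.integrable_snd[OF W'] by simp
  qed
  have "averaged T E f g = (\<integral>z. \<integral>r. W (r, z) \<partial>\<mu> \<partial>(\<mu> \<Otimes>\<^sub>M \<mu>))"
    unfolding averaged_def using inner by (intro Bochner_Integration.integral_cong) (auto simp: K_def)
  also have "\<dots> = (\<integral>r. \<integral>z. W (r, z) \<partial>(\<mu> \<Otimes>\<^sub>M \<mu>) \<partial>\<mu>)"
    by (rule P.Fubini_integral[OF W'])
  finally have av: "averaged T E f g = (\<integral>r. bil \<mu> (T (smooth (fw r))) (smooth (gw r)) \<partial>\<mu>)"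
    by (simp add: W_int)
  have int_r: "integrable \<mu> (\<lambda>r. bil \<mu> (T (smooth (fw r))) (smooth (gw r)))"
    using P.integrable_fst[OF W'] by (simp add: W_int)
  have "cmod (averaged T E f g) \<le> (\<integral>r. cmod (bil \<mu> (T (smooth (fw r))) (smooth (gw r))) \<partial>\<mu>)"
    unfolding av by (rule integral_norm_bound)
  also have "\<dots> \<le> (\<integral>r. C * (l2_norm \<mu> (fw r) * l2_norm \<mu> (gw r)) \<partial>\<mu>)"
  proof (rule integral_mono)
    fix r
    have "cmod (bil \<mu> (T (smooth (fw r))) (smooth (gw r))) \<le> C * (l2_norm \<mu> (smooth (fw r)) * l2_norm \<mu> (smooth (gw r)))"
      by (intro bil_op_bound T C smooth_L2 fw gw)
    also have "\<dots> \<le> C * (l2_norm \<mu> (fw r) * l2_norm \<mu> (gw r))"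
      using C(1) by (intro mult_left_mono mult_mono smooth_L2 fw gw) auto
    finally show "cmod (bil \<mu> (T (smooth (fw r))) (smooth (gw r))) \<le> C * (l2_norm \<mu> (fw r) * l2_norm \<mu> (gw r))" .
  qed (intro integrable_norm int_r integrable_mult_right nfg)+
  also have "\<dots> = C * (\<integral>r. cmod (complex_of_real (l2_norm \<mu> (fw r)) * complex_of_real (l2_norm \<mu> (gw r))) \<partial>\<mu>)"
    by (simp add: norm_mult)
  also have "\<dots> \<le> C * (l2_norm \<mu> f * l2_norm \<mu> g)"
    using l2_norm_Cauchy_Schwarz[OF nf(1) ng(1)] C(1) by (intro mult_left_mono) (simp_all add: nf ng)
  finally show "cmod (averaged T E f g) \<le> C * (l2_norm \<mu> f * l2_norm \<mu> g)" .
qed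

end

context haar_hilbert begin

section \<open>Approximation by integrable functions\<close>

lemma L2_approx_integrable:
  assumes f: "f \<in> L2 \<mu>" and \<epsilon>: "0 < \<epsilon>"
  shows "\<exists>f'\<in>L2 \<mu>. integrable \<mu> f' \<and> l2_norm \<mu> f' \<le> l2_norm \<mu> f \<and> l2_norm \<mu> (\<lambda>x. f x - f' x) < \<epsilon>"
proof -
  have [measurable]: "f \<in> borel_measurable \<mu>"
    by (rule L2_measurable[OF f])
  obtain A :: "nat \<Rightarrow> 'g set" where A: "range A \<subseteq> sets \<mu>" "(\<Union>i. A i) = space \<mu>" "\<forall>i. emeasure \<mu> (A i) \<noteq> \<infinity>" "incseq A"
    using sigma_finite_measure.sigma_finite_incseq[OF sigma_finite_haar] by metis
  have A_sets [measurable]: "A k \<in> sets borel" for k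
    using A(1) by auto
  have ind: "(\<lambda>x. indicator (A k) x :: complex) \<in> L2 \<mu>" for k
    using A(3) by (intro indicator_L2 A_sets) (simp add: less_top)
  define F where "F k x = f x * indicator (A k) x" for k x
  have F: "F k \<in> L2 \<mu>" for k
    by (rule L2_dominated[OF _ f]) (auto simp: F_def[abs_def] indicator_def)
  have "(\<lambda>k. \<integral>x. (cmod (f x - F k x))\<^sup>2 \<partial>\<mu>) \<longlonglongrightarrow> (\<integral>x. 0 \<partial>\<mu>)"
  proof (rule integral_dominated_convergence)
    show "integrable \<mu> (\<lambda>x. (cmod (f x))\<^sup>2)"
      by (rule L2_integrable[OF f])
    show "AE x in \<mu>. (\<lambda>k. (cmod (f x - F k x))\<^sup>2) \<longlonglongrightarrow> 0"
    proof (rule AE_I2)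
      fix x
      obtain m where m: "x \<in> A m"
        using A(2) by auto
      have "\<forall>\<^sub>F k in sequentially. (cmod (f x - F k x))\<^sup>2 = 0"
        using eventually_ge_at_top[of m]
      proof eventually_elim
        case (elim k)
        then have "x \<in> A k"
          using m incseqD[OF A(4)] by blast
        then show ?case
          by (simp add: F_def)
      qed
      then show "(\<lambda>k. (cmod (f x - F k x))\<^sup>2) \<longlonglongrightarrow> 0"
        by (rule tendsto_eventually)
    qed
    show "AE x in \<mu>. norm ((cmod (f x - F k x))\<^sup>2) \<le> (cmod (f x))\<^sup>2" for k
      by (intro AE_I2) (auto simp: F_def indicator_def)
  qed (auto simp: F_def[abs_def])
  then have "\<forall>\<^sub>F k in sequentially. (\<integral>x. (cmod (f x - F k x))\<^sup>2 \<partial>\<mu>) < \<epsilon>\<^sup>2"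
    using \<epsilon> by (intro order_tendstoD(2)[of _ 0]) auto
  then obtain k where "(l2_norm \<mu> (\<lambda>x. f x - F k x))\<^sup>2 < \<epsilon>\<^sup>2"
    unfolding l2_norm_square by (auto simp: eventually_sequentially)
  then have "l2_norm \<mu> (\<lambda>x. f x - F k x) < \<epsilon>"
    by (rule power2_less_imp_less) (use \<epsilon> in simp)
  moreover have "integrable \<mu> (F k)"
    using L2_mult_integrable[OF f ind[of k]] by (simp add: F_def[abs_def])
  moreover have "l2_norm \<mu> (F k) \<le> l2_norm \<mu> f"
    by (rule l2_norm_mono[OF F f]) (auto simp: F_def indicator_def)
  ultimately show ?thesis
    using F by blast
qed

end

context haar_bump begin

lemma averaged_diff:
  assumes L2: "f \<in> L2 \<mu>" "f' \<in> L2 \<mu>" "g \<in> L2 \<mu>" and T: "T \<in> BL2 \<mu>" and E: "compact E" "0 < measure \<mu> E"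
  shows "averaged T E (\<lambda>x. f x - f' x) g = averaged T E f g - averaged T E f' g"
    and "averaged T E g (\<lambda>x. f x - f' x) = averaged T E g f - averaged T E g f'"
proof -
  obtain C where "0 \<le> C" "\<forall>f\<in>L2 \<mu>. l2_norm \<mu> (T f) \<le> C * l2_norm \<mu> f"
    using BL2_bound[OF T] by blast
  note C = this(1) this(2)[rule_format]
  have int: "integrable (\<mu> \<Otimes>\<^sub>M \<mu>) (\<lambda>(x, y). f x * g y * complex_of_real (overlap E (- x + y)) * bil \<mu> (T (bump x)) (bump y))"
    if "f \<in> L2 \<mu>" "g \<in> L2 \<mu>" for f g
    by (rule averaged_bound(1)[OF that T E C])
  show "averaged T E (\<lambda>x. f x - f' x) g = averaged T E f g - averaged T E f' g"
    unfolding averaged_def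
    by (subst Bochner_Integration.integral_diff[symmetric, OF int[OF L2(1,3)] int[OF L2(2,3)]])
       (intro Bochner_Integration.integral_cong, auto simp: algebra_simps)
  show "averaged T E g (\<lambda>x. f x - f' x) = averaged T E g f - averaged T E g f'"
    unfolding averaged_def
    by (subst Bochner_Integration.integral_diff[symmetric, OF int[OF L2(3,1)] int[OF L2(3,2)]])
       (intro Bochner_Integration.integral_cong, auto simp: algebra_simps)
qed

text \<open>The substitution \<open>y = v + x\<close> splits the plane into diagonals;
  \<open>I v\<close> is the integral along one of them, and the weight, depending on
  \<open>v\<close> alone, comes out of it.\<close>

lemma averaged_shear:
  assumes f: "f \<in> L2 \<mu>" and g: "g \<in> L2 \<mu>" and T: "T \<in> BL2 \<mu>" and E: "compact E" "0 < measure \<mu> E"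
  defines "I \<equiv> \<lambda>v. \<integral>x. bil \<mu> (T (bump x)) (bump (v + x)) * f x * g (v + x) \<partial>\<mu>"
  shows "integrable \<mu> (\<lambda>v. complex_of_real (overlap E v) * I v)"
    and "averaged T E f g = (\<integral>v. complex_of_real (overlap E v) * I v \<partial>\<mu>)"
proof -
  obtain C where "0 \<le> C" "\<forall>f\<in>L2 \<mu>. l2_norm \<mu> (T f) \<le> C * l2_norm \<mu> f"
    using BL2_bound[OF T] by blast
  note C = this(1) this(2)[rule_format]
  note [measurable] = overlap_measurable[OF E]
  have [measurable]: "f \<in> borel_measurable borel" "g \<in> borel_measurable borel"
    using L2_measurable[OF f] L2_measurable[OF g] by (simp_all add: borel_measurable_eq)
  define K where "K x y = bil \<mu> (T (bump x)) (bump y)" for x y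
  have K_meas [measurable (raw)]: "(\<lambda>w. K (p w) (q w)) \<in> borel_measurable N"
    if "p \<in> borel_measurable N" "q \<in> borel_measurable N" for p q and N :: "('g \<times> 'g) measure"
    unfolding K_def using op_kernel_measurable[OF T that] .
  define h where "h x y = f x * g y * complex_of_real (overlap E (- x + y)) * K x y" for x y
  have int: "integrable (\<mu> \<Otimes>\<^sub>M \<mu>) (\<lambda>(x, y). h x y)"
    unfolding h_def K_def by (rule averaged_bound(1)[OF f g T E C])
  have int': "integrable (\<mu> \<Otimes>\<^sub>M \<mu>) (\<lambda>(x, v). h x (x + v))"
  proof (rule Fubini_integrable)
    show "(\<lambda>(x, v). h x (x + v)) \<in> borel_measurable (\<mu> \<Otimes>\<^sub>M \<mu>)"
      unfolding h_def case_prod_beta by measurable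
    have "(\<integral>v. norm (h x (x + v)) \<partial>\<mu>) = (\<integral>y. norm (h x y) \<partial>\<mu>)" for x
      by (rule integral_translate)
    moreover have "integrable \<mu> (\<lambda>x. \<integral>y. norm (h x y) \<partial>\<mu>)"
      using integrable_fst'[OF integrable_norm[OF int]] by simp
    ultimately show "integrable \<mu> (\<lambda>x. \<integral>v. norm (case (x, v) of (x, v) \<Rightarrow> h x (x + v)) \<partial>\<mu>)"
      by simp
    show "AE x in \<mu>. integrable \<mu> (\<lambda>v. case (x, v) of (x, v) \<Rightarrow> h x (x + v))"
      using AE_integrable_fst'[OF int] by (simp add: integrable_translate_iff)
  qed
  have inner: "(\<integral>x. h x (x + v) \<partial>\<mu>) = complex_of_real (overlap E v) * I v" for v
  proof -
    have "- x + (x + v) = v" for x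
      by (simp add: algebra_simps)
    then have "h x (x + v) = complex_of_real (overlap E v) * (K x (v + x) * f x * g (v + x))" for x
      unfolding h_def by (simp add: add.commute[of x v])
    then show ?thesis
      unfolding I_def K_def by simp
  qed
  show "integrable \<mu> (\<lambda>v. complex_of_real (overlap E v) * I v)"
    using integrable_snd[OF int'] by (simp add: inner)
  have "averaged T E f g = (\<integral>x. \<integral>y. h x y \<partial>\<mu> \<partial>\<mu>)"
    using integral_fst'[OF int] by (simp add: averaged_def h_def K_def)
  also have "\<dots> = (\<integral>x. \<integral>v. h x (x + v) \<partial>\<mu> \<partial>\<mu>)"
    by (simp add: integral_translate)
  also have "\<dots> = (\<integral>v. \<integral>x. h x (x + v) \<partial>\<mu> \<partial>\<mu>)"
    using Fubini_integral[OF int'] by simp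
  finally show "averaged T E f g = (\<integral>v. complex_of_real (overlap E v) * I v \<partial>\<mu>)"
    by (simp add: inner)
qed

text \<open>Since \<open>overlap\<close> lies between 0 and 1, the unweighted integrand, which is
  integrable for integrable \<open>f\<close> and \<open>g\<close>, dominates.\<close>

lemma averaged_tendsto_integrable:
  assumes f: "f \<in> L2 \<mu>" "integrable \<mu> f" and g: "g \<in> L2 \<mu>" "integrable \<mu> g" and T: "T \<in> BL2 \<mu>"
    and E: "\<And>n::nat. compact (E n)" "\<And>n. 0 < measure \<mu> (E n)" and lim: "\<And>w. (\<lambda>n. overlap (E n) w) \<longlonglongrightarrow> 1"
  shows "(\<lambda>n. averaged T (E n) f g) \<longlonglongrightarrow> bil \<mu> (T (smooth f)) (smooth g)"
  unfolding averaged_def bil_op_smooth_smooth(2)[OF f g T]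
proof (rule integral_dominated_convergence)
  let ?K = "\<lambda>(x, y). f x * g y * bil \<mu> (T (bump x)) (bump y)"
  note int = bil_op_smooth_smooth(1)[OF f g T]
  show "?K \<in> borel_measurable (\<mu> \<Otimes>\<^sub>M \<mu>)"
    using int by simp
  show "integrable (\<mu> \<Otimes>\<^sub>M \<mu>) (\<lambda>z. norm (?K z))"
    by (rule integrable_norm[OF int])
  obtain C where "0 \<le> C" "\<forall>f\<in>L2 \<mu>. l2_norm \<mu> (T f) \<le> C * l2_norm \<mu> f"
    using BL2_bound[OF T] by blast
  note C = this(1) this(2)[rule_format]
  show "(\<lambda>(x, y). f x * g y * complex_of_real (overlap (E n) (- x + y)) * bil \<mu> (T (bump x)) (bump y)) \<in> borel_measurable (\<mu> \<Otimes>\<^sub>M \<mu>)" for n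
    using averaged_bound(1)[OF f(1) g(1) T E C] by (rule borel_measurable_integrable)
  show "AE z in \<mu> \<Otimes>\<^sub>M \<mu>. (\<lambda>n. case z of (x, y) \<Rightarrow> f x * g y * complex_of_real (overlap (E n) (- x + y)) * bil \<mu> (T (bump x)) (bump y)) \<longlonglongrightarrow> ?K z"
  proof (rule AE_I2)
    fix z :: "'g \<times> 'g"
    obtain x y where z: "z = (x, y)"
      by fastforce
    have "(\<lambda>n. f x * g y * complex_of_real (overlap (E n) (- x + y)) * bil \<mu> (T (bump x)) (bump y))
        \<longlonglongrightarrow> f x * g y * complex_of_real 1 * bil \<mu> (T (bump x)) (bump y)"
      by (intro tendsto_intros lim)
    then show "(\<lambda>n. case z of (x, y) \<Rightarrow> f x * g y * complex_of_real (overlap (E n) (- x + y)) * bil \<mu> (T (bump x)) (bump y)) \<longlonglongrightarrow> ?K z"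
      by (simp add: z)
  qed
  show "AE z in \<mu> \<Otimes>\<^sub>M \<mu>. norm (case z of (x, y) \<Rightarrow> f x * g y * complex_of_real (overlap (E n) (- x + y)) * bil \<mu> (T (bump x)) (bump y)) \<le> norm (?K z)" for n
  proof (rule AE_I2)
    fix z :: "'g \<times> 'g"
    obtain x y where z: "z = (x, y)"
      by fastforce
    have "cmod (f x * g y * bil \<mu> (T (bump x)) (bump y)) * overlap (E n) (- x + y) \<le> cmod (f x * g y * bil \<mu> (T (bump x)) (bump y)) * 1"
      by (intro mult_left_mono overlap_le_1 E) auto
    then show "norm (case z of (x, y) \<Rightarrow> f x * g y * complex_of_real (overlap (E n) (- x + y)) * bil \<mu> (T (bump x)) (bump y)) \<le> norm (?K z)"
      using overlap_nonneg[OF E(1)[of n] E(2)[of n], of "- x + y"] by (simp add: z norm_mult mult_ac)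
  qed
qed

text \<open>The averaged forms and their limit are bilinear and share the bound \<open>C\<close>
  times the norms, so integrable functions may be substituted for \<open>f\<close> and
  \<open>g\<close> at a cost independent of \<open>n\<close>.\<close>

lemma averaged_tendsto:
  assumes f: "f \<in> L2 \<mu>" and g: "g \<in> L2 \<mu>" and T: "T \<in> BL2 \<mu>"
    and E: "\<And>n::nat. compact (E n)" "\<And>n. 0 < measure \<mu> (E n)" and lim: "\<And>w. (\<lambda>n. overlap (E n) w) \<longlonglongrightarrow> 1"
  shows "(\<lambda>n. averaged T (E n) f g) \<longlonglongrightarrow> bil \<mu> (T (smooth f)) (smooth g)"
proof (rule LIMSEQ_I)
  fix \<epsilon> :: real assume \<epsilon>: "0 < \<epsilon>"
  obtain C where "0 \<le> C" "\<forall>f\<in>L2 \<mu>. l2_norm \<mu> (T f) \<le> C * l2_norm \<mu> f"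
    using BL2_bound[OF T] by blast
  note C = this(1) this(2)[rule_format]
  \<comment> \<open>The added 1 keeps \<open>D\<close> positive. Each form changes by at most
    \<open>D * \<delta> = \<epsilon> / 4\<close> under the substitution, leaving
    \<open>\<epsilon> / 2\<close> for the convergence.\<close>
  define D where "D = C * (l2_norm \<mu> f + l2_norm \<mu> g) + 1"
  have D: "0 < D"
    using C(1) by (simp add: D_def add_nonneg_pos)
  define \<delta> where "\<delta> = \<epsilon> / (4 * D)"
  have \<delta>: "0 < \<delta>"
    using \<epsilon> D by (simp add: \<delta>_def)
  obtain f' where f': "f' \<in> L2 \<mu>" "integrable \<mu> f'" "l2_norm \<mu> f' \<le> l2_norm \<mu> f" "l2_norm \<mu> (\<lambda>x. f x - f' x) < \<delta>"
    using L2_approx_integrable[OF f \<delta>] by blast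
  obtain g' where g': "g' \<in> L2 \<mu>" "integrable \<mu> g'" "l2_norm \<mu> g' \<le> l2_norm \<mu> g" "l2_norm \<mu> (\<lambda>x. g x - g' x) < \<delta>"
    using L2_approx_integrable[OF g \<delta>] by blast
  \<comment> \<open>Stated for an abstract form \<open>B\<close>, as it is used both for the
    averaged forms and for their limit.\<close>
  have close: "cmod (B f g - B f' g') \<le> D * \<delta>"
    if bound: "\<And>f g. f \<in> L2 \<mu> \<Longrightarrow> g \<in> L2 \<mu> \<Longrightarrow> cmod (B f g) \<le> C * (l2_norm \<mu> f * l2_norm \<mu> g)"
      and diff: "\<And>f f' g. f \<in> L2 \<mu> \<Longrightarrow> f' \<in> L2 \<mu> \<Longrightarrow> g \<in> L2 \<mu> \<Longrightarrow> B (\<lambda>x. f x - f' x) g = B f g - B f' g"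
        "\<And>f f' g. f \<in> L2 \<mu> \<Longrightarrow> f' \<in> L2 \<mu> \<Longrightarrow> g \<in> L2 \<mu> \<Longrightarrow> B g (\<lambda>x. f x - f' x) = B g f - B g f'"
    for B :: "('g \<Rightarrow> complex) \<Rightarrow> ('g \<Rightarrow> complex) \<Rightarrow> complex"
  proof -
    have "B f g - B f' g' = B (\<lambda>x. f x - f' x) g + B f' (\<lambda>x. g x - g' x)"
      by (simp add: diff f g f' g')
    then have "cmod (B f g - B f' g') \<le> C * (l2_norm \<mu> (\<lambda>x. f x - f' x) * l2_norm \<mu> g) + C * (l2_norm \<mu> f' * l2_norm \<mu> (\<lambda>x. g x - g' x))"
      by (simp only:) (intro norm_triangle_mono bound L2_diff f g f' g')
    also have "\<dots> \<le> C * (\<delta> * l2_norm \<mu> g) + C * (l2_norm \<mu> f * \<delta>)"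
      using f' g' \<delta> C(1) by (intro add_mono mult_left_mono mult_mono) auto
    also have "\<dots> \<le> D * \<delta>"
      using \<delta> by (simp add: D_def algebra_simps)
    finally show ?thesis .
  qed
  have 1: "cmod (averaged T (E n) f g - averaged T (E n) f' g') \<le> D * \<delta>" for n
    by (intro close averaged_bound(2)[OF _ _ T E C] averaged_diff T E)
  have 2: "cmod (bil \<mu> (T (smooth f)) (smooth g) - bil \<mu> (T (smooth f')) (smooth g')) \<le> D * \<delta>"
  proof (rule close)
    show "cmod (bil \<mu> (T (smooth f)) (smooth g)) \<le> C * (l2_norm \<mu> f * l2_norm \<mu> g)" if "f \<in> L2 \<mu>" "g \<in> L2 \<mu>" for f g
    proof -
      have "cmod (bil \<mu> (T (smooth f)) (smooth g)) \<le> C * (l2_norm \<mu> (smooth f) * l2_norm \<mu> (smooth g))"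
        by (intro bil_op_bound T C smooth_L2 that)
      also have "\<dots> \<le> C * (l2_norm \<mu> f * l2_norm \<mu> g)"
        using C(1) by (intro mult_left_mono mult_mono smooth_L2 that) auto
      finally show ?thesis .
    qed
    show "bil \<mu> (T (smooth (\<lambda>x. f x - f' x))) (smooth g) = bil \<mu> (T (smooth f)) (smooth g) - bil \<mu> (T (smooth f')) (smooth g)"
      if "f \<in> L2 \<mu>" "f' \<in> L2 \<mu>" "g \<in> L2 \<mu>" for f f' g
    proof -
      note s = smooth_L2(1)[OF that(1)] smooth_L2(1)[OF that(2)] smooth_L2(1)[OF that(3)]
      have "bil \<mu> (T (\<lambda>x. smooth f x - smooth f' x)) (smooth g) = bil \<mu> (\<lambda>x. T (smooth f) x - T (smooth f') x) (smooth g)"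
        by (intro bil_cong_AE L2_measurable L2_diff BL2_L2[OF T] s BL2_diff[OF T]) simp
      then show ?thesis
        by (simp add: smooth_diff that bil_diff_left BL2_L2[OF T] s)
    qed
    show "bil \<mu> (T (smooth g)) (smooth (\<lambda>x. f x - f' x)) = bil \<mu> (T (smooth g)) (smooth f) - bil \<mu> (T (smooth g)) (smooth f')"
      if "f \<in> L2 \<mu>" "f' \<in> L2 \<mu>" "g \<in> L2 \<mu>" for f f' g
      by (simp add: smooth_diff that bil_diff_right BL2_L2[OF T] smooth_L2)
  qed
  obtain N where N: "\<forall>n\<ge>N. norm (averaged T (E n) f' g' - bil \<mu> (T (smooth f')) (smooth g')) < \<epsilon> / 2"
    using LIMSEQ_D[OF averaged_tendsto_integrable[OF f'(1,2) g'(1,2) T E lim], of "\<epsilon> / 2"] \<epsilon> by auto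
  have D\<delta>: "D * \<delta> = \<epsilon> / 4"
    using D by (simp add: \<delta>_def)
  have "norm (averaged T (E n) f g - bil \<mu> (T (smooth f)) (smooth g)) < \<epsilon>" if n: "N \<le> n" for n
  proof -
    have "averaged T (E n) f g - bil \<mu> (T (smooth f)) (smooth g) = (averaged T (E n) f g - averaged T (E n) f' g')
        + (averaged T (E n) f' g' - bil \<mu> (T (smooth f')) (smooth g'))
        + - (bil \<mu> (T (smooth f)) (smooth g) - bil \<mu> (T (smooth f')) (smooth g'))"
      by simp
    then have "norm (averaged T (E n) f g - bil \<mu> (T (smooth f)) (smooth g))
        \<le> norm (averaged T (E n) f g - averaged T (E n) f' g')
        + norm (averaged T (E n) f' g' - bil \<mu> (T (smooth f')) (smooth g'))
        + norm (bil \<mu> (T (smooth f)) (smooth g) - bil \<mu> (T (smooth f')) (smooth g'))"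
      by (simp only:) (metis norm_triangle_mono norm_minus_cancel order_refl)
    then show ?thesis
      using 1[of n] 2 N n D\<delta> \<epsilon> by fastforce
  qed
  then show "\<exists>no. \<forall>n\<ge>no. norm (averaged T (E n) f g - bil \<mu> (T (smooth f)) (smooth g)) < \<epsilon>"
    by blast
qed

subsection \<open>The inclusion of the annihilator in \<open>Bim\<close>\<close>

text \<open>The diagonals of the smoothed kernel of \<open>T\<close> are matrix coefficients of the orbit of \<open>T\<close> under
  conjugation by \<open>rho\<close>, so they annihilate \<open>J\<close> when \<open>\<Theta>(J)\<close> kills \<open>T\<close>; no duality between
  \<open>L\<^sup>1\<close> and \<open>L\<^sup>\<infinity>\<close> is needed.\<close>

lemma kernel_diagonal_annihilates:
  assumes T: "T \<in> BL2 \<mu>" and J: "J \<subseteq> L1 \<mu>"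
    and ann: "\<And>\<phi> h. \<phi> \<in> J \<Longrightarrow> h \<in> TC \<mu> \<Longrightarrow> Theta_pairing \<mu> \<phi> T h = 0"
  shows "(\<lambda>x. bil \<mu> (T (bump x)) (bump (v + x))) \<in> L1_annihilator \<mu> J"
proof -
  obtain C where "0 \<le> C" "\<forall>f\<in>L2 \<mu>. l2_norm \<mu> (T f) \<le> C * l2_norm \<mu> f"
    using BL2_bound[OF T] by blast
  note C = this(1) this(2)[rule_format]
  have "(\<lambda>x. bil \<mu> (T (bump x)) (bump (v + x))) \<in> Linf \<mu>"
  proof (rule bounded_Linf)
    show "(\<lambda>x. bil \<mu> (T (bump x)) (bump (v + x))) \<in> borel_measurable borel"
      by (rule op_kernel_measurable[OF T]) measurable
  qed (rule op_kernel_bound[OF T C])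
  moreover have "(\<integral>x. bil \<mu> (T (bump x)) (bump (v + x)) * \<phi> x \<partial>\<mu>) = 0" if \<phi>: "\<phi> \<in> J" for \<phi>
  proof -
    have "(\<lambda>(x, y). bump 0 x * bump v y) \<in> TC \<mu>"
      using represents_single[OF bump_L2 bump_L2] by (auto simp: TC_def)
    from ann[OF \<phi> this] have "(\<integral>r. pairing \<mu> (rho \<mu> r \<circ> T \<circ> rho \<mu> (- r)) (\<lambda>(x, y). bump 0 x * bump v y) * \<phi> r \<partial>\<mu>) = 0"
      by (simp add: Theta_pairing_def)
    moreover have "pairing \<mu> (rho \<mu> r \<circ> T \<circ> rho \<mu> (- r)) (\<lambda>(x, y). bump 0 x * bump v y) = bil \<mu> (T (bump r)) (bump (v + r))" for r
    proof -
      \<comment> \<open>Translating a bump moves its centre, so the conjugates of \<open>T\<close>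
        tested on \<open>bump 0\<close> and \<open>bump v\<close> run along the diagonal through
        \<open>(0, v)\<close>.\<close>
      have b: "(\<lambda>x. bump u (- r + x)) = bump (u + r)" for u
        by (simp add: fun_eq_iff bump_def algebra_simps)
      show ?thesis
        unfolding pairing_single[OF bump_L2 bump_L2 conjugate_BL2[OF T]] bil_conjugate b by simp
    qed
    ultimately show ?thesis
      by simp
  qed
  ultimately show ?thesis
    by (simp add: L1_annihilator_def)
qed

text \<open>On each diagonal the sum over \<open>i\<close> is the pairing of \<open>h\<close> with
  an operator \<open>lambda v \<circ> mult_op a \<circ> lambda 0\<close>, where \<open>a\<close> is
  the kernel restricted to the diagonal, and vanishes by assumption; integrability of the weight
  allows the sum to be integrated over \<open>v\<close>. The factor \<open>lambda 0\<close> is the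
  identity and gives the operator the shape of a generator of \<open>Bim\<close>.\<close>

lemma averaged_sums_zero:
  assumes T: "T \<in> BL2 \<mu>" and r: "represents \<mu> f g h" and E: "compact E" "0 < measure \<mu> E"
    and zero: "\<And>v. pairing \<mu> (lambda v \<circ> mult_op (\<lambda>x. bil \<mu> (T (bump x)) (bump (v + x))) \<circ> lambda 0) h = 0"
  shows "(\<lambda>i. averaged T E (f i) (g i)) sums 0"
proof -
  obtain C where "0 \<le> C" "\<forall>f\<in>L2 \<mu>. l2_norm \<mu> (T f) \<le> C * l2_norm \<mu> f"
    using BL2_bound[OF T] by blast
  note C = this(1) this(2)[rule_format]
  define K where "K x y = bil \<mu> (T (bump x)) (bump y)" for x y
  have K_meas: "(\<lambda>x. K x (v + x)) \<in> borel_measurable borel" for v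
    unfolding K_def by (rule op_kernel_measurable[OF T]) measurable
  have K_bound: "cmod (K x y) \<le> C * bump_norm\<^sup>2" for x y
    unfolding K_def by (rule op_kernel_bound[OF T C])
  define I where "I i v = (\<integral>x. K x (v + x) * f i x * g i (v + x) \<partial>\<mu>)" for i v
  let ?R = "\<lambda>v. lambda v \<circ> mult_op (\<lambda>x. K x (v + x)) \<circ> lambda 0"
  have R: "?R v \<in> BL2 \<mu>" for v
    by (intro BL2_comp lambda_BL2 mult_op_BL2 bounded_Linf[OF K_meas K_bound])
  have I_bil: "I i v = bil \<mu> (?R v (f i)) (g i)" for i v
    using integral_translate[of "\<lambda>x. K (- v + x) (v + (- v + x)) * f i (- v + x) * g i x" v]
    by (simp add: I_def bil_def lambda_eq mult_op_def)
  have I_sums: "(\<lambda>i. I i v) sums 0" for v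
    using pairing_sums[OF r R, of v] zero[of v] unfolding I_bil K_def by simp
  have I_bound: "cmod (I i v) \<le> C * bump_norm\<^sup>2 * (l2_norm \<mu> (f i) * l2_norm \<mu> (g i))" for i v
  proof -
    have f: "(\<lambda>x. K x (v + x) * f i x) \<in> L2 \<mu>"
      by (intro L2_mult_Linf bounded_Linf[OF K_meas K_bound] represents_L2[OF r])
    have g: "(\<lambda>x. g i (v + x)) \<in> L2 \<mu>"
      using represents_L2[OF r] by (simp add: L2_translate_iff)
    have c: "(\<lambda>x. complex_of_real (C * bump_norm\<^sup>2) * f i x) \<in> L2 \<mu>"
      by (intro L2_scale represents_L2[OF r])
    have "cmod (K x (v + x) * f i x) \<le> cmod (complex_of_real (C * bump_norm\<^sup>2) * f i x)" for x
      unfolding norm_mult norm_of_real by (intro mult_right_mono order_trans[OF K_bound abs_ge_self]) simp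
    then have n: "l2_norm \<mu> (\<lambda>x. K x (v + x) * f i x) \<le> l2_norm \<mu> (\<lambda>x. complex_of_real (C * bump_norm\<^sup>2) * f i x)"
      by (intro l2_norm_mono f c AE_I2)
    have "I i v = bil \<mu> (\<lambda>x. K x (v + x) * f i x) (\<lambda>x. g i (v + x))"
      by (simp add: I_def bil_def)
    also have "cmod \<dots> \<le> l2_norm \<mu> (\<lambda>x. K x (v + x) * f i x) * l2_norm \<mu> (\<lambda>x. g i (v + x))"
      by (rule bil_bound[OF f g])
    also have "\<dots> \<le> l2_norm \<mu> (\<lambda>x. complex_of_real (C * bump_norm\<^sup>2) * f i x) * l2_norm \<mu> (\<lambda>x. g i (v + x))"
      using n by (intro mult_right_mono) auto
    also have "\<dots> = C * bump_norm\<^sup>2 * (l2_norm \<mu> (f i) * l2_norm \<mu> (g i))"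
      unfolding l2_norm_scale l2_norm_translate norm_of_real using C(1) by (simp add: abs_mult)
    finally show ?thesis .
  qed
  have sb: "summable (\<lambda>i. C * bump_norm\<^sup>2 * (l2_norm \<mu> (f i) * l2_norm \<mu> (g i)))"
    by (intro summable_mult represents_norm_summable[OF r])
  have int: "integrable \<mu> (\<lambda>v. complex_of_real (overlap E v) * I i v)" for i
    unfolding I_def K_def by (rule averaged_shear(1)[OF represents_L2(1)[OF r] represents_L2(2)[OF r] T E])
  have av: "averaged T E (f i) (g i) = (\<integral>v. complex_of_real (overlap E v) * I i v \<partial>\<mu>)" for i
    unfolding I_def K_def by (rule averaged_shear(2)[OF represents_L2(1)[OF r] represents_L2(2)[OF r] T E])
  have norm_le: "norm (complex_of_real (overlap E v) * I i v) \<le> C * bump_norm\<^sup>2 * (l2_norm \<mu> (f i) * l2_norm \<mu> (g i)) * overlap E v" for i v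
    using mult_right_mono[OF I_bound[of i v] overlap_nonneg[OF E, of v]] overlap_nonneg[OF E, of v]
    by (simp add: norm_mult mult.commute)
  have s1: "AE v in \<mu>. summable (\<lambda>i. norm (complex_of_real (overlap E v) * I i v))"
  proof (rule AE_I2)
    fix v
    show "summable (\<lambda>i. norm (complex_of_real (overlap E v) * I i v))"
      by (rule summable_comparison_test'[OF summable_mult2[OF sb, of "overlap E v"], of 0]) (use norm_le in simp)
  qed
  have s2: "summable (\<lambda>i. \<integral>v. norm (complex_of_real (overlap E v) * I i v) \<partial>\<mu>)"
  proof (rule summable_comparison_test'[OF summable_mult2[OF sb, of "\<integral>v. overlap E v \<partial>\<mu>"], of 0])
    fix i
    have "(\<integral>v. norm (complex_of_real (overlap E v) * I i v) \<partial>\<mu>) \<le> (\<integral>v. C * bump_norm\<^sup>2 * (l2_norm \<mu> (f i) * l2_norm \<mu> (g i)) * overlap E v \<partial>\<mu>)"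
      by (intro integral_mono integrable_norm int integrable_mult_right integrable_overlap E norm_le)
    then show "norm (\<integral>v. norm (complex_of_real (overlap E v) * I i v) \<partial>\<mu>) \<le> C * bump_norm\<^sup>2 * (l2_norm \<mu> (f i) * l2_norm \<mu> (g i)) * (\<integral>v. overlap E v \<partial>\<mu>)"
      by (simp only: real_norm_def abs_of_nonneg[OF Bochner_Integration.integral_nonneg[OF norm_ge_zero]]) simp
  qed
  have "(\<Sum>i. complex_of_real (overlap E v) * I i v) = 0" for v
    using sums_mult[OF I_sums[of v], of "complex_of_real (overlap E v)"] by (simp add: sums_iff)
  then show ?thesis
    unfolding av using sums_integral[OF int s1 s2] by simp
qed

text \<open>The constant in \<open>averaged_bound\<close> is the same for all Folner sets, so
  Tannery's theorem lets the limit pass under the series representing \<open>h\<close>.\<close>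

lemma smoothed_sums_zero:
  assumes T: "T \<in> BL2 \<mu>" and r: "represents \<mu> f g h"
    and zero: "\<And>v. pairing \<mu> (lambda v \<circ> mult_op (\<lambda>x. bil \<mu> (T (bump x)) (bump (v + x))) \<circ> lambda 0) h = 0"
  shows "(\<Sum>i. bil \<mu> (T (smooth (f i))) (smooth (g i))) = 0"
proof -
  obtain C where "0 \<le> C" "\<forall>f\<in>L2 \<mu>. l2_norm \<mu> (T f) \<le> C * l2_norm \<mu> f"
    using BL2_bound[OF T] by blast
  note C = this(1) this(2)[rule_format]
  obtain E :: "nat \<Rightarrow> 'g set" where E: "\<forall>n. compact (E n) \<and> 0 < measure \<mu> (E n)"
    "\<forall>w. (\<lambda>n. measure \<mu> (E n \<inter> {x. w + x \<in> E n}) / measure \<mu> (E n)) \<longlonglongrightarrow> 1"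
    using ex_Folner_sequence by (elim exE conjE)
  have E': "compact (E n)" "0 < measure \<mu> (E n)" "(\<lambda>n. overlap (E n) w) \<longlonglongrightarrow> 1" for n w
    using E by (auto simp: overlap_def)
  have "(\<lambda>n. \<Sum>i. averaged T (E n) (f i) (g i)) \<longlonglongrightarrow> (\<Sum>i. bil \<mu> (T (smooth (f i))) (smooth (g i)))"
  proof (rule tannerys_theorem[THEN conjunct2, THEN conjunct2])
    show "(\<lambda>n. averaged T (E n) (f i) (g i)) \<longlonglongrightarrow> bil \<mu> (T (smooth (f i))) (smooth (g i))" for i
      by (intro averaged_tendsto represents_L2[OF r] T E')
    show "\<forall>\<^sub>F (i, n) in sequentially \<times>\<^sub>F sequentially.
        cmod (averaged T (E n) (f i) (g i)) \<le> C * (l2_norm \<mu> (f i) * l2_norm \<mu> (g i))"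
      using represents_L2[OF r] by (auto intro!: always_eventually averaged_bound(2) T C E')
    show "summable (\<lambda>i. C * (l2_norm \<mu> (f i) * l2_norm \<mu> (g i)))"
      by (intro summable_mult represents_norm_summable[OF r])
  qed simp
  moreover have "(\<Sum>i. averaged T (E n) (f i) (g i)) = 0" for n
    using averaged_sums_zero[OF T r E'(1,2) zero] by (simp add: sums_iff)
  ultimately show ?thesis
    by (simp add: LIMSEQ_const_iff)
qed

end

context haar_hilbert begin

text \<open>By continuity of translations, smoothing over shrinking neighbourhoods converges
  strongly to the identity while its norm stays at most 1; so this limit passes under the series as
  well.\<close>

lemma pairing_zero_of_annihilates:
  assumes T: "T \<in> BL2 \<mu>" and J: "J \<subseteq> L1 \<mu>"
    and ann: "\<And>\<phi> h. \<phi> \<in> J \<Longrightarrow> h \<in> TC \<mu> \<Longrightarrow> Theta_pairing \<mu> \<phi> T h = 0"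
    and h: "h \<in> TC \<mu>"
    and zero: "\<And>a v. a \<in> L1_annihilator \<mu> J \<Longrightarrow> pairing \<mu> (lambda v \<circ> mult_op a \<circ> lambda 0) h = 0"
  shows "pairing \<mu> T h = 0"
proof -
  obtain f g where r: "represents \<mu> f g h"
    using h by (auto simp: TC_def)
  obtain C where "0 \<le> C" "\<forall>f\<in>L2 \<mu>. l2_norm \<mu> (T f) \<le> C * l2_norm \<mu> f"
    using BL2_bound[OF T] by blast
  note C = this(1) this(2)[rule_format]
  obtain U :: "nat \<Rightarrow> 'g set" where U: "\<forall>n. open (U n) \<and> 0 \<in> U n \<and> emeasure \<mu> (U n) < \<infinity> \<and> (\<forall>x. - x \<in> U n \<longleftrightarrow> x \<in> U n)"
    "\<forall>W. open W \<longrightarrow> 0 \<in> W \<longrightarrow> (\<forall>\<^sub>F n in sequentially. U n \<subseteq> W)"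
    using ex_symmetric_nhds by (elim exE conjE)
  have bump: "haar_bump \<mu> e (U n)" for n
    using U(1) by unfold_locales auto
  define S where "S n = haar_bump.smooth \<mu> (U n)" for n
  have S_L2: "S n f \<in> L2 \<mu>" "l2_norm \<mu> (S n f) \<le> l2_norm \<mu> f" if "f \<in> L2 \<mu>" for n f
    unfolding S_def using haar_bump.smooth_L2[OF bump that] by auto
  have S_lim: "(\<lambda>n. l2_norm \<mu> (\<lambda>x. S n f x - f x)) \<longlonglongrightarrow> 0" if f: "f \<in> L2 \<mu>" for f
  proof (rule LIMSEQ_I)
    fix \<epsilon> :: real assume \<epsilon>: "0 < \<epsilon>"
    \<comment> \<open>The estimate for smoothing is not strict, hence the half.\<close>
    then have "0 < \<epsilon> / 2" by simp
    from translation_continuous[OF f this] obtain W where W: "open W" "0 \<in> W" "\<forall>r\<in>W. l2_norm \<mu> (\<lambda>x. f (r + x) - f x) < \<epsilon> / 2"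
      by blast
    obtain N where N: "\<forall>n\<ge>N. U n \<subseteq> W"
      using U(2) W(1,2) unfolding eventually_sequentially by blast
    have "l2_norm \<mu> (\<lambda>x. S n f x - f x) \<le> \<epsilon> / 2" if "N \<le> n" for n
      unfolding S_def using N W(3) that \<epsilon> by (intro haar_bump.smooth_diff_bound[OF bump f]) (auto intro!: less_imp_le)
    then show "\<exists>N. \<forall>n\<ge>N. norm (l2_norm \<mu> (\<lambda>x. S n f x - f x) - 0) < \<epsilon>"
      using \<epsilon> by (intro exI[of _ N]) force
  qed
  have "(\<lambda>n. \<Sum>i. bil \<mu> (T (S n (f i))) (S n (g i))) \<longlonglongrightarrow> (\<Sum>i. bil \<mu> (T (f i)) (g i))"
  proof (rule tannerys_theorem[THEN conjunct2, THEN conjunct2])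
    show "(\<lambda>n. bil \<mu> (T (S n (f i))) (S n (g i))) \<longlonglongrightarrow> bil \<mu> (T (f i)) (g i)" for i
      by (intro bil_BL2_tendsto T S_L2 S_lim represents_L2[OF r])
    have "cmod (bil \<mu> (T (S n (f i))) (S n (g i))) \<le> C * (l2_norm \<mu> (f i) * l2_norm \<mu> (g i))" for i n
    proof -
      have "cmod (bil \<mu> (T (S n (f i))) (S n (g i))) \<le> C * (l2_norm \<mu> (S n (f i)) * l2_norm \<mu> (S n (g i)))"
        by (intro bil_op_bound T C S_L2 represents_L2[OF r])
      also have "\<dots> \<le> C * (l2_norm \<mu> (f i) * l2_norm \<mu> (g i))"
        using C(1) by (intro mult_left_mono mult_mono S_L2 represents_L2[OF r]) auto
      finally show ?thesis .
    qed
    then show "\<forall>\<^sub>F (i, n) in sequentially \<times>\<^sub>F sequentially.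
        cmod (bil \<mu> (T (S n (f i))) (S n (g i))) \<le> C * (l2_norm \<mu> (f i) * l2_norm \<mu> (g i))"
      by (auto intro: always_eventually)
    show "summable (\<lambda>i. C * (l2_norm \<mu> (f i) * l2_norm \<mu> (g i)))"
      by (intro summable_mult represents_norm_summable[OF r])
  qed simp
  moreover have "(\<Sum>i. bil \<mu> (T (S n (f i))) (S n (g i))) = 0" for n
    unfolding S_def
    by (intro haar_bump.smoothed_sums_zero[OF bump T r] zero haar_bump.kernel_diagonal_annihilates[OF bump T J ann])
  ultimately show ?thesis
    by (simp add: pairing_eq[OF r T] LIMSEQ_const_iff)
qed

lemma annihilator_subset_Bim:
  assumes J: "J \<subseteq> L1 \<mu>"
  shows "tc_annihilator \<mu> (Ran \<mu> J) \<subseteq> Bim \<mu> (L1_annihilator \<mu> J)"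
proof
  fix T assume "T \<in> tc_annihilator \<mu> (Ran \<mu> J)"
  then have T: "T \<in> BL2 \<mu>" and ann: "\<And>\<phi> h. \<phi> \<in> J \<Longrightarrow> h \<in> TC \<mu> \<Longrightarrow> Theta_pairing \<mu> \<phi> T h = 0"
    by (auto simp: annihilator_Ran[OF J])
  let ?X = "{A \<circ> mult_op a \<circ> B | A a B. A \<in> VN \<mu> \<and> a \<in> L1_annihilator \<mu> J \<and> B \<in> VN \<mu>}"
  show "T \<in> Bim \<mu> (L1_annihilator \<mu> J)"
    unfolding Bim_def
  proof (rule in_weak_star_closure_span[OF T])
    show "?X \<subseteq> BL2 \<mu>"
      by (auto simp: L1_annihilator_def intro!: BL2_comp[OF BL2_comp[OF VN_BL2 mult_op_BL2] VN_BL2])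
    fix h assume h: "h \<in> TC \<mu>" and zero: "\<And>R. R \<in> ?X \<Longrightarrow> pairing \<mu> R h = 0"
    show "pairing \<mu> T h = 0"
    proof (rule pairing_zero_of_annihilates[OF T J ann h])
      show "pairing \<mu> (lambda v \<circ> mult_op a \<circ> lambda 0) h = 0" if "a \<in> L1_annihilator \<mu> J" for a v
        using that lambda_VN by (intro zero) blast
    qed
  qed
qed

end

theorem proposition4p2:
  fixes \<mu> :: "'g::{topological_ab_group_add, t2_space, second_countable_topology} measure"
    and J :: "('g \<Rightarrow> complex) set"
  assumes "locally_compact_space (euclidean :: 'g topology)"
    and "left_haar_measure \<mu>"
    and "closed_ideal_L1 \<mu> J"
  shows "tc_annihilator \<mu> (Ran \<mu> J) = Bim \<mu> (L1_annihilator \<mu> J)"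
proof -
  interpret haar_abelian \<mu>
    using assms(1,2) by unfold_locales
  obtain e where e: "hilbert_basis \<mu> e"
    using ex_hilbert_basis by (elim exE)
  interpret haar_hilbert \<mu> e
    by (rule haar_hilbert.intro[OF haar_abelian_axioms e])
  have "J \<subseteq> L1 \<mu>"
    using assms(3) by (simp add: closed_ideal_L1_def)
  then show ?thesis
    using annihilator_subset_Bim Bim_subset_annihilator[OF assms(3)] by blast
qed

end
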